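(* Let $\Bbbk$ be a field and let $\mathscr A=\bigoplus_{n\ge0}A_n$ be a nice tower of algebras over $\Bbbk$. Then the pairing $\langle-,-\rangle:\mathcal K(\mathscr A)\times\mathcal G^f(\mathscr A)\to\mathbb Z[q,q^{-1}]$ given by $\langle[P],[M]\rangle=\mathrm{gdim}_\Bbbk(P^\psi\otimes_{A_n}M)$ if $P\in A_n\text{-pmod}$ and $M\in A_n\text{-fmod}$ (same $n$), and by $0$ otherwise, is a bialgebra pairing; that is, for all $p,p'\in\mathcal K(\mathscr A)$ and $m,m'\in\mathcal G^f(\mathscr A)$, $$\langle pp',m\rangle=\langle p\boxtimes p',\Delta(m)\rangle,\qquad \langle p,mm'\rangle=\langle\Delta(p),m\boxtimes m'\rangle,$$ $$\langle1_{\mathcal K(\mathscr A)},m\rangle=\epsilon(m),\qquad\langle p,1_{\mathcal G^f(\mathscr A)}\rangle=\epsilon(p).$$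
   Context: **Nice graded algebra.** A $\mathbb Z$-graded $\Bbbk$-algebra $R=\bigoplus_{i\in\mathbb Z}R_i$ is *nice* if (1) there is a positively (respectively negatively) graded ideal $I\subseteq\bigoplus_{i>0}R_i$ (respectively $I\subseteq\bigoplus_{i<0}R_i$) such that all graded simple $R$-modules are annihilated by $I$, and (2) $R/I$ is a finite-dimensional algebra. **Nice tower of algebras.** A graded $\Bbbk$-algebra $\mathscr A=\bigoplus_{n\ge0}A_n$ such that for all $m,n$: (TA1) $A_n$ is a nice graded algebra, and $A_0=\Bbbk$; (TA2) there is a unital algebra morphism $A_n\otimes A_m\to A_{n+m}$; (TA3) $A_{m+n}$ is a two-sided projective $A_n\otimes A_m$-module; (TA4) there exists an anti-automorphism $\psi$ of $A_n$. **Notation.** $\boxtimes=\otimes_\Bbbk$. $A_n\text{-fmod}$ and $A_n\text{-pmod}$ are the categories of graded finite-dimensional, respectively graded finitely generated projective, left $A_n$-modules. $\mathcal G^f(\mathscr A)=\bigoplus_nK_0(A_n\text{-fmod})$ and $\mathcal K(\mathscr A)=\bigoplus_nK_0(A_n\text{-pmod})$, which are $\mathbb Z[q,q^{-1}]$-modules with $q$ acting by grading shift; $\mathrm{gdim}_\Bbbk$ is the graded dimension. For a left module $P$, $P^\psi$ is the right module on the same space with $m\cdot a:=\psi(a)m$. **Structure maps** (on both $\mathcal K(\mathscr A)$ and $\mathcal G^f(\mathscr A)$). The product is induced by the functor $\mathrm{IND}$, which on $A_m\otimes A_n$-modules is $\mathrm{Ind}_{A_m\otimes A_n}^{A_{m+n}}=A_{m+n}\otimes_{A_m\otimes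 A_n}(-)$; the unit is induced by $\eta$, which regards $V\in\Bbbk\text{-mod}$ as an $A_0$-module. The coproduct $\Delta$ is induced by the functor $\mathrm{RES}$, which on $A_n$-modules is $\bigoplus_{k+\ell=n}\mathrm{Res}^{A_n}_{A_k\otimes A_\ell}$; the counit is induced by the functor $\epsilon$ with $\epsilon(V)=V$ if $V$ is an $A_0=\Bbbk$-module, and $\epsilon(V)=0$ otherwise. **Pairing on tensor products.** $\langle p\boxtimes p',k\boxtimes k'\rangle=\langle p,k\rangle\langle p',k'\rangle$; for modules this reads $\langle[P]\boxtimes[P'],[M]\boxtimes[M']\rangle=\mathrm{gdim}_\Bbbk\big((P^\psi\boxtimes P'^\psi)\otimes_{A_n\boxtimes A_m}(M\boxtimes M')\big)$, and the same graded-dimension formula is used to pair with $A_n\boxtimes A_m$-modules such as $\mathrm{Res}^{A_{n+m}}_{A_n\otimes A_m}M$.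
   Formalization: The anti-automorphisms ψ are assumed graded, k-linear and compatible with A_m⊗A_n→A_{m+n} (the first two identities fail otherwise), and "two-sided projective" in (TA3) is read as finitely generated projective, so that induction and restriction are defined on the Grothendieck groups. *)

theory Defs
  imports
    "Jordan_Normal_Form.Missing_VectorSpace"
    "HOL-Algebra.Free_Abelian_Groups"
    "HOL-Algebra.QuotRing"
    "HOL-Library.Groups_Big_Fun"
begin

section \<open>Graded vector spaces\<close>

text \<open>
  A graded space extends the record of modules by its homogeneous pieces. Graded algebras use the same
  record; for mere spaces and modules the fields \<open>mult\<close> and \<open>one\<close> carry no information.
\<close>

record ('k, 'v) gspace = "('k, 'v) module" +
  gr :: "int \<Rightarrow> 'v set"

definition hdecomp :: "('k, 'v, 'z) gspace_scheme \<Rightarrow> 'v \<Rightarrow> (int \<Rightarrow> 'v) \<Rightarrow> bool" where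
  "hdecomp V x c \<longleftrightarrow> (\<forall>d. c d \<in> gr V d) \<and> finite {d. c d \<noteq> \<zero>\<^bsub>V\<^esub>} \<and>
     x = (\<Oplus>\<^bsub>V\<^esub> d \<in> {d. c d \<noteq> \<zero>\<^bsub>V\<^esub>}. c d)"

definition hcomp :: "('k, 'v, 'z) gspace_scheme \<Rightarrow> 'v \<Rightarrow> int \<Rightarrow> 'v" where
  "hcomp V x = (THE c. hdecomp V x c)"

locale graded_space = vectorspace K V
  for K :: "'k ring" and V :: "('k, 'v, 'z) gspace_scheme" +
  assumes gr_subspace: "subspace K (gr V d) V"
    and gr_decomp: "x \<in> carrier V \<Longrightarrow> \<exists>!c. hdecomp V x c"

type_synonym laurent = "int \<Rightarrow>\<^sub>0 int"

abbreviation q :: laurent where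
  "q \<equiv> Poly_Mapping.single 1 1"

definition gdim :: "'k ring \<Rightarrow> ('k, 'v, 'z) gspace_scheme \<Rightarrow> laurent" where
  "gdim K V = Abs_poly_mapping (\<lambda>d. int (vectorspace.dim K (V\<lparr>carrier := gr V d\<rparr>)))"

definition ground :: "'k ring \<Rightarrow> ('k, 'k) gspace" where
  "ground K = \<lparr>carrier = carrier K, mult = mult K, one = \<one>\<^bsub>K\<^esub>, ring.zero = \<zero>\<^bsub>K\<^esub>, add = add K,
     smult = mult K, gr = (\<lambda>d. if d = 0 then carrier K else {\<zero>\<^bsub>K\<^esub>})\<rparr>"


section \<open>Graded algebras and graded modules\<close>

locale graded_algebra = graded_space K A + ring A
  for K :: "'k ring" and A :: "('k, 'a) gspace" +
  assumes smult_mult_left: "\<lbrakk>c \<in> carrier K; a \<in> carrier A; b \<in> carrier A\<rbrakk> \<Longrightarrow>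
      (c \<odot>\<^bsub>A\<^esub> a) \<otimes>\<^bsub>A\<^esub> b = c \<odot>\<^bsub>A\<^esub> (a \<otimes>\<^bsub>A\<^esub> b)"
    and smult_mult_right: "\<lbrakk>c \<in> carrier K; a \<in> carrier A; b \<in> carrier A\<rbrakk> \<Longrightarrow>
      a \<otimes>\<^bsub>A\<^esub> (c \<odot>\<^bsub>A\<^esub> b) = c \<odot>\<^bsub>A\<^esub> (a \<otimes>\<^bsub>A\<^esub> b)"
    and gr_one: "\<one>\<^bsub>A\<^esub> \<in> gr A 0"
    and gr_mult: "\<lbrakk>a \<in> gr A i; b \<in> gr A j\<rbrakk> \<Longrightarrow> a \<otimes>\<^bsub>A\<^esub> b \<in> gr A (i + j)"

definition galg_hom :: "'k ring \<Rightarrow> ('k, 'a) gspace \<Rightarrow> ('k, 'b) gspace \<Rightarrow> ('a \<Rightarrow> 'b) set" where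
  "galg_hom K A B = {f \<in> ring_hom A B.
     (\<forall>c \<in> carrier K. \<forall>a \<in> carrier A. f (c \<odot>\<^bsub>A\<^esub> a) = c \<odot>\<^bsub>B\<^esub> f a) \<and> (\<forall>d. f ` gr A d \<subseteq> gr B d)}"

definition opposite :: "('k, 'a) gspace \<Rightarrow> ('k, 'a) gspace" where
  "opposite A = A\<lparr>mult := (\<lambda>x y. y \<otimes>\<^bsub>A\<^esub> x)\<rparr>"

record ('k, 'a, 'v) gmod = "('k, 'v) gspace" +
  act :: "'a \<Rightarrow> 'v \<Rightarrow> 'v"

definition with_act :: "('k, 'v, 'z) gspace_scheme \<Rightarrow> ('a \<Rightarrow> 'v \<Rightarrow> 'v) \<Rightarrow> ('k, 'a, 'v) gmod" where
  "with_act V f = \<lparr>carrier = carrier V, mult = mult V, one = one V, ring.zero = ring.zero V, add = add V,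
     smult = Module.smult V, gr = gr V, act = f\<rparr>"

text \<open>Right modules over \<open>A\<close> are left modules over \<open>opposite A\<close>: \<open>act M a x\<close> is then \<open>x \<sqdot> a\<close>.\<close>

locale left_gmod = A: graded_algebra K A + M: graded_space K M
  for K :: "'k ring" and A :: "('k, 'a) gspace" and M :: "('k, 'a, 'v) gmod" +
  assumes act_closed: "\<lbrakk>a \<in> carrier A; x \<in> carrier M\<rbrakk> \<Longrightarrow> act M a x \<in> carrier M"
    and act_add_right: "\<lbrakk>a \<in> carrier A; x \<in> carrier M; y \<in> carrier M\<rbrakk> \<Longrightarrow>
      act M a (x \<oplus>\<^bsub>M\<^esub> y) = act M a x \<oplus>\<^bsub>M\<^esub> act M a y"
    and act_add_left: "\<lbrakk>a \<in> carrier A; b \<in> carrier A; x \<in> carrier M\<rbrakk> \<Longrightarrow>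
      act M (a \<oplus>\<^bsub>A\<^esub> b) x = act M a x \<oplus>\<^bsub>M\<^esub> act M b x"
    and act_mult: "\<lbrakk>a \<in> carrier A; b \<in> carrier A; x \<in> carrier M\<rbrakk> \<Longrightarrow>
      act M (a \<otimes>\<^bsub>A\<^esub> b) x = act M a (act M b x)"
    and act_one: "x \<in> carrier M \<Longrightarrow> act M \<one>\<^bsub>A\<^esub> x = x"
    and act_smult_left: "\<lbrakk>c \<in> carrier K; a \<in> carrier A; x \<in> carrier M\<rbrakk> \<Longrightarrow>
      act M (c \<odot>\<^bsub>A\<^esub> a) x = c \<odot>\<^bsub>M\<^esub> act M a x"
    and act_smult_right: "\<lbrakk>c \<in> carrier K; a \<in> carrier A; x \<in> carrier M\<rbrakk> \<Longrightarrow>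
      act M a (c \<odot>\<^bsub>M\<^esub> x) = c \<odot>\<^bsub>M\<^esub> act M a x"
    and gr_act: "\<lbrakk>a \<in> gr A i; x \<in> gr M j\<rbrakk> \<Longrightarrow> act M a x \<in> gr M (i + j)"

definition gmod_hom ::
  "'k ring \<Rightarrow> ('k, 'a) gspace \<Rightarrow> ('k, 'a, 'v) gmod \<Rightarrow> ('k, 'a, 'w) gmod \<Rightarrow> ('v \<Rightarrow> 'w) set" where
  "gmod_hom K A M N = {f \<in> module_hom K M N.
     (\<forall>a \<in> carrier A. \<forall>x \<in> carrier M. f (act M a x) = act N a (f x)) \<and> (\<forall>d. f ` gr M d \<subseteq> gr N d)}"

definition gmod_iso ::
  "'k ring \<Rightarrow> ('k, 'a) gspace \<Rightarrow> ('k, 'a, 'v) gmod \<Rightarrow> ('k, 'a, 'w) gmod \<Rightarrow> bool" where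
  "gmod_iso K A M N \<longleftrightarrow> (\<exists>f \<in> gmod_hom K A M N. bij_betw f (carrier M) (carrier N))"

definition short_exact :: "'k ring \<Rightarrow> ('k, 'a) gspace \<Rightarrow>
    ('k, 'a, 'u) gmod \<Rightarrow> ('k, 'a, 'v) gmod \<Rightarrow> ('k, 'a, 'w) gmod \<Rightarrow> bool" where
  "short_exact K A M' M M'' \<longleftrightarrow> (\<exists>f \<in> gmod_hom K A M' M. \<exists>g \<in> gmod_hom K A M M''.
     inj_on f (carrier M') \<and> g ` carrier M = carrier M'' \<and>
     f ` carrier M' = {x \<in> carrier M. g x = \<zero>\<^bsub>M''\<^esub>})"

text \<open>The free module on generators of degrees \<open>ds\<close>, elements being coefficient lists.\<close>

definition free_gmod :: "('k, 'a) gspace \<Rightarrow> int list \<Rightarrow> ('k, 'a, 'a list) gmod" where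
  "free_gmod A ds = (let C = {xs. length xs = length ds \<and> set xs \<subseteq> carrier A};
       Z = replicate (length ds) \<zero>\<^bsub>A\<^esub> in
     \<lparr>carrier = C, mult = (\<lambda>_ _. Z), one = Z, ring.zero = Z, add = map2 (add A),
      smult = (\<lambda>c. map (Module.smult A c)),
      gr = (\<lambda>e. {xs \<in> C. \<forall>i < length ds. xs ! i \<in> gr A (e - ds ! i)}),
      act = (\<lambda>a. map (mult A a))\<rparr>)"

text \<open>Graded finitely generated projective: a graded direct summand of such a free module.\<close>

definition fg_projective :: "'k ring \<Rightarrow> ('k, 'a) gspace \<Rightarrow> ('k, 'a, 'v) gmod \<Rightarrow> bool" where
  "fg_projective K A P \<longleftrightarrow> left_gmod K A P \<and>
     (\<exists>ds. \<exists>i \<in> gmod_hom K A P (free_gmod A ds). \<exists>r \<in> gmod_hom K A (free_gmod A ds) P.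
        \<forall>x \<in> carrier P. r (i x) = x)"

text \<open>
  A finitely generated module injects, as a set, into the lists over its algebra (send an element to
  coefficients with respect to fixed generators), and graded simple modules are cyclic. So modules
  carried by the type \<open>'a list\<close> represent all isomorphism classes of interest here.
\<close>

definition fmod :: "'k ring \<Rightarrow> ('k, 'a) gspace \<Rightarrow> ('k, 'a, 'a list) gmod set" where
  "fmod K A = {M. left_gmod K A M \<and> vectorspace.fin_dim K M}"

definition pmod :: "'k ring \<Rightarrow> ('k, 'a) gspace \<Rightarrow> ('k, 'a, 'a list) gmod set" where
  "pmod K A = {P. fg_projective K A P}"

text \<open>The grading shift \<open>q\<close>, normalised so that \<open>gdim\<close> gets multiplied by \<open>q\<close>.\<close>

definition shift :: "('k, 'a, 'v) gmod \<Rightarrow> ('k, 'a, 'v) gmod" where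
  "shift M = M\<lparr>gr := (\<lambda>d. gr M (d - 1))\<rparr>"


section \<open>Nice graded algebras\<close>

definition homogeneous :: "('k, 'v, 'z) gspace_scheme \<Rightarrow> 'v set \<Rightarrow> bool" where
  "homogeneous V N \<longleftrightarrow> (\<forall>x \<in> N. \<forall>d. hcomp V x d \<in> N)"

definition graded_submodule :: "'k ring \<Rightarrow> ('k, 'a) gspace \<Rightarrow> 'v set \<Rightarrow> ('k, 'a, 'v) gmod \<Rightarrow> bool" where
  "graded_submodule K A N M \<longleftrightarrow> subspace K N M \<and> (\<forall>a \<in> carrier A. \<forall>x \<in> N. act M a x \<in> N) \<and>
     homogeneous M N"

definition graded_simple :: "'k ring \<Rightarrow> ('k, 'a) gspace \<Rightarrow> ('k, 'a, 'v) gmod \<Rightarrow> bool" where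
  "graded_simple K A S \<longleftrightarrow> left_gmod K A S \<and> carrier S \<noteq> {\<zero>\<^bsub>S\<^esub>} \<and>
     (\<forall>N. graded_submodule K A N S \<longrightarrow> N = {\<zero>\<^bsub>S\<^esub>} \<or> N = carrier S)"

definition quot_space :: "('k, 'a) gspace \<Rightarrow> 'a set \<Rightarrow> ('k, 'a set) module" where
  "quot_space A I = \<lparr>carrier = carrier (A Quot I), mult = mult (A Quot I), one = \<one>\<^bsub>A Quot I\<^esub>,
     ring.zero = \<zero>\<^bsub>A Quot I\<^esub>, add = add (A Quot I), smult = (\<lambda>c X. \<Union>x \<in> X. I +>\<^bsub>A\<^esub> (c \<odot>\<^bsub>A\<^esub> x))\<rparr>"

definition pos_part :: "('k, 'a) gspace \<Rightarrow> 'a set" where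
  "pos_part A = {x \<in> carrier A. \<forall>d \<le> 0. hcomp A x d = \<zero>\<^bsub>A\<^esub>}"

definition neg_part :: "('k, 'a) gspace \<Rightarrow> 'a set" where
  "neg_part A = {x \<in> carrier A. \<forall>d \<ge> 0. hcomp A x d = \<zero>\<^bsub>A\<^esub>}"

definition nice_algebra :: "'k ring \<Rightarrow> ('k, 'a) gspace \<Rightarrow> bool" where
  "nice_algebra K A \<longleftrightarrow> graded_algebra K A \<and>
     (\<exists>I. ideal I A \<and> homogeneous A I \<and> (I \<subseteq> pos_part A \<or> I \<subseteq> neg_part A) \<and>
        (\<forall>S :: ('k, 'a, 'a list) gmod. graded_simple K A S \<longrightarrow>
           (\<forall>x \<in> I. \<forall>v \<in> carrier S. act S x v = \<zero>\<^bsub>S\<^esub>)) \<and>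
        vectorspace.fin_dim K (quot_space A I))"


section \<open>Tensor products\<close>

text \<open>
  \<open>tensor S r l M N\<close> is the quotient of the free abelian group on pairs by biadditivity and by
  \<open>(r s m, n) \<sim> (m, l s n)\<close> for \<open>s \<in> S\<close>, where \<open>r\<close> is a right action on \<open>M\<close> and \<open>l\<close> a left action on
  \<open>N\<close>. Its elements are cosets. Operations on tensor products are given on representatives, like
  \<^const>\<open>rcoset_mult\<close>.
\<close>

abbreviation pairs :: "('k, 'm, 'y) gspace_scheme \<Rightarrow> ('k, 'n, 'z) gspace_scheme \<Rightarrow> ('m \<times> 'n \<Rightarrow>\<^sub>0 int) monoid"
  where "pairs M N \<equiv> free_Abelian_group (carrier M \<times> carrier N)"

definition tensor_rels :: "'s set \<Rightarrow> ('s \<Rightarrow> 'm \<Rightarrow> 'm) \<Rightarrow> ('s \<Rightarrow> 'n \<Rightarrow> 'n) \<Rightarrow>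
    ('k, 'm, 'y) gspace_scheme \<Rightarrow> ('k, 'n, 'z) gspace_scheme \<Rightarrow> ('m \<times> 'n \<Rightarrow>\<^sub>0 int) set" where
  "tensor_rels S r l M N = generate (pairs M N)
     ({frag_of (m \<oplus>\<^bsub>M\<^esub> m', n) - frag_of (m, n) - frag_of (m', n) | m m' n.
         m \<in> carrier M \<and> m' \<in> carrier M \<and> n \<in> carrier N} \<union>
      {frag_of (m, n \<oplus>\<^bsub>N\<^esub> n') - frag_of (m, n) - frag_of (m, n') | m n n'.
         m \<in> carrier M \<and> n \<in> carrier N \<and> n' \<in> carrier N} \<union>
      {frag_of (r s m, n) - frag_of (m, l s n) | s m n.
         s \<in> S \<and> m \<in> carrier M \<and> n \<in> carrier N})"

definition tensor_map :: "('m \<times> 'n \<Rightarrow>\<^sub>0 int) set \<Rightarrow> ('k, 'm, 'y) gspace_scheme \<Rightarrow> ('k, 'n, 'z) gspace_scheme \<Rightarrow>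
    ('m \<Rightarrow> 'm) \<Rightarrow> ('n \<Rightarrow> 'n) \<Rightarrow> ('m \<times> 'n \<Rightarrow>\<^sub>0 int) set \<Rightarrow> ('m \<times> 'n \<Rightarrow>\<^sub>0 int) set" where
  "tensor_map H M N f g X =
     (\<Union>x \<in> X. H #>\<^bsub>pairs M N\<^esub> frag_extend (\<lambda>(m, n). frag_of (f m, g n)) x)"

definition tensor_act :: "('m \<times> 'n \<Rightarrow>\<^sub>0 int) set \<Rightarrow> ('k, 'm, 'y) gspace_scheme \<Rightarrow> ('k, 'n, 'z) gspace_scheme \<Rightarrow>
    ('a \<Rightarrow> 'm \<Rightarrow> 'm) \<Rightarrow> ('b \<Rightarrow> 'n \<Rightarrow> 'n) \<Rightarrow>
    ('a \<times> 'b \<Rightarrow>\<^sub>0 int) set \<Rightarrow> ('m \<times> 'n \<Rightarrow>\<^sub>0 int) set \<Rightarrow> ('m \<times> 'n \<Rightarrow>\<^sub>0 int) set" where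
  "tensor_act H M N f g X Y = (\<Union>x \<in> X. \<Union>y \<in> Y. H #>\<^bsub>pairs M N\<^esub>
     frag_extend (\<lambda>(a, b). frag_extend (\<lambda>(m, n). frag_of (f a m, g b n)) y) x)"

definition tensor :: "'s set \<Rightarrow> ('s \<Rightarrow> 'm \<Rightarrow> 'm) \<Rightarrow> ('s \<Rightarrow> 'n \<Rightarrow> 'n) \<Rightarrow>
    ('k, 'm, 'y) gspace_scheme \<Rightarrow> ('k, 'n, 'z) gspace_scheme \<Rightarrow> ('k, ('m \<times> 'n \<Rightarrow>\<^sub>0 int) set) gspace" where
  "tensor S r l M N = (let G = pairs M N; H = tensor_rels S r l M N in
     \<lparr>carrier = carrier (G Mod H), mult = (\<lambda>_ _. H), one = H,
      ring.zero = \<one>\<^bsub>G Mod H\<^esub>, add = mult (G Mod H),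
      smult = (\<lambda>c. tensor_map H M N (Module.smult M c) (\<lambda>n. n)),
      gr = (\<lambda>d. (\<lambda>x. H #>\<^bsub>G\<^esub> x) `
        generate G {frag_of (m, n) | m n i j. m \<in> gr M i \<and> n \<in> gr N j \<and> i + j = d})\<rparr>)"

text \<open>\<open>M \<otimes>\<^sub>A N\<close> for a right module \<open>M\<close> and a left module \<open>N\<close>\<close>

abbreviation mtensor_rels :: "('k, 'a) gspace \<Rightarrow> ('k, 'a, 'm) gmod \<Rightarrow> ('k, 'a, 'n) gmod \<Rightarrow> ('m \<times> 'n \<Rightarrow>\<^sub>0 int) set" where
  "mtensor_rels A M N \<equiv> tensor_rels (carrier A) (act M) (act N) M N"

abbreviation mtensor :: "('k, 'a) gspace \<Rightarrow> ('k, 'a, 'm) gmod \<Rightarrow> ('k, 'a, 'n) gmod \<Rightarrow> ('k, ('m \<times> 'n \<Rightarrow>\<^sub>0 int) set) gspace" where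
  "mtensor A M N \<equiv> tensor (carrier A) (act M) (act N) M N"

abbreviation ktensor_rels :: "'k ring \<Rightarrow> ('k, 'm, 'y) gspace_scheme \<Rightarrow> ('k, 'n, 'z) gspace_scheme \<Rightarrow> ('m \<times> 'n \<Rightarrow>\<^sub>0 int) set" where
  "ktensor_rels K M N \<equiv> tensor_rels (carrier K) (Module.smult M) (Module.smult N) M N"

abbreviation ktensor :: "'k ring \<Rightarrow> ('k, 'm, 'y) gspace_scheme \<Rightarrow> ('k, 'n, 'z) gspace_scheme \<Rightarrow> ('k, ('m \<times> 'n \<Rightarrow>\<^sub>0 int) set) gspace" where
  "ktensor K M N \<equiv> tensor (carrier K) (Module.smult M) (Module.smult N) M N"

definition ptensor :: "'k ring \<Rightarrow> ('k, 'm, 'y) gspace_scheme \<Rightarrow> ('k, 'n, 'z) gspace_scheme \<Rightarrow> 'm \<Rightarrow> 'n \<Rightarrow> ('m \<times> 'n \<Rightarrow>\<^sub>0 int) set" where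
  "ptensor K M N m n = ktensor_rels K M N #>\<^bsub>pairs M N\<^esub> frag_of (m, n)"

text \<open>The algebra \<open>A \<boxtimes> B\<close> (without signs) and the \<open>A \<boxtimes> B\<close>-module \<open>M \<boxtimes> N\<close>\<close>

definition alg_tensor :: "'k ring \<Rightarrow> ('k, 'a) gspace \<Rightarrow> ('k, 'b) gspace \<Rightarrow> ('k, ('a \<times> 'b \<Rightarrow>\<^sub>0 int) set) gspace" where
  "alg_tensor K A B = (ktensor K A B)
     \<lparr>mult := tensor_act (ktensor_rels K A B) A B (mult A) (mult B),
      one := ptensor K A B \<one>\<^bsub>A\<^esub> \<one>\<^bsub>B\<^esub>\<rparr>"

definition mod_tensor :: "'k ring \<Rightarrow> ('k, 'a, 'm) gmod \<Rightarrow> ('k, 'b, 'n) gmod \<Rightarrow>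
    ('k, ('a \<times> 'b \<Rightarrow>\<^sub>0 int) set, ('m \<times> 'n \<Rightarrow>\<^sub>0 int) set) gmod" where
  "mod_tensor K M N =
     with_act (ktensor K M N) (tensor_act (ktensor_rels K M N) M N (act M) (act N))"


section \<open>Induction, restriction and twisting\<close>

definition left_reg :: "('b \<Rightarrow> 'c) \<Rightarrow> ('k, 'c) gspace \<Rightarrow> ('k, 'b, 'c) gmod" where
  "left_reg \<rho> C = with_act C (\<lambda>b c. \<rho> b \<otimes>\<^bsub>C\<^esub> c)"

definition right_reg :: "('b \<Rightarrow> 'c) \<Rightarrow> ('k, 'c) gspace \<Rightarrow> ('k, 'b, 'c) gmod" where
  "right_reg \<rho> C = with_act C (\<lambda>b c. c \<otimes>\<^bsub>C\<^esub> \<rho> b)"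

definition Ind :: "('b \<Rightarrow> 'c) \<Rightarrow> ('k, 'b) gspace \<Rightarrow> ('k, 'c) gspace \<Rightarrow> ('k, 'b, 'n) gmod \<Rightarrow>
    ('k, 'c, ('c \<times> 'n \<Rightarrow>\<^sub>0 int) set) gmod" where
  "Ind \<rho> B C N = with_act (mtensor B (right_reg \<rho> C) N)
     (\<lambda>c. tensor_map (mtensor_rels B (right_reg \<rho> C) N) C N (mult C c) (\<lambda>n. n))"

definition Res :: "('b \<Rightarrow> 'c) \<Rightarrow> ('k, 'c, 'n) gmod \<Rightarrow> ('k, 'b, 'n) gmod" where
  "Res \<rho> M = with_act M (\<lambda>b. act M (\<rho> b))"

text \<open>\<open>twist \<psi> P\<close> is the right module \<open>P\<^sup>\<psi>\<close>.\<close>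

definition twist :: "('a \<Rightarrow> 'a) \<Rightarrow> ('k, 'a, 'v) gmod \<Rightarrow> ('k, 'a, 'v) gmod" where
  "twist \<psi> P = with_act P (\<lambda>a. act P (\<psi> a))"

text \<open>A graded space as a module over \<open>A\<close>, when \<open>c \<mapsto> c \<odot> \<one>\<close> is a bijection from \<open>K\<close> onto \<open>A\<close>\<close>

definition eta :: "'k ring \<Rightarrow> ('k, 'a) gspace \<Rightarrow> ('k, 'v) gspace \<Rightarrow> ('k, 'a, 'v) gmod" where
  "eta K A V = with_act V (\<lambda>a. Module.smult V (inv_into (carrier K) (\<lambda>c. c \<odot>\<^bsub>A\<^esub> \<one>\<^bsub>A\<^esub>) a))"


section \<open>Nice towers of algebras\<close>

abbreviation twr2 :: "'k ring \<Rightarrow> (nat \<Rightarrow> ('k, 'a) gspace) \<Rightarrow> nat \<Rightarrow> nat \<Rightarrow> ('k, ('a \<times> 'a \<Rightarrow>\<^sub>0 int) set) gspace" where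
  "twr2 K A m n \<equiv> alg_tensor K (A m) (A n)"

text \<open>
  The morphisms \<open>\<rho>\<close> are the multiplication of the \<open>\<nat>\<close>-graded algebra formed by the \<open>A n\<close>, whence
  associativity and unit. Projectivity includes finite generation: otherwise induction need not
  preserve finite-dimensional modules, nor restriction finitely generated ones. The
  anti-automorphisms are compatible with \<open>\<rho>\<close>: without this the adjunction of product and coproduct
  fails already for \<open>A n = (K \<times> K)\<^sup>\<otimes>\<^sup>n\<close>, with \<open>\<psi> 1\<close> the identity and \<open>\<psi> 2\<close> exchanging the
  idempotents of the first factor.
\<close>

locale nice_tower =
  fixes K :: "'k ring" and A :: "nat \<Rightarrow> ('k, 'a) gspace"
    and \<rho> :: "nat \<Rightarrow> nat \<Rightarrow> ('a \<times> 'a \<Rightarrow>\<^sub>0 int) set \<Rightarrow> 'a" and \<psi> :: "nat \<Rightarrow> 'a \<Rightarrow> 'a"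
  assumes field: "field K"
    and nice: "nice_algebra K (A n)"
    and A0: "bij_betw (\<lambda>c. c \<odot>\<^bsub>A 0\<^esub> \<one>\<^bsub>A 0\<^esub>) (carrier K) (carrier (A 0))"
    and rho_hom: "\<rho> m n \<in> galg_hom K (twr2 K A m n) (A (m + n))"
    and rho_assoc: "\<lbrakk>a \<in> carrier (A l); b \<in> carrier (A m); c \<in> carrier (A n)\<rbrakk> \<Longrightarrow>
      \<rho> (l + m) n (ptensor K (A (l + m)) (A n) (\<rho> l m (ptensor K (A l) (A m) a b)) c) =
      \<rho> l (m + n) (ptensor K (A l) (A (m + n)) a (\<rho> m n (ptensor K (A m) (A n) b c)))"
    and rho_unit_left: "a \<in> carrier (A n) \<Longrightarrow> \<rho> 0 n (ptensor K (A 0) (A n) \<one>\<^bsub>A 0\<^esub> a) = a"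
    and rho_unit_right: "a \<in> carrier (A n) \<Longrightarrow> \<rho> n 0 (ptensor K (A n) (A 0) a \<one>\<^bsub>A 0\<^esub>) = a"
    and projective_left: "fg_projective K (twr2 K A m n) (left_reg (\<rho> m n) (A (m + n)))"
    and projective_right: "fg_projective K (opposite (twr2 K A m n)) (right_reg (\<rho> m n) (A (m + n)))"
    and psi_hom: "\<psi> n \<in> galg_hom K (A n) (opposite (A n))"
    and psi_bij: "bij_betw (\<psi> n) (carrier (A n)) (carrier (A n))"
    and psi_rho: "\<lbrakk>a \<in> carrier (A m); b \<in> carrier (A n)\<rbrakk> \<Longrightarrow>
      \<psi> (m + n) (\<rho> m n (ptensor K (A m) (A n) a b)) = \<rho> m n (ptensor K (A m) (A n) (\<psi> m a) (\<psi> n b))"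

abbreviation psi2 :: "'k ring \<Rightarrow> (nat \<Rightarrow> ('k, 'a) gspace) \<Rightarrow> (nat \<Rightarrow> 'a \<Rightarrow> 'a) \<Rightarrow> nat \<Rightarrow> nat \<Rightarrow>
    ('a \<times> 'a \<Rightarrow>\<^sub>0 int) set \<Rightarrow> ('a \<times> 'a \<Rightarrow>\<^sub>0 int) set" where
  "psi2 K A \<psi> m n \<equiv> tensor_map (ktensor_rels K (A m) (A n)) (A m) (A n) (\<psi> m) (\<psi> n)"


section \<open>Grothendieck groups\<close>

text \<open>Following \<^const>\<open>free_Abelian_group\<close>, these abelian groups are written multiplicatively.\<close>

definition K0_rels :: "'k ring \<Rightarrow> ('k, 'a) gspace \<Rightarrow> ('k, 'a, 'v) gmod set \<Rightarrow> (('k, 'a, 'v) gmod \<Rightarrow>\<^sub>0 int) set" where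
  "K0_rels K A C = generate (free_Abelian_group C)
     {frag_of M - frag_of M' - frag_of M'' | M' M M''.
        M' \<in> C \<and> M \<in> C \<and> M'' \<in> C \<and> short_exact K A M' M M''}"

definition K0 :: "'k ring \<Rightarrow> ('k, 'a) gspace \<Rightarrow> ('k, 'a, 'v) gmod set \<Rightarrow> (('k, 'a, 'v) gmod \<Rightarrow>\<^sub>0 int) set monoid" where
  "K0 K A C = free_Abelian_group C Mod K0_rels K A C"

text \<open>The class of any module, on an arbitrary type, that is isomorphic to one in \<open>C\<close>\<close>

definition rep :: "'k ring \<Rightarrow> ('k, 'a) gspace \<Rightarrow> ('k, 'a, 'v) gmod set \<Rightarrow> ('k, 'a, 'u) gmod \<Rightarrow> ('k, 'a, 'v) gmod" where
  "rep K A C M = (SOME N. N \<in> C \<and> gmod_iso K A M N)"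

definition K0_class :: "'k ring \<Rightarrow> ('k, 'a) gspace \<Rightarrow> ('k, 'a, 'v) gmod set \<Rightarrow> ('k, 'a, 'u) gmod \<Rightarrow>
    (('k, 'a, 'v) gmod \<Rightarrow>\<^sub>0 int) set" where
  "K0_class K A C M = K0_rels K A C #>\<^bsub>free_Abelian_group C\<^esub> frag_of (rep K A C M)"

text \<open>The (bi)additive maps into \<open>K0 K A C\<close> induced by a functor, respectively a bifunctor, \<open>F\<close>\<close>

definition K0_map :: "'k ring \<Rightarrow> ('k, 'a) gspace \<Rightarrow> ('k, 'a, 'v) gmod set \<Rightarrow>
    (('k, 'b, 'w) gmod \<Rightarrow> ('k, 'a, 'u) gmod) \<Rightarrow>
    (('k, 'b, 'w) gmod \<Rightarrow>\<^sub>0 int) set \<Rightarrow> (('k, 'a, 'v) gmod \<Rightarrow>\<^sub>0 int) set" where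
  "K0_map K A C F X = (\<Union>x \<in> X. K0_rels K A C #>\<^bsub>free_Abelian_group C\<^esub>
     frag_extend (\<lambda>M. frag_of (rep K A C (F M))) x)"

definition K0_map2 :: "'k ring \<Rightarrow> ('k, 'a) gspace \<Rightarrow> ('k, 'a, 'v) gmod set \<Rightarrow>
    (('k, 'b, 'w) gmod \<Rightarrow> ('k, 'b', 'w') gmod \<Rightarrow> ('k, 'a, 'u) gmod) \<Rightarrow>
    (('k, 'b, 'w) gmod \<Rightarrow>\<^sub>0 int) set \<Rightarrow> (('k, 'b', 'w') gmod \<Rightarrow>\<^sub>0 int) set \<Rightarrow>
    (('k, 'a, 'v) gmod \<Rightarrow>\<^sub>0 int) set" where
  "K0_map2 K A C F X Y = (\<Union>x \<in> X. \<Union>y \<in> Y. K0_rels K A C #>\<^bsub>free_Abelian_group C\<^esub>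
     frag_extend (\<lambda>M. frag_extend (\<lambda>N. frag_of (rep K A C (F M N))) y) x)"

definition laurent_extend :: "('x \<Rightarrow> laurent) \<Rightarrow> ('x \<Rightarrow>\<^sub>0 int) \<Rightarrow> laurent" where
  "laurent_extend f x = (\<Sum>i \<in> Poly_Mapping.keys x. of_int (Poly_Mapping.lookup x i) * f i)"

text \<open>\<open>[P], [M] \<mapsto> gdim (P\<^sup>\<psi> \<otimes>\<^sub>A M)\<close>, extended biadditively\<close>

definition K0_pairing :: "'k ring \<Rightarrow> ('k, 'a) gspace \<Rightarrow> ('a \<Rightarrow> 'a) \<Rightarrow>
    (('k, 'a, 'v) gmod \<Rightarrow>\<^sub>0 int) set \<Rightarrow> (('k, 'a, 'w) gmod \<Rightarrow>\<^sub>0 int) set \<Rightarrow> laurent" where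
  "K0_pairing K A \<psi> X Y = the_elem
     {laurent_extend (\<lambda>P. laurent_extend (\<lambda>M. gdim K (mtensor A (twist \<psi> P) M)) y) x | x y.
        x \<in> X \<and> y \<in> Y}"


section \<open>The Grothendieck groups of a tower and their structure maps\<close>

text \<open>
  The groups \<open>KK\<close> and \<open>GG\<close> are \<open>\<K>(\<A>)\<close> and \<open>\<G>\<^sup>f(\<A>)\<close>. Coproducts and external products live
  in the direct sums, over all \<open>k\<close> and \<open>l\<close>, of the Grothendieck groups of \<open>A k \<boxtimes> A l\<close>.
\<close>

abbreviation (input) pcat where "pcat K A n \<equiv> pmod K (A n)"
abbreviation (input) fcat where "fcat K A n \<equiv> fmod K (A n)"
abbreviation (input) pcat2 where "pcat2 K A k l \<equiv> pmod K (twr2 K A k l)"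
abbreviation (input) fcat2 where "fcat2 K A k l \<equiv> fmod K (twr2 K A k l)"

definition KK :: "'k ring \<Rightarrow> (nat \<Rightarrow> ('k, 'a) gspace) \<Rightarrow>
    (nat \<Rightarrow> (('k, 'a, 'a list) gmod \<Rightarrow>\<^sub>0 int) set) monoid" where
  "KK K A = sum_group UNIV (\<lambda>n. K0 K (A n) (pcat K A n))"

definition GG :: "'k ring \<Rightarrow> (nat \<Rightarrow> ('k, 'a) gspace) \<Rightarrow>
    (nat \<Rightarrow> (('k, 'a, 'a list) gmod \<Rightarrow>\<^sub>0 int) set) monoid" where
  "GG K A = sum_group UNIV (\<lambda>n. K0 K (A n) (fcat K A n))"

text \<open>
  In the following, \<open>C\<close> is one of \<^term>\<open>pcat K A\<close> and \<^term>\<open>fcat K A\<close>, and \<open>D\<close> one of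
  \<^term>\<open>pcat2 K A\<close> and \<^term>\<open>fcat2 K A\<close>.
\<close>

definition homog_elt :: "'k ring \<Rightarrow> (nat \<Rightarrow> ('k, 'a) gspace) \<Rightarrow> (nat \<Rightarrow> ('k, 'a, 'v) gmod set) \<Rightarrow> nat \<Rightarrow>
    ('k, 'a, 'u) gmod \<Rightarrow> nat \<Rightarrow> (('k, 'a, 'v) gmod \<Rightarrow>\<^sub>0 int) set" where
  "homog_elt K A C n M = (\<lambda>i. if i = n then K0_class K (A n) (C n) M else \<one>\<^bsub>K0 K (A i) (C i)\<^esub>)"

definition q_act :: "'k ring \<Rightarrow> (nat \<Rightarrow> ('k, 'a) gspace) \<Rightarrow> (nat \<Rightarrow> ('k, 'a, 'v) gmod set) \<Rightarrow>
    (nat \<Rightarrow> (('k, 'a, 'v) gmod \<Rightarrow>\<^sub>0 int) set) \<Rightarrow> nat \<Rightarrow> (('k, 'a, 'v) gmod \<Rightarrow>\<^sub>0 int) set" where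
  "q_act K A C p = (\<lambda>n. K0_map K (A n) (C n) shift (p n))"

definition tower_unit :: "'k ring \<Rightarrow> (nat \<Rightarrow> ('k, 'a) gspace) \<Rightarrow> (nat \<Rightarrow> ('k, 'a, 'v) gmod set) \<Rightarrow>
    nat \<Rightarrow> (('k, 'a, 'v) gmod \<Rightarrow>\<^sub>0 int) set" where
  "tower_unit K A C = homog_elt K A C 0 (eta K (A 0) (ground K))"

definition tower_prod :: "'k ring \<Rightarrow> (nat \<Rightarrow> ('k, 'a) gspace) \<Rightarrow>
    (nat \<Rightarrow> nat \<Rightarrow> ('a \<times> 'a \<Rightarrow>\<^sub>0 int) set \<Rightarrow> 'a) \<Rightarrow> (nat \<Rightarrow> ('k, 'a, 'v) gmod set) \<Rightarrow>
    (nat \<Rightarrow> (('k, 'a, 'v) gmod \<Rightarrow>\<^sub>0 int) set) \<Rightarrow> (nat \<Rightarrow> (('k, 'a, 'v) gmod \<Rightarrow>\<^sub>0 int) set) \<Rightarrow>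
    nat \<Rightarrow> (('k, 'a, 'v) gmod \<Rightarrow>\<^sub>0 int) set" where
  "tower_prod K A \<rho> C x y = (\<lambda>n. \<Otimes>\<^bsub>K0 K (A n) (C n)\<^esub> k \<in> {..n}.
     K0_map2 K (A n) (C n)
       (\<lambda>M N. Ind (\<rho> k (n - k)) (twr2 K A k (n - k)) (A n) (mod_tensor K M N)) (x k) (y (n - k)))"

definition tower_coprod :: "'k ring \<Rightarrow> (nat \<Rightarrow> ('k, 'a) gspace) \<Rightarrow>
    (nat \<Rightarrow> nat \<Rightarrow> ('a \<times> 'a \<Rightarrow>\<^sub>0 int) set \<Rightarrow> 'a) \<Rightarrow>
    (nat \<Rightarrow> nat \<Rightarrow> ('k, ('a \<times> 'a \<Rightarrow>\<^sub>0 int) set, 'w) gmod set) \<Rightarrow>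
    (nat \<Rightarrow> (('k, 'a, 'v) gmod \<Rightarrow>\<^sub>0 int) set) \<Rightarrow>
    nat \<times> nat \<Rightarrow> (('k, ('a \<times> 'a \<Rightarrow>\<^sub>0 int) set, 'w) gmod \<Rightarrow>\<^sub>0 int) set" where
  "tower_coprod K A \<rho> D x = (\<lambda>(k, l). K0_map K (twr2 K A k l) (D k l) (Res (\<rho> k l)) (x (k + l)))"

definition ext_prod :: "'k ring \<Rightarrow> (nat \<Rightarrow> ('k, 'a) gspace) \<Rightarrow>
    (nat \<Rightarrow> nat \<Rightarrow> ('k, ('a \<times> 'a \<Rightarrow>\<^sub>0 int) set, 'w) gmod set) \<Rightarrow>
    (nat \<Rightarrow> (('k, 'a, 'v) gmod \<Rightarrow>\<^sub>0 int) set) \<Rightarrow> (nat \<Rightarrow> (('k, 'a, 'v) gmod \<Rightarrow>\<^sub>0 int) set) \<Rightarrow>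
    nat \<times> nat \<Rightarrow> (('k, ('a \<times> 'a \<Rightarrow>\<^sub>0 int) set, 'w) gmod \<Rightarrow>\<^sub>0 int) set" where
  "ext_prod K A D x y = (\<lambda>(k, l). K0_map2 K (twr2 K A k l) (D k l) (mod_tensor K) (x k) (y l))"

text \<open>
  The counit takes values in the Grothendieck group of graded vector spaces, identified with the
  Laurent polynomials by \<open>gdim\<close>.
\<close>

definition tower_counit :: "'k ring \<Rightarrow> (nat \<Rightarrow> (('k, 'a, 'v) gmod \<Rightarrow>\<^sub>0 int) set) \<Rightarrow> laurent" where
  "tower_counit K x = the_elem (laurent_extend (gdim K) ` x 0)"

definition tower_pairing :: "'k ring \<Rightarrow> (nat \<Rightarrow> ('k, 'a) gspace) \<Rightarrow> (nat \<Rightarrow> 'a \<Rightarrow> 'a) \<Rightarrow>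
    (nat \<Rightarrow> (('k, 'a, 'v) gmod \<Rightarrow>\<^sub>0 int) set) \<Rightarrow> (nat \<Rightarrow> (('k, 'a, 'w) gmod \<Rightarrow>\<^sub>0 int) set) \<Rightarrow> laurent" where
  "tower_pairing K A \<psi> p m = Sum_any (\<lambda>n. K0_pairing K (A n) (\<psi> n) (p n) (m n))"

definition tower_pairing2 :: "'k ring \<Rightarrow> (nat \<Rightarrow> ('k, 'a) gspace) \<Rightarrow> (nat \<Rightarrow> 'a \<Rightarrow> 'a) \<Rightarrow>
    (nat \<times> nat \<Rightarrow> (('k, ('a \<times> 'a \<Rightarrow>\<^sub>0 int) set, 'v) gmod \<Rightarrow>\<^sub>0 int) set) \<Rightarrow>
    (nat \<times> nat \<Rightarrow> (('k, ('a \<times> 'a \<Rightarrow>\<^sub>0 int) set, 'w) gmod \<Rightarrow>\<^sub>0 int) set) \<Rightarrow> laurent" where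
  "tower_pairing2 K A \<psi> x y =
     Sum_any (\<lambda>(k, l). K0_pairing K (twr2 K A k l) (psi2 K A \<psi> k l) (x (k, l)) (y (k, l)))"

end

(*
Every class involved has the form kcoset u, where u is a formal sum of modules, so each identity
reduces, by biadditivity, to modules P, N and M. There the two adjunctions are isomorphisms of
graded spaces. The first sends x \<otimes> m to (1 \<otimes> x) \<otimes> m:

  N^\<psi> \<otimes>_B Res M = (Ind N)^\<psi> \<otimes>_C M,    (Res P)^\<psi> \<otimes>_B N = P^\<psi> \<otimes>_C Ind N,

with B = A k \<otimes> A l and C = A (k + l); they use that \<psi> is compatible with B \<rightarrow> C. That the pairing
and the structure maps are defined on Grothendieck groups is an exactness statement. Projective
modules have finite graded dual bases, through which tensoring with them is a direct summand of a
finite power of the identity, hence exact and preserving finite dimension; this applies to P^\<psi> and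
to C as a right B-module. Tensoring over the field is exact because short exact sequences split there.
*)
theory Submission
  imports Defs
begin


section \<open>Abelian groups by generators and relations\<close>

text \<open>Operations on cosets are unions over all representatives, and the pairing and the counit
  are \<open>the_elem\<close> of a set of values; each of them computes to something only once the
  union or set has collapsed. A second obstacle is the grading of a tensor product: its pieces are
  images of generated subgroups of a free abelian group, and their directness is obtained by
  constructing the projections through the universal property. Tensor products over the field are
  treated as tensor products over the algebra \<open>ground K\<close>, so one construction serves
  both. In the projective argument of the pairing the other factor is an arbitrary
  finite-dimensional module, so the sequence itself has to split. The splitting is in general not
  graded; only the maps of the sequence are, which suffices for counting dimensions degree by
  degree. Finally, functors yield modules on new carrier types, so every class passes through the
  choice \<open>rep\<close>; invariance of the pairing under isomorphism removes that choice
  again.\<close>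

abbreviation gcoset :: "'a set \<Rightarrow> ('a \<Rightarrow>\<^sub>0 int) set \<Rightarrow> ('a \<Rightarrow>\<^sub>0 int) \<Rightarrow> ('a \<Rightarrow>\<^sub>0 int) set" where
  "gcoset S R x \<equiv> generate (free_Abelian_group S) R #>\<^bsub>free_Abelian_group S\<^esub> x"

abbreviation presented :: "'a set \<Rightarrow> ('a \<Rightarrow>\<^sub>0 int) set \<Rightarrow> ('a \<Rightarrow>\<^sub>0 int) set monoid" where
  "presented S R \<equiv> free_Abelian_group S Mod generate (free_Abelian_group S) R"

lemma frag_extend_in_carrier:
  assumes "\<And>x. x \<in> S \<Longrightarrow> Poly_Mapping.keys (F x) \<subseteq> S'" "Poly_Mapping.keys u \<subseteq> S"
  shows "Poly_Mapping.keys (frag_extend F u) \<subseteq> S'"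
  using keys_frag_extend[of F u] assms by fast

text \<open>Tensor products and Grothendieck groups are both of this form, and the degree pieces of
  a tensor product reuse the facts on generated subgroups; closure, induction and well-definedness
  are settled here once.\<close>

locale presentation =
  fixes S :: "'a set" and R :: "('a \<Rightarrow>\<^sub>0 int) set"
  assumes R_carrier: "R \<subseteq> carrier (free_Abelian_group S)"
begin

sublocale F: comm_group "free_Abelian_group S"
  by (rule abelian_free_Abelian_group)

lemma subgroup_rels: "subgroup (generate (free_Abelian_group S) R) (free_Abelian_group S)"
  by (rule F.generate_is_subgroup[OF R_carrier])

lemma normal_rels: "generate (free_Abelian_group S) R \<lhd> free_Abelian_group S"
  using F.normal_iff_subgroup subgroup_rels by blast

lemma rels_keys: "h \<in> generate (free_Abelian_group S) R \<Longrightarrow> Poly_Mapping.keys h \<subseteq> S"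
  by (metis subgroup.subset[OF subgroup_rels] subsetD carrier_free_Abelian_group_iff)

text \<open>Differences suffice as closure step, because \<open>- x = 0 - x\<close> and
  \<open>x + y = x - (- y)\<close>. This matches \<open>frag_induction\<close>, so that
  \<open>frag_extend\<close> only has to be compatible with subtraction.\<close>

lemma rels_induct [consumes 1, case_names zero incl diff]:
  assumes "h \<in> generate (free_Abelian_group S) R"
    and "P 0" "\<And>r. r \<in> R \<Longrightarrow> P r" "\<And>x y. P x \<Longrightarrow> P y \<Longrightarrow> P (x - y)"
  shows "P h"
proof -
  have m: "P (- x)" if "P x" for x using assms(4)[OF assms(2) that] by simp
  show ?thesis using assms(1)
  proof (induction rule: generate.induct)
    case (inv h)
    then have "inv\<^bsub>free_Abelian_group S\<^esub> h = - h" using R_carrier by (auto intro: inv_free_Abelian_group)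
    then show ?case using m assms(3) inv by simp
  next
    case (eng h1 h2)
    then show ?case using assms(4)[OF eng.IH(1) m[OF eng.IH(2)]] by simp
  qed (use assms in simp_all)
qed

lemma rels_zero: "0 \<in> generate (free_Abelian_group S) R"
  using subgroup.one_closed[OF subgroup_rels] by simp

lemma rels_diff:
  assumes "x \<in> generate (free_Abelian_group S) R" "y \<in> generate (free_Abelian_group S) R"
  shows "x - y \<in> generate (free_Abelian_group S) R"
  using subgroup.m_closed[OF subgroup_rels assms(1) subgroup.m_inv_closed[OF subgroup_rels assms(2)]]
    rels_keys[OF assms(2)] by simp

lemma rels_minus:
  "x \<in> generate (free_Abelian_group S) R \<Longrightarrow> - x \<in> generate (free_Abelian_group S) R"
  using rels_diff[OF rels_zero] by simp

lemma rels_incl: "r \<in> R \<Longrightarrow> r \<in> generate (free_Abelian_group S) R"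
  by (rule generate.incl)

lemma mem_gcoset: "y \<in> gcoset S R x \<longleftrightarrow> y - x \<in> generate (free_Abelian_group S) R"
  by (auto simp: r_coset_def) (metis diff_add_cancel)

lemma gcoset_self: "x \<in> gcoset S R x"
  by (simp add: mem_gcoset rels_zero)

lemma gcoset_eqI:
  assumes "x - y \<in> generate (free_Abelian_group S) R" shows "gcoset S R x = gcoset S R y"
proof -
  have "y - x \<in> generate (free_Abelian_group S) R" using rels_minus[OF assms] by simp
  then show ?thesis
    using rels_diff[of "_ - x" "y - x"] rels_diff[of "_ - y" "x - y"] assms
    by (auto simp: mem_gcoset)
qed

lemma gcoset_eq_iff: "gcoset S R x = gcoset S R y \<longleftrightarrow> x - y \<in> generate (free_Abelian_group S) R"
  using gcoset_eqI gcoset_self mem_gcoset by metis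

lemma presented_comm_group: "comm_group (presented S R)"
  by (rule F.abelian_FactGroup[OF subgroup_rels])

lemma gcoset_closed: "Poly_Mapping.keys x \<subseteq> S \<Longrightarrow> gcoset S R x \<in> carrier (presented S R)"
  by (auto simp: carrier_FactGroup)

lemma presented_cases:
  assumes "X \<in> carrier (presented S R)"
  obtains x where "Poly_Mapping.keys x \<subseteq> S" "X = gcoset S R x"
  using assms by (auto simp: carrier_FactGroup)

lemma gcoset_keys: "Poly_Mapping.keys x \<subseteq> S \<Longrightarrow> y \<in> gcoset S R x \<Longrightarrow> Poly_Mapping.keys y \<subseteq> S"
  using keys_add[of "y - x" x] rels_keys[of "y - x"] by (auto simp: mem_gcoset)

lemma gcoset_add:
  assumes "Poly_Mapping.keys x \<subseteq> S" "Poly_Mapping.keys y \<subseteq> S"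
  shows "gcoset S R x \<otimes>\<^bsub>presented S R\<^esub> gcoset S R y = gcoset S R (x + y)"
  using normal.rcos_sum[OF normal_rels, of x y] assms by simp

lemma gcoset_zero: "gcoset S R 0 = \<one>\<^bsub>presented S R\<^esub>"
  by (simp only: one_FactGroup set_eq_iff mem_gcoset diff_zero) blast

lemma presented_induct [consumes 1, case_names zero gen diff]:
  assumes "X \<in> carrier (presented S R)"
    and zero: "P (gcoset S R 0)" and gen: "\<And>s. s \<in> S \<Longrightarrow> P (gcoset S R (frag_of s))"
    and diff: "\<And>x y. \<lbrakk>Poly_Mapping.keys x \<subseteq> S; Poly_Mapping.keys y \<subseteq> S; P (gcoset S R x); P (gcoset S R y)\<rbrakk>
      \<Longrightarrow> P (gcoset S R (x - y))"
  shows "P X"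
proof -
  obtain x where x: "Poly_Mapping.keys x \<subseteq> S" "X = gcoset S R x" by (rule presented_cases[OF assms(1)])
  have "Poly_Mapping.keys x \<subseteq> S \<and> P (gcoset S R x)" using x(1)
  proof (induction x rule: frag_induction)
    case (diff a b)
    then show ?case using assms(4)[of a b] keys_diff[of a b] by blast
  qed (use zero gen in auto)
  then show ?thesis using x by simp
qed

text \<open>Once the extension of \<open>F\<close> sends generating relations to relations, two
  representatives of a coset have images that differ by a relation. The union over representatives,
  which is how such maps are defined, then consists of a single coset.\<close>

lemma gcoset_map:
  assumes S': "presentation S' R'"
    and F_rels: "\<And>r. r \<in> R \<Longrightarrow> frag_extend F r \<in> generate (free_Abelian_group S') R'"
  shows "(\<Union>x \<in> gcoset S R u. gcoset S' R' (frag_extend F x)) = gcoset S' R' (frag_extend F u)"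
proof -
  interpret S': presentation S' R' by fact
  have *: "frag_extend F h \<in> generate (free_Abelian_group S') R'" if "h \<in> generate (free_Abelian_group S) R" for h
    using that by (induction rule: rels_induct) (auto simp: S'.rels_zero F_rels frag_extend_diff S'.rels_diff)
  have "gcoset S' R' (frag_extend F x) = gcoset S' R' (frag_extend F u)" if "x \<in> gcoset S R u" for x
    using * that by (intro S'.gcoset_eqI) (auto simp: mem_gcoset frag_extend_diff[symmetric])
  then show ?thesis using gcoset_self by blast
qed

text \<open>The kernel of the extension of \<open>b\<close> to the free group contains the generated
  subgroup, so the extension factors. The hypothesis \<open>rels\<close> ranges over all extensions
  \<open>h\<close> because the one to be factored is only obtained inside the proof.\<close>

lemma universal:
  assumes W: "comm_group W" and b: "\<And>s. s \<in> S \<Longrightarrow> b s \<in> carrier W"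
    and rels: "\<And>h r. \<lbrakk>h \<in> hom (free_Abelian_group S) W; \<And>s. s \<in> S \<Longrightarrow> h (frag_of s) = b s; r \<in> R\<rbrakk> \<Longrightarrow> h r = \<one>\<^bsub>W\<^esub>"
  obtains g where "g \<in> hom (presented S R) W" "\<And>s. s \<in> S \<Longrightarrow> g (gcoset S R (frag_of s)) = b s"
proof -
  interpret W: comm_group W by fact
  obtain h where h: "h \<in> hom (free_Abelian_group S) W" "\<And>s. s \<in> S \<Longrightarrow> h (frag_of s) = b s"
    by (rule W.free_Abelian_group_universal[of b S]) (use b in auto)
  interpret h: group_hom "free_Abelian_group S" W h
    by unfold_locales (rule h)
  have "generate (free_Abelian_group S) R \<subseteq> kernel (free_Abelian_group S) W h"
  proof (rule F.generate_subgroup_incl[OF _ h.subgroup_kernel])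
    show "R \<subseteq> kernel (free_Abelian_group S) W h"
      unfolding kernel_def using rels[OF h] R_carrier by blast
  qed
  then obtain g where g: "g \<in> hom (presented S R) W"
      "\<And>x. x \<in> carrier (free_Abelian_group S) \<Longrightarrow> g (gcoset S R x) = h x"
    using h.FactGroup_universal_kernel[OF normal_rels] by blast
  show thesis by (rule that[OF g(1)]) (simp add: g(2) h(2))
qed

end

text \<open>The two arguments are changed one after the other. Relations are tested only against
  single generators of the other argument; arbitrary formal sums there are reached by
  induction.\<close>

lemma gcoset_map2:
  assumes 1: "presentation S R" and 2: "presentation S' R'" and T: "presentation T Q"
    and F1: "\<And>r t. r \<in> R \<Longrightarrow> t \<in> S' \<Longrightarrow> frag_extend (\<lambda>s. F s t) r \<in> generate (free_Abelian_group T) Q"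
    and F2: "\<And>r s. r \<in> R' \<Longrightarrow> s \<in> S \<Longrightarrow> frag_extend (F s) r \<in> generate (free_Abelian_group T) Q"
    and u: "Poly_Mapping.keys u \<subseteq> S" and v: "Poly_Mapping.keys v \<subseteq> S'"
  shows "(\<Union>x \<in> gcoset S R u. \<Union>y \<in> gcoset S' R' v. gcoset T Q (frag_extend (\<lambda>s. frag_extend (F s) y) x)) =
    gcoset T Q (frag_extend (\<lambda>s. frag_extend (F s) v) u)"
proof -
  interpret U: presentation S R by fact
  interpret V: presentation S' R' by fact
  interpret T: presentation T Q by fact
  \<comment> \<open>Biadditive extension may be carried out in either order, which allows an
    induction on either argument.\<close>
  have sw: "frag_extend (\<lambda>s. frag_extend (F s) y) x = frag_extend (\<lambda>t. frag_extend (\<lambda>s. F s t) x) y" for x y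
  proof -
    have "Poly_Mapping.keys x \<subseteq> UNIV" by simp
    then show ?thesis
    proof (induction x rule: frag_induction)
      case zero
      show ?case by (simp add: frag_extend_eq_0)
    next
      case (diff a b)
      have *: "frag_extend (\<lambda>t. f t - g t) y = frag_extend f y - frag_extend g y" for f g
        by (rule poly_mapping_eqI)
          (simp add: frag_extend_def lookup_sum lookup_minus sum_subtractf right_diff_distrib)
      show ?case using diff by (simp add: frag_extend_diff *)
    next
      case (one a)
      show ?case by (simp only: frag_extend_of)
    qed
  qed
  \<comment> \<open>Two nested inductions: on the relation \<open>r\<close>, and, for a generating
    relation, on \<open>y\<close>. The swap brings \<open>y\<close> into the outer position for the
    second one.\<close>
  have A: "frag_extend (\<lambda>s. frag_extend (F s) y) r \<in> generate (free_Abelian_group T) Q"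
    if r: "r \<in> generate (free_Abelian_group S) R" and y: "Poly_Mapping.keys y \<subseteq> S'" for r y
    using r
  proof (induction rule: U.rels_induct)
    case (incl r)
    show ?case apply (subst sw) using y
      by (induction y rule: frag_induction) (auto simp: T.rels_zero frag_extend_diff T.rels_diff F1 incl)
  qed (auto simp: T.rels_zero frag_extend_diff T.rels_diff)
  have B: "frag_extend (\<lambda>t. frag_extend (\<lambda>s. F s t) x) r \<in> generate (free_Abelian_group T) Q"
    if r: "r \<in> generate (free_Abelian_group S') R'" and x: "Poly_Mapping.keys x \<subseteq> S" for r x
    using r
  proof (induction rule: V.rels_induct)
    case (incl r)
    show ?case apply (subst sw[symmetric]) using x
      by (induction x rule: frag_induction) (auto simp: T.rels_zero frag_extend_diff T.rels_diff F2 incl)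
  qed (auto simp: T.rels_zero frag_extend_diff T.rels_diff)
  have "gcoset T Q (frag_extend (\<lambda>s. frag_extend (F s) y) x) = gcoset T Q (frag_extend (\<lambda>s. frag_extend (F s) v) u)"
    if x: "x \<in> gcoset S R u" and y: "y \<in> gcoset S' R' v" for x y
  proof -
    have "gcoset T Q (frag_extend (\<lambda>s. frag_extend (F s) y) x) = gcoset T Q (frag_extend (\<lambda>s. frag_extend (F s) y) u)"
      by (rule T.gcoset_eqI) (use A[of "x - u" y] x V.gcoset_keys[OF v y] in \<open>simp add: U.mem_gcoset frag_extend_diff\<close>)
    also have "\<dots> = gcoset T Q (frag_extend (\<lambda>s. frag_extend (F s) v) u)"
    proof (rule T.gcoset_eqI)
      have "y - v \<in> generate (free_Abelian_group S') R'" using y V.mem_gcoset by blast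
      from B[OF this u] have "frag_extend (\<lambda>t. frag_extend (\<lambda>s. F s t) u) y - frag_extend (\<lambda>t. frag_extend (\<lambda>s. F s t) u) v
          \<in> generate (free_Abelian_group T) Q"
        by (subst (asm) frag_extend_diff)
      then show "frag_extend (\<lambda>s. frag_extend (F s) y) u - frag_extend (\<lambda>s. frag_extend (F s) v) u
          \<in> generate (free_Abelian_group T) Q"
        by (rule back_subst[where P = "\<lambda>z. z \<in> generate (free_Abelian_group T) Q"])
          (rule arg_cong2[of _ _ _ _ minus, OF sw[symmetric] sw[symmetric]])
    qed
    finally show ?thesis .
  qed
  then have "(\<Union>x \<in> gcoset S R u. \<Union>y \<in> gcoset S' R' v. gcoset T Q (frag_extend (\<lambda>s. frag_extend (F s) y) x)) =
      (\<Union>x \<in> gcoset S R u. \<Union>y \<in> gcoset S' R' v. gcoset T Q (frag_extend (\<lambda>s. frag_extend (F s) v) u))"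
    by (intro SUP_cong refl)
  also have "\<dots> = gcoset T Q (frag_extend (\<lambda>s. frag_extend (F s) v) u)"
    using U.gcoset_self[of u] V.gcoset_self[of v] by (simp only: UN_constant split: if_split) blast
  finally show ?thesis .
qed


section \<open>Additive maps and tensor products\<close>

text \<open>Additivity alone is recorded: maps out of a tensor product are constructed and compared
  through it, and linearity over \<open>K\<close> or over an algebra is added where it
  matters.\<close>

definition addmap :: "('a, 'y) ring_scheme \<Rightarrow> ('b, 'z) ring_scheme \<Rightarrow> ('a \<Rightarrow> 'b) \<Rightarrow> bool" where
  "addmap V W f \<longleftrightarrow> (\<forall>x \<in> carrier V. f x \<in> carrier W) \<and>
     (\<forall>x \<in> carrier V. \<forall>y \<in> carrier V. f (x \<oplus>\<^bsub>V\<^esub> y) = f x \<oplus>\<^bsub>W\<^esub> f y)"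

lemma addmapI:
  "\<lbrakk>\<And>x. x \<in> carrier V \<Longrightarrow> f x \<in> carrier W;
    \<And>x y. \<lbrakk>x \<in> carrier V; y \<in> carrier V\<rbrakk> \<Longrightarrow> f (x \<oplus>\<^bsub>V\<^esub> y) = f x \<oplus>\<^bsub>W\<^esub> f y\<rbrakk> \<Longrightarrow> addmap V W f"
  by (simp add: addmap_def)

lemma addmap_closed: "addmap V W f \<Longrightarrow> x \<in> carrier V \<Longrightarrow> f x \<in> carrier W"
  by (simp add: addmap_def)

lemma addmap_add:
  "addmap V W f \<Longrightarrow> x \<in> carrier V \<Longrightarrow> y \<in> carrier V \<Longrightarrow> f (x \<oplus>\<^bsub>V\<^esub> y) = f x \<oplus>\<^bsub>W\<^esub> f y"
  by (simp add: addmap_def)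

lemma addmap_comp: "addmap V W f \<Longrightarrow> addmap W X g \<Longrightarrow> addmap V X (\<lambda>x. g (f x))"
  by (simp add: addmap_def)

lemma addmap_id: "addmap V V (\<lambda>x. x)"
  by (simp add: addmap_def)

lemma addmap_iff_group_hom:
  assumes "abelian_group V" "abelian_group W"
  shows "addmap V W f \<longleftrightarrow> group_hom (add_monoid V) (add_monoid W) f"
proof -
  interpret V: abelian_group V by fact
  interpret W: abelian_group W by fact
  show ?thesis
    by (auto simp: addmap_def group_hom_def group_hom_axioms_def hom_def V.a_group W.a_group)
qed

lemma addmap_zero:
  assumes "abelian_group V" "abelian_group W" "addmap V W f"
  shows "f \<zero>\<^bsub>V\<^esub> = \<zero>\<^bsub>W\<^esub>"
  using group_hom.hom_one[of "add_monoid V" "add_monoid W" f] addmap_iff_group_hom assms by fastforce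

lemma addmap_minus:
  assumes "abelian_group V" "abelian_group W" "addmap V W f" "x \<in> carrier V"
  shows "f (\<ominus>\<^bsub>V\<^esub> x) = \<ominus>\<^bsub>W\<^esub> f x"
  using group_hom.hom_inv[of "add_monoid V" "add_monoid W" f x] addmap_iff_group_hom assms
  by (fastforce simp: a_inv_def)

lemma addmap_diff:
  assumes "abelian_group V" "abelian_group W" "addmap V W f" "x \<in> carrier V" "y \<in> carrier V"
  shows "f (x \<ominus>\<^bsub>V\<^esub> y) = f x \<ominus>\<^bsub>W\<^esub> f y"
proof -
  interpret V: abelian_group V by fact
  show ?thesis using assms by (simp add: a_minus_def addmap_add addmap_minus)
qed

lemma addmap_finsum:
  assumes "abelian_group V" "abelian_group W" "addmap V W f" "g \<in> I \<rightarrow> carrier V"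
  shows "f (finsum V g I) = finsum W (\<lambda>i. f (g i)) I"
proof -
  interpret V: abelian_group V by fact
  interpret W: abelian_group W by fact
  show ?thesis using assms(4)
  proof (induction I rule: infinite_finite_induct)
    case (insert i I)
    then have *: "(\<lambda>i. f (g i)) \<in> I \<rightarrow> carrier W" "f (g i) \<in> carrier W" "g \<in> I \<rightarrow> carrier V" "g i \<in> carrier V"
      using addmap_closed[OF assms(3)] by auto
    show ?case using insert * by (simp add: addmap_add[OF assms(3)])
  qed (simp_all add: addmap_zero[OF assms(1-3)])
qed

lemma addmap_plus:
  assumes "abelian_group W" "addmap V W f" "addmap V W g"
  shows "addmap V W (\<lambda>x. f x \<oplus>\<^bsub>W\<^esub> g x)"
proof -
  interpret W: abelian_group W by fact
  show ?thesis by (rule addmapI) (use assms(2,3) in \<open>auto simp: addmap_def W.a_ac\<close>)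
qed

lemma addmap_finsum_pointwise:
  assumes "abelian_group V" "abelian_group W" "\<And>i. i \<in> I \<Longrightarrow> addmap V W (f i)"
  shows "addmap V W (\<lambda>x. finsum W (\<lambda>i. f i x) I)"
proof -
  interpret W: abelian_group W by fact
  show ?thesis
  proof (rule addmapI)
    fix x y assume "x \<in> carrier V" "y \<in> carrier V"
    then have xy: "f i x \<in> carrier W" "f i y \<in> carrier W" "f i (x \<oplus>\<^bsub>V\<^esub> y) = f i x \<oplus>\<^bsub>W\<^esub> f i y" if "i \<in> I" for i
      using assms(3)[OF that] by (simp_all add: addmap_def)
    have "(\<Oplus>\<^bsub>W\<^esub>i\<in>I. f i (x \<oplus>\<^bsub>V\<^esub> y)) = (\<Oplus>\<^bsub>W\<^esub>i\<in>I. f i x \<oplus>\<^bsub>W\<^esub> f i y)"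
      by (rule W.finsum_cong') (use xy in auto)
    also have "\<dots> = (\<Oplus>\<^bsub>W\<^esub>i\<in>I. f i x) \<oplus>\<^bsub>W\<^esub> (\<Oplus>\<^bsub>W\<^esub>i\<in>I. f i y)"
      by (rule W.finsum_addf) (use xy in auto)
    finally show "(\<Oplus>\<^bsub>W\<^esub>i\<in>I. f i (x \<oplus>\<^bsub>V\<^esub> y)) = (\<Oplus>\<^bsub>W\<^esub>i\<in>I. f i x) \<oplus>\<^bsub>W\<^esub> (\<Oplus>\<^bsub>W\<^esub>i\<in>I. f i y)" .
  qed (use assms(3) in \<open>auto intro!: W.finsum_closed simp: addmap_def\<close>)
qed

text \<open>Extending a record gives a new type of structures with the same operations; the group
  laws are carried across along equality of these operations.\<close>

lemma comm_group_cong: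
  assumes "comm_group G" "carrier H = carrier G" "(\<otimes>\<^bsub>H\<^esub>) = (\<otimes>\<^bsub>G\<^esub>)" "\<one>\<^bsub>H\<^esub> = \<one>\<^bsub>G\<^esub>"
  shows "comm_group H"
proof -
  interpret G: comm_group G by fact
  show ?thesis
    by (rule comm_groupI) (use assms(2-4) in \<open>auto simp: G.m_ac intro: G.l_inv_ex\<close>)
qed

text \<open>The generating set inside \<open>tensor_rels\<close>, named separately so that a tensor
  product becomes \<open>presented\<close> by it.\<close>

definition trels where
  "trels S r l M N =
     {frag_of (m \<oplus>\<^bsub>M\<^esub> m', n) - frag_of (m, n) - frag_of (m', n) | m m' n.
         m \<in> carrier M \<and> m' \<in> carrier M \<and> n \<in> carrier N} \<union>
      {frag_of (m, n \<oplus>\<^bsub>N\<^esub> n') - frag_of (m, n) - frag_of (m, n') | m n n'.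
         m \<in> carrier M \<and> n \<in> carrier N \<and> n' \<in> carrier N} \<union>
      {frag_of (r s m, n) - frag_of (m, l s n) | s m n.
         s \<in> S \<and> m \<in> carrier M \<and> n \<in> carrier N}"

lemma tensor_rels_eq: "tensor_rels S r l M N = generate (pairs M N) (trels S r l M N)"
  by (simp add: tensor_rels_def trels_def)

text \<open>The pure tensor \<open>m \<otimes> n\<close>, for balancing over an arbitrary set of
  scalars.\<close>

definition pt where "pt S r l M N m n = gcoset (carrier M \<times> carrier N) (trels S r l M N) (frag_of (m, n))"

lemma ptensor_eq: "ptensor K M N m n = pt (carrier K) (Module.smult M) (Module.smult N) M N m n"
  by (simp add: ptensor_def pt_def tensor_rels_eq)

text \<open>Balancing is over a mere index set \<open>S\<close> with two families of maps, so that
  tensor products over an algebra and over the field are instances of the same group-theoretic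
  construction.\<close>

locale tensor_data = M: abelian_group M + N: abelian_group N
  for S :: "'s set" and r :: "'s \<Rightarrow> 'm \<Rightarrow> 'm" and l :: "'s \<Rightarrow> 'n \<Rightarrow> 'n"
    and M :: "('k, 'm, 'y) gspace_scheme" and N :: "('k, 'n, 'z) gspace_scheme" +
  assumes r_closed: "s \<in> S \<Longrightarrow> m \<in> carrier M \<Longrightarrow> r s m \<in> carrier M"
    and l_closed: "s \<in> S \<Longrightarrow> n \<in> carrier N \<Longrightarrow> l s n \<in> carrier N"
begin

abbreviation "T \<equiv> tensor S r l M N"
abbreviation "tn \<equiv> pt S r l M N"

sublocale P: presentation "carrier M \<times> carrier N" "trels S r l M N"
proof
  have *: "Poly_Mapping.keys (a - b) \<subseteq> X" if "Poly_Mapping.keys a \<subseteq> X" "Poly_Mapping.keys b \<subseteq> X"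
    for a b :: "('m \<times> 'n) \<Rightarrow>\<^sub>0 int" and X
    using that keys_diff[of a b] by blast
  show "trels S r l M N \<subseteq> carrier (pairs M N)"
  proof
    fix x assume x: "x \<in> trels S r l M N"
    have k: "Poly_Mapping.keys (frag_of p :: ('m \<times> 'n) \<Rightarrow>\<^sub>0 int) \<subseteq> X" if "p \<in> X" for p X
      using that by (simp add: keys_frag_of)
    have "Poly_Mapping.keys x \<subseteq> carrier M \<times> carrier N"
      using x unfolding trels_def
      by (elim UnE CollectE exE conjE; hypsubst) (intro * k SigmaI M.a_closed N.a_closed r_closed l_closed; assumption)+
    then show "x \<in> carrier (pairs M N)" by simp
  qed
qed

lemma carrier_T: "carrier T = carrier (presented (carrier M \<times> carrier N) (trels S r l M N))"
  by (simp add: tensor_def Let_def tensor_rels_eq)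

lemma add_T: "x \<oplus>\<^bsub>T\<^esub> y = x \<otimes>\<^bsub>presented (carrier M \<times> carrier N) (trels S r l M N)\<^esub> y"
  by (simp add: tensor_def Let_def tensor_rels_eq)

lemma zero_T: "\<zero>\<^bsub>T\<^esub> = gcoset (carrier M \<times> carrier N) (trels S r l M N) 0"
  unfolding P.gcoset_zero by (simp add: tensor_def Let_def tensor_rels_eq)

lemma abelian_group_T: "abelian_group T"
proof -
  have *: "comm_group (add_monoid T)"
    by (rule comm_group_cong[OF P.presented_comm_group]) (simp_all add: tensor_def Let_def tensor_rels_eq)
  then show ?thesis
    by (simp add: abelian_group_def abelian_group_axioms_def abelian_monoid_def comm_group_def)
qed

sublocale T: abelian_group T by (rule abelian_group_T)

lemma tn_closed: "m \<in> carrier M \<Longrightarrow> n \<in> carrier N \<Longrightarrow> tn m n \<in> carrier T"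
  unfolding carrier_T pt_def by (rule P.gcoset_closed) simp

lemma gcoset_add_T:
  assumes "Poly_Mapping.keys x \<subseteq> carrier M \<times> carrier N" "Poly_Mapping.keys y \<subseteq> carrier M \<times> carrier N"
  shows "gcoset (carrier M \<times> carrier N) (trels S r l M N) x \<oplus>\<^bsub>T\<^esub> gcoset (carrier M \<times> carrier N) (trels S r l M N) y =
    gcoset (carrier M \<times> carrier N) (trels S r l M N) (x + y)"
  by (simp only: add_T P.gcoset_add[OF assms])

lemma tn_add_left:
  assumes "m \<in> carrier M" "m' \<in> carrier M" "n \<in> carrier N"
  shows "tn (m \<oplus>\<^bsub>M\<^esub> m') n = tn m n \<oplus>\<^bsub>T\<^esub> tn m' n"
proof -
  have "frag_of (m \<oplus>\<^bsub>M\<^esub> m', n) - frag_of (m, n) - frag_of (m', n) \<in> trels S r l M N"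
    unfolding trels_def using assms by blast
  from P.rels_incl[OF this] show ?thesis
    unfolding pt_def using assms
    by (subst gcoset_add_T) (auto intro!: P.gcoset_eqI simp: diff_diff_eq)
qed

lemma tn_add_right:
  assumes "m \<in> carrier M" "n' \<in> carrier N" "n \<in> carrier N"
  shows "tn m (n \<oplus>\<^bsub>N\<^esub> n') = tn m n \<oplus>\<^bsub>T\<^esub> tn m n'"
proof -
  have "frag_of (m, n \<oplus>\<^bsub>N\<^esub> n') - frag_of (m, n) - frag_of (m, n') \<in> trels S r l M N"
    unfolding trels_def using assms by blast
  from P.rels_incl[OF this] show ?thesis
    unfolding pt_def using assms
    by (subst gcoset_add_T) (auto intro!: P.gcoset_eqI simp: diff_diff_eq)
qed

lemma tn_balanced:
  assumes "s \<in> S" "m \<in> carrier M" "n \<in> carrier N"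
  shows "tn (r s m) n = tn m (l s n)"
proof -
  have "frag_of (r s m, n) - frag_of (m, l s n) \<in> trels S r l M N"
    unfolding trels_def using assms by blast
  from P.rels_incl[OF this] show ?thesis
    unfolding pt_def by (rule P.gcoset_eqI)
qed

lemma addmap_tn_left: "n \<in> carrier N \<Longrightarrow> addmap M T (\<lambda>m. tn m n)"
  by (rule addmapI) (auto simp: tn_closed tn_add_left)

lemma addmap_tn_right: "m \<in> carrier M \<Longrightarrow> addmap N T (\<lambda>n. tn m n)"
  by (rule addmapI) (auto simp: tn_closed tn_add_right)

lemmas tn_zero_left = addmap_zero[OF M.abelian_group_axioms T.abelian_group_axioms addmap_tn_left]
lemmas tn_zero_right = addmap_zero[OF N.abelian_group_axioms T.abelian_group_axioms addmap_tn_right]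
lemmas tn_minus_left = addmap_minus[OF M.abelian_group_axioms T.abelian_group_axioms addmap_tn_left]
lemmas tn_finsum_left = addmap_finsum[OF M.abelian_group_axioms T.abelian_group_axioms addmap_tn_left]
lemmas tn_finsum_right = addmap_finsum[OF N.abelian_group_axioms T.abelian_group_axioms addmap_tn_right]

text \<open>Sums of pure tensors exhaust the tensor product since
  \<open>- (m \<otimes> n) = (- m) \<otimes> n\<close>. As \<open>presented_induct\<close> proceeds
  through differences, the property is proved for \<open>z\<close> and its negative at the same
  time.\<close>

lemma tensor_induct [consumes 1, case_names pure add]:
  assumes z: "z \<in> carrier T"
    and pure: "\<And>m n. m \<in> carrier M \<Longrightarrow> n \<in> carrier N \<Longrightarrow> Q (tn m n)"
    and add: "\<And>x y. \<lbrakk>x \<in> carrier T; y \<in> carrier T; Q x; Q y\<rbrakk> \<Longrightarrow> Q (x \<oplus>\<^bsub>T\<^esub> y)"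
  shows "Q z"
proof -
  let ?c = "gcoset (carrier M \<times> carrier N) (trels S r l M N)"
  have Q0: "Q \<zero>\<^bsub>T\<^esub>" using pure[of "\<zero>\<^bsub>M\<^esub>" "\<zero>\<^bsub>N\<^esub>"] by (simp add: tn_zero_left)
  have "z \<in> carrier T \<and> Q z \<and> Q (\<ominus>\<^bsub>T\<^esub> z)"
    using z unfolding carrier_T
  proof (induction z rule: P.presented_induct)
    case zero
    have "\<ominus>\<^bsub>T\<^esub> \<zero>\<^bsub>T\<^esub> = \<zero>\<^bsub>T\<^esub>" by (metis T.l_zero T.r_neg T.a_inv_closed T.zero_closed)
    with Q0 have "\<zero>\<^bsub>T\<^esub> \<in> carrier T \<and> Q \<zero>\<^bsub>T\<^esub> \<and> Q (\<ominus>\<^bsub>T\<^esub> \<zero>\<^bsub>T\<^esub>)" by (metis T.zero_closed)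
    then show ?case by (simp only: zero_T carrier_T)
  next
    case (gen s)
    then obtain m n where s: "s = (m, n)" "m \<in> carrier M" "n \<in> carrier N" by auto
    then have "?c (frag_of s) = tn m n" by (simp add: pt_def)
    then show ?case using s pure[of m n] pure[of "\<ominus>\<^bsub>M\<^esub> m" n]
      by (simp add: carrier_T[symmetric] tn_closed tn_minus_left)
  next
    case (diff x y)
    have xy: "?c x \<in> carrier T" "?c y \<in> carrier T" "Q (?c x)" "Q (?c y)" "Q (\<ominus>\<^bsub>T\<^esub> ?c x)" "Q (\<ominus>\<^bsub>T\<^esub> ?c y)"
      using diff by (simp_all only: carrier_T)
    have k: "Poly_Mapping.keys (x - y) \<subseteq> carrier M \<times> carrier N"
      using diff(1,2) keys_diff[of x y] by blast
    then have "?c (x - y) \<oplus>\<^bsub>T\<^esub> ?c y = ?c x" "?c (x - y) \<in> carrier T"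
      using diff(1,2) P.gcoset_closed by (simp_all add: gcoset_add_T carrier_T)
    then have "?c (x - y) = ?c x \<oplus>\<^bsub>T\<^esub> \<ominus>\<^bsub>T\<^esub> ?c y"
      using xy(2) by (metis T.a_assoc T.r_neg T.r_zero T.a_inv_closed)
    then show ?case using xy add[of "?c x" "\<ominus>\<^bsub>T\<^esub> ?c y"] add[of "\<ominus>\<^bsub>T\<^esub> ?c x" "?c y"]
      by (simp add: carrier_T[symmetric] T.minus_add)
  qed
  then show ?thesis by simp
qed

lemma tensor_ext:
  assumes "addmap T W f" "addmap T W g" "z \<in> carrier T"
    and "\<And>m n. m \<in> carrier M \<Longrightarrow> n \<in> carrier N \<Longrightarrow> f (tn m n) = g (tn m n)"
  shows "f z = g z"
  using assms(3) by (induction rule: tensor_induct) (auto simp: assms(4) addmap_add[OF assms(1)] addmap_add[OF assms(2)])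

text \<open>The universal property: the hypotheses on \<open>b\<close> say exactly that its additive
  extension kills the three families of generators in \<open>trels\<close>.\<close>

lemma tensor_lift:
  assumes W: "abelian_group W"
    and left: "\<And>n. n \<in> carrier N \<Longrightarrow> addmap M W (\<lambda>m. b m n)"
    and right: "\<And>m. m \<in> carrier M \<Longrightarrow> addmap N W (\<lambda>n. b m n)"
    and bal: "\<And>s m n. \<lbrakk>s \<in> S; m \<in> carrier M; n \<in> carrier N\<rbrakk> \<Longrightarrow> b (r s m) n = b m (l s n)"
  obtains h where "addmap T W h" "\<And>m n. m \<in> carrier M \<Longrightarrow> n \<in> carrier N \<Longrightarrow> h (tn m n) = b m n"
proof -
  interpret W: abelian_group W by fact
  have b: "b m n \<in> carrier W" if "m \<in> carrier M" "n \<in> carrier N" for m n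
    using addmap_closed[OF left] that by blast
  obtain g where g: "g \<in> hom (presented (carrier M \<times> carrier N) (trels S r l M N)) (add_monoid W)"
    "\<And>s. s \<in> carrier M \<times> carrier N \<Longrightarrow> g (gcoset (carrier M \<times> carrier N) (trels S r l M N) (frag_of s)) = case_prod b s"
  proof (rule P.universal[of "add_monoid W" "case_prod b"])
    show "comm_group (add_monoid W)" by (rule W.a_comm_group)
    fix h t assume h: "h \<in> hom (pairs M N) (add_monoid W)" "\<And>s. s \<in> carrier M \<times> carrier N \<Longrightarrow> h (frag_of s) = case_prod b s"
      and t: "t \<in> trels S r l M N"
    interpret h: group_hom "pairs M N" "add_monoid W" h by unfold_locales (rule h)
    have hd: "h (x - y) = h x \<ominus>\<^bsub>W\<^esub> h y" if "x \<in> carrier (pairs M N)" "y \<in> carrier (pairs M N)" for x y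
    proof -
      have "h (x \<otimes>\<^bsub>pairs M N\<^esub> inv\<^bsub>pairs M N\<^esub> y) = h x \<ominus>\<^bsub>W\<^esub> h y"
        using that P.F.inv_closed[of y] h.hom_mult[of x "inv\<^bsub>pairs M N\<^esub> y"] h.hom_inv[of y]
        by (simp add: a_minus_def a_inv_def)
      then show ?thesis using that by simp
    qed
    have an: "a \<oplus>\<^bsub>W\<^esub> (c \<oplus>\<^bsub>W\<^esub> (\<ominus>\<^bsub>W\<^esub> a \<oplus>\<^bsub>W\<^esub> \<ominus>\<^bsub>W\<^esub> c)) = \<zero>\<^bsub>W\<^esub>" if "a \<in> carrier W" "c \<in> carrier W" for a c
      using that by (simp add: W.minus_add[symmetric] W.a_assoc[symmetric] W.r_neg)
    have hm: "h (frag_of (m, n)) = b m n" if "m \<in> carrier M" "n \<in> carrier N" for m n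
      using h(2)[of "(m, n)"] that by simp
    have c: "frag_of (m, n) - frag_of (m', n') \<in> carrier (pairs M N)" if "m \<in> carrier M" "n \<in> carrier N" "m' \<in> carrier M" "n' \<in> carrier N"
      for m n m' n' using that keys_diff[of "frag_of (m, n)" "frag_of (m', n')"] by auto
    show "h t = \<one>\<^bsub>add_monoid W\<^esub>"
      using t unfolding trels_def
      by (auto simp: hd c hm r_closed l_closed b addmap_add[OF left] addmap_add[OF right] bal an W.minus_eq W.minus_add W.a_ac W.r_neg W.r_neg1 W.r_neg2
         simp del: carrier_free_Abelian_group_iff)
  qed (auto simp: b)
  show thesis
  proof (rule that)
    show "addmap T W g"
      by (rule addmapI) (use g(1) in \<open>auto simp: carrier_T add_T hom_def\<close>)
    show "\<And>m n. m \<in> carrier M \<Longrightarrow> n \<in> carrier N \<Longrightarrow> g (tn m n) = b m n"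
      using g(2) by (simp add: pt_def)
  qed
qed

end


section \<open>Graded spaces\<close>

lemma with_act_simps [simp]:
  "carrier (with_act V f) = carrier V" "add (with_act V f) = add V" "ring.zero (with_act V f) = ring.zero V"
  "Module.smult (with_act V f) = Module.smult V" "gr (with_act V f) = gr V" "act (with_act V f) = f"
  by (simp_all add: with_act_def)

context graded_space
begin

lemma gr_carrier: "x \<in> gr V d \<Longrightarrow> x \<in> carrier V"
  using gr_subspace[of d] by (auto simp: subspace_def submodule_def)

lemma gr_zero: "\<zero>\<^bsub>V\<^esub> \<in> gr V d"
  using gr_subspace[of d] by (auto simp: subspace_def submodule_def)

lemma gr_add: "x \<in> gr V d \<Longrightarrow> y \<in> gr V d \<Longrightarrow> x \<oplus>\<^bsub>V\<^esub> y \<in> gr V d"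
  using gr_subspace[of d] by (auto simp: subspace_def submodule_def)

lemma gr_smult: "c \<in> carrier K \<Longrightarrow> x \<in> gr V d \<Longrightarrow> c \<odot>\<^bsub>V\<^esub> x \<in> gr V d"
  using gr_subspace[of d] by (auto simp: subspace_def submodule_def)

lemma gr_minus: "x \<in> gr V d \<Longrightarrow> \<ominus>\<^bsub>V\<^esub> x \<in> gr V d"
  using gr_smult[of "\<ominus>\<^bsub>K\<^esub> \<one>\<^bsub>K\<^esub>" x d] gr_carrier smult_l_minus smult_one by force

lemma gr_finsum: "(\<And>i. i \<in> I \<Longrightarrow> f i \<in> gr V d) \<Longrightarrow> finsum V f I \<in> gr V d"
proof (induction I rule: infinite_finite_induct)
  case (insert i I)
  then have "f \<in> I \<rightarrow> carrier V" "f i \<in> carrier V" using gr_carrier by auto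
  with insert show ?case by (simp add: gr_add)
qed (simp_all add: gr_zero)

lemma hdecomp_hcomp: "x \<in> carrier V \<Longrightarrow> hdecomp V x (hcomp V x)"
  unfolding hcomp_def by (rule theI'[OF gr_decomp])

lemma hcomp_gr: "x \<in> carrier V \<Longrightarrow> hcomp V x d \<in> gr V d"
  using hdecomp_hcomp by (auto simp: hdecomp_def)

lemma hcomp_closed: "x \<in> carrier V \<Longrightarrow> hcomp V x d \<in> carrier V"
  using hcomp_gr gr_carrier by blast

lemma finite_hcomp: "x \<in> carrier V \<Longrightarrow> finite {d. hcomp V x d \<noteq> \<zero>\<^bsub>V\<^esub>}"
  using hdecomp_hcomp by (auto simp: hdecomp_def)

lemma hcomp_sum: "x \<in> carrier V \<Longrightarrow> (\<Oplus>\<^bsub>V\<^esub> d \<in> {d. hcomp V x d \<noteq> \<zero>\<^bsub>V\<^esub>}. hcomp V x d) = x"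
  using hdecomp_hcomp[of x] by (auto simp: hdecomp_def)

lemma hcomp_eqI:
  assumes c: "\<And>d. c d \<in> gr V d" and D: "finite D" "\<And>d. d \<notin> D \<Longrightarrow> c d = \<zero>\<^bsub>V\<^esub>"
    and x: "x = (\<Oplus>\<^bsub>V\<^esub> d \<in> D. c d)"
  shows "hcomp V x = c"
proof -
  have "(\<Oplus>\<^bsub>V\<^esub> d \<in> {d. c d \<noteq> \<zero>\<^bsub>V\<^esub>}. c d) = (\<Oplus>\<^bsub>V\<^esub> d \<in> D. c d)"
    using D c by (intro add.finprod_mono_neutral_cong_left) (auto intro: gr_carrier)
  moreover have "finite {d. c d \<noteq> \<zero>\<^bsub>V\<^esub>}" using D by (rule_tac finite_subset[of _ D]) auto
  ultimately have "hdecomp V x c" using c x by (simp add: hdecomp_def)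
  moreover have "x \<in> carrier V" using x c gr_carrier by (auto intro!: finsum_closed)
  ultimately show ?thesis using gr_decomp hdecomp_hcomp by blast
qed

lemma hcomp_homogeneous:
  assumes "x \<in> gr V d" shows "hcomp V x e = (if e = d then x else \<zero>\<^bsub>V\<^esub>)"
proof -
  have "hcomp V x = (\<lambda>e. if e = d then x else \<zero>\<^bsub>V\<^esub>)"
    by (rule hcomp_eqI[of _ "{d}"]) (use assms gr_carrier in \<open>auto simp: gr_zero\<close>)
  then show ?thesis by simp
qed

lemma hcomp_sum_superset:
  assumes "x \<in> carrier V" "finite D" "\<And>d. d \<notin> D \<Longrightarrow> hcomp V x d = \<zero>\<^bsub>V\<^esub>"
  shows "(\<Oplus>\<^bsub>V\<^esub> d \<in> D. hcomp V x d) = x"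
  using assms hcomp_closed
  by (subst (2) hcomp_sum[OF assms(1), symmetric], intro add.finprod_mono_neutral_cong_right) auto

text \<open>Adding the decompositions of \<open>x\<close> and \<open>y\<close> componentwise
  decomposes the sum, and decompositions are unique. All sums run over the union \<open>?D\<close>
  of both supports, because cancellation may shrink the support of the sum.\<close>

lemma addmap_hcomp: "addmap V V (\<lambda>x. hcomp V x d)"
proof (rule addmapI)
  fix x y assume x: "x \<in> carrier V" and y: "y \<in> carrier V"
  let ?D = "{d. hcomp V x d \<noteq> \<zero>\<^bsub>V\<^esub>} \<union> {d. hcomp V y d \<noteq> \<zero>\<^bsub>V\<^esub>}"
  have "hcomp V (x \<oplus>\<^bsub>V\<^esub> y) = (\<lambda>d. hcomp V x d \<oplus>\<^bsub>V\<^esub> hcomp V y d)"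
  proof (rule hcomp_eqI[of _ ?D])
    have "(\<Oplus>\<^bsub>V\<^esub>d\<in>?D. hcomp V x d \<oplus>\<^bsub>V\<^esub> hcomp V y d) = (\<Oplus>\<^bsub>V\<^esub>d\<in>?D. hcomp V x d) \<oplus>\<^bsub>V\<^esub> (\<Oplus>\<^bsub>V\<^esub>d\<in>?D. hcomp V y d)"
      by (rule finsum_addf) (use x y hcomp_closed in auto)
    also have "\<dots> = x \<oplus>\<^bsub>V\<^esub> y"
      using x y finite_hcomp by (intro arg_cong2[of _ _ _ _ "add V"] hcomp_sum_superset) auto
    finally show "x \<oplus>\<^bsub>V\<^esub> y = (\<Oplus>\<^bsub>V\<^esub>d\<in>?D. hcomp V x d \<oplus>\<^bsub>V\<^esub> hcomp V y d)" by simp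
  qed (use x y finite_hcomp hcomp_gr in \<open>auto intro: gr_add\<close>)
  then show "hcomp V (x \<oplus>\<^bsub>V\<^esub> y) d = hcomp V x d \<oplus>\<^bsub>V\<^esub> hcomp V y d" by simp
qed (rule hcomp_closed)

lemma gr_induct [consumes 1, case_names homogeneous add]:
  assumes x: "x \<in> carrier V" and hom: "\<And>d x. x \<in> gr V d \<Longrightarrow> Q x"
    and add: "\<And>x y. \<lbrakk>x \<in> carrier V; y \<in> carrier V; Q x; Q y\<rbrakk> \<Longrightarrow> Q (x \<oplus>\<^bsub>V\<^esub> y)"
  shows "Q x"
proof -
  have "finite D \<Longrightarrow> Q (\<Oplus>\<^bsub>V\<^esub> d \<in> D. hcomp V x d)" for D
  proof (induction D rule: finite_induct)
    case (insert d D)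
    then show ?case using hom[OF hcomp_gr[OF x]] hcomp_closed[OF x] by (auto intro!: add finsum_closed)
  qed (use hom[OF gr_zero] in simp)
  from this[OF finite_hcomp[OF x]] show ?thesis using hcomp_sum[OF x] by simp
qed

lemma gr_ext:
  assumes "addmap V W f" "addmap V W g" "x \<in> carrier V" "\<And>d x. x \<in> gr V d \<Longrightarrow> f x = g x"
  shows "f x = g x"
  using assms(3) by (induction rule: gr_induct) (auto simp: assms(4) addmap_add[OF assms(1)] addmap_add[OF assms(2)])

lemma addmap_smult: "c \<in> carrier K \<Longrightarrow> addmap V V (\<lambda>x. c \<odot>\<^bsub>V\<^esub> x)"
  by (rule addmapI) (auto simp: smult_r_distr)

lemma hcomp_smult:
  assumes "c \<in> carrier K" "x \<in> carrier V" shows "hcomp V (c \<odot>\<^bsub>V\<^esub> x) d = c \<odot>\<^bsub>V\<^esub> hcomp V x d"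
  by (rule gr_ext[OF addmap_comp[OF addmap_smult addmap_hcomp] addmap_comp[OF addmap_hcomp addmap_smult] assms(2)])
    (use assms(1) in \<open>auto simp: hcomp_homogeneous hcomp_homogeneous[OF gr_smult]\<close>)

end

text \<open>Finite sums of homogeneous elements. That they fill the carrier says that the pieces
  generate, without exhibiting a decomposition indexed by degrees.\<close>

inductive_set hsums for V where
  homogeneous: "x \<in> gr V d \<Longrightarrow> x \<in> hsums V"
| add: "\<lbrakk>x \<in> hsums V; y \<in> hsums V\<rbrakk> \<Longrightarrow> x \<oplus>\<^bsub>V\<^esub> y \<in> hsums V"

text \<open>The maps \<open>h d\<close> are candidates for the projections. Being additive, the
  identity on degree \<open>d\<close> and zero on the other degrees, they compute the components of
  any sum of homogeneous elements, which gives existence and uniqueness of decompositions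
  together.\<close>

lemma graded_spaceI:
  assumes vs: "vectorspace K V" and gr: "\<And>d. subspace K (gr V d) V"
    and gen: "carrier V \<subseteq> hsums V"
    and h: "\<And>d. addmap V V (h d)" "\<And>d x. x \<in> gr V d \<Longrightarrow> h d x = x"
      "\<And>d e x. x \<in> gr V e \<Longrightarrow> d \<noteq> e \<Longrightarrow> h d x = \<zero>\<^bsub>V\<^esub>"
  shows "graded_space K V"
proof -
  interpret vectorspace K V by fact
  have grc: "x \<in> gr V d \<Longrightarrow> x \<in> carrier V" and gr0: "\<zero>\<^bsub>V\<^esub> \<in> gr V d"
    and gra: "x \<in> gr V d \<Longrightarrow> y \<in> gr V d \<Longrightarrow> x \<oplus>\<^bsub>V\<^esub> y \<in> gr V d" for x y d
    using gr[of d] by (auto simp: subspace_def submodule_def)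
  have dec: "x \<in> carrier V \<and> hdecomp V x (\<lambda>d. h d x)" if "x \<in> hsums V" for x
    using that
  proof (induction rule: hsums.induct)
    case (homogeneous x e)
    have hx: "h d x = (if d = e then x else \<zero>\<^bsub>V\<^esub>)" for d using h(2,3) homogeneous by auto
    have "{d. h d x \<noteq> \<zero>\<^bsub>V\<^esub>} = (if x = \<zero>\<^bsub>V\<^esub> then {} else {e})" by (auto simp: hx)
    then show ?case using homogeneous grc gr0 by (simp add: hdecomp_def hx)
  next
    case (add x y)
    let ?D = "{d. h d x \<noteq> \<zero>\<^bsub>V\<^esub>} \<union> {d. h d y \<noteq> \<zero>\<^bsub>V\<^esub>}"
    have xy: "x \<in> carrier V" "y \<in> carrier V" using add by auto
    have hc: "h d x \<in> carrier V" "h d y \<in> carrier V" for d using addmap_closed[OF h(1)] xy by auto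
    have ha: "h d (x \<oplus>\<^bsub>V\<^esub> y) = h d x \<oplus>\<^bsub>V\<^esub> h d y" for d using addmap_add[OF h(1)] xy by auto
    have fin: "finite ?D" using add by (auto simp: hdecomp_def)
    have "x = (\<Oplus>\<^bsub>V\<^esub>d\<in>{d. h d x \<noteq> \<zero>\<^bsub>V\<^esub>}. h d x)" "y = (\<Oplus>\<^bsub>V\<^esub>d\<in>{d. h d y \<noteq> \<zero>\<^bsub>V\<^esub>}. h d y)"
      using add by (auto simp: hdecomp_def)
    moreover have "(\<Oplus>\<^bsub>V\<^esub>d\<in>{d. h d x \<noteq> \<zero>\<^bsub>V\<^esub>}. h d x) = (\<Oplus>\<^bsub>V\<^esub>d\<in>?D. h d x)"
      by (rule add.finprod_mono_neutral_cong_left) (use fin hc in auto)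
    moreover have "(\<Oplus>\<^bsub>V\<^esub>d\<in>{d. h d y \<noteq> \<zero>\<^bsub>V\<^esub>}. h d y) = (\<Oplus>\<^bsub>V\<^esub>d\<in>?D. h d y)"
      by (rule add.finprod_mono_neutral_cong_left) (use fin hc in auto)
    moreover have "(\<Oplus>\<^bsub>V\<^esub>d\<in>?D. h d (x \<oplus>\<^bsub>V\<^esub> y)) = (\<Oplus>\<^bsub>V\<^esub>d\<in>?D. h d x) \<oplus>\<^bsub>V\<^esub> (\<Oplus>\<^bsub>V\<^esub>d\<in>?D. h d y)"
      unfolding ha by (rule finsum_addf) (use hc in auto)
    moreover have "(\<Oplus>\<^bsub>V\<^esub>d\<in>{d. h d (x \<oplus>\<^bsub>V\<^esub> y) \<noteq> \<zero>\<^bsub>V\<^esub>}. h d (x \<oplus>\<^bsub>V\<^esub> y)) = (\<Oplus>\<^bsub>V\<^esub>d\<in>?D. h d (x \<oplus>\<^bsub>V\<^esub> y))"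
      by (rule add.finprod_mono_neutral_cong_left) (use fin hc in \<open>auto simp: ha\<close>)
    moreover have "finite {d. h d (x \<oplus>\<^bsub>V\<^esub> y) \<noteq> \<zero>\<^bsub>V\<^esub>}"
      by (rule finite_subset[OF _ fin]) (use hc in \<open>auto simp: ha\<close>)
    ultimately show ?case using xy add gra by (simp add: hdecomp_def ha)
  qed
  show ?thesis
  proof (intro graded_space.intro graded_space_axioms.intro vs gr)
    fix x assume "x \<in> carrier V"
    then have x: "hdecomp V x (\<lambda>d. h d x)" using dec gen by blast
    moreover have "c = (\<lambda>d. h d x)" if c: "hdecomp V x c" for c
    proof
      fix d
      have cg: "c e \<in> gr V e" for e using c by (auto simp: hdecomp_def)
      have fin: "finite {d. c d \<noteq> \<zero>\<^bsub>V\<^esub>}" using c by (auto simp: hdecomp_def)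
      \<comment> \<open>Applied to any decomposition \<open>c\<close> of \<open>x\<close>, the map
        \<open>h d\<close> keeps only the summand of degree \<open>d\<close>; the components are
        therefore forced to be \<open>h d x\<close>.\<close>
      have he: "h d (c e) = (if e = d then c d else \<zero>\<^bsub>V\<^esub>)" for e
        using h(2)[OF cg] h(3)[OF cg, of d e] by auto
      have "h d x = h d (\<Oplus>\<^bsub>V\<^esub>e\<in>{d. c d \<noteq> \<zero>\<^bsub>V\<^esub>}. c e)" using c by (simp add: hdecomp_def)
      also have "\<dots> = (\<Oplus>\<^bsub>V\<^esub>e\<in>{d. c d \<noteq> \<zero>\<^bsub>V\<^esub>}. h d (c e))"
        by (rule addmap_finsum[OF abelian_group_axioms abelian_group_axioms h(1)]) (use cg grc in auto)
      also have "\<dots> = (\<Oplus>\<^bsub>V\<^esub>e\<in>insert d {d. c d \<noteq> \<zero>\<^bsub>V\<^esub>}. if e = d then c d else \<zero>\<^bsub>V\<^esub>)"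
        unfolding he by (rule add.finprod_mono_neutral_cong_left) (use fin grc[OF cg] in auto)
      also have "\<dots> = c d"
        using fin grc[OF cg] by (subst add.finprod_singleton_swap) auto
      finally show "c d = h d x" ..
    qed
    ultimately show "\<exists>!c. hdecomp V x c" by blast
  qed
qed

lemma trelsE:
  assumes "t \<in> trels S r l M N"
  obtains (left) m m' n where "m \<in> carrier M" "m' \<in> carrier M" "n \<in> carrier N"
      "t = frag_of (m \<oplus>\<^bsub>M\<^esub> m', n) - frag_of (m, n) - frag_of (m', n)"
  | (right) m n n' where "m \<in> carrier M" "n \<in> carrier N" "n' \<in> carrier N"
      "t = frag_of (m, n \<oplus>\<^bsub>N\<^esub> n') - frag_of (m, n) - frag_of (m, n')"
  | (balanced) s m n where "s \<in> S" "m \<in> carrier M" "n \<in> carrier N" "t = frag_of (r s m, n) - frag_of (m, l s n)"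
  using assms unfolding trels_def by blast

context tensor_data
begin

text \<open>An identity between pure tensors is read back as membership in the relation subgroup,
  the form in which maps given on representatives are tested on generators.\<close>

lemma frag_rel2:
  assumes "tn a b = tn c d"
  shows "frag_of (a, b) - frag_of (c, d) \<in> generate (pairs M N) (trels S r l M N)"
  using assms by (simp add: pt_def P.gcoset_eq_iff)

lemma frag_rel3:
  assumes "tn a b = tn c d \<oplus>\<^bsub>T\<^esub> tn e f" "c \<in> carrier M" "d \<in> carrier N" "e \<in> carrier M" "f \<in> carrier N"
  shows "frag_of (a, b) - frag_of (c, d) - frag_of (e, f) \<in> generate (pairs M N) (trels S r l M N)"
proof -
  have "gcoset (carrier M \<times> carrier N) (trels S r l M N) (frag_of (a, b)) =
      gcoset (carrier M \<times> carrier N) (trels S r l M N) (frag_of (c, d) + frag_of (e, f))"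
    using assms unfolding pt_def by (subst (asm) gcoset_add_T) (auto simp: keys_frag_of)
  then show ?thesis by (simp add: P.gcoset_eq_iff diff_diff_eq)
qed

lemma T_cases:
  assumes "z \<in> carrier T"
  obtains x where "Poly_Mapping.keys x \<subseteq> carrier M \<times> carrier N" "z = gcoset (carrier M \<times> carrier N) (trels S r l M N) x"
  using assms unfolding carrier_T by (rule P.presented_cases)

lemma gcoset_closed_T:
  "Poly_Mapping.keys x \<subseteq> carrier M \<times> carrier N \<Longrightarrow> gcoset (carrier M \<times> carrier N) (trels S r l M N) x \<in> carrier T"
  unfolding carrier_T by (rule P.gcoset_closed)

text \<open>\<open>bal\<close> is what the third family of relations demands of \<open>f\<close> and
  \<open>g\<close>. It compares only the resulting pure tensors, so it is weaker than equivariance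
  of each of the two maps.\<close>

lemma tensor_map:
  assumes f: "addmap M M f" and g: "addmap N N g"
    and bal: "\<And>s m n. \<lbrakk>s \<in> S; m \<in> carrier M; n \<in> carrier N\<rbrakk> \<Longrightarrow> tn (f (r s m)) (g n) = tn (f m) (g (l s n))"
  shows "addmap T T (tensor_map (tensor_rels S r l M N) M N f g)"
    and "m \<in> carrier M \<Longrightarrow> n \<in> carrier N \<Longrightarrow> tensor_map (tensor_rels S r l M N) M N f g (tn m n) = tn (f m) (g n)"
proof -
  let ?F = "\<lambda>(m, n). frag_of (f m, g n)"
  let ?c = "gcoset (carrier M \<times> carrier N) (trels S r l M N)"
  note fc = addmap_closed[OF f] and gc = addmap_closed[OF g]
  have rel: "frag_extend ?F t \<in> generate (pairs M N) (trels S r l M N)" if "t \<in> trels S r l M N" for t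
    using that
    by (cases rule: trelsE) (auto simp: frag_extend_diff addmap_add[OF f] addmap_add[OF g] tn_add_left tn_add_right fc gc bal
        intro!: frag_rel2 frag_rel3)
  have map: "tensor_map (tensor_rels S r l M N) M N f g (?c x) = ?c (frag_extend ?F x)" for x
    unfolding tensor_map_def tensor_rels_eq
    by (rule P.gcoset_map[OF P.presentation_axioms rel])
  have keys: "Poly_Mapping.keys (frag_extend ?F x) \<subseteq> carrier M \<times> carrier N"
    if "Poly_Mapping.keys x \<subseteq> carrier M \<times> carrier N" for x
    by (rule frag_extend_in_carrier[OF _ that]) (auto simp: keys_frag_of fc gc)
  show "addmap T T (tensor_map (tensor_rels S r l M N) M N f g)"
  proof (rule addmapI)
    fix x y assume "x \<in> carrier T" "y \<in> carrier T"
    then obtain u v where u: "Poly_Mapping.keys u \<subseteq> carrier M \<times> carrier N" "x = ?c u"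
      and v: "Poly_Mapping.keys v \<subseteq> carrier M \<times> carrier N" "y = ?c v" by (metis T_cases)
    have "?c u \<oplus>\<^bsub>T\<^esub> ?c v = ?c (u + v)" by (rule gcoset_add_T[OF u(1) v(1)])
    moreover have "?c (frag_extend ?F u) \<oplus>\<^bsub>T\<^esub> ?c (frag_extend ?F v) = ?c (frag_extend ?F u + frag_extend ?F v)"
      by (rule gcoset_add_T[OF keys[OF u(1)] keys[OF v(1)]])
    ultimately show "tensor_map (tensor_rels S r l M N) M N f g (x \<oplus>\<^bsub>T\<^esub> y) =
       tensor_map (tensor_rels S r l M N) M N f g x \<oplus>\<^bsub>T\<^esub> tensor_map (tensor_rels S r l M N) M N f g y"
      unfolding u(2) v(2) by (simp only: map frag_extend_add)
  next
    fix x assume "x \<in> carrier T"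
    then obtain u where u: "Poly_Mapping.keys u \<subseteq> carrier M \<times> carrier N" "x = ?c u" by (metis T_cases)
    show "tensor_map (tensor_rels S r l M N) M N f g x \<in> carrier T"
      unfolding u(2) map by (rule gcoset_closed_T[OF keys[OF u(1)]])
  qed
  show "tensor_map (tensor_rels S r l M N) M N f g (tn m n) = tn (f m) (g n)"
    if "m \<in> carrier M" "n \<in> carrier N"
    unfolding pt_def map by simp
qed

end

section \<open>Actions of one tensor product on another\<close>

locale tensor_action = U: tensor_data S r l A B + V: tensor_data S' r' l' M N
  for S :: "'s set" and r l and A :: "('k, 'a, 'y) gspace_scheme" and B :: "('k, 'b, 'z) gspace_scheme"
    and S' :: "'t set" and r' l' and M :: "('k, 'm, 'u) gspace_scheme" and N :: "('k, 'n, 'v) gspace_scheme" +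
  fixes f :: "'a \<Rightarrow> 'm \<Rightarrow> 'm" and g :: "'b \<Rightarrow> 'n \<Rightarrow> 'n"
  assumes f1: "m \<in> carrier M \<Longrightarrow> addmap A M (\<lambda>a. f a m)" and f2: "a \<in> carrier A \<Longrightarrow> addmap M M (f a)"
    and g1: "n \<in> carrier N \<Longrightarrow> addmap B N (\<lambda>b. g b n)" and g2: "b \<in> carrier B \<Longrightarrow> addmap N N (g b)"
    and bal1: "\<lbrakk>s \<in> S; a \<in> carrier A; b \<in> carrier B; m \<in> carrier M; n \<in> carrier N\<rbrakk> \<Longrightarrow>
      V.tn (f (r s a) m) (g b n) = V.tn (f a m) (g (l s b) n)"
    and bal2: "\<lbrakk>t \<in> S'; a \<in> carrier A; b \<in> carrier B; m \<in> carrier M; n \<in> carrier N\<rbrakk> \<Longrightarrow>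
      V.tn (f a (r' t m)) (g b n) = V.tn (f a m) (g b (l' t n))"
begin

abbreviation "\<Phi> \<equiv> tensor_act (tensor_rels S' r' l' M N) M N f g"

lemma f_closed: "a \<in> carrier A \<Longrightarrow> m \<in> carrier M \<Longrightarrow> f a m \<in> carrier M" by (rule addmap_closed[OF f2])
lemma g_closed: "b \<in> carrier B \<Longrightarrow> n \<in> carrier N \<Longrightarrow> g b n \<in> carrier N" by (rule addmap_closed[OF g2])

abbreviation (input) "cU \<equiv> gcoset (carrier A \<times> carrier B) (trels S r l A B)"
abbreviation (input) "cV \<equiv> gcoset (carrier M \<times> carrier N) (trels S' r' l' M N)"
abbreviation (input) "FF \<equiv> \<lambda>(a, b). \<lambda>(m, n). frag_of (f a m, g b n)"

text \<open>Relations in the acting tensor product are absorbed by \<open>bal1\<close>, those in the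
  tensor product acted upon by \<open>bal2\<close>; additivity of \<open>f\<close> and
  \<open>g\<close> in each variable deals with the remaining generators.\<close>

lemma action_gcoset:
  assumes u: "Poly_Mapping.keys u \<subseteq> carrier A \<times> carrier B" and v: "Poly_Mapping.keys v \<subseteq> carrier M \<times> carrier N"
  shows "\<Phi> (cU u) (cV v) = cV (frag_extend (\<lambda>s. frag_extend (FF s) v) u)"
proof -
  have eq: "frag_extend (\<lambda>(a, b). frag_extend (\<lambda>(m, n). frag_of (f a m, g b n)) y) x =
      frag_extend (\<lambda>s. frag_extend (FF s) y) x" for x y
    by (simp add: case_prod_beta')
  have "frag_extend (\<lambda>s. FF s t) q \<in> generate (pairs M N) (trels S' r' l' M N)"
    if "q \<in> trels S r l A B" "t \<in> carrier M \<times> carrier N" for q t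
    using that(1,2)
    by (cases rule: trelsE) (auto simp: frag_extend_diff addmap_add[OF f1] addmap_add[OF g1] V.tn_add_left V.tn_add_right f_closed g_closed bal1
        intro!: V.frag_rel2 V.frag_rel3)
  moreover have "frag_extend (FF s) q \<in> generate (pairs M N) (trels S' r' l' M N)"
    if "q \<in> trels S' r' l' M N" "s \<in> carrier A \<times> carrier B" for q s
    using that(1,2)
    by (cases rule: trelsE) (auto simp: frag_extend_diff addmap_add[OF f2] addmap_add[OF g2] V.tn_add_left V.tn_add_right f_closed g_closed bal2
        intro!: V.frag_rel2 V.frag_rel3)
  ultimately show ?thesis
    unfolding tensor_act_def eq tensor_rels_eq
    by (intro gcoset_map2[OF U.P.presentation_axioms V.P.presentation_axioms V.P.presentation_axioms _ _ u v])
qed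

lemma FF_keys:
  assumes u: "Poly_Mapping.keys u \<subseteq> carrier A \<times> carrier B" and v: "Poly_Mapping.keys v \<subseteq> carrier M \<times> carrier N"
  shows "Poly_Mapping.keys (frag_extend (\<lambda>s. frag_extend (FF s) v) u) \<subseteq> carrier M \<times> carrier N"
  by (intro frag_extend_in_carrier[OF _ u] frag_extend_in_carrier[OF _ v])
    (auto simp: keys_frag_of f_closed g_closed)

lemma action_closed:
  assumes "x \<in> carrier U.T" "y \<in> carrier V.T" shows "\<Phi> x y \<in> carrier V.T"
  using assms by (metis U.T_cases V.T_cases action_gcoset FF_keys V.gcoset_closed_T)

lemma action_add_left:
  assumes y: "y \<in> carrier V.T" shows "addmap U.T V.T (\<lambda>x. \<Phi> x y)"
proof (rule addmapI)
  fix x x' assume "x \<in> carrier U.T" "x' \<in> carrier U.T"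
  then obtain u u' where u: "Poly_Mapping.keys u \<subseteq> carrier A \<times> carrier B" "x = cU u"
    and u': "Poly_Mapping.keys u' \<subseteq> carrier A \<times> carrier B" "x' = cU u'" by (metis U.T_cases)
  obtain v where v: "Poly_Mapping.keys v \<subseteq> carrier M \<times> carrier N" "y = cV v" using y by (metis V.T_cases)
  have "Poly_Mapping.keys (u + u') \<subseteq> carrier A \<times> carrier B" using u u' keys_add[of u u'] by blast
  then show "\<Phi> (x \<oplus>\<^bsub>U.T\<^esub> x') y = \<Phi> x y \<oplus>\<^bsub>V.T\<^esub> \<Phi> x' y"
    unfolding u(2) u'(2) v(2) U.gcoset_add_T[OF u(1) u'(1)]
    by (simp only: action_gcoset[OF u(1) v(1)] action_gcoset[OF u'(1) v(1)] action_gcoset[OF _ v(1)] frag_extend_add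
        V.gcoset_add_T[OF FF_keys[OF u(1) v(1)] FF_keys[OF u'(1) v(1)]])
qed (use action_closed y in auto)

lemma action_pure:
  assumes "a \<in> carrier A" "b \<in> carrier B" "m \<in> carrier M" "n \<in> carrier N"
  shows "\<Phi> (U.tn a b) (V.tn m n) = V.tn (f a m) (g b n)"
  unfolding pt_def by (subst action_gcoset) (use assms in \<open>auto simp: keys_frag_of\<close>)

lemma action_add_right:
  assumes x: "x \<in> carrier U.T" shows "addmap V.T V.T (\<Phi> x)"
proof (rule addmapI)
  fix y y' assume "y \<in> carrier V.T" "y' \<in> carrier V.T"
  then obtain v v' where v: "Poly_Mapping.keys v \<subseteq> carrier M \<times> carrier N" "y = cV v"
    and v': "Poly_Mapping.keys v' \<subseteq> carrier M \<times> carrier N" "y' = cV v'" by (metis V.T_cases)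
  obtain u where u: "Poly_Mapping.keys u \<subseteq> carrier A \<times> carrier B" "x = cU u" using x by (metis U.T_cases)
  have k: "Poly_Mapping.keys (v + v') \<subseteq> carrier M \<times> carrier N" using v v' keys_add[of v v'] by blast
  have "frag_extend (\<lambda>s. f s + g s) w = frag_extend f w + frag_extend g w" for f g :: "_ \<Rightarrow> ('m \<times> 'n \<Rightarrow>\<^sub>0 int)" and w :: "('a \<times> 'b) \<Rightarrow>\<^sub>0 int"
    by (simp add: frag_extend_def frag_cmul_distrib2 sum.distrib)
  then show "\<Phi> x (y \<oplus>\<^bsub>V.T\<^esub> y') = \<Phi> x y \<oplus>\<^bsub>V.T\<^esub> \<Phi> x y'"
    unfolding u(2) v(2) v'(2) V.gcoset_add_T[OF v(1) v'(1)]
    by (simp only: action_gcoset[OF u(1) v(1)] action_gcoset[OF u(1) v'(1)] action_gcoset[OF u(1) k] frag_extend_add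
        V.gcoset_add_T[OF FF_keys[OF u(1) v(1)] FF_keys[OF u(1) v'(1)]])
qed (use action_closed x in auto)

end

lemma opposite_simps [simp]:
  "carrier (opposite A) = carrier A" "add (opposite A) = add A" "ring.zero (opposite A) = ring.zero A"
  "Module.smult (opposite A) = Module.smult A" "gr (opposite A) = gr A" "\<one>\<^bsub>opposite A\<^esub> = \<one>\<^bsub>A\<^esub>"
  "a \<otimes>\<^bsub>opposite A\<^esub> b = b \<otimes>\<^bsub>A\<^esub> a"
  by (simp_all add: opposite_def)

context left_gmod
begin

lemma addmap_act: "a \<in> carrier A \<Longrightarrow> addmap M M (act M a)"
  by (rule addmapI) (auto simp: act_closed act_add_right)

lemma addmap_act_left: "x \<in> carrier M \<Longrightarrow> addmap A M (\<lambda>a. act M a x)"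
  by (rule addmapI) (auto simp: act_closed act_add_left)

text \<open>Acting by an element of degree \<open>i\<close> moves every component up by
  \<open>i\<close>. Both sides are additive in \<open>x\<close>, so homogeneous \<open>x\<close>
  suffice.\<close>

lemma hcomp_act:
  assumes a: "a \<in> gr A i" and x: "x \<in> carrier M"
  shows "hcomp M (act M a x) d = act M a (hcomp M x (d - i))"
proof (rule M.gr_ext[OF _ _ x])
  have "a \<in> carrier A" using a A.gr_carrier by blast
  then show "addmap M M (\<lambda>x. hcomp M (act M a x) d)" "addmap M M (\<lambda>x. act M a (hcomp M x (d - i)))"
    by (intro addmap_comp[OF addmap_act M.addmap_hcomp] addmap_comp[OF M.addmap_hcomp addmap_act]; simp)+
  fix e x assume "x \<in> gr M e"
  then show "hcomp M (act M a x) d = act M a (hcomp M x (d - i))"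
    using M.hcomp_homogeneous[OF gr_act[OF a]] M.hcomp_homogeneous[of x e]
      addmap_zero[OF M.abelian_group_axioms M.abelian_group_axioms addmap_act[OF \<open>a \<in> carrier A\<close>]]
    by auto
qed

text \<open>Scalars act through multiples of the unit. Hence balancing over the algebra includes
  balancing over the field, and maps linear over the algebra are linear over
  \<open>K\<close>.\<close>

lemma smult_act: "c \<in> carrier K \<Longrightarrow> x \<in> carrier M \<Longrightarrow> c \<odot>\<^bsub>M\<^esub> x = act M (c \<odot>\<^bsub>A\<^esub> \<one>\<^bsub>A\<^esub>) x"
  by (simp add: act_smult_left act_one)

end


section \<open>Gradings on tensor products\<close>

text \<open>The existential form, from which a whole family of lifts can be chosen under a
  quantifier.\<close>

lemma (in tensor_data) tensor_lift_ex:
  assumes "abelian_group W"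
    and "\<And>n. n \<in> carrier N \<Longrightarrow> addmap M W (\<lambda>m. b m n)"
    and "\<And>m. m \<in> carrier M \<Longrightarrow> addmap N W (\<lambda>n. b m n)"
    and "\<And>s m n. \<lbrakk>s \<in> S; m \<in> carrier M; n \<in> carrier N\<rbrakk> \<Longrightarrow> b (r s m) n = b m (l s n)"
  shows "\<exists>h. addmap T W h \<and> (\<forall>m n. m \<in> carrier M \<longrightarrow> n \<in> carrier N \<longrightarrow> h (tn m n) = b m n)"
proof (rule tensor_lift[OF assms])
  fix h assume "addmap T W h" "\<And>m n. m \<in> carrier M \<Longrightarrow> n \<in> carrier N \<Longrightarrow> h (tn m n) = b m n"
  then show ?thesis by blast
qed

locale gtensor = L: left_gmod K "opposite A" M + R: left_gmod K A N
  for K :: "'k ring" and A :: "('k, 'a) gspace" and M :: "('k, 'a, 'm) gmod" and N :: "('k, 'a, 'n) gmod"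
begin

sublocale tensor_data "carrier A" "act M" "act N" M N
proof -
  show "tensor_data (carrier A) (act M) (act N) M N"
    using L.act_closed R.act_closed
    by (simp add: tensor_data_def tensor_data_axioms_def L.M.abelian_group_axioms R.M.abelian_group_axioms)
qed

lemma smult_T: "Module.smult T c = tensor_map (tensor_rels (carrier A) (act M) (act N) M N) M N (Module.smult M c) (\<lambda>n. n)"
  by (simp add: tensor_def Let_def)

lemma addmap_smult_T: "c \<in> carrier K \<Longrightarrow> addmap T T (Module.smult T c)"
  and smult_tn: "\<lbrakk>c \<in> carrier K; m \<in> carrier M; n \<in> carrier N\<rbrakk> \<Longrightarrow> c \<odot>\<^bsub>T\<^esub> tn m n = tn (c \<odot>\<^bsub>M\<^esub> m) n"
proof -
  assume c: "c \<in> carrier K"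
  have bal: "tn (c \<odot>\<^bsub>M\<^esub> act M a m) n = tn (c \<odot>\<^bsub>M\<^esub> m) (act N a n)"
    if "a \<in> carrier A" "m \<in> carrier M" "n \<in> carrier N" for a m n
    using tn_balanced[of a "c \<odot>\<^bsub>M\<^esub> m" n] L.act_smult_right[of c a m] that c by simp
  note map = tensor_map[of "Module.smult M c" "\<lambda>n. n", OF L.M.addmap_smult[OF c] addmap_id]
  show "addmap T T (Module.smult T c)"
    unfolding smult_T by (rule map(1)[OF bal])
  show "c \<odot>\<^bsub>T\<^esub> tn m n = tn (c \<odot>\<^bsub>M\<^esub> m) n" if "m \<in> carrier M" "n \<in> carrier N"
    unfolding smult_T by (rule map(2)[OF bal that])
qed

lemma tn_smult:
  assumes "c \<in> carrier K" "m \<in> carrier M" "n \<in> carrier N"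
  shows "tn (c \<odot>\<^bsub>M\<^esub> m) n = tn m (c \<odot>\<^bsub>N\<^esub> n)"
  using assms L.smult_act[of c m] R.smult_act[of c n]
    tn_balanced[of "c \<odot>\<^bsub>A\<^esub> \<one>\<^bsub>A\<^esub>" m n] R.A.smult_closed[of c "\<one>\<^bsub>A\<^esub>"] by simp

lemma K_one: "\<one>\<^bsub>K\<^esub> \<in> carrier K"
proof -
  have "cring K" using L.M.vectorspace_axioms unfolding vectorspace_def module_def by blast
  then show ?thesis using cring_def monoid.one_closed ring.is_monoid by blast
qed

text \<open>Each law with one tensor variable is an equality of two additive maps and is checked on
  pure tensors, where scalars sit in the left factor and the laws of \<open>M\<close> apply.\<close>

lemma vectorspace_T: "vectorspace K T"
proof -
  have *: "addmap T T (\<lambda>z. (c \<oplus>\<^bsub>K\<^esub> d) \<odot>\<^bsub>T\<^esub> z)" "addmap T T (\<lambda>z. c \<odot>\<^bsub>T\<^esub> z \<oplus>\<^bsub>T\<^esub> d \<odot>\<^bsub>T\<^esub> z)"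
    "addmap T T (\<lambda>z. (c \<otimes>\<^bsub>K\<^esub> d) \<odot>\<^bsub>T\<^esub> z)" "addmap T T (\<lambda>z. c \<odot>\<^bsub>T\<^esub> (d \<odot>\<^bsub>T\<^esub> z))"
    if "c \<in> carrier K" "d \<in> carrier K" for c d
  proof -
    have cd: "c \<oplus>\<^bsub>K\<^esub> d \<in> carrier K" "c \<otimes>\<^bsub>K\<^esub> d \<in> carrier K" using that by simp_all
    show "addmap T T (\<lambda>z. (c \<oplus>\<^bsub>K\<^esub> d) \<odot>\<^bsub>T\<^esub> z)" "addmap T T (\<lambda>z. (c \<otimes>\<^bsub>K\<^esub> d) \<odot>\<^bsub>T\<^esub> z)"
      by (rule addmap_smult_T[OF cd(1)], rule addmap_smult_T[OF cd(2)])
    show "addmap T T (\<lambda>z. c \<odot>\<^bsub>T\<^esub> z \<oplus>\<^bsub>T\<^esub> d \<odot>\<^bsub>T\<^esub> z)"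
      by (rule addmap_plus[OF T.abelian_group_axioms addmap_smult_T[OF that(1)] addmap_smult_T[OF that(2)]])
    show "addmap T T (\<lambda>z. c \<odot>\<^bsub>T\<^esub> (d \<odot>\<^bsub>T\<^esub> z))"
      by (rule addmap_comp[OF addmap_smult_T[OF that(2)] addmap_smult_T[OF that(1)]])
  qed
  have "module_axioms K T"
  proof
    fix c z assume "c \<in> carrier K" "z \<in> carrier T"
    then show "c \<odot>\<^bsub>T\<^esub> z \<in> carrier T" by (rule addmap_closed[OF addmap_smult_T])
  next
    fix c d z assume cd: "c \<in> carrier K" "d \<in> carrier K" "z \<in> carrier T"
    show "(c \<oplus>\<^bsub>K\<^esub> d) \<odot>\<^bsub>T\<^esub> z = c \<odot>\<^bsub>T\<^esub> z \<oplus>\<^bsub>T\<^esub> d \<odot>\<^bsub>T\<^esub> z"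
      by (rule tensor_ext[OF *(1,2)]) (use cd in \<open>auto simp: smult_tn L.M.smult_l_distr tn_add_left\<close>)
    show "(c \<otimes>\<^bsub>K\<^esub> d) \<odot>\<^bsub>T\<^esub> z = c \<odot>\<^bsub>T\<^esub> (d \<odot>\<^bsub>T\<^esub> z)"
      by (rule tensor_ext[OF *(3,4)]) (use cd in \<open>auto simp: smult_tn L.M.smult_assoc1\<close>)
  next
    fix c x y assume "c \<in> carrier K" "x \<in> carrier T" "y \<in> carrier T"
    then show "c \<odot>\<^bsub>T\<^esub> (x \<oplus>\<^bsub>T\<^esub> y) = c \<odot>\<^bsub>T\<^esub> x \<oplus>\<^bsub>T\<^esub> c \<odot>\<^bsub>T\<^esub> y" by (intro addmap_add[OF addmap_smult_T])
  next
    fix z assume "z \<in> carrier T"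
    then show "\<one>\<^bsub>K\<^esub> \<odot>\<^bsub>T\<^esub> z = z"
      by (rule tensor_ext[OF addmap_smult_T[OF K_one] addmap_id]) (simp add: smult_tn)
  qed
  with L.M.vectorspace_axioms T.abelian_group_axioms show ?thesis
    unfolding vectorspace_def module_def by blast
qed

lemma gr_T: "gr T d = (\<lambda>x. gcoset (carrier M \<times> carrier N) (trels (carrier A) (act M) (act N) M N) x) `
    generate (pairs M N) {frag_of (m, n) | m n i j. m \<in> gr M i \<and> n \<in> gr N j \<and> i + j = d}"
  by (simp only: tensor_def Let_def tensor_rels_eq gspace.select_convs)

text \<open>The homogeneous generators of degree \<open>d\<close> are put in the place of relations;
  what is used of the locale is closure under differences and induction for the subgroup they
  generate.\<close>

lemma presentation_gr: "presentation (carrier M \<times> carrier N) {frag_of (m, n) | m n i j. m \<in> gr M i \<and> n \<in> gr N j \<and> i + j = d}"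
proof
  show "{frag_of (m, n) | m n i j. m \<in> gr M i \<and> n \<in> gr N j \<and> i + j = d} \<subseteq> carrier (pairs M N)"
  proof
    fix t assume "t \<in> {frag_of (m, n) | m n i j. m \<in> gr M i \<and> n \<in> gr N j \<and> i + j = d}"
    then obtain m n i j where "t = frag_of (m, n)" "m \<in> gr M i" "n \<in> gr N j" by blast
    then show "t \<in> carrier (pairs M N)" using L.M.gr_carrier[of m i] R.M.gr_carrier[of n j] by simp
  qed
qed

lemma gr_T_carrier: "z \<in> gr T d \<Longrightarrow> z \<in> carrier T"
  unfolding gr_T by (elim imageE, hypsubst, rule gcoset_closed_T, rule presentation.rels_keys[OF presentation_gr])

lemma tn_gr: "\<lbrakk>m \<in> gr M i; n \<in> gr N j; i + j = d\<rbrakk> \<Longrightarrow> tn m n \<in> gr T d"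
  unfolding gr_T pt_def by (intro imageI generate.incl) blast

lemma gr_T_zero: "\<zero>\<^bsub>T\<^esub> \<in> gr T d"
  using tn_gr[OF L.M.gr_zero[of 0] R.M.gr_zero[of d]] by (simp add: tn_zero_left)

lemma gr_T_add:
  assumes "x \<in> gr T d" "y \<in> gr T d" shows "x \<oplus>\<^bsub>T\<^esub> y \<in> gr T d"
proof -
  interpret P': presentation "carrier M \<times> carrier N" "{frag_of (m, n) | m n i j. m \<in> gr M i \<and> n \<in> gr N j \<and> i + j = d}"
    by (rule presentation_gr)
  let ?c = "gcoset (carrier M \<times> carrier N) (trels (carrier A) (act M) (act N) M N)"
  let ?H = "generate (pairs M N) {frag_of (m, n) | m n i j. m \<in> gr M i \<and> n \<in> gr N j \<and> i + j = d}"
  obtain u v where u: "u \<in> ?H" "x = ?c u" and v: "v \<in> ?H" "y = ?c v"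
    using assms unfolding gr_T by blast
  have "u + v \<in> ?H" using P'.rels_diff[OF u(1) P'.rels_minus[OF v(1)]] by simp
  moreover have "x \<oplus>\<^bsub>T\<^esub> y = ?c (u + v)"
    unfolding u(2) v(2) by (rule gcoset_add_T[OF P'.rels_keys[OF u(1)] P'.rels_keys[OF v(1)]])
  ultimately show ?thesis unfolding gr_T by blast
qed

text \<open>As in \<open>tensor_induct\<close>, negatives are absorbed by the left factor, so the
  induction carries the property and membership in degree \<open>d\<close> for an element together
  with its negative.\<close>

lemma gr_T_induct [consumes 1, case_names pure add]:
  assumes z: "z \<in> gr T d"
    and pure: "\<And>m n i j. \<lbrakk>m \<in> gr M i; n \<in> gr N j; i + j = d\<rbrakk> \<Longrightarrow> Q (tn m n)"
    and add: "\<And>x y. \<lbrakk>x \<in> gr T d; y \<in> gr T d; Q x; Q y\<rbrakk> \<Longrightarrow> Q (x \<oplus>\<^bsub>T\<^esub> y)"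
  shows "Q z"
proof -
  interpret P': presentation "carrier M \<times> carrier N" "{frag_of (m, n) | m n i j. m \<in> gr M i \<and> n \<in> gr N j \<and> i + j = d}"
    by (rule presentation_gr)
  let ?c = "gcoset (carrier M \<times> carrier N) (trels (carrier A) (act M) (act N) M N)"
  have Q0: "Q \<zero>\<^bsub>T\<^esub>" using pure[OF L.M.gr_zero[of 0] R.M.gr_zero[of d]] by (simp add: tn_zero_left)
  have m0: "\<ominus>\<^bsub>T\<^esub> \<zero>\<^bsub>T\<^esub> = \<zero>\<^bsub>T\<^esub>" by (metis T.l_zero T.r_neg T.a_inv_closed T.zero_closed)
  obtain x where x: "x \<in> generate (pairs M N) {frag_of (m, n) | m n i j. m \<in> gr M i \<and> n \<in> gr N j \<and> i + j = d}" "z = ?c x"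
    using z unfolding gr_T by blast
  have "Poly_Mapping.keys x \<subseteq> carrier M \<times> carrier N \<and> ?c x \<in> gr T d \<and> Q (?c x) \<and> \<ominus>\<^bsub>T\<^esub> ?c x \<in> gr T d \<and> Q (\<ominus>\<^bsub>T\<^esub> ?c x)"
    using x(1)
  proof (induction x rule: P'.rels_induct)
    case zero
    have "\<zero>\<^bsub>T\<^esub> \<in> gr T d \<and> Q \<zero>\<^bsub>T\<^esub> \<and> \<ominus>\<^bsub>T\<^esub> \<zero>\<^bsub>T\<^esub> \<in> gr T d \<and> Q (\<ominus>\<^bsub>T\<^esub> \<zero>\<^bsub>T\<^esub>)"
      unfolding m0 using gr_T_zero Q0 by blast
    then show ?case unfolding zero_T by simp
  next
    case (incl t)
    then obtain m n i j where t: "t = frag_of (m, n)" "m \<in> gr M i" "n \<in> gr N j" "i + j = d" by blast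
    have c: "?c t = tn m n" "m \<in> carrier M" "n \<in> carrier N"
      using t L.M.gr_carrier R.M.gr_carrier by (auto simp: pt_def)
    show ?case
      unfolding c(1) tn_minus_left[OF c(3,2), symmetric]
      using t c(2,3) L.M.gr_minus by (auto intro!: tn_gr pure simp: keys_frag_of)
  next
    case (diff x y)
    have k: "Poly_Mapping.keys (x - y) \<subseteq> carrier M \<times> carrier N"
      using diff keys_diff[of x y] by blast
    have cl: "?c x \<in> carrier T" "?c y \<in> carrier T" using diff gcoset_closed_T by auto
    have "?c (x - y) \<oplus>\<^bsub>T\<^esub> ?c y = ?c x" "?c (x - y) \<in> carrier T"
      using diff k gcoset_closed_T by (simp_all add: gcoset_add_T)
    then have "?c (x - y) = ?c x \<oplus>\<^bsub>T\<^esub> \<ominus>\<^bsub>T\<^esub> ?c y"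
      using cl by (metis T.a_assoc T.r_neg T.r_zero T.a_inv_closed)
    moreover have "\<ominus>\<^bsub>T\<^esub> (?c x \<oplus>\<^bsub>T\<^esub> \<ominus>\<^bsub>T\<^esub> ?c y) = \<ominus>\<^bsub>T\<^esub> ?c x \<oplus>\<^bsub>T\<^esub> ?c y"
      using cl by (simp add: T.minus_add)
    ultimately show ?case using k diff by (auto intro!: gr_T_add add)
  qed
  then show ?thesis using x by simp
qed

lemma subspace_gr_T: "subspace K (gr T d) T"
proof -
  interpret T: vectorspace K T by (rule vectorspace_T)
  have "c \<odot>\<^bsub>T\<^esub> z \<in> gr T d" if "c \<in> carrier K" "z \<in> gr T d" for c z
    using that(2)
  proof (induction rule: gr_T_induct)
    case (pure m n i j)
    then show ?case using that(1) L.M.gr_carrier R.M.gr_carrier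
      by (subst smult_tn) (auto intro!: tn_gr L.M.gr_smult)
  next
    case (add x y)
    then show ?case using that(1) gr_T_carrier by (auto simp: T.smult_r_distr intro!: gr_T_add)
  qed
  then show ?thesis
    by (auto simp: subspace_def submodule_def T.vectorspace_axioms T.module_axioms gr_T_carrier gr_T_add gr_T_zero)
qed

text \<open>The projection onto degree \<open>d\<close> sends \<open>m \<otimes> n\<close> to the sum of the \<open>m\<^sub>i \<otimes> n\<^sub>d\<^sub>-\<^sub>i\<close>.\<close>

definition proj_pure :: "int \<Rightarrow> 'm \<Rightarrow> 'n \<Rightarrow> ('m \<times> 'n \<Rightarrow>\<^sub>0 int) set" where
  "proj_pure d m n = (\<Oplus>\<^bsub>T\<^esub> i \<in> {i. hcomp M m i \<noteq> \<zero>\<^bsub>M\<^esub>}. tn (hcomp M m i) (hcomp N n (d - i)))"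

lemma proj_pure_superset:
  assumes "m \<in> carrier M" "n \<in> carrier N" "finite I" "\<And>i. i \<notin> I \<Longrightarrow> hcomp M m i = \<zero>\<^bsub>M\<^esub>"
  shows "proj_pure d m n = (\<Oplus>\<^bsub>T\<^esub> i \<in> I. tn (hcomp M m i) (hcomp N n (d - i)))"
  unfolding proj_pure_def
  by (rule T.add.finprod_mono_neutral_cong_left)
    (use assms L.M.hcomp_closed R.M.hcomp_closed in \<open>auto intro!: tn_closed simp: tn_zero_left\<close>)

lemma proj_pure_left: "n \<in> carrier N \<Longrightarrow> addmap M T (\<lambda>m. proj_pure d m n)"
proof (rule addmapI)
  fix m m' assume n: "n \<in> carrier N" and m: "m \<in> carrier M" "m' \<in> carrier M"
  let ?I = "{i. hcomp M m i \<noteq> \<zero>\<^bsub>M\<^esub>} \<union> {i. hcomp M m' i \<noteq> \<zero>\<^bsub>M\<^esub>}"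
  note cl = L.M.hcomp_closed R.M.hcomp_closed tn_closed
  have fin: "finite ?I" using L.M.finite_hcomp m by auto
  have a: "hcomp M (m \<oplus>\<^bsub>M\<^esub> m') i = hcomp M m i \<oplus>\<^bsub>M\<^esub> hcomp M m' i" for i
    using addmap_add[OF L.M.addmap_hcomp] m by auto
  have "proj_pure d (m \<oplus>\<^bsub>M\<^esub> m') n = (\<Oplus>\<^bsub>T\<^esub> i \<in> ?I. tn (hcomp M (m \<oplus>\<^bsub>M\<^esub> m') i) (hcomp N n (d - i)))"
    by (rule proj_pure_superset) (use m n fin in \<open>auto simp: a\<close>)
  also have "\<dots> = (\<Oplus>\<^bsub>T\<^esub> i \<in> ?I. tn (hcomp M m i) (hcomp N n (d - i)) \<oplus>\<^bsub>T\<^esub> tn (hcomp M m' i) (hcomp N n (d - i)))"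
    by (rule T.finsum_cong') (use m n cl in \<open>auto simp: a tn_add_left\<close>)
  also have "\<dots> = (\<Oplus>\<^bsub>T\<^esub> i \<in> ?I. tn (hcomp M m i) (hcomp N n (d - i))) \<oplus>\<^bsub>T\<^esub> (\<Oplus>\<^bsub>T\<^esub> i \<in> ?I. tn (hcomp M m' i) (hcomp N n (d - i)))"
    by (rule T.finsum_addf) (use m n cl in auto)
  also have "\<dots> = proj_pure d m n \<oplus>\<^bsub>T\<^esub> proj_pure d m' n"
    by (intro arg_cong2[of _ _ _ _ "add T"] proj_pure_superset[symmetric]) (use m n fin in auto)
  finally show "proj_pure d (m \<oplus>\<^bsub>M\<^esub> m') n = proj_pure d m n \<oplus>\<^bsub>T\<^esub> proj_pure d m' n" .
next
  fix m assume "n \<in> carrier N" "m \<in> carrier M"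
  then show "proj_pure d m n \<in> carrier T"
    unfolding proj_pure_def by (intro T.finsum_closed Pi_I tn_closed L.M.hcomp_closed R.M.hcomp_closed)
qed

lemma proj_pure_right: "m \<in> carrier M \<Longrightarrow> addmap N T (\<lambda>n. proj_pure d m n)"
  unfolding proj_pure_def
  by (rule addmap_finsum_pointwise[OF R.M.abelian_group_axioms T.abelian_group_axioms])
    (rule addmap_comp[OF R.M.addmap_hcomp addmap_tn_right[OF L.M.hcomp_closed]])

lemma proj_pure_homogeneous:
  assumes "m \<in> gr M i" "n \<in> carrier N" shows "proj_pure d m n = tn m (hcomp N n (d - i))"
proof -
  note c = L.M.gr_carrier[OF assms(1)]
  have "proj_pure d m n = (\<Oplus>\<^bsub>T\<^esub> j \<in> {i}. tn (hcomp M m j) (hcomp N n (d - j)))"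
    by (rule proj_pure_superset) (use assms c in \<open>auto simp: L.M.hcomp_homogeneous\<close>)
  then show ?thesis using assms c by (simp add: L.M.hcomp_homogeneous tn_closed R.M.hcomp_closed)
qed

text \<open>For homogeneous \<open>a\<close> of degree \<open>e\<close> and \<open>m\<close> of
  degree \<open>i\<close> both sides reduce to one pure tensor: the degree that \<open>a\<close>
  adds on the left is the degree by which \<open>hcomp_act\<close> lowers the component taken on the
  right. Additivity first in \<open>m\<close> and then in \<open>a\<close> gives the general
  case.\<close>

lemma proj_pure_balanced:
  assumes a: "a \<in> carrier A" and m: "m \<in> carrier M" and n: "n \<in> carrier N"
  shows "proj_pure d (act M a m) n = proj_pure d m (act N a n)"
proof -
  have hom: "proj_pure d (act M a m) n = proj_pure d m (act N a n)"
    if a: "a \<in> gr A e" and m: "m \<in> gr M i" for a m e i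
  proof -
    have ac: "a \<in> carrier A" and mc: "m \<in> carrier M" using a m L.A.gr_carrier[of a e] L.M.gr_carrier by auto
    have am: "act M a m \<in> gr M (e + i)" using L.gr_act[of a e m i] a m by simp
    have "proj_pure d (act M a m) n = tn (act M a m) (hcomp N n (d - (e + i)))"
      by (rule proj_pure_homogeneous[OF am n])
    also have "\<dots> = tn m (act N a (hcomp N n (d - (e + i))))"
      by (rule tn_balanced[OF ac mc R.M.hcomp_closed[OF n]])
    also have "act N a (hcomp N n (d - (e + i))) = hcomp N (act N a n) (d - i)"
      using R.hcomp_act[OF a n, of "d - i"] by (simp add: algebra_simps)
    also have "tn m \<dots> = proj_pure d m (act N a n)"
      by (rule proj_pure_homogeneous[OF m R.act_closed[OF ac n], symmetric])
    finally show ?thesis .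
  qed
  have left: "addmap A T (\<lambda>a. proj_pure d (act M a m) n)" "addmap A T (\<lambda>a. proj_pure d m (act N a n))" if "m \<in> carrier M" for m
    using addmap_comp[OF _ proj_pure_left[OF n], of A "\<lambda>a. act M a m"]
      addmap_comp[OF _ proj_pure_right[OF that], of A "\<lambda>a. act N a n"] L.addmap_act_left[OF that] R.addmap_act_left[OF n]
    by (auto simp: addmap_def)
  have right: "addmap M T (\<lambda>m. proj_pure d (act M a m) n)" "addmap M T (\<lambda>m. proj_pure d m (act N a n))" if "a \<in> carrier A" for a
    using addmap_comp[OF L.addmap_act proj_pure_left[OF n], of a] proj_pure_left[OF R.act_closed[OF that n]] that by auto
  show ?thesis
  proof (rule R.A.gr_ext[OF left[OF m] a])
    fix e b assume b: "b \<in> gr A e"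
    show "proj_pure d (act M b m) n = proj_pure d m (act N b n)"
      by (rule L.M.gr_ext[OF right m]) (use b R.A.gr_carrier hom in auto)
  qed
qed

text \<open>\<open>proj_pure d\<close> is biadditive and balanced, hence lifts to the whole tensor
  product; \<open>graded_spaceI\<close> turns the lifted projections into a grading.\<close>

lemma graded_space_T: "graded_space K T"
proof -
  have "\<exists>h. addmap T T h \<and> (\<forall>m n. m \<in> carrier M \<longrightarrow> n \<in> carrier N \<longrightarrow> h (tn m n) = proj_pure d m n)" for d
  proof -
    obtain h where "addmap T T h" "\<forall>m n. m \<in> carrier M \<longrightarrow> n \<in> carrier N \<longrightarrow> h (tn m n) = proj_pure d m n"
      using tensor_lift_ex[OF T.abelian_group_axioms proj_pure_left[of _ d] proj_pure_right[of _ d] proj_pure_balanced] by blast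
    then show ?thesis by blast
  qed
  then obtain h where h: "\<And>d. addmap T T (h d)"
    "\<And>d m n. m \<in> carrier M \<Longrightarrow> n \<in> carrier N \<Longrightarrow> h d (tn m n) = proj_pure d m n" by metis
  \<comment> \<open>On \<open>m \<otimes> n\<close> of degrees \<open>i\<close> and \<open>j\<close>
    the projection leaves \<open>m\<close> times the component of \<open>n\<close> in degree
    \<open>d - i\<close>, which vanishes unless \<open>i + j = d\<close>.\<close>
  have hz: "h d z = (if d = e then z else \<zero>\<^bsub>T\<^esub>)" if "z \<in> gr T e" for z d e
    using that
  proof (induction rule: gr_T_induct)
    case (pure m n i j)
    have c: "m \<in> carrier M" "n \<in> carrier N" using pure L.M.gr_carrier R.M.gr_carrier by auto
    show ?case
      using pure by (simp add: h(2)[OF c] proj_pure_homogeneous[OF pure(1) c(2)] R.M.hcomp_homogeneous[OF pure(2)])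
        (auto simp: tn_zero_right c)
  next
    case (add x y)
    have "h d (x \<oplus>\<^bsub>T\<^esub> y) = h d x \<oplus>\<^bsub>T\<^esub> h d y" by (rule addmap_add[OF h(1)]) (rule gr_T_carrier, rule add)+
    also have "\<dots> = (if d = e then x \<oplus>\<^bsub>T\<^esub> y else \<zero>\<^bsub>T\<^esub>)" unfolding add(3,4) by simp
    finally show ?case .
  qed
  show ?thesis
  proof (rule graded_spaceI[OF vectorspace_T subspace_gr_T, of h])
    show "carrier T \<subseteq> hsums T"
    proof
      fix z assume "z \<in> carrier T"
      then show "z \<in> hsums T"
      proof (induction rule: tensor_induct)
        case (pure m n)
        show ?case using pure(1)
        proof (induction rule: L.M.gr_induct)
          case (homogeneous i m)
          then have mc: "m \<in> carrier M" by (rule L.M.gr_carrier)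
          show ?case using pure(2)
          proof (induction rule: R.M.gr_induct)
            case (homogeneous j n)
            show ?case by (rule hsums.homogeneous[OF tn_gr[OF \<open>m \<in> gr M i\<close> homogeneous refl]])
          next
            case (add x y)
            show ?case unfolding tn_add_right[OF mc add(2,1)] by (rule hsums.add[OF add(3,4)])
          qed
        next
          case (add x y)
          show ?case unfolding tn_add_left[OF add(1,2) pure(2)] by (rule hsums.add[OF add(3,4)])
        qed
      qed (rule hsums.add)
    qed
  next
    show "addmap T T (h d)" for d by (rule h(1))
    show "h d x = x" if "x \<in> gr T d" for d x using hz[OF that, of d] by simp
    show "h d x = \<zero>\<^bsub>T\<^esub>" if "x \<in> gr T e" "d \<noteq> e" for d e x using hz[OF that(1), of d] that(2) by simp
  qed
qed


end


section \<open>Exact sequences and graded dimensions\<close>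

text \<open>Linearity over \<open>K\<close> follows by \<open>alin_smult\<close>. The grading is
  kept apart in \<open>graded_map\<close>, because the splittings used later are linear but in
  general not graded.\<close>

definition alin :: "('k, 'a) gspace \<Rightarrow> ('k, 'a, 'm) gmod \<Rightarrow> ('k, 'a, 'n) gmod \<Rightarrow> ('m \<Rightarrow> 'n) \<Rightarrow> bool" where
  "alin A M N f \<longleftrightarrow> addmap M N f \<and> (\<forall>a \<in> carrier A. \<forall>x \<in> carrier M. f (act M a x) = act N a (f x))"

definition graded_map :: "('k, 'm, 'y) gspace_scheme \<Rightarrow> ('k, 'n, 'z) gspace_scheme \<Rightarrow> ('m \<Rightarrow> 'n) \<Rightarrow> bool" where
  "graded_map M N f \<longleftrightarrow> (\<forall>d. \<forall>x \<in> gr M d. f x \<in> gr N d)"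

lemma graded_mapD: "graded_map M N f \<Longrightarrow> x \<in> gr M d \<Longrightarrow> f x \<in> gr N d"
  by (simp add: graded_map_def)

lemma alin_addmap: "alin A M N f \<Longrightarrow> addmap M N f"
  by (simp add: alin_def)

lemma alin_act: "alin A M N f \<Longrightarrow> a \<in> carrier A \<Longrightarrow> x \<in> carrier M \<Longrightarrow> f (act M a x) = act N a (f x)"
  by (simp add: alin_def)

lemma alin_smult:
  assumes "left_gmod K A M" "left_gmod K A N" "alin A M N f" "c \<in> carrier K" "x \<in> carrier M"
  shows "f (c \<odot>\<^bsub>M\<^esub> x) = c \<odot>\<^bsub>N\<^esub> f x"
proof -
  interpret M: left_gmod K A M by fact
  interpret N: left_gmod K A N by fact
  have "c \<odot>\<^bsub>A\<^esub> \<one>\<^bsub>A\<^esub> \<in> carrier A" using assms(4) by simp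
  then show ?thesis
    using assms alin_act[OF assms(3), of "c \<odot>\<^bsub>A\<^esub> \<one>\<^bsub>A\<^esub>" x] M.smult_act[of c x] N.smult_act[of c "f x"]
      addmap_closed[OF alin_addmap[OF assms(3)]] by simp
qed

lemma module_hom_iff:
  "f \<in> module_hom K M N \<longleftrightarrow> addmap M N f \<and> (\<forall>c \<in> carrier K. \<forall>x \<in> carrier M. f (c \<odot>\<^bsub>M\<^esub> x) = c \<odot>\<^bsub>N\<^esub> f x)"
  by (auto simp: module_hom_def addmap_def)

lemma gmod_hom_iff:
  "f \<in> gmod_hom K A M N \<longleftrightarrow> f \<in> module_hom K M N \<and> alin A M N f \<and> graded_map M N f"
  by (auto simp: gmod_hom_def module_hom_iff alin_def graded_map_def image_subset_iff)

lemma gmod_homI: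
  assumes "left_gmod K A M" "left_gmod K A N" "alin A M N f" "graded_map M N f"
  shows "f \<in> gmod_hom K A M N"
  using assms alin_smult[OF assms(1-3)] by (simp add: gmod_hom_iff module_hom_iff alin_addmap)

lemma hcomp_graded_map:
  assumes "graded_space K M" "graded_space K N" "addmap M N f" "graded_map M N f" "x \<in> carrier M"
  shows "hcomp N (f x) d = f (hcomp M x d)"
proof -
  interpret M: graded_space K M by fact
  interpret N: graded_space K N by fact
  show ?thesis
  proof (rule M.gr_ext[OF addmap_comp[OF assms(3) N.addmap_hcomp] addmap_comp[OF M.addmap_hcomp assms(3)] assms(5)])
    fix e x assume "x \<in> gr M e"
    then show "hcomp N (f x) d = f (hcomp M x d)"
      using M.hcomp_homogeneous[of x e d] N.hcomp_homogeneous[OF graded_mapD[OF assms(4)], of x e d]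
        addmap_zero[OF M.abelian_group_axioms N.abelian_group_axioms assms(3)] by simp
  qed
qed

text \<open>Exactness of two given maps, free of linearity and grading, so that the same predicate
  applies to modules and to tensor products.\<close>

definition exact_seq :: "('k, 'u, 'x) gspace_scheme \<Rightarrow> ('k, 'v, 'y) gspace_scheme \<Rightarrow> ('k, 'w, 'z) gspace_scheme \<Rightarrow>
    ('u \<Rightarrow> 'v) \<Rightarrow> ('v \<Rightarrow> 'w) \<Rightarrow> bool" where
  "exact_seq M' M M'' f g \<longleftrightarrow> inj_on f (carrier M') \<and> g ` carrier M = carrier M'' \<and>
     f ` carrier M' = {x \<in> carrier M. g x = \<zero>\<^bsub>M''\<^esub>}"

lemma short_exact_iff:
  "short_exact K A M' M M'' \<longleftrightarrow> (\<exists>f \<in> gmod_hom K A M' M. \<exists>g \<in> gmod_hom K A M M''. exact_seq M' M M'' f g)"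
  by (simp add: short_exact_def exact_seq_def)

text \<open>Rank-nullity for \<open>g\<close>: its image is all of \<open>V''\<close>, and
  \<open>f\<close> identifies its kernel with \<open>V'\<close>.\<close>

lemma dim_exact:
  fixes V' :: "('k, 'u, 'x) module_scheme" and V :: "('k, 'v, 'y) module_scheme" and V'' :: "('k, 'w, 'z) module_scheme"
  assumes vs: "vectorspace K V'" "vectorspace K V" "vectorspace K V''"
    and f: "f \<in> module_hom K V' V" and g: "g \<in> module_hom K V V''"
    and fin: "vectorspace.fin_dim K V'" "vectorspace.fin_dim K V"
    and ex: "inj_on f (carrier V')" "g ` carrier V = carrier V''" "f ` carrier V' = {x \<in> carrier V. g x = \<zero>\<^bsub>V''\<^esub>}"
  shows "vectorspace.dim K V = vectorspace.dim K V' + vectorspace.dim K V''"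
proof -
  interpret g: linear_map K V V'' g
    using vs g by (simp add: linear_map_def mod_hom_def mod_hom_axioms_def vectorspace_def)
  have ker: "g.kerT = f ` carrier V'" unfolding g.ker_def ex(3) by simp
  have "vectorspace K (V\<lparr>carrier := g.kerT\<rparr>)"
    by (rule vectorspace.subspace_is_vs[OF vs(2) g.kerT_is_subspace])
  moreover have "f \<in> module_hom K V' (V\<lparr>carrier := g.kerT\<rparr>)"
    using f unfolding ker by (auto simp: module_hom_def)
  ultimately interpret f: linear_map K V' "V\<lparr>carrier := g.kerT\<rparr>" f
    using vs by (simp add: linear_map_def mod_hom_def mod_hom_axioms_def vectorspace_def)
  have "vectorspace.dim K V' = vectorspace.dim K (V\<lparr>carrier := g.kerT\<rparr>)"
    by (rule f.dim_eq) (use fin ex ker in auto)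
  moreover have "g.imT = carrier V''" unfolding g.im_def using ex(2) by simp
  ultimately show ?thesis using g.rank_nullity[OF fin(2)] by simp
qed

lemma dim_iso:
  assumes vs: "vectorspace K V" "vectorspace K W" and f: "f \<in> module_hom K V W"
    and fin: "vectorspace.fin_dim K V" and bij: "bij_betw f (carrier V) (carrier W)"
  shows "vectorspace.dim K V = vectorspace.dim K W"
proof -
  interpret f: linear_map K V W f
    using vs f by (simp add: linear_map_def mod_hom_def mod_hom_axioms_def vectorspace_def)
  show ?thesis by (rule f.dim_eq) (use fin bij in \<open>auto simp: bij_betw_def\<close>)
qed

lemma fin_dim_image:
  assumes vs: "vectorspace K V" "vectorspace K W" and f: "f \<in> module_hom K V W"
    and fin: "vectorspace.fin_dim K V" and surj: "f ` carrier V = carrier W"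
  shows "vectorspace.fin_dim K W"
proof -
  interpret f: linear_map K V W f
    using vs f by (simp add: linear_map_def mod_hom_def mod_hom_axioms_def vectorspace_def)
  show ?thesis using f.rank_nullity_main(2)[OF fin surj] .
qed

text \<open>A formulation through submodules instead of linear combinations. In tensor products and
  images it is easier to show that every submodule containing a finite set is everything.\<close>

lemma (in vectorspace) fin_dim_iff:
  "fin_dim \<longleftrightarrow> (\<exists>B. finite B \<and> B \<subseteq> carrier V \<and> (\<forall>W. submodule K W V \<longrightarrow> B \<subseteq> W \<longrightarrow> carrier V \<subseteq> W))"
proof
  assume fin_dim
  then obtain B where B: "finite B" "B \<subseteq> carrier V" "span B = carrier V" unfolding fin_dim_def by blast
  have "carrier V \<subseteq> W" if "submodule K W V" "B \<subseteq> W" for W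
    using span_is_subset[OF that(2,1)] B(3) by simp
  then show "\<exists>B. finite B \<and> B \<subseteq> carrier V \<and> (\<forall>W. submodule K W V \<longrightarrow> B \<subseteq> W \<longrightarrow> carrier V \<subseteq> W)"
    using B by blast
next
  assume "\<exists>B. finite B \<and> B \<subseteq> carrier V \<and> (\<forall>W. submodule K W V \<longrightarrow> B \<subseteq> W \<longrightarrow> carrier V \<subseteq> W)"
  then obtain B where B: "finite B" "B \<subseteq> carrier V" "\<And>W. submodule K W V \<Longrightarrow> B \<subseteq> W \<Longrightarrow> carrier V \<subseteq> W" by blast
  have "carrier V \<subseteq> span B" by (rule B(3)[OF span_is_submodule[OF B(2)] in_own_span[OF B(2)]])
  then have "span B = carrier V" using span_is_subset2[OF B(2)] by blast
  then show fin_dim unfolding fin_dim_def using B by blast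
qed

context graded_space
begin

lemma gr_vectorspace: "vectorspace K (V\<lparr>carrier := gr V d\<rparr>)"
  by (rule subspace_is_vs[OF gr_subspace])

text \<open>The projection \<open>hcomp\<close> onto degree \<open>d\<close> is linear and onto, and
  images of finite-dimensional spaces are finite-dimensional.\<close>

lemma gr_fin_dim:
  assumes "fin_dim" shows "vectorspace.fin_dim K (V\<lparr>carrier := gr V d\<rparr>)"
proof (rule fin_dim_image[OF vectorspace_axioms gr_vectorspace _ assms])
  show "(\<lambda>x. hcomp V x d) \<in> module_hom K V (V\<lparr>carrier := gr V d\<rparr>)"
    using addmap_add[OF addmap_hcomp] by (auto simp: module_hom_def hcomp_gr hcomp_smult)
  show "(\<lambda>x. hcomp V x d) ` carrier V = carrier (V\<lparr>carrier := gr V d\<rparr>)"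
  proof (intro equalityI subsetI)
    fix x assume "x \<in> carrier (V\<lparr>carrier := gr V d\<rparr>)"
    then have "x \<in> carrier V" "x = hcomp V x d" using hcomp_homogeneous[of x d d] gr_carrier by simp_all
    then show "x \<in> (\<lambda>x. hcomp V x d) ` carrier V" by (rule rev_image_eqI)
  qed (auto simp: hcomp_gr)
qed

text \<open>Finitely many generators have components in only finitely many degrees \<open>D\<close>.
  The elements supported on \<open>D\<close> form a submodule containing the generators, hence
  everything.\<close>

lemma finite_gr_nonzero:
  assumes "fin_dim" shows "finite {d. gr V d \<noteq> {\<zero>\<^bsub>V\<^esub>}}"
proof -
  obtain B where B: "finite B" "B \<subseteq> carrier V" "\<And>W. submodule K W V \<Longrightarrow> B \<subseteq> W \<Longrightarrow> carrier V \<subseteq> W"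
    using assms unfolding fin_dim_iff by blast
  define D where "D = (\<Union>x \<in> B. {d. hcomp V x d \<noteq> \<zero>\<^bsub>V\<^esub>})"
  have fin: "finite D" unfolding D_def using B finite_hcomp by blast
  let ?W = "{x \<in> carrier V. \<forall>d. d \<notin> D \<longrightarrow> hcomp V x d = \<zero>\<^bsub>V\<^esub>}"
  have "submodule K ?W V"
    by unfold_locales
      (auto simp: addmap_add[OF addmap_hcomp] hcomp_smult addmap_zero[OF abelian_group_axioms abelian_group_axioms addmap_hcomp])
  moreover have "B \<subseteq> ?W" using B(2) unfolding D_def by blast
  ultimately have W: "carrier V \<subseteq> ?W" using B(3) by blast
  have "gr V d = {\<zero>\<^bsub>V\<^esub>}" if "d \<notin> D" for d
  proof -
    have "x = \<zero>\<^bsub>V\<^esub>" if x: "x \<in> gr V d" for x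
    proof -
      have "hcomp V x d = \<zero>\<^bsub>V\<^esub>" using W gr_carrier[OF x] \<open>d \<notin> D\<close> by blast
      then show ?thesis using hcomp_homogeneous[OF x, of d] by simp
    qed
    then show ?thesis using gr_zero by blast
  qed
  then show ?thesis by (intro finite_subset[OF _ fin]) blast
qed

text \<open>\<open>Abs_poly_mapping\<close> is controlled only for functions of finite support,
  which finite dimension provides. This is why finite dimension accompanies every computation with
  \<open>gdim\<close>.\<close>

lemma lookup_gdim:
  assumes "fin_dim"
  shows "Poly_Mapping.lookup (gdim K V) d = int (vectorspace.dim K (V\<lparr>carrier := gr V d\<rparr>))"
proof -
  have z: "vectorspace.dim K (V\<lparr>carrier := gr V e\<rparr>) = 0" if e: "gr V e = {\<zero>\<^bsub>V\<^esub>}" for e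
  proof -
    interpret S: vectorspace K "V\<lparr>carrier := gr V e\<rparr>" by (rule gr_vectorspace)
    have z: "{\<zero>\<^bsub>V\<^esub>} \<subseteq> carrier (V\<lparr>carrier := gr V e\<rparr>)" unfolding e by simp
    have "S.span {\<zero>\<^bsub>V\<^esub>} = {\<zero>\<^bsub>V\<^esub>}"
      using S.span_is_subset2[OF z] S.in_own_span[OF z] unfolding e by (intro equalityI) simp_all
    then have "S.span {\<zero>\<^bsub>V\<lparr>carrier := gr V e\<rparr>\<^esub>} = carrier (V\<lparr>carrier := gr V e\<rparr>)" unfolding e by simp
    then show ?thesis by (rule S.dim0I)
  qed
  let ?f = "\<lambda>d. int (vectorspace.dim K (V\<lparr>carrier := gr V d\<rparr>))"
  have "{d. ?f d \<noteq> 0} \<subseteq> {d. gr V d \<noteq> {\<zero>\<^bsub>V\<^esub>}}"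
  proof (intro subsetI CollectI notI)
    fix e assume "e \<in> {d. ?f d \<noteq> 0}" "gr V e = {\<zero>\<^bsub>V\<^esub>}"
    then show False using z[of e] by simp
  qed
  then have "finite {d. ?f d \<noteq> 0}" by (rule finite_subset[OF _ finite_gr_nonzero[OF assms]])
  then have "Poly_Mapping.lookup (Abs_poly_mapping ?f) = ?f" by (intro Abs_poly_mapping_inverse CollectI)
  then show ?thesis unfolding gdim_def by (rule fun_cong)
qed

end

text \<open>Exactness passes to each degree: a preimage of a homogeneous element may be
  inhomogeneous, but its component in that degree is again a preimage, since graded maps commute
  with taking components.\<close>

lemma gdim_exact:
  fixes M' :: "('k, 'u, 'x) gspace_scheme" and M :: "('k, 'v, 'y) gspace_scheme" and M'' :: "('k, 'w, 'z) gspace_scheme"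
  assumes gs: "graded_space K M'" "graded_space K M" "graded_space K M''"
    and f: "f \<in> module_hom K M' M" "graded_map M' M f" and g: "g \<in> module_hom K M M''" "graded_map M M'' g"
    and fin: "vectorspace.fin_dim K M'" "vectorspace.fin_dim K M" "vectorspace.fin_dim K M''" and ex: "exact_seq M' M M'' f g"
  shows "gdim K M = gdim K M' + gdim K M''"
proof (rule poly_mapping_eqI)
  fix d
  interpret M': graded_space K M' by fact
  interpret M: graded_space K M by fact
  interpret M'': graded_space K M'' by fact
  have fa: "addmap M' M f" and ga: "addmap M M'' g" using f g by (simp_all add: module_hom_iff)
  note hf = hcomp_graded_map[OF gs(1,2) fa f(2)] and hg = hcomp_graded_map[OF gs(2,3) ga g(2)]
  have inj: "inj_on f (carrier M')" and surj: "g ` carrier M = carrier M''"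
    and ker: "f ` carrier M' = {x \<in> carrier M. g x = \<zero>\<^bsub>M''\<^esub>}" using ex by (simp_all add: exact_seq_def)
  have "vectorspace.dim K (M\<lparr>carrier := gr M d\<rparr>) =
      vectorspace.dim K (M'\<lparr>carrier := gr M' d\<rparr>) + vectorspace.dim K (M''\<lparr>carrier := gr M'' d\<rparr>)"
  proof (rule dim_exact[OF M'.gr_vectorspace M.gr_vectorspace M''.gr_vectorspace _ _ M'.gr_fin_dim[OF fin(1)] M.gr_fin_dim[OF fin(2)]])
    show "f \<in> module_hom K (M'\<lparr>carrier := gr M' d\<rparr>) (M\<lparr>carrier := gr M d\<rparr>)"
      using f M'.gr_carrier by (auto simp: module_hom_def graded_map_def)
    show "g \<in> module_hom K (M\<lparr>carrier := gr M d\<rparr>) (M''\<lparr>carrier := gr M'' d\<rparr>)"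
      using g M.gr_carrier by (auto simp: module_hom_def graded_map_def)
    show "inj_on f (carrier (M'\<lparr>carrier := gr M' d\<rparr>))"
      using inj M'.gr_carrier by (auto simp: inj_on_def)
    have "\<exists>x \<in> gr M d. g x = y" if y: "y \<in> gr M'' d" for y
    proof -
      have "y \<in> g ` carrier M" unfolding surj by (rule M''.gr_carrier[OF y])
      then obtain x where x: "x \<in> carrier M" "g x = y" by blast
      have "g (hcomp M x d) = y" using hg[OF x(1), of d] M''.hcomp_homogeneous[OF y, of d] x(2) by simp
      then show ?thesis using M.hcomp_gr[OF x(1)] by blast
    qed
    then show "g ` carrier (M\<lparr>carrier := gr M d\<rparr>) = carrier (M''\<lparr>carrier := gr M'' d\<rparr>)"
      using graded_mapD[OF g(2)] by auto
    have "\<exists>z \<in> gr M' d. f z = x" if x: "x \<in> gr M d" "g x = \<zero>\<^bsub>M''\<^esub>" for x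
    proof -
      have "x \<in> f ` carrier M'" unfolding ker using x(2) M.gr_carrier[OF x(1)] by simp
      then obtain z where z: "z \<in> carrier M'" "f z = x" by blast
      have "f (hcomp M' z d) = x" using hf[OF z(1), of d] M.hcomp_homogeneous[OF x(1), of d] z(2) by simp
      then show ?thesis using M'.hcomp_gr[OF z(1)] by blast
    qed
    moreover have "g (f z) = \<zero>\<^bsub>M''\<^esub>" if "z \<in> carrier M'" for z
    proof -
      have "f z \<in> f ` carrier M'" using that by (rule imageI)
      then show ?thesis unfolding ker by simp
    qed
    ultimately show "f ` carrier (M'\<lparr>carrier := gr M' d\<rparr>) =
        {x \<in> carrier (M\<lparr>carrier := gr M d\<rparr>). g x = \<zero>\<^bsub>M''\<lparr>carrier := gr M'' d\<rparr>\<^esub>}"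
      using graded_mapD[OF f(2)] M'.gr_carrier by auto
  qed
  then show "Poly_Mapping.lookup (gdim K M) d = Poly_Mapping.lookup (gdim K M' + gdim K M'') d"
    using fin by (simp add: M.lookup_gdim M'.lookup_gdim M''.lookup_gdim lookup_add)
qed

text \<open>Replacing a preimage by its component of the right degree shows that the inverse of a
  graded bijection is graded.\<close>

lemma graded_iso_surj:
  assumes "graded_space K M" "graded_space K N" "addmap M N f" "graded_map M N f"
    and "bij_betw f (carrier M) (carrier N)"
  shows "f ` gr M d = gr N d"
proof -
  interpret M: graded_space K M by fact
  interpret N: graded_space K N by fact
  have "\<exists>x \<in> gr M d. f x = y" if y: "y \<in> gr N d" for y
  proof -
    have "y \<in> f ` carrier M" unfolding bij_betw_imp_surj_on[OF assms(5)] by (rule N.gr_carrier[OF y])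
    then obtain x where x: "x \<in> carrier M" "f x = y" by blast
    have "f (hcomp M x d) = y"
      using hcomp_graded_map[OF assms(1-4) x(1), of d] N.hcomp_homogeneous[OF y, of d] x(2) by simp
    then show ?thesis using M.hcomp_gr[OF x(1)] by blast
  qed
  then show ?thesis using graded_mapD[OF assms(4)] by auto
qed

lemma gdim_iso:
  fixes M :: "('k, 'u, 'x) gspace_scheme" and N :: "('k, 'v, 'y) gspace_scheme"
  assumes gs: "graded_space K M" "graded_space K N" and f: "f \<in> module_hom K M N" "graded_map M N f"
    and bij: "bij_betw f (carrier M) (carrier N)" and fin: "vectorspace.fin_dim K M"
  shows "gdim K M = gdim K N"
proof (rule poly_mapping_eqI)
  fix d
  interpret M: graded_space K M by fact
  interpret N: graded_space K N by fact
  have finN: "vectorspace.fin_dim K N"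
    by (rule fin_dim_image[OF M.vectorspace_axioms N.vectorspace_axioms f(1) fin]) (use bij in \<open>simp add: bij_betw_def\<close>)
  have "vectorspace.dim K (M\<lparr>carrier := gr M d\<rparr>) = vectorspace.dim K (N\<lparr>carrier := gr N d\<rparr>)"
  proof (rule dim_iso[OF M.gr_vectorspace N.gr_vectorspace _ M.gr_fin_dim[OF fin]])
    show "f \<in> module_hom K (M\<lparr>carrier := gr M d\<rparr>) (N\<lparr>carrier := gr N d\<rparr>)"
      using f M.gr_carrier by (auto simp: module_hom_def graded_map_def)
    have "inj_on f (gr M d)" using bij M.gr_carrier by (auto simp: bij_betw_def inj_on_def)
    moreover have "f ` gr M d = gr N d"
      by (rule graded_iso_surj[OF gs _ f(2) bij]) (use f(1) in \<open>simp add: module_hom_iff\<close>)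
    ultimately show "bij_betw f (carrier (M\<lparr>carrier := gr M d\<rparr>)) (carrier (N\<lparr>carrier := gr N d\<rparr>))"
      by (simp add: bij_betw_def)
  qed
  then show "Poly_Mapping.lookup (gdim K M) d = Poly_Mapping.lookup (gdim K N) d"
    using fin finN by (simp add: M.lookup_gdim N.lookup_gdim)
qed

text \<open>The sequence of the \<open>T\<close> is a direct summand of a finite power of the sequence of the \<open>N\<close>.\<close>

lemma exact_retract:
  assumes ab: "abelian_group N'" "abelian_group N" "abelian_group N''" "abelian_group T'" "abelian_group T" "abelian_group T''"
    and F: "addmap T' T F" and G: "addmap T T'' G" and f: "addmap N' N f" and g: "addmap N N'' g"
    and ex: "exact_seq N' N N'' f g"
    and \<kappa>: "\<And>j. j \<in> J \<Longrightarrow> addmap T' N' (\<kappa>' j)" "\<And>j. j \<in> J \<Longrightarrow> addmap T N (\<kappa> j)" "\<And>j. j \<in> J \<Longrightarrow> addmap T'' N'' (\<kappa>'' j)"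
    and \<iota>: "\<And>j. j \<in> J \<Longrightarrow> addmap N' T' (\<iota>' j)" "\<And>j. j \<in> J \<Longrightarrow> addmap N T (\<iota> j)" "\<And>j. j \<in> J \<Longrightarrow> addmap N'' T'' (\<iota>'' j)"
    and nat\<kappa>: "\<And>j z. j \<in> J \<Longrightarrow> z \<in> carrier T' \<Longrightarrow> \<kappa> j (F z) = f (\<kappa>' j z)"
      "\<And>j z. j \<in> J \<Longrightarrow> z \<in> carrier T \<Longrightarrow> \<kappa>'' j (G z) = g (\<kappa> j z)"
    and nat\<iota>: "\<And>j n. j \<in> J \<Longrightarrow> n \<in> carrier N' \<Longrightarrow> F (\<iota>' j n) = \<iota> j (f n)"
      "\<And>j n. j \<in> J \<Longrightarrow> n \<in> carrier N \<Longrightarrow> G (\<iota> j n) = \<iota>'' j (g n)"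
    and ret: "\<And>z. z \<in> carrier T' \<Longrightarrow> (\<Oplus>\<^bsub>T'\<^esub>j\<in>J. \<iota>' j (\<kappa>' j z)) = z"
      "\<And>z. z \<in> carrier T \<Longrightarrow> (\<Oplus>\<^bsub>T\<^esub>j\<in>J. \<iota> j (\<kappa> j z)) = z"
      "\<And>z. z \<in> carrier T'' \<Longrightarrow> (\<Oplus>\<^bsub>T''\<^esub>j\<in>J. \<iota>'' j (\<kappa>'' j z)) = z"
  shows "exact_seq T' T T'' F G"
proof -
  interpret N': abelian_group N' by fact
  interpret N: abelian_group N by fact
  interpret N'': abelian_group N'' by fact
  interpret T': abelian_group T' by fact
  interpret T: abelian_group T by fact
  interpret T'': abelian_group T'' by fact
  have inj: "inj_on f (carrier N')" and surj: "g ` carrier N = carrier N''"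
    and ker: "f ` carrier N' = {x \<in> carrier N. g x = \<zero>\<^bsub>N''\<^esub>}" using ex by (simp_all add: exact_seq_def)
  have c\<kappa>: "j \<in> J \<Longrightarrow> z \<in> carrier T' \<Longrightarrow> \<kappa>' j z \<in> carrier N'" "j \<in> J \<Longrightarrow> w \<in> carrier T \<Longrightarrow> \<kappa> j w \<in> carrier N"
    "j \<in> J \<Longrightarrow> v \<in> carrier T'' \<Longrightarrow> \<kappa>'' j v \<in> carrier N''" for j z w v
    using addmap_closed[OF \<kappa>(1)[of j], of z] addmap_closed[OF \<kappa>(2)[of j], of w] addmap_closed[OF \<kappa>(3)[of j], of v] by simp_all
  have c\<iota>: "j \<in> J \<Longrightarrow> z \<in> carrier N' \<Longrightarrow> \<iota>' j z \<in> carrier T'" "j \<in> J \<Longrightarrow> w \<in> carrier N \<Longrightarrow> \<iota> j w \<in> carrier T"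
    "j \<in> J \<Longrightarrow> v \<in> carrier N'' \<Longrightarrow> \<iota>'' j v \<in> carrier T''" for j z w v
    using addmap_closed[OF \<iota>(1)[of j], of z] addmap_closed[OF \<iota>(2)[of j], of w] addmap_closed[OF \<iota>(3)[of j], of v] by simp_all
  have "inj_on F (carrier T')"
  proof (rule inj_onI)
    fix x y assume x: "x \<in> carrier T'" and y: "y \<in> carrier T'" and xy: "F x = F y"
    have k: "\<kappa>' j x = \<kappa>' j y" if j: "j \<in> J" for j
      using inj_onD[OF inj, of "\<kappa>' j x" "\<kappa>' j y"] nat\<kappa>(1)[OF j x] nat\<kappa>(1)[OF j y] xy
        addmap_closed[OF \<kappa>(1)[OF j]] x y by simp
    have "(\<Oplus>\<^bsub>T'\<^esub>j\<in>J. \<iota>' j (\<kappa>' j x)) = (\<Oplus>\<^bsub>T'\<^esub>j\<in>J. \<iota>' j (\<kappa>' j y))"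
      by (rule T'.finsum_cong') (simp_all add: k c\<iota> c\<kappa> x y Pi_I)
    then show "x = y" using ret(1)[OF x] ret(1)[OF y] by simp
  qed
  moreover have "G ` carrier T = carrier T''"
  proof
    show "G ` carrier T \<subseteq> carrier T''" using addmap_closed[OF G] by blast
    show "carrier T'' \<subseteq> G ` carrier T"
    proof
      fix z assume z: "z \<in> carrier T''"
      \<comment> \<open>Each coordinate of \<open>z\<close> is lifted separately and the lifts are
        reassembled by \<open>\<iota>\<close>. Naturality of \<open>\<iota>\<close> and the
        retraction identity make the image equal to \<open>z\<close>.\<close>
      have "\<exists>n \<in> carrier N. g n = \<kappa>'' j z" if j: "j \<in> J" for j
            proof -
      have "\<kappa>'' j z \<in> g ` carrier N" unfolding surj by (rule c\<kappa>(3)[OF j z])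
      then show ?thesis by (metis imageE)
    qed
      then obtain n where n: "\<And>j. j \<in> J \<Longrightarrow> n j \<in> carrier N \<and> g (n j) = \<kappa>'' j z" by metis
      have c: "(\<lambda>j. \<iota> j (n j)) \<in> J \<rightarrow> carrier T" using n c\<iota>(2) by blast
      have "G (\<Oplus>\<^bsub>T\<^esub>j\<in>J. \<iota> j (n j)) = (\<Oplus>\<^bsub>T''\<^esub>j\<in>J. G (\<iota> j (n j)))"
        by (rule addmap_finsum[OF ab(5,6) G c])
      also have "\<dots> = (\<Oplus>\<^bsub>T''\<^esub>j\<in>J. \<iota>'' j (\<kappa>'' j z))"
        by (rule T''.finsum_cong') (simp_all add: n nat\<iota>(2) c\<iota> c\<kappa> z Pi_I)
      also have "\<dots> = z" by (rule ret(3)[OF z])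
      finally have e: "G (\<Oplus>\<^bsub>T\<^esub>j\<in>J. \<iota> j (n j)) = z" .
      show "z \<in> G ` carrier T" using imageI[OF T.finsum_closed[OF c], of G] unfolding e .
    qed
  qed
  moreover have "F ` carrier T' = {x \<in> carrier T. G x = \<zero>\<^bsub>T''\<^esub>}"
  proof (intro equalityI subsetI)
    fix z assume "z \<in> F ` carrier T'"
    then obtain w where w: "w \<in> carrier T'" "z = F w" by blast
    have zc: "z \<in> carrier T" using w addmap_closed[OF F] by simp
    have "\<kappa>'' j (G z) = \<zero>\<^bsub>N''\<^esub>" if j: "j \<in> J" for j
    proof -
      have "f (\<kappa>' j w) \<in> f ` carrier N'" using addmap_closed[OF \<kappa>(1)[OF j] w(1)] by blast
      then have "g (f (\<kappa>' j w)) = \<zero>\<^bsub>N''\<^esub>" unfolding ker by simp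
      then show ?thesis using nat\<kappa>(2)[OF j zc] nat\<kappa>(1)[OF j w(1)] w(2) by simp
    qed
    then have "(\<Oplus>\<^bsub>T''\<^esub>j\<in>J. \<iota>'' j (\<kappa>'' j (G z))) = (\<Oplus>\<^bsub>T''\<^esub>j\<in>J. \<zero>\<^bsub>T''\<^esub>)"
      by (intro T''.finsum_cong') (simp_all add: addmap_zero[OF ab(3,6) \<iota>(3)])
    then have "G z = \<zero>\<^bsub>T''\<^esub>" using ret(3)[OF addmap_closed[OF G zc]] by simp
    then show "z \<in> {x \<in> carrier T. G x = \<zero>\<^bsub>T''\<^esub>}" using zc by simp
  next
    fix z assume "z \<in> {x \<in> carrier T. G x = \<zero>\<^bsub>T''\<^esub>}"
    then have z: "z \<in> carrier T" "G z = \<zero>\<^bsub>T''\<^esub>" by auto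
    \<comment> \<open>The coordinates of an element killed by \<open>G\<close> are killed by
      \<open>g\<close>, hence come from \<open>N'\<close>; reassembled by \<open>\<iota>'\<close>
      they give a preimage under \<open>F\<close>.\<close>
    have "\<exists>n \<in> carrier N'. f n = \<kappa> j z" if j: "j \<in> J" for j
    proof -
      have "g (\<kappa> j z) = \<zero>\<^bsub>N''\<^esub>" using nat\<kappa>(2)[OF j z(1)] z(2) addmap_zero[OF ab(6,3) \<kappa>(3)[OF j]] by simp
      then have "\<kappa> j z \<in> f ` carrier N'" unfolding ker using addmap_closed[OF \<kappa>(2)[OF j] z(1)] by simp
      then show ?thesis by (metis imageE)
    qed
    then obtain n where n: "\<And>j. j \<in> J \<Longrightarrow> n j \<in> carrier N' \<and> f (n j) = \<kappa> j z" by metis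
    have c: "(\<lambda>j. \<iota>' j (n j)) \<in> J \<rightarrow> carrier T'" using n c\<iota>(1) by blast
    have "F (\<Oplus>\<^bsub>T'\<^esub>j\<in>J. \<iota>' j (n j)) = (\<Oplus>\<^bsub>T\<^esub>j\<in>J. F (\<iota>' j (n j)))"
      by (rule addmap_finsum[OF ab(4,5) F c])
    also have "\<dots> = (\<Oplus>\<^bsub>T\<^esub>j\<in>J. \<iota> j (\<kappa> j z))"
      by (rule T.finsum_cong') (simp_all add: n nat\<iota>(1) c\<iota> c\<kappa> z Pi_I)
    also have "\<dots> = z" by (rule ret(2)[OF z(1)])
    finally have e: "F (\<Oplus>\<^bsub>T'\<^esub>j\<in>J. \<iota>' j (n j)) = z" .
    show "z \<in> F ` carrier T'" using imageI[OF T'.finsum_closed[OF c], of F] unfolding e .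
  qed
  ultimately show ?thesis by (simp add: exact_seq_def)
qed

text \<open>A split sequence is described by four identities between additive maps. Such identities
  survive tensoring and already force exactness.\<close>

lemma exact_splitI:
  assumes "abelian_group T'" "abelian_group T" "abelian_group T''"
    and F: "addmap T' T F" and G: "addmap T T'' G" and S: "addmap T T' S" and R: "addmap T'' T R"
    and SF: "\<And>x. x \<in> carrier T' \<Longrightarrow> S (F x) = x" and GR: "\<And>y. y \<in> carrier T'' \<Longrightarrow> G (R y) = y"
    and GF: "\<And>x. x \<in> carrier T' \<Longrightarrow> G (F x) = \<zero>\<^bsub>T''\<^esub>"
    and sum: "\<And>z. z \<in> carrier T \<Longrightarrow> F (S z) \<oplus>\<^bsub>T\<^esub> R (G z) = z"
  shows "exact_seq T' T T'' F G"
proof -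
  interpret T: abelian_group T by fact
  have "inj_on F (carrier T')" by (rule inj_on_inverseI[of _ S]) (rule SF)
  moreover have "G ` carrier T = carrier T''"
  proof (intro equalityI subsetI)
    fix y assume "y \<in> carrier T''"
    then show "y \<in> G ` carrier T" using GR[of y] addmap_closed[OF R, of y] by (intro rev_image_eqI[of "R y"]) auto
  qed (use addmap_closed[OF G] in auto)
  moreover have "z \<in> F ` carrier T'" if "z \<in> carrier T" "G z = \<zero>\<^bsub>T''\<^esub>" for z
  proof (rule rev_image_eqI[of "S z"])
    show "S z \<in> carrier T'" by (rule addmap_closed[OF S that(1)])
    then show "z = F (S z)"
      using sum[OF that(1)] that(2) addmap_zero[OF assms(3,2) R] addmap_closed[OF F, of "S z"] by simp
  qed
  ultimately show ?thesis using addmap_closed[OF F] GF unfolding exact_seq_def by blast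
qed


section \<open>Dual bases\<close>

text \<open>In the sense of the dual basis lemma for finitely generated projective modules: the
  \<open>p j\<close> generate, and the linear functionals \<open>\<phi> j\<close> supply
  coefficients, which are in general not unique.\<close>

definition dual_basis :: "('k, 'a) gspace \<Rightarrow> ('k, 'a, 'm) gmod \<Rightarrow> 'j set \<Rightarrow> ('j \<Rightarrow> 'm) \<Rightarrow> ('j \<Rightarrow> 'm \<Rightarrow> 'a) \<Rightarrow> bool" where
  "dual_basis A M J p \<phi> \<longleftrightarrow> finite J \<and>
     (\<forall>j \<in> J. p j \<in> carrier M \<and> addmap M A (\<phi> j) \<and>
        (\<forall>a \<in> carrier A. \<forall>x \<in> carrier M. \<phi> j (act M a x) = a \<otimes>\<^bsub>A\<^esub> \<phi> j x)) \<and>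
     (\<forall>x \<in> carrier M. (\<Oplus>\<^bsub>M\<^esub>j\<in>J. act M (\<phi> j x) (p j)) = x)"

text \<open>As the coefficient of a generator of degree \<open>\<delta> j\<close>, the functional
  \<open>\<phi> j\<close> lowers degrees by \<open>\<delta> j\<close>.\<close>

definition graded_dual_basis :: "('k, 'a) gspace \<Rightarrow> ('k, 'a, 'm) gmod \<Rightarrow> 'j set \<Rightarrow> ('j \<Rightarrow> int) \<Rightarrow> ('j \<Rightarrow> 'm) \<Rightarrow> ('j \<Rightarrow> 'm \<Rightarrow> 'a) \<Rightarrow> bool" where
  "graded_dual_basis A M J \<delta> p \<phi> \<longleftrightarrow> dual_basis A M J p \<phi> \<and>
     (\<forall>j \<in> J. p j \<in> gr M (\<delta> j) \<and> (\<forall>d. \<forall>x \<in> gr M d. \<phi> j x \<in> gr A (d - \<delta> j)))"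

lemma dual_basisD:
  assumes "dual_basis A M J p \<phi>"
  shows "finite J" "j \<in> J \<Longrightarrow> p j \<in> carrier M" "j \<in> J \<Longrightarrow> addmap M A (\<phi> j)"
    "j \<in> J \<Longrightarrow> a \<in> carrier A \<Longrightarrow> x \<in> carrier M \<Longrightarrow> \<phi> j (act M a x) = a \<otimes>\<^bsub>A\<^esub> \<phi> j x"
    "x \<in> carrier M \<Longrightarrow> (\<Oplus>\<^bsub>M\<^esub>j\<in>J. act M (\<phi> j x) (p j)) = x"
    "j \<in> J \<Longrightarrow> x \<in> carrier M \<Longrightarrow> \<phi> j x \<in> carrier A"
  using assms by (simp_all add: dual_basis_def addmap_def)

context gtensor
begin

lemma lift_ex:
  assumes "abelian_group W"
    and "\<And>n. n \<in> carrier N \<Longrightarrow> addmap M W (\<lambda>m. b m n)"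
    and "\<And>m. m \<in> carrier M \<Longrightarrow> addmap N W (\<lambda>n. b m n)"
    and "\<And>a m n. \<lbrakk>a \<in> carrier A; m \<in> carrier M; n \<in> carrier N\<rbrakk> \<Longrightarrow> b (act M a m) n = b m (act N a n)"
  shows "\<exists>h. addmap T W h \<and> (\<forall>m n. m \<in> carrier M \<longrightarrow> n \<in> carrier N \<longrightarrow> h (tn m n) = b m n)"
  by (rule tensor_lift_ex[OF assms])

lemma module_homI:
  assumes W: "vectorspace K W" and h: "addmap T W h"
    and lin: "\<And>c m n. \<lbrakk>c \<in> carrier K; m \<in> carrier M; n \<in> carrier N\<rbrakk> \<Longrightarrow> h (tn (c \<odot>\<^bsub>M\<^esub> m) n) = c \<odot>\<^bsub>W\<^esub> h (tn m n)"
  shows "h \<in> module_hom K T W"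
proof -
  interpret W: vectorspace K W by fact
  have "h (c \<odot>\<^bsub>T\<^esub> z) = c \<odot>\<^bsub>W\<^esub> h z" if c: "c \<in> carrier K" and z: "z \<in> carrier T" for c z
  proof (rule tensor_ext[OF _ _ z])
    show "addmap T W (\<lambda>z. h (c \<odot>\<^bsub>T\<^esub> z))" by (rule addmap_comp[OF addmap_smult_T[OF c] h])
    show "addmap T W (\<lambda>z. c \<odot>\<^bsub>W\<^esub> h z)"
      by (rule addmapI) (simp_all add: c addmap_closed[OF h] addmap_add[OF h] W.smult_r_distr)
  qed (simp add: c smult_tn lin)
  then show ?thesis using h by (simp add: module_hom_iff)
qed

lemma graded_mapI:
  assumes W: "graded_space K W" and h: "addmap T W h"
    and gr: "\<And>m n i j. \<lbrakk>m \<in> gr M i; n \<in> gr N j\<rbrakk> \<Longrightarrow> h (tn m n) \<in> gr W (i + j)"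
  shows "graded_map T W h"
  unfolding graded_map_def
proof (intro allI ballI)
  fix d z assume "z \<in> gr T d"
  then show "h z \<in> gr W d"
  proof (induction rule: gr_T_induct)
    case (pure m n i j)
    then show ?case using gr[of m i n j] by simp
  next
    case (add x y)
    have "h (x \<oplus>\<^bsub>T\<^esub> y) = h x \<oplus>\<^bsub>W\<^esub> h y" by (rule addmap_add[OF h gr_T_carrier[OF add(1)] gr_T_carrier[OF add(2)]])
    then show ?case using graded_space.gr_add[OF W add(3,4)] by simp
  qed
qed

text \<open>Expanding \<open>m\<close> by the dual basis and moving the coefficients across the
  tensor sign gives \<open>m \<otimes> n\<close> as the sum of the
  \<open>p j \<otimes> \<phi> j m n\<close>. So \<open>\<kappa>\<close> and the maps
  \<open>p j \<otimes> -\<close> exhibit the tensor product as a retract of a finite power of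
  \<open>N\<close>.\<close>

lemma dual_expansion:
  assumes db: "dual_basis (opposite A) M J p \<phi>"
  shows "\<exists>\<kappa>. (\<forall>j \<in> J. addmap T N (\<kappa> j) \<and> (\<forall>m n. m \<in> carrier M \<longrightarrow> n \<in> carrier N \<longrightarrow> \<kappa> j (tn m n) = act N (\<phi> j m) n)) \<and>
    (\<forall>z \<in> carrier T. (\<Oplus>\<^bsub>T\<^esub>j\<in>J. tn (p j) (\<kappa> j z)) = z)"
proof -
  note D = dual_basisD[OF db, simplified]
  have "\<exists>h. addmap T N h \<and> (\<forall>m n. m \<in> carrier M \<longrightarrow> n \<in> carrier N \<longrightarrow> h (tn m n) = act N (\<phi> j m) n)" if j: "j \<in> J" for j
  proof (rule lift_ex[OF R.M.abelian_group_axioms])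
    have *: "addmap M A (\<phi> j)" using D(3)[OF j] by (simp add: addmap_def)
    show "addmap M N (\<lambda>m. act N (\<phi> j m) n)" if "n \<in> carrier N" for n
      by (rule addmap_comp[OF * R.addmap_act_left[OF that]])
    show "addmap N N (\<lambda>n. act N (\<phi> j m) n)" if "m \<in> carrier M" for m
      by (rule R.addmap_act[OF D(6)[OF j that]])
    show "act N (\<phi> j (act M a m)) n = act N (\<phi> j m) (act N a n)"
      if "a \<in> carrier A" "m \<in> carrier M" "n \<in> carrier N" for a m n
      using D(4)[OF j that(1,2)] R.act_mult[OF D(6)[OF j that(2)] that(1,3)] by simp
  qed
  then obtain \<kappa> where \<kappa>: "\<And>j. j \<in> J \<Longrightarrow> addmap T N (\<kappa> j)"
    "\<And>j m n. j \<in> J \<Longrightarrow> m \<in> carrier M \<Longrightarrow> n \<in> carrier N \<Longrightarrow> \<kappa> j (tn m n) = act N (\<phi> j m) n" by metis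
  have s: "addmap T T (\<lambda>z. \<Oplus>\<^bsub>T\<^esub>j\<in>J. tn (p j) (\<kappa> j z))"
    by (rule addmap_finsum_pointwise[OF T.abelian_group_axioms T.abelian_group_axioms])
      (rule addmap_comp[OF \<kappa>(1) addmap_tn_right[OF D(2)]])
  have "(\<Oplus>\<^bsub>T\<^esub>j\<in>J. tn (p j) (\<kappa> j z)) = z" if z: "z \<in> carrier T" for z
  proof (rule tensor_ext[OF s addmap_id z])
    fix m n assume m: "m \<in> carrier M" and n: "n \<in> carrier N"
    have c: "act M (\<phi> j m) (p j) \<in> carrier M" if "j \<in> J" for j
      using L.act_closed[of "\<phi> j m" "p j"] D(2,6) that m by simp
    have "(\<Oplus>\<^bsub>T\<^esub>j\<in>J. tn (p j) (\<kappa> j (tn m n))) = (\<Oplus>\<^bsub>T\<^esub>j\<in>J. tn (act M (\<phi> j m) (p j)) n)"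
    proof (rule T.finsum_cong'[OF refl])
      show "(\<lambda>j. tn (act M (\<phi> j m) (p j)) n) \<in> J \<rightarrow> carrier T" using tn_closed[OF c n] by blast
    qed (simp add: \<kappa>(2)[OF _ m n] tn_balanced[OF D(6)[OF _ m] D(2) n])
    also have "\<dots> = tn (\<Oplus>\<^bsub>M\<^esub>j\<in>J. act M (\<phi> j m) (p j)) n"
      by (rule tn_finsum_left[OF n, symmetric]) (use c in blast)
    finally show "(\<Oplus>\<^bsub>T\<^esub>j\<in>J. tn (p j) (\<kappa> j (tn m n))) = tn m n" using D(5)[OF m] by simp
  qed
  then show ?thesis by (intro exI[of _ \<kappa>] conjI ballI allI impI) (simp_all add: \<kappa>)
qed

text \<open>The finitely many tensors \<open>p j \<otimes> b\<close>, with \<open>b\<close> in a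
  generating set of \<open>N\<close>, generate, by \<open>dual_expansion\<close>.\<close>

lemma fin_dim_T:
  assumes db: "dual_basis (opposite A) M J p \<phi>" and fin: "vectorspace.fin_dim K N"
  shows "vectorspace.fin_dim K T"
proof -
  obtain B where B: "finite B" "B \<subseteq> carrier N" "\<And>W. submodule K W N \<Longrightarrow> B \<subseteq> W \<Longrightarrow> carrier N \<subseteq> W"
    using fin unfolding R.M.fin_dim_iff by blast
  obtain \<kappa> where \<kappa>: "\<And>j. j \<in> J \<Longrightarrow> addmap T N (\<kappa> j)" "\<And>z. z \<in> carrier T \<Longrightarrow> (\<Oplus>\<^bsub>T\<^esub>j\<in>J. tn (p j) (\<kappa> j z)) = z"
    using dual_expansion[OF db] by (elim exE conjE) blast
  note D = dual_basisD[OF db]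
  let ?C = "(\<lambda>(j, b). tn (p j) b) ` (J \<times> B)"
  show ?thesis
    unfolding vectorspace.fin_dim_iff[OF vectorspace_T]
  proof (intro exI conjI allI impI)
    show "finite ?C" using B(1) D(1) by simp
    show "?C \<subseteq> carrier T" using B(2) D(2) tn_closed by auto
    fix W assume W: "submodule K W T" and CW: "?C \<subseteq> W"
    interpret W: submodule K W T by fact
    \<comment> \<open>The elements of \<open>N\<close> whose product with \<open>p j\<close> lies in
      \<open>W\<close> form a submodule; once it contains \<open>B\<close> it is all of
      \<open>N\<close>.\<close>
    have sub: "submodule K {n \<in> carrier N. tn (p j) n \<in> W} N" if j: "j \<in> J" for j
    proof
      have sm: "tn (p j) (c \<odot>\<^bsub>N\<^esub> n) = c \<odot>\<^bsub>T\<^esub> tn (p j) n" if "c \<in> carrier K" "n \<in> carrier N" for c n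
        using that D(2)[OF j] by (simp add: smult_tn tn_smult)
      fix c v assume "c \<in> carrier K" "v \<in> {n \<in> carrier N. tn (p j) n \<in> W}"
      then show "c \<odot>\<^bsub>N\<^esub> v \<in> {n \<in> carrier N. tn (p j) n \<in> W}" by (simp add: sm)
    qed (use D(2)[OF j] in \<open>auto simp: tn_add_right tn_zero_right\<close>)
    have tW: "tn (p j) n \<in> W" if "j \<in> J" "n \<in> carrier N" for j n
    proof -
      have "tn (p j) b \<in> W" if "b \<in> B" for b
        using CW \<open>j \<in> J\<close> that by (intro subsetD[OF CW] image_eqI[of _ _ "(j, b)"]) simp_all
      then have "B \<subseteq> {n \<in> carrier N. tn (p j) n \<in> W}" using B(2) by blast
      from B(3)[OF sub[OF that(1)] this] that(2) show ?thesis by blast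
    qed
    show "carrier T \<subseteq> W"
    proof
      fix z assume z: "z \<in> carrier T"
      have "(\<Oplus>\<^bsub>T\<^esub>j\<in>I. tn (p j) (\<kappa> j z)) \<in> W" if "finite I" "I \<subseteq> J" for I
        using that
      proof (induction I rule: finite_induct)
        case (insert i I)
        have c: "tn (p j) (\<kappa> j z) \<in> W" "tn (p j) (\<kappa> j z) \<in> carrier T" if "j \<in> J" for j
          using tW[OF that addmap_closed[OF \<kappa>(1)[OF that] z]] W.subset by auto
        have i: "i \<in> J" using insert.prems by simp
        have "(\<Oplus>\<^bsub>T\<^esub>j\<in>insert i I. tn (p j) (\<kappa> j z)) = tn (p i) (\<kappa> i z) \<oplus>\<^bsub>T\<^esub> (\<Oplus>\<^bsub>T\<^esub>j\<in>I. tn (p j) (\<kappa> j z))"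
          by (rule T.finsum_insert[OF insert(1,2)]) (use c insert.prems in auto)
        moreover have "(\<Oplus>\<^bsub>T\<^esub>j\<in>I. tn (p j) (\<kappa> j z)) \<in> W" using insert by simp
        ultimately show ?case using c(1)[OF i] by simp
      qed simp
      from this[OF D(1) order_refl] show "z \<in> W" using \<kappa>(2)[OF z] by simp
    qed
  qed
qed

end

text \<open>Preservation of degrees is a conditional clause, so that ungraded splittings can be
  tensored by the same lemma as the graded maps of a sequence.\<close>

lemma tensor_functor:
  assumes G: "gtensor K A M N" "gtensor K A M' N'" and f: "alin (opposite A) M M' f" and g: "alin A N N' g"
  shows "\<exists>F. addmap (mtensor A M N) (mtensor A M' N') F \<and> F \<in> module_hom K (mtensor A M N) (mtensor A M' N') \<and>
    (\<forall>m n. m \<in> carrier M \<longrightarrow> n \<in> carrier N \<longrightarrow>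
      F (pt (carrier A) (act M) (act N) M N m n) = pt (carrier A) (act M') (act N') M' N' (f m) (g n)) \<and>
    (graded_map M M' f \<longrightarrow> graded_map N N' g \<longrightarrow> graded_map (mtensor A M N) (mtensor A M' N') F)"
proof -
  interpret G: gtensor K A M N by fact
  interpret G': gtensor K A M' N' by fact
  note fa = alin_addmap[OF f] and ga = alin_addmap[OF g]
  note fc = addmap_closed[OF fa] and gc = addmap_closed[OF ga]
  have "\<exists>h. addmap G.T G'.T h \<and> (\<forall>m n. m \<in> carrier M \<longrightarrow> n \<in> carrier N \<longrightarrow> h (G.tn m n) = G'.tn (f m) (g n))"
  proof (rule G.lift_ex[OF G'.abelian_group_T])
    show "addmap M G'.T (\<lambda>m. G'.tn (f m) (g n))" if "n \<in> carrier N" for n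
      by (rule addmap_comp[OF fa G'.addmap_tn_left[OF gc[OF that]]])
    show "addmap N G'.T (\<lambda>n. G'.tn (f m) (g n))" if "m \<in> carrier M" for m
      by (rule addmap_comp[OF ga G'.addmap_tn_right[OF fc[OF that]]])
    show "G'.tn (f (act M a m)) (g n) = G'.tn (f m) (g (act N a n))"
      if "a \<in> carrier A" "m \<in> carrier M" "n \<in> carrier N" for a m n
      using alin_act[OF f, of a m] alin_act[OF g, of a n] G'.tn_balanced[OF that(1) fc[OF that(2)] gc[OF that(3)]] that by simp
  qed
  then obtain F where F: "addmap G.T G'.T F" "\<And>m n. m \<in> carrier M \<Longrightarrow> n \<in> carrier N \<Longrightarrow> F (G.tn m n) = G'.tn (f m) (g n)" by blast
  have "F \<in> module_hom K G.T G'.T"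
  proof (rule G.module_homI[OF G'.vectorspace_T F(1)])
    fix c m n assume c: "c \<in> carrier K" "m \<in> carrier M" "n \<in> carrier N"
    then show "F (G.tn (c \<odot>\<^bsub>M\<^esub> m) n) = c \<odot>\<^bsub>G'.T\<^esub> F (G.tn m n)"
      using alin_smult[OF G.L.left_gmod_axioms G'.L.left_gmod_axioms f c(1,2)]
      by (simp add: F(2) G'.smult_tn fc gc)
  qed
  moreover have "graded_map G.T G'.T F" if "graded_map M M' f" "graded_map N N' g"
  proof (rule G.graded_mapI[OF G'.graded_space_T F(1)])
    fix m n i j assume m: "m \<in> gr M i" and n: "n \<in> gr N j"
    show "F (G.tn m n) \<in> gr G'.T (i + j)"
      using F(2)[OF G.L.M.gr_carrier[OF m] G.R.M.gr_carrier[OF n]]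
        G'.tn_gr[OF graded_mapD[OF that(1) m] graded_mapD[OF that(2) n] refl] by simp
  qed
  ultimately show ?thesis by (intro exI[of _ F] conjI allI impI) (simp_all add: F)
qed

lemma alin_id: "alin A M M (\<lambda>x. x)"
  by (simp add: alin_def addmap_def)

lemma graded_map_id: "graded_map M M (\<lambda>x. x)"
  by (simp add: graded_map_def)

text \<open>An instance of \<open>exact_retract\<close> with the maps of
  \<open>dual_expansion\<close>. Naturality holds because the functionals \<open>\<phi> j\<close>
  involve only \<open>M\<close>, while \<open>f\<close> and \<open>g\<close> are linear over
  \<open>A\<close>.\<close>

lemma tensor_exact_right:
  assumes G: "gtensor K A M N'" "gtensor K A M N" "gtensor K A M N''" and db: "dual_basis (opposite A) M J p \<phi>"
    and f: "alin A N' N f" and g: "alin A N N'' g" and ex: "exact_seq N' N N'' f g"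
    and F: "addmap (mtensor A M N') (mtensor A M N) F"
      "\<And>m n. m \<in> carrier M \<Longrightarrow> n \<in> carrier N' \<Longrightarrow>
        F (pt (carrier A) (act M) (act N') M N' m n) = pt (carrier A) (act M) (act N) M N m (f n)"
    and H: "addmap (mtensor A M N) (mtensor A M N'') H"
      "\<And>m n. m \<in> carrier M \<Longrightarrow> n \<in> carrier N \<Longrightarrow>
        H (pt (carrier A) (act M) (act N) M N m n) = pt (carrier A) (act M) (act N'') M N'' m (g n)"
  shows "exact_seq (mtensor A M N') (mtensor A M N) (mtensor A M N'') F H"
proof -
  interpret G': gtensor K A M N' by fact
  interpret G: gtensor K A M N by fact
  interpret G'': gtensor K A M N'' by fact
  obtain \<kappa>' where \<kappa>': "\<And>j. j \<in> J \<Longrightarrow> addmap G'.T N' (\<kappa>' j)"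
      "\<And>j m n. j \<in> J \<Longrightarrow> m \<in> carrier M \<Longrightarrow> n \<in> carrier N' \<Longrightarrow> \<kappa>' j (G'.tn m n) = act N' (\<phi> j m) n"
      "\<And>z. z \<in> carrier G'.T \<Longrightarrow> (\<Oplus>\<^bsub>G'.T\<^esub>j\<in>J. G'.tn (p j) (\<kappa>' j z)) = z"
    using G'.dual_expansion[OF db] by (elim exE conjE) blast
  obtain \<kappa> where \<kappa>: "\<And>j. j \<in> J \<Longrightarrow> addmap G.T N (\<kappa> j)"
      "\<And>j m n. j \<in> J \<Longrightarrow> m \<in> carrier M \<Longrightarrow> n \<in> carrier N \<Longrightarrow> \<kappa> j (G.tn m n) = act N (\<phi> j m) n"
      "\<And>z. z \<in> carrier G.T \<Longrightarrow> (\<Oplus>\<^bsub>G.T\<^esub>j\<in>J. G.tn (p j) (\<kappa> j z)) = z"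
    using G.dual_expansion[OF db] by (elim exE conjE) blast
  obtain \<kappa>'' where \<kappa>'': "\<And>j. j \<in> J \<Longrightarrow> addmap G''.T N'' (\<kappa>'' j)"
      "\<And>j m n. j \<in> J \<Longrightarrow> m \<in> carrier M \<Longrightarrow> n \<in> carrier N'' \<Longrightarrow> \<kappa>'' j (G''.tn m n) = act N'' (\<phi> j m) n"
      "\<And>z. z \<in> carrier G''.T \<Longrightarrow> (\<Oplus>\<^bsub>G''.T\<^esub>j\<in>J. G''.tn (p j) (\<kappa>'' j z)) = z"
    using G''.dual_expansion[OF db] by (elim exE conjE) blast
  note D = dual_basisD[OF db, simplified]
  note fa = alin_addmap[OF f] and ga = alin_addmap[OF g]
  show ?thesis
  proof (rule exact_retract[where J = J and \<kappa>' = \<kappa>' and \<kappa> = \<kappa> and \<kappa>'' = \<kappa>'' and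
        \<iota>' = "\<lambda>j. G'.tn (p j)" and \<iota> = "\<lambda>j. G.tn (p j)" and \<iota>'' = "\<lambda>j. G''.tn (p j)",
        OF G'.R.M.abelian_group_axioms G.R.M.abelian_group_axioms G''.R.M.abelian_group_axioms
          G'.abelian_group_T G.abelian_group_T G''.abelian_group_T F(1) H(1) fa ga ex \<kappa>'(1) \<kappa>(1) \<kappa>''(1)])
    fix j assume j: "j \<in> J"
    show "addmap N' G'.T (G'.tn (p j))" "addmap N G.T (G.tn (p j))" "addmap N'' G''.T (G''.tn (p j))"
      using G'.addmap_tn_right[OF D(2)[OF j]] G.addmap_tn_right[OF D(2)[OF j]] G''.addmap_tn_right[OF D(2)[OF j]] by simp_all
    show "\<kappa> j (F z) = f (\<kappa>' j z)" if z: "z \<in> carrier G'.T" for z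
      by (rule G'.tensor_ext[OF addmap_comp[OF F(1) \<kappa>(1)[OF j]] addmap_comp[OF \<kappa>'(1)[OF j] fa] z])
        (simp add: F(2) \<kappa>(2)[OF j] \<kappa>'(2)[OF j] addmap_closed[OF fa] alin_act[OF f] D(6)[OF j])
    show "\<kappa>'' j (H z) = g (\<kappa> j z)" if z: "z \<in> carrier G.T" for z
      by (rule G.tensor_ext[OF addmap_comp[OF H(1) \<kappa>''(1)[OF j]] addmap_comp[OF \<kappa>(1)[OF j] ga] z])
        (simp add: H(2) \<kappa>''(2)[OF j] \<kappa>(2)[OF j] addmap_closed[OF ga] alin_act[OF g] D(6)[OF j])
  qed (simp_all add: F(2) H(2) D(2) \<kappa>(3) \<kappa>'(3) \<kappa>''(3))
qed

text \<open>Surjectivity of \<open>g\<close> lifts the generators of \<open>M''\<close>, and a dual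
  basis extends these lifts linearly to a section. The retraction is what remains of
  \<open>x\<close> after the section is subtracted.\<close>

lemma projective_split:
  assumes M: "left_gmod K A M'" "left_gmod K A M" "left_gmod K A M''" and db: "dual_basis A M'' J p \<phi>"
    and f: "alin A M' M f" and g: "alin A M M'' g" and ex: "exact_seq M' M M'' f g"
  shows "\<exists>s t. alin A M M' s \<and> alin A M'' M t \<and> (\<forall>x \<in> carrier M'. s (f x) = x) \<and> (\<forall>y \<in> carrier M''. g (t y) = y) \<and>
    (\<forall>x \<in> carrier M'. g (f x) = \<zero>\<^bsub>M''\<^esub>) \<and> (\<forall>x \<in> carrier M. f (s x) \<oplus>\<^bsub>M\<^esub> t (g x) = x)"
proof -
  interpret M': left_gmod K A M' by fact
  interpret M: left_gmod K A M by fact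
  interpret M'': left_gmod K A M'' by fact
  note D = dual_basisD[OF db] and fa = alin_addmap[OF f] and ga = alin_addmap[OF g]
  have inj: "inj_on f (carrier M')" and surj: "g ` carrier M = carrier M''"
    and ker: "f ` carrier M' = {x \<in> carrier M. g x = \<zero>\<^bsub>M''\<^esub>}" using ex by (simp_all add: exact_seq_def)
  have "\<exists>u \<in> carrier M. g u = p j" if "j \<in> J" for j
  proof -
    have "p j \<in> g ` carrier M" unfolding surj by (rule D(2)[OF that])
    then show ?thesis by (metis imageE)
  qed
  then obtain u where u: "\<And>j. j \<in> J \<Longrightarrow> u j \<in> carrier M" "\<And>j. j \<in> J \<Longrightarrow> g (u j) = p j" by metis
  \<comment> \<open>The section: coordinates of \<open>y\<close> are applied to lifts
    \<open>u j\<close> of the generators. The lifts are arbitrary preimages, so \<open>t\<close> is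
    in general not graded.\<close>
  define t where "t y = (\<Oplus>\<^bsub>M\<^esub>j\<in>J. act M (\<phi> j y) (u j))" for y
  have tc: "(\<lambda>j. act M (\<phi> j y) (u j)) \<in> J \<rightarrow> carrier M" if "y \<in> carrier M''" for y
    using M.act_closed D(6) u(1) that by blast
  have ta: "addmap M'' M t"
    unfolding t_def by (rule addmap_finsum_pointwise[OF M''.M.abelian_group_axioms M.M.abelian_group_axioms])
      (rule addmap_comp[OF D(3) M.addmap_act_left[OF u(1)]])
  have t: "alin A M'' M t"
    unfolding alin_def
  proof (intro conjI ta ballI)
    fix a y assume a: "a \<in> carrier A" and y: "y \<in> carrier M''"
    have "act M a (t y) = (\<Oplus>\<^bsub>M\<^esub>j\<in>J. act M a (act M (\<phi> j y) (u j)))"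
      unfolding t_def by (rule addmap_finsum[OF M.M.abelian_group_axioms M.M.abelian_group_axioms M.addmap_act[OF a] tc[OF y]])
    also have "\<dots> = t (act M'' a y)"
      unfolding t_def by (rule M.M.finsum_cong')
        (simp_all add: a y D(4) D(6) u(1) M.act_mult M.act_closed Pi_I M'.A.m_closed)
    finally show "t (act M'' a y) = act M a (t y)" ..
  qed
  have gt: "g (t y) = y" if y: "y \<in> carrier M''" for y
  proof -
    have "g (t y) = (\<Oplus>\<^bsub>M''\<^esub>j\<in>J. g (act M (\<phi> j y) (u j)))"
      unfolding t_def by (rule addmap_finsum[OF M.M.abelian_group_axioms M''.M.abelian_group_axioms ga tc[OF y]])
    also have "\<dots> = (\<Oplus>\<^bsub>M''\<^esub>j\<in>J. act M'' (\<phi> j y) (p j))"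
      by (rule M''.M.finsum_cong') (simp_all add: alin_act[OF g] D(6) D(2) y u M''.act_closed Pi_I)
    finally show ?thesis using D(5)[OF y] by simp
  qed
  note tcl = addmap_closed[OF ta] and gcl = addmap_closed[OF ga] and fcl = addmap_closed[OF fa]
  have gf: "g (f x) = \<zero>\<^bsub>M''\<^esub>" if "x \<in> carrier M'" for x
  proof -
    have "f x \<in> f ` carrier M'" using that by (rule imageI)
    then show ?thesis unfolding ker by simp
  qed
  have "\<exists>w \<in> carrier M'. f w = x \<ominus>\<^bsub>M\<^esub> t (g x)" if x: "x \<in> carrier M" for x
  proof -
    have "g (x \<ominus>\<^bsub>M\<^esub> t (g x)) = \<zero>\<^bsub>M''\<^esub>"
      using addmap_diff[OF M.M.abelian_group_axioms M''.M.abelian_group_axioms ga x tcl[OF gcl[OF x]]] gt[OF gcl[OF x]] gcl[OF x]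
      by (simp add: a_minus_def M''.M.r_neg)
    then have "x \<ominus>\<^bsub>M\<^esub> t (g x) \<in> f ` carrier M'" unfolding ker using x tcl gcl by simp
    then show ?thesis by (metis imageE)
  qed
  then obtain s where s: "\<And>x. x \<in> carrier M \<Longrightarrow> s x \<in> carrier M'" "\<And>x. x \<in> carrier M \<Longrightarrow> f (s x) = x \<ominus>\<^bsub>M\<^esub> t (g x)" by metis
  have sum: "f (s x) \<oplus>\<^bsub>M\<^esub> t (g x) = x" if x: "x \<in> carrier M" for x
    using s(2)[OF x] x tcl[OF gcl[OF x]] by (simp add: a_minus_def M.M.a_assoc M.M.l_neg)
  \<comment> \<open>By injectivity of \<open>f\<close>, an identity in \<open>M'\<close> may be
    tested after applying \<open>f\<close> and adding a common term. All properties of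
    \<open>s\<close> follow from \<open>sum\<close> in this way.\<close>
  have can: "a = b" if "f a \<oplus>\<^bsub>M\<^esub> c = f b \<oplus>\<^bsub>M\<^esub> c" "a \<in> carrier M'" "b \<in> carrier M'" "c \<in> carrier M" for a b c
    using inj_onD[OF inj _ that(2,3)] M.M.add.right_cancel[of c "f a" "f b"] that fcl by simp
  have sf: "s (f x) = x" if x: "x \<in> carrier M'" for x
  proof (rule can[of _ "t (g (f x))"])
    have "t (g (f x)) = \<zero>\<^bsub>M\<^esub>" using gf[OF x] addmap_zero[OF M''.M.abelian_group_axioms M.M.abelian_group_axioms ta] by simp
    then show "f (s (f x)) \<oplus>\<^bsub>M\<^esub> t (g (f x)) = f x \<oplus>\<^bsub>M\<^esub> t (g (f x))" using sum[OF fcl[OF x]] fcl[OF x] by simp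
  qed (simp_all add: x s(1) fcl tcl gcl)
  have "alin A M M' s"
    unfolding alin_def
  proof (intro conjI ballI addmapI)
    fix x y assume x: "x \<in> carrier M" and y: "y \<in> carrier M"
    show "s (x \<oplus>\<^bsub>M\<^esub> y) = s x \<oplus>\<^bsub>M'\<^esub> s y"
    proof (rule can[of _ "t (g (x \<oplus>\<^bsub>M\<^esub> y))"])
      have "f (s x \<oplus>\<^bsub>M'\<^esub> s y) \<oplus>\<^bsub>M\<^esub> t (g (x \<oplus>\<^bsub>M\<^esub> y)) = (f (s x) \<oplus>\<^bsub>M\<^esub> f (s y)) \<oplus>\<^bsub>M\<^esub> (t (g x) \<oplus>\<^bsub>M\<^esub> t (g y))"
        using x y by (simp add: addmap_add[OF fa] addmap_add[OF ga] addmap_add[OF ta] s(1) gcl)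
      also have "\<dots> = (f (s x) \<oplus>\<^bsub>M\<^esub> t (g x)) \<oplus>\<^bsub>M\<^esub> (f (s y) \<oplus>\<^bsub>M\<^esub> t (g y))"
        using x y s(1) fcl tcl gcl by (simp add: M.M.a_ac)
      also have "\<dots> = f (s (x \<oplus>\<^bsub>M\<^esub> y)) \<oplus>\<^bsub>M\<^esub> t (g (x \<oplus>\<^bsub>M\<^esub> y))" using x y by (simp add: sum)
      finally show "f (s (x \<oplus>\<^bsub>M\<^esub> y)) \<oplus>\<^bsub>M\<^esub> t (g (x \<oplus>\<^bsub>M\<^esub> y)) = f (s x \<oplus>\<^bsub>M'\<^esub> s y) \<oplus>\<^bsub>M\<^esub> t (g (x \<oplus>\<^bsub>M\<^esub> y))" ..
    qed (simp_all add: x y s(1) tcl gcl)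
  next
    fix a x assume a: "a \<in> carrier A" and x: "x \<in> carrier M"
    show "s (act M a x) = act M' a (s x)"
    proof (rule can[of _ "t (g (act M a x))"])
      have "f (act M' a (s x)) \<oplus>\<^bsub>M\<^esub> t (g (act M a x)) = act M a (f (s x)) \<oplus>\<^bsub>M\<^esub> act M a (t (g x))"
        using a x by (simp add: alin_act[OF f] alin_act[OF g] alin_act[OF t] s(1) gcl)
      also have "\<dots> = act M a x"
        using M.act_add_right[OF a, of "f (s x)" "t (g x)"] x s(1) fcl tcl gcl by (simp add: sum)
      finally show "f (s (act M a x)) \<oplus>\<^bsub>M\<^esub> t (g (act M a x)) = f (act M' a (s x)) \<oplus>\<^bsub>M\<^esub> t (g (act M a x))"
        using sum[OF M.act_closed[OF a x]] by simp
    qed (simp_all add: a x s(1) tcl gcl M.act_closed M'.act_closed)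
  qed (rule s(1))
  then show ?thesis by (intro exI[of _ s] exI[of _ t] conjI ballI t) (simp_all add: sf gt gf sum)
qed


section \<open>Graded modules and anti-automorphisms\<close>

text \<open>Transport of structure along a bijection that respects the operations. It moves modules
  to a prescribed carrier type and, with the identity map, between different records with the same
  operations.\<close>

lemma graded_space_iso:
  fixes V :: "('k, 'v, 'y) gspace_scheme" and W :: "('k, 'w, 'z) gspace_scheme"
  assumes V: "graded_space K V" and bij: "bij_betw f (carrier V) (carrier W)"
    and add: "\<And>x y. x \<in> carrier V \<Longrightarrow> y \<in> carrier V \<Longrightarrow> f (x \<oplus>\<^bsub>V\<^esub> y) = f x \<oplus>\<^bsub>W\<^esub> f y"
    and zero: "f \<zero>\<^bsub>V\<^esub> = \<zero>\<^bsub>W\<^esub>"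
    and smult: "\<And>c x. c \<in> carrier K \<Longrightarrow> x \<in> carrier V \<Longrightarrow> f (c \<odot>\<^bsub>V\<^esub> x) = c \<odot>\<^bsub>W\<^esub> f x"
    and gr: "\<And>d. gr W d = f ` gr V d"
  shows "graded_space K W"
proof -
  interpret V: graded_space K V by fact
  let ?g = "the_inv_into (carrier V) f"
  have inj: "inj_on f (carrier V)" and im: "f ` carrier V = carrier W" using bij by (simp_all add: bij_betw_def)
  have fc: "f x \<in> carrier W" if "x \<in> carrier V" for x using imageI[OF that, of f] unfolding im .
  have gc: "?g y \<in> carrier V" "f (?g y) = y" if "y \<in> carrier W" for y
    using the_inv_into_into[OF inj, of y "carrier V"] f_the_inv_into_f[OF inj, of y] that im by simp_all
  have gf: "?g (f x) = x" if "x \<in> carrier V" for x using the_inv_into_f_f[OF inj that] .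
  have c: "\<exists>x \<in> carrier V. y = f x" if "y \<in> carrier W" for y using gc[OF that] by metis
  have "comm_group (add_monoid W)"
  proof (rule comm_groupI; simp)
    show "\<And>x y. x \<in> carrier W \<Longrightarrow> y \<in> carrier W \<Longrightarrow> x \<oplus>\<^bsub>W\<^esub> y \<in> carrier W"
      by (drule c, drule c) (auto simp: add[symmetric] fc)
    show "\<zero>\<^bsub>W\<^esub> \<in> carrier W" using fc[OF V.zero_closed] zero by simp
    show "\<And>x y z. x \<in> carrier W \<Longrightarrow> y \<in> carrier W \<Longrightarrow> z \<in> carrier W \<Longrightarrow> x \<oplus>\<^bsub>W\<^esub> y \<oplus>\<^bsub>W\<^esub> z = x \<oplus>\<^bsub>W\<^esub> (y \<oplus>\<^bsub>W\<^esub> z)"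
      by (drule c, drule c, drule c) (auto simp: add[symmetric] V.a_assoc)
    show "\<And>x y. x \<in> carrier W \<Longrightarrow> y \<in> carrier W \<Longrightarrow> x \<oplus>\<^bsub>W\<^esub> y = y \<oplus>\<^bsub>W\<^esub> x"
      by (drule c, drule c) (auto simp: add[symmetric] V.a_comm)
    show "\<And>x. x \<in> carrier W \<Longrightarrow> \<zero>\<^bsub>W\<^esub> \<oplus>\<^bsub>W\<^esub> x = x"
      by (drule c) (auto simp: add[symmetric] zero[symmetric])
    show "\<exists>y\<in>carrier W. y \<oplus>\<^bsub>W\<^esub> x = \<zero>\<^bsub>W\<^esub>" if x: "x \<in> carrier W" for x
    proof (rule bexI[of _ "f (\<ominus>\<^bsub>V\<^esub> ?g x)"])
      have "f (\<ominus>\<^bsub>V\<^esub> ?g x) \<oplus>\<^bsub>W\<^esub> f (?g x) = f (\<ominus>\<^bsub>V\<^esub> ?g x \<oplus>\<^bsub>V\<^esub> ?g x)" using gc(1)[OF x] by (simp add: add)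
      then show "f (\<ominus>\<^bsub>V\<^esub> ?g x) \<oplus>\<^bsub>W\<^esub> x = \<zero>\<^bsub>W\<^esub>" using gc[OF x] by (simp add: V.l_neg zero)
    qed (simp add: fc gc(1)[OF x])
  qed
  then have ab: "abelian_group W"
    by (simp add: abelian_group_def abelian_group_axioms_def abelian_monoid_def comm_group_def)
  interpret W: abelian_group W by (rule ab)
  have "module_axioms K W"
  proof
    show "\<And>a x. a \<in> carrier K \<Longrightarrow> x \<in> carrier W \<Longrightarrow> a \<odot>\<^bsub>W\<^esub> x \<in> carrier W"
      by (drule c) (auto simp: smult[symmetric] fc)
    show "\<And>a b x. a \<in> carrier K \<Longrightarrow> b \<in> carrier K \<Longrightarrow> x \<in> carrier W \<Longrightarrow> (a \<oplus>\<^bsub>K\<^esub> b) \<odot>\<^bsub>W\<^esub> x = a \<odot>\<^bsub>W\<^esub> x \<oplus>\<^bsub>W\<^esub> b \<odot>\<^bsub>W\<^esub> x"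
      by (drule c) (auto simp: smult[symmetric] add[symmetric] V.smult_l_distr)
    show "\<And>a x y. a \<in> carrier K \<Longrightarrow> x \<in> carrier W \<Longrightarrow> y \<in> carrier W \<Longrightarrow> a \<odot>\<^bsub>W\<^esub> (x \<oplus>\<^bsub>W\<^esub> y) = a \<odot>\<^bsub>W\<^esub> x \<oplus>\<^bsub>W\<^esub> a \<odot>\<^bsub>W\<^esub> y"
      by (drule c, drule c) (auto simp: smult[symmetric] add[symmetric] V.smult_r_distr)
    show "\<And>a b x. a \<in> carrier K \<Longrightarrow> b \<in> carrier K \<Longrightarrow> x \<in> carrier W \<Longrightarrow> (a \<otimes>\<^bsub>K\<^esub> b) \<odot>\<^bsub>W\<^esub> x = a \<odot>\<^bsub>W\<^esub> (b \<odot>\<^bsub>W\<^esub> x)"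
      by (drule c) (auto simp: smult[symmetric] V.smult_assoc1)
    show "\<And>x. x \<in> carrier W \<Longrightarrow> \<one>\<^bsub>K\<^esub> \<odot>\<^bsub>W\<^esub> x = x"
      by (drule c) (auto simp: smult[symmetric])
  qed
  then have vs: "vectorspace K W"
    using V.vectorspace_axioms ab unfolding vectorspace_def module_def by blast
  interpret W: vectorspace K W by (rule vs)
  show ?thesis
  proof (rule graded_spaceI[OF vs, of "\<lambda>d y. f (hcomp V (?g y) d)"])
    have fa: "addmap V W f" by (rule addmapI) (simp_all add: fc add)
    have ga: "addmap W V ?g"
    proof (rule addmapI)
      fix x y assume x: "x \<in> carrier W" and y: "y \<in> carrier W"
      have "?g (f (?g x \<oplus>\<^bsub>V\<^esub> ?g y)) = ?g x \<oplus>\<^bsub>V\<^esub> ?g y" by (rule gf) (simp add: gc(1) x y)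
      then show "?g (x \<oplus>\<^bsub>W\<^esub> y) = ?g x \<oplus>\<^bsub>V\<^esub> ?g y" by (simp add: add gc x y)
    qed (rule gc(1))
    show "subspace K (gr W d) W" for d
    proof (intro subspace.intro vs submodule.intro W.module_axioms)
      show "gr W d \<subseteq> carrier W" unfolding gr using fc V.gr_carrier by blast
      show "\<And>v w. v \<in> gr W d \<Longrightarrow> w \<in> gr W d \<Longrightarrow> v \<oplus>\<^bsub>W\<^esub> w \<in> gr W d"
        unfolding gr by (auto simp: add[symmetric] V.gr_carrier V.gr_add)
      show "\<zero>\<^bsub>W\<^esub> \<in> gr W d" unfolding gr zero[symmetric] by (rule imageI[OF V.gr_zero])
      show "\<And>a v. a \<in> carrier K \<Longrightarrow> v \<in> gr W d \<Longrightarrow> a \<odot>\<^bsub>W\<^esub> v \<in> gr W d"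
        unfolding gr by (auto simp: smult[symmetric] V.gr_carrier V.gr_smult)
    qed
    show "carrier W \<subseteq> hsums W"
    proof
      fix y assume "y \<in> carrier W"
      then obtain x where x: "x \<in> carrier V" "y = f x" using c by blast
      have "f x \<in> hsums W" using x(1)
      proof (induction rule: V.gr_induct)
        case (homogeneous d x)
        then show ?case using gr by (intro hsums.homogeneous[of _ _ d]) simp
      qed (simp add: add hsums.add)
      then show "y \<in> hsums W" using x by simp
    qed
    show "addmap W W (\<lambda>y. f (hcomp V (?g y) d))" for d
      by (rule addmap_comp[OF addmap_comp[OF ga V.addmap_hcomp] fa])
    show "f (hcomp V (?g y) d) = y" if "y \<in> gr W d" for d y
    proof -
      obtain x where x: "x \<in> gr V d" "y = f x" using \<open>y \<in> gr W d\<close> unfolding gr by (rule imageE)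
      then show ?thesis using gf[OF V.gr_carrier[OF x(1)]] V.hcomp_homogeneous[OF x(1), of d] by simp
    qed
    show "f (hcomp V (?g y) d) = \<zero>\<^bsub>W\<^esub>" if "y \<in> gr W e" "d \<noteq> e" for d e y
    proof -
      obtain x where x: "x \<in> gr V e" "y = f x" using \<open>y \<in> gr W e\<close> unfolding gr by (rule imageE)
      then show ?thesis using gf[OF V.gr_carrier[OF x(1)]] V.hcomp_homogeneous[OF x(1), of d] that(2) zero by simp
    qed
  qed
qed

lemma graded_space_cong:
  fixes V :: "('k, 'v, 'y) gspace_scheme" and W :: "('k, 'v, 'z) gspace_scheme"
  assumes "graded_space K V" "carrier W = carrier V" "add W = add V" "\<zero>\<^bsub>W\<^esub> = \<zero>\<^bsub>V\<^esub>"
    "Module.smult W = Module.smult V" "gr W = gr V"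
  shows "graded_space K W"
  by (rule graded_space_iso[OF assms(1), of "\<lambda>x. x"]) (simp_all add: assms(2-) bij_betw_def)

lemma fin_dim_cong:
  fixes V :: "('k, 'v, 'y) gspace_scheme" and W :: "('k, 'v, 'z) gspace_scheme"
  assumes "graded_space K V" "carrier W = carrier V" "add W = add V" "\<zero>\<^bsub>W\<^esub> = \<zero>\<^bsub>V\<^esub>"
    "Module.smult W = Module.smult V" "gr W = gr V" "vectorspace.fin_dim K V"
  shows "vectorspace.fin_dim K W"
proof (rule fin_dim_image[of K V W "\<lambda>x. x"])
  show "vectorspace K V" "vectorspace K W"
    using assms(1) graded_space_cong[OF assms(1-6)] by (simp_all add: graded_space_def)
qed (use assms in \<open>auto simp: module_hom_def\<close>)

lemma left_gmod_iso:
  assumes M: "left_gmod K A M" and f: "bij_betw f (carrier M) (carrier N)"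
    "\<And>x y. x \<in> carrier M \<Longrightarrow> y \<in> carrier M \<Longrightarrow> f (x \<oplus>\<^bsub>M\<^esub> y) = f x \<oplus>\<^bsub>N\<^esub> f y"
    "f \<zero>\<^bsub>M\<^esub> = \<zero>\<^bsub>N\<^esub>"
    "\<And>c x. c \<in> carrier K \<Longrightarrow> x \<in> carrier M \<Longrightarrow> f (c \<odot>\<^bsub>M\<^esub> x) = c \<odot>\<^bsub>N\<^esub> f x"
    "\<And>d. gr N d = f ` gr M d"
    and act: "\<And>a x. a \<in> carrier A \<Longrightarrow> x \<in> carrier M \<Longrightarrow> f (act M a x) = act N a (f x)"
  shows "left_gmod K A N"
proof -
  interpret M: left_gmod K A M by fact
  have im: "f ` carrier M = carrier N" using f(1) by (simp add: bij_betw_def)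
  have fc: "f x \<in> carrier N" if "x \<in> carrier M" for x using imageI[OF that, of f] unfolding im .
  have c: "\<exists>x \<in> carrier M. y = f x" if "y \<in> carrier N" for y using that unfolding im[symmetric] by (metis imageE)
  note sm = act[symmetric] f(2)[symmetric] f(4)[symmetric] fc
  show ?thesis
  proof (intro left_gmod.intro left_gmod_axioms.intro M.A.graded_algebra_axioms graded_space_iso[OF M.M.graded_space_axioms f])
    fix a y assume "a \<in> carrier A" "y \<in> carrier N"
    then show "act N a y \<in> carrier N" using c[of y] by (auto simp: sm M.act_closed)
  next
    fix a y z assume "a \<in> carrier A" "y \<in> carrier N" "z \<in> carrier N"
    then show "act N a (y \<oplus>\<^bsub>N\<^esub> z) = act N a y \<oplus>\<^bsub>N\<^esub> act N a z"
      using c[of y] c[of z] by (auto simp: sm M.act_closed M.act_add_right)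
  next
    fix a b y assume "a \<in> carrier A" "b \<in> carrier A" "y \<in> carrier N"
    then show "act N (a \<oplus>\<^bsub>A\<^esub> b) y = act N a y \<oplus>\<^bsub>N\<^esub> act N b y" "act N (a \<otimes>\<^bsub>A\<^esub> b) y = act N a (act N b y)"
      using c[of y] by (auto simp: sm M.act_closed M.act_add_left M.act_mult)
  next
    fix y assume "y \<in> carrier N"
    then show "act N \<one>\<^bsub>A\<^esub> y = y" using c[of y] by (auto simp: sm M.act_one)
  next
    fix k a y assume "k \<in> carrier K" "a \<in> carrier A" "y \<in> carrier N"
    then show "act N (k \<odot>\<^bsub>A\<^esub> a) y = k \<odot>\<^bsub>N\<^esub> act N a y" "act N a (k \<odot>\<^bsub>N\<^esub> y) = k \<odot>\<^bsub>N\<^esub> act N a y"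
      using c[of y] by (auto simp: sm M.act_closed M.act_smult_left M.act_smult_right)
  next
    fix a i y j assume a: "a \<in> gr A i" and "y \<in> gr N j"
    then obtain x where x: "x \<in> gr M j" "y = f x" unfolding f(5) by blast
    have "f (act M a x) \<in> f ` gr M (i + j)" using M.gr_act[OF a x(1)] by (rule imageI)
    then show "act N a y \<in> gr N (i + j)"
      using act[OF M.A.gr_carrier[OF a] M.M.gr_carrier[OF x(1)]] x(2) unfolding f(5) by simp
  qed
qed

lemma galg_homD:
  assumes "f \<in> galg_hom K A B"
  shows "a \<in> carrier A \<Longrightarrow> f a \<in> carrier B"
    "a \<in> carrier A \<Longrightarrow> b \<in> carrier A \<Longrightarrow> f (a \<otimes>\<^bsub>A\<^esub> b) = f a \<otimes>\<^bsub>B\<^esub> f b"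
    "a \<in> carrier A \<Longrightarrow> b \<in> carrier A \<Longrightarrow> f (a \<oplus>\<^bsub>A\<^esub> b) = f a \<oplus>\<^bsub>B\<^esub> f b"
    "f \<one>\<^bsub>A\<^esub> = \<one>\<^bsub>B\<^esub>"
    "c \<in> carrier K \<Longrightarrow> a \<in> carrier A \<Longrightarrow> f (c \<odot>\<^bsub>A\<^esub> a) = c \<odot>\<^bsub>B\<^esub> f a"
    "x \<in> gr A d \<Longrightarrow> f x \<in> gr B d" "addmap A B f"
  using assms by (auto simp: galg_hom_def ring_hom_def addmap_def image_subset_iff)

lemma graded_algebra_opposite:
  assumes "graded_algebra K A" shows "graded_algebra K (opposite A)"
proof -
  interpret A: graded_algebra K A by fact
  have "graded_space K (opposite A)" by (rule graded_space_cong[OF A.graded_space_axioms]) simp_all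
  moreover have "ring (opposite A)"
  proof (rule ringI)
    show "abelian_group (opposite A)"
      using graded_space.axioms(1)[OF calculation] unfolding vectorspace_def module_def by blast
    show "monoid (opposite A)" by (rule monoidI) (simp_all add: A.m_assoc)
  qed (simp_all add: A.l_distr A.r_distr)
  ultimately show ?thesis
  proof (intro graded_algebra.intro graded_algebra_axioms.intro)
    fix a b i j assume "a \<in> gr (opposite A) i" "b \<in> gr (opposite A) j"
    then show "a \<otimes>\<^bsub>opposite A\<^esub> b \<in> gr (opposite A) (i + j)" using A.gr_mult[of b j a i] by (simp add: add.commute)
  qed (simp_all add: A.smult_mult_left A.smult_mult_right A.gr_one)
qed

lemma left_gmod_Res:
  assumes B: "graded_algebra K B" and \<rho>: "\<rho> \<in> galg_hom K B C" and M: "left_gmod K C M"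
  shows "left_gmod K B (Res \<rho> M)"
proof -
  interpret M: left_gmod K C M by fact
  note h = galg_homD[OF \<rho>]
  have gs: "graded_space K (Res \<rho> M)"
    by (rule graded_space_cong[OF M.M.graded_space_axioms]) (simp_all add: Res_def)
  show ?thesis
    by (intro left_gmod.intro left_gmod_axioms.intro B gs)
      (simp_all add: Res_def h M.act_closed M.act_add_right M.act_add_left M.act_mult M.act_one M.act_smult_left
        M.act_smult_right M.gr_act)
qed

text \<open>Read as a homomorphism out of the opposite algebra, \<open>\<psi>\<close> makes twisting
  a case of restriction.\<close>

lemma twist_eq_Res: "twist \<psi> P = Res \<psi> P"
  by (simp add: twist_def Res_def)

locale anti_galg = graded_algebra K A for K :: "'k ring" and A :: "('k, 'a) gspace" +
  fixes \<psi> :: "'a \<Rightarrow> 'a"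
  assumes psi_hom: "\<psi> \<in> galg_hom K A (opposite A)" and psi_bij: "bij_betw \<psi> (carrier A) (carrier A)"
begin

lemma psi_hom': "\<psi> \<in> galg_hom K (opposite A) A"
  using psi_hom by (auto simp: galg_hom_def ring_hom_def)

lemma left_gmod_twist: "left_gmod K A P \<Longrightarrow> left_gmod K (opposite A) (twist \<psi> P)"
  unfolding twist_eq_Res by (rule left_gmod_Res[OF graded_algebra_opposite[OF graded_algebra_axioms] psi_hom'])

abbreviation "\<psi>i \<equiv> the_inv_into (carrier A) \<psi>"

lemma psi_inv: "a \<in> carrier A \<Longrightarrow> \<psi>i a \<in> carrier A" "a \<in> carrier A \<Longrightarrow> \<psi> (\<psi>i a) = a" "a \<in> carrier A \<Longrightarrow> \<psi>i (\<psi> a) = a"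
proof -
  have inj: "inj_on \<psi> (carrier A)" and im: "\<psi> ` carrier A = carrier A" using psi_bij by (simp_all add: bij_betw_def)
  show "a \<in> carrier A \<Longrightarrow> \<psi>i a \<in> carrier A" "a \<in> carrier A \<Longrightarrow> \<psi> (\<psi>i a) = a" "a \<in> carrier A \<Longrightarrow> \<psi>i (\<psi> a) = a"
    using the_inv_into_into[OF inj, of a "carrier A"] f_the_inv_into_f[OF inj, of a] the_inv_into_f_f[OF inj, of a] im by simp_all
qed

lemma psi_inv_eqI: "a \<in> carrier A \<Longrightarrow> \<psi> a = b \<Longrightarrow> \<psi>i b = a"
  using psi_inv(3) by blast

lemma psi_inv_add: "a \<in> carrier A \<Longrightarrow> b \<in> carrier A \<Longrightarrow> \<psi>i (a \<oplus>\<^bsub>A\<^esub> b) = \<psi>i a \<oplus>\<^bsub>A\<^esub> \<psi>i b"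
  using galg_homD(3)[OF psi_hom, of "\<psi>i a" "\<psi>i b"] by (intro psi_inv_eqI) (simp_all add: psi_inv)

lemma psi_inv_mult: "a \<in> carrier A \<Longrightarrow> b \<in> carrier A \<Longrightarrow> \<psi>i (a \<otimes>\<^bsub>A\<^esub> b) = \<psi>i b \<otimes>\<^bsub>A\<^esub> \<psi>i a"
  using galg_homD(2)[OF psi_hom, of "\<psi>i b" "\<psi>i a"] by (intro psi_inv_eqI) (simp_all add: psi_inv)

lemma psi_inv_one: "\<psi>i \<one>\<^bsub>A\<^esub> = \<one>\<^bsub>A\<^esub>"
  using galg_homD(4)[OF psi_hom] by (intro psi_inv_eqI) simp_all

lemma psi_inv_smult: "c \<in> carrier K \<Longrightarrow> a \<in> carrier A \<Longrightarrow> \<psi>i (c \<odot>\<^bsub>A\<^esub> a) = c \<odot>\<^bsub>A\<^esub> \<psi>i a"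
  using galg_homD(5)[OF psi_hom, of c "\<psi>i a"] by (intro psi_inv_eqI) (simp_all add: psi_inv)

lemma addmap_psi_inv: "addmap A A \<psi>i"
  by (rule addmapI) (simp_all add: psi_inv psi_inv_add)

text \<open>In the twisted module \<open>a\<close> acts as \<open>\<psi> a\<close>, so the
  coefficient \<open>\<phi> j x\<close> has to be replaced by its image under the inverse of
  \<open>\<psi>\<close>. The inverse reverses products, which is linearity over the opposite
  algebra.\<close>

lemma twist_dual_basis:
  assumes P: "left_gmod K A P" and db: "dual_basis A P J p \<phi>"
  shows "dual_basis (opposite A) (twist \<psi> P) J p (\<lambda>j x. \<psi>i (\<phi> j x))"
proof -
  interpret P: left_gmod K A P by fact
  note D = dual_basisD[OF db]
  have a: "addmap (twist \<psi> P) (opposite A) (\<lambda>x. \<psi>i (\<phi> j x))" if "j \<in> J" for j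
    using addmap_comp[OF D(3)[OF that] addmap_psi_inv] by (simp add: twist_def addmap_def)
  have s: "(\<Oplus>\<^bsub>twist \<psi> P\<^esub>j\<in>J. act P (\<phi> j x) (p j)) = x" if "x \<in> carrier P" for x
  proof -
    have "(\<Oplus>\<^bsub>twist \<psi> P\<^esub>j\<in>J. act P (\<phi> j x) (p j)) = (\<Oplus>\<^bsub>P\<^esub>j\<in>J. act P (\<phi> j x) (p j))"
      by (simp add: finsum_def finprod_def twist_def)
    then show ?thesis using D(5)[OF that] by simp
  qed
  have "(\<Oplus>\<^bsub>twist \<psi> P\<^esub>j\<in>J. act (twist \<psi> P) (\<psi>i (\<phi> j x)) (p j)) = x" if x: "x \<in> carrier P" for x
  proof -
    interpret tw: left_gmod K "opposite A" "twist \<psi> P" by (rule left_gmod_twist[OF P])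
    have "(\<Oplus>\<^bsub>twist \<psi> P\<^esub>j\<in>J. act (twist \<psi> P) (\<psi>i (\<phi> j x)) (p j)) = (\<Oplus>\<^bsub>twist \<psi> P\<^esub>j\<in>J. act P (\<phi> j x) (p j))"
      by (rule tw.M.finsum_cong'[OF refl]) (use x D P.act_closed in \<open>auto simp: twist_def psi_inv\<close>)
    then show ?thesis using s[OF x] by simp
  qed
  moreover have "\<psi>i (\<phi> j (act (twist \<psi> P) b x)) = b \<otimes>\<^bsub>opposite A\<^esub> \<psi>i (\<phi> j x)"
    if "j \<in> J" "b \<in> carrier A" "x \<in> carrier P" for j b x
    using that galg_homD(1)[OF psi_hom, of b] by (simp add: twist_def D psi_inv_mult psi_inv)
  ultimately show ?thesis using D(1,2) a by (simp add: dual_basis_def twist_def)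
qed

end

lemma fg_projective_left_gmod: "fg_projective K A P \<Longrightarrow> left_gmod K A P"
  by (simp add: fg_projective_def)

text \<open>One half of the graded dual basis lemma: the coordinates embed \<open>P\<close> into the
  free module on generators of degrees \<open>\<delta>\<close>, and evaluation at the
  \<open>p j\<close> is a retraction.\<close>

lemma fg_projectiveI:
  assumes M: "left_gmod K A P" and db: "graded_dual_basis A P (J :: 'j set) \<delta> p \<phi>"
  shows "fg_projective K A P"
proof -
  interpret P: left_gmod K A P by fact
  have db': "dual_basis A P J p \<phi>" and pg: "\<And>j. j \<in> J \<Longrightarrow> p j \<in> gr P (\<delta> j)"
    and \<phi>g: "\<And>j d x. j \<in> J \<Longrightarrow> x \<in> gr P d \<Longrightarrow> \<phi> j x \<in> gr A (d - \<delta> j)"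
    using db by (auto simp: graded_dual_basis_def)
  note D = dual_basisD[OF db']
  \<comment> \<open>\<open>free_gmod\<close> is indexed by a list of degrees, so \<open>J\<close> is
    enumerated without repetition.\<close>
  obtain js where js: "set js = J" "distinct js" using finite_distinct_list[OF D(1)] by blast
  let ?ds = "map \<delta> js"
  let ?F = "free_gmod A ?ds"
  have car: "carrier ?F = {xs. length xs = length js \<and> set xs \<subseteq> carrier A}"
    by (simp add: free_gmod_def Let_def)
  have jJ: "js ! i \<in> J" if "i < length js" for i using js(1) that nth_mem by blast
  let ?i = "\<lambda>x. map (\<lambda>j. \<phi> j x) js"
  let ?r = "\<lambda>xs. (\<Oplus>\<^bsub>P\<^esub>k\<in>{..<length js}. act P (xs ! k) (p (js ! k)))"
  have ic: "?i x \<in> carrier ?F" if "x \<in> carrier P" for x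
    unfolding car using js D(6) that by auto
  have xc: "xs ! k \<in> carrier A" if "xs \<in> carrier ?F" "k < length js" for xs k
    using that nth_mem[of k xs] unfolding car by auto
  have rc: "(\<lambda>k. act P (xs ! k) (p (js ! k))) \<in> {..<length js} \<rightarrow> carrier P" if "xs \<in> carrier ?F" for xs
    using P.act_closed xc[OF that] D(2)[OF jJ] by auto
  have ihom: "?i \<in> gmod_hom K A P ?F"
  proof -
    have "addmap P ?F ?i"
    proof (rule addmapI[OF ic])
      fix x y assume "x \<in> carrier P" "y \<in> carrier P"
      then show "?i (x \<oplus>\<^bsub>P\<^esub> y) = ?i x \<oplus>\<^bsub>?F\<^esub> ?i y"
        by (intro nth_equalityI) (simp_all add: free_gmod_def Let_def addmap_add[OF D(3)[OF jJ]])
    qed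
    moreover have sm: "\<phi> j (c \<odot>\<^bsub>P\<^esub> x) = c \<odot>\<^bsub>A\<^esub> \<phi> j x" if "c \<in> carrier K" "x \<in> carrier P" "j \<in> J" for c x j
      using P.smult_act[OF that(1,2)] D(4)[OF that(3), of "c \<odot>\<^bsub>A\<^esub> \<one>\<^bsub>A\<^esub>" x] that D(6)
      by (simp add: P.A.smult_mult_left)
    moreover have "graded_map P ?F ?i"
      unfolding graded_map_def using ic P.M.gr_carrier \<phi>g jJ by (auto simp: free_gmod_def Let_def)
    ultimately show ?thesis
      using js(1) D(4) by (auto simp: gmod_hom_iff module_hom_iff alin_def free_gmod_def Let_def)
  qed
  have rhom: "?r \<in> gmod_hom K A ?F P"
  proof -
    have "addmap ?F P ?r"
    proof (rule addmapI)
      fix xs ys assume x: "xs \<in> carrier ?F" and y: "ys \<in> carrier ?F"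
      have n: "(xs \<oplus>\<^bsub>?F\<^esub> ys) ! k = xs ! k \<oplus>\<^bsub>A\<^esub> ys ! k" if "k < length js" for k
        using that x y unfolding car by (simp add: free_gmod_def Let_def)
      have "?r (xs \<oplus>\<^bsub>?F\<^esub> ys) = (\<Oplus>\<^bsub>P\<^esub>k\<in>{..<length js}. act P (xs ! k) (p (js ! k)) \<oplus>\<^bsub>P\<^esub> act P (ys ! k) (p (js ! k)))"
      proof (rule P.M.finsum_cong'[OF refl])
        show "(\<lambda>k. act P (xs ! k) (p (js ! k)) \<oplus>\<^bsub>P\<^esub> act P (ys ! k) (p (js ! k))) \<in> {..<length js} \<rightarrow> carrier P"
          using rc[OF x] rc[OF y] by auto
      qed (simp add: n xc[OF x] xc[OF y] P.act_add_left D(2)[OF jJ])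
      also have "\<dots> = ?r xs \<oplus>\<^bsub>P\<^esub> ?r ys" by (rule P.M.finsum_addf[OF rc[OF x] rc[OF y]])
      finally show "?r (xs \<oplus>\<^bsub>?F\<^esub> ys) = ?r xs \<oplus>\<^bsub>P\<^esub> ?r ys" .
    qed (rule P.M.finsum_closed[OF rc])
    moreover have "?r (c \<odot>\<^bsub>?F\<^esub> xs) = c \<odot>\<^bsub>P\<^esub> ?r xs" if c: "c \<in> carrier K" and x: "xs \<in> carrier ?F" for c xs
    proof -
      have n: "(c \<odot>\<^bsub>?F\<^esub> xs) ! k = c \<odot>\<^bsub>A\<^esub> xs ! k" if "k < length js" for k
        using that x unfolding car by (simp add: free_gmod_def Let_def)
      have "c \<odot>\<^bsub>P\<^esub> ?r xs = (\<Oplus>\<^bsub>P\<^esub>k\<in>{..<length js}. c \<odot>\<^bsub>P\<^esub> act P (xs ! k) (p (js ! k)))"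
        by (rule addmap_finsum[OF P.M.abelian_group_axioms P.M.abelian_group_axioms P.M.addmap_smult[OF c] rc[OF x]])
      also have "\<dots> = ?r (c \<odot>\<^bsub>?F\<^esub> xs)"
        by (rule P.M.finsum_cong'[OF refl]) (use c xc[OF x] D(2)[OF jJ] P.act_closed in \<open>auto simp: n P.act_smult_left\<close>)
      finally show ?thesis ..
    qed
    moreover have "?r (act ?F a xs) = act P a (?r xs)" if a: "a \<in> carrier A" and x: "xs \<in> carrier ?F" for a xs
    proof -
      have n: "(act ?F a xs) ! k = a \<otimes>\<^bsub>A\<^esub> xs ! k" if "k < length js" for k
        using that x unfolding car by (simp add: free_gmod_def Let_def)
      have "act P a (?r xs) = (\<Oplus>\<^bsub>P\<^esub>k\<in>{..<length js}. act P a (act P (xs ! k) (p (js ! k))))"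
        by (rule addmap_finsum[OF P.M.abelian_group_axioms P.M.abelian_group_axioms P.addmap_act[OF a] rc[OF x]])
      also have "\<dots> = ?r (act ?F a xs)"
        by (rule P.M.finsum_cong'[OF refl]) (use a xc[OF x] D(2)[OF jJ] P.act_closed in \<open>auto simp: n P.act_mult\<close>)
      finally show ?thesis ..
    qed
    moreover have "?r xs \<in> gr P d" if x: "xs \<in> gr ?F d" for xs d
    proof (rule P.M.gr_finsum)
      fix k assume k: "k \<in> {..<length js}"
      have "xs ! k \<in> gr A (d - \<delta> (js ! k))" using x k by (simp add: free_gmod_def Let_def)
      from P.gr_act[OF this pg[OF jJ[of k]]] k show "act P (xs ! k) (p (js ! k)) \<in> gr P d" by simp
    qed
    ultimately show ?thesis by (simp add: gmod_hom_iff module_hom_iff alin_def graded_map_def)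
  qed
  have "?r (?i x) = x" if x: "x \<in> carrier P" for x
  proof -
    have "?r (?i x) = (\<Oplus>\<^bsub>P\<^esub>k\<in>{..<length js}. act P (\<phi> (js ! k) x) (p (js ! k)))"
      by (rule P.M.finsum_cong'[OF refl]) (use P.act_closed D(6)[OF jJ x] D(2)[OF jJ] in auto)
    also have "\<dots> = (\<Oplus>\<^bsub>P\<^esub>j\<in>(!) js ` {..<length js}. act P (\<phi> j x) (p j))"
    proof (rule P.M.finsum_reindex[symmetric])
      show "inj_on ((!) js) {..<length js}" using js(2) by (auto simp: inj_on_def nth_eq_iff_index_eq)
    qed (use P.act_closed D(6)[OF jJ x] D(2)[OF jJ] in auto)
    also have "(!) js ` {..<length js} = J" using js(1) by (auto simp: set_conv_nth)
    finally show ?thesis using D(5)[OF x] by simp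
  qed
  then show ?thesis unfolding fg_projective_def
    by (intro conjI M exI[of _ ?ds] bexI[OF _ ihom] bexI[OF _ rhom] ballI) assumption
qed

text \<open>The other half: the generators are the images under the retraction of the standard basis
  vectors \<open>e k\<close>, and the functionals are the coordinates of the embedding.\<close>

lemma fg_projective_dual_basis:
  assumes "fg_projective K A P"
  shows "\<exists>n \<delta> p \<phi>. graded_dual_basis A P {..<n :: nat} \<delta> p \<phi>"
proof -
  interpret P: left_gmod K A P using assms by (rule fg_projective_left_gmod)
  obtain ds i r where i: "i \<in> gmod_hom K A P (free_gmod A ds)" and r: "r \<in> gmod_hom K A (free_gmod A ds) P"
    and ri: "\<And>x. x \<in> carrier P \<Longrightarrow> r (i x) = x" using assms unfolding fg_projective_def by blast
  let ?F = "free_gmod A ds" and ?n = "length ds"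
  have car: "carrier ?F = {xs. length xs = ?n \<and> set xs \<subseteq> carrier A}" by (simp add: free_gmod_def Let_def)
  have ia: "addmap P ?F i" and ra: "addmap ?F P r" and il: "alin A P ?F i" and rl: "alin A ?F P r"
    and ig: "graded_map P ?F i" and rg: "graded_map ?F P r" using i r by (simp_all add: gmod_hom_iff module_hom_iff)
  define e where "e k = (replicate ?n \<zero>\<^bsub>A\<^esub>)[k := \<one>\<^bsub>A\<^esub>]" for k
  have ec: "e k \<in> carrier ?F" for k
    unfolding car e_def by (intro CollectI conjI order_trans[OF set_update_subset_insert]) (auto simp: set_replicate_conv_if)
  have eg: "e k \<in> gr ?F (ds ! k)" if "k < ?n" for k
    using ec[of k] that P.A.gr_one P.A.gr_zero
    by (auto simp: free_gmod_def Let_def e_def nth_list_update)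
  \<comment> \<open>The first \<open>m\<close> coordinates, padded by zeros. Expansion in the
    standard basis is proved by induction on \<open>m\<close>, adding one coordinate at a
    time.\<close>
  define trunc where "trunc m xs = take m xs @ replicate (?n - m) \<zero>\<^bsub>A\<^esub>" for m xs
  have tc: "trunc m xs \<in> carrier ?F" if "xs \<in> carrier ?F" "m \<le> ?n" for m xs
    using that set_take_subset[of m xs] unfolding car trunc_def by auto
  have zc: "replicate ?n \<zero>\<^bsub>A\<^esub> \<in> carrier ?F" unfolding car by auto
  have zz: "replicate ?n \<zero>\<^bsub>A\<^esub> \<oplus>\<^bsub>?F\<^esub> replicate ?n \<zero>\<^bsub>A\<^esub> = replicate ?n \<zero>\<^bsub>A\<^esub>"
    by (rule nth_equalityI) (simp_all add: free_gmod_def Let_def)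
  \<comment> \<open>Preservation of zero is obtained directly from additivity, by cancelling in
    \<open>P\<close> the image of \<open>0 + 0 = 0\<close>; the group laws of the free module have
    not been established.\<close>
  have r0: "r (replicate ?n \<zero>\<^bsub>A\<^esub>) = \<zero>\<^bsub>P\<^esub>"
    using addmap_add[OF ra zc zc] addmap_closed[OF ra zc] unfolding zz
    using P.M.add.right_cancel[of "r (replicate ?n \<zero>\<^bsub>A\<^esub>)" "r (replicate ?n \<zero>\<^bsub>A\<^esub>)" "\<zero>\<^bsub>P\<^esub>"] by simp
  have rsum: "r (trunc m xs) = (\<Oplus>\<^bsub>P\<^esub>k\<in>{..<m}. act P (xs ! k) (r (e k)))" if x: "xs \<in> carrier ?F" and m: "m \<le> ?n" for m xs
    using m
  proof (induction m)
    case 0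
    then show ?case using r0 by (simp add: trunc_def)
  next
    case (Suc m)
    then have m: "m < ?n" "m < length xs" using x unfolding car by auto
    have xm: "xs ! k \<in> carrier A" if "k < ?n" for k using x nth_mem[of k xs] that unfolding car by auto
    have ac: "act ?F (xs ! m) (e m) \<in> carrier ?F"
      using xm[OF m(1)] ec[of m] unfolding car by (auto simp: free_gmod_def Let_def)
    have len: "length xs = ?n" using x unfolding car by simp
    have "trunc (Suc m) xs = trunc m xs \<oplus>\<^bsub>?F\<^esub> act ?F (xs ! m) (e m)"
    proof (rule nth_equalityI)
      show "length (trunc (Suc m) xs) = length (trunc m xs \<oplus>\<^bsub>?F\<^esub> act ?F (xs ! m) (e m))"
        using m len by (simp add: trunc_def free_gmod_def Let_def e_def)
      fix k assume "k < length (trunc (Suc m) xs)"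
      then have k: "k < ?n" using m len by (simp add: trunc_def)
      show "trunc (Suc m) xs ! k = (trunc m xs \<oplus>\<^bsub>?F\<^esub> act ?F (xs ! m) (e m)) ! k"
        using m len k xm[OF k] xm[OF m(1)]
        by (auto simp: trunc_def free_gmod_def Let_def e_def nth_append nth_list_update less_Suc_eq)
    qed
    then have "r (trunc (Suc m) xs) = r (trunc m xs) \<oplus>\<^bsub>P\<^esub> act P (xs ! m) (r (e m))"
      using addmap_add[OF ra tc[OF x less_imp_le[OF m(1)]] ac] alin_act[OF rl xm[OF m(1)] ec] by simp
    also have "\<dots> = act P (xs ! m) (r (e m)) \<oplus>\<^bsub>P\<^esub> (\<Oplus>\<^bsub>P\<^esub>k\<in>{..<m}. act P (xs ! k) (r (e k)))"
      using Suc xm addmap_closed[OF ra ec] m by (simp add: P.M.a_comm P.act_closed P.M.finsum_closed Pi_I)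
    also have "\<dots> = (\<Oplus>\<^bsub>P\<^esub>k\<in>{..<Suc m}. act P (xs ! k) (r (e k)))"
      unfolding lessThan_Suc
      by (rule P.M.finsum_insert[symmetric]) (use xm addmap_closed[OF ra ec] m P.act_closed in auto)
    finally show ?case .
  qed
  have tr: "trunc ?n xs = xs" if "xs \<in> carrier ?F" for xs using that unfolding car trunc_def by simp
  have nth: "i x ! k \<in> carrier A" if "x \<in> carrier P" "k < ?n" for x k
    using addmap_closed[OF ia that(1)] nth_mem[of k "i x"] that(2) unfolding car by auto
  have len: "length (i x) = ?n" if "x \<in> carrier P" for x
    using addmap_closed[OF ia that] unfolding car by simp
  have "graded_dual_basis A P {..<?n} (\<lambda>k. ds ! k) (\<lambda>k. r (e k)) (\<lambda>k x. i x ! k)"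
    unfolding graded_dual_basis_def dual_basis_def
  proof (intro conjI ballI allI)
    show "finite {..<?n}" by simp
    show "\<And>k. k \<in> {..<?n} \<Longrightarrow> r (e k) \<in> carrier P" using addmap_closed[OF ra ec] by simp
    show "addmap P A (\<lambda>x. i x ! k)" if "k \<in> {..<?n}" for k
      using that by (intro addmapI) (auto simp: nth addmap_add[OF ia] free_gmod_def Let_def len)
    show "i (act P a x) ! k = a \<otimes>\<^bsub>A\<^esub> i x ! k" if "k \<in> {..<?n}" "a \<in> carrier A" "x \<in> carrier P" for k a x
      using that by (simp add: alin_act[OF il] free_gmod_def Let_def len)
    show "(\<Oplus>\<^bsub>P\<^esub>k\<in>{..<?n}. act P (i x ! k) (r (e k))) = x" if "x \<in> carrier P" for x
      using rsum[OF addmap_closed[OF ia that] order_refl] tr[OF addmap_closed[OF ia that]] ri[OF that] by simp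
    show "\<And>k. k \<in> {..<?n} \<Longrightarrow> r (e k) \<in> gr P (ds ! k)" using graded_mapD[OF rg eg] by simp
    show "i x ! k \<in> gr A (d - ds ! k)" if "k \<in> {..<?n}" "x \<in> gr P d" for k d x
      using graded_mapD[OF ig that(2)] that(1) by (simp add: free_gmod_def Let_def)
  qed
  then show ?thesis by blast
qed


section \<open>External tensor products\<close>

lemma finsum_Times:
  fixes G (structure)
  assumes "abelian_group G" "finite I" "finite J" "\<And>i j. i \<in> I \<Longrightarrow> j \<in> J \<Longrightarrow> f i j \<in> carrier G"
  shows "(\<Oplus>x\<in>I \<times> J. f (fst x) (snd x)) = (\<Oplus>i\<in>I. \<Oplus>j\<in>J. f i j)"
proof -
  interpret G: abelian_group G by fact
  show ?thesis using assms(2,4)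
  proof (induction I rule: finite_induct)
    case (insert i I)
    have eq: "insert i I \<times> J = Pair i ` J \<union> I \<times> J" by auto
    have c: "\<And>k j. k \<in> insert i I \<Longrightarrow> j \<in> J \<Longrightarrow> f k j \<in> carrier G" using insert.prems by blast
    have "(\<Oplus>x\<in>insert i I \<times> J. f (fst x) (snd x)) = (\<Oplus>x\<in>Pair i ` J. f (fst x) (snd x)) \<oplus> (\<Oplus>x\<in>I \<times> J. f (fst x) (snd x))"
      unfolding eq by (rule G.finsum_Un_disjoint) (use insert.hyps assms(3) c in auto)
    also have "(\<Oplus>x\<in>Pair i ` J. f (fst x) (snd x)) = (\<Oplus>j\<in>J. f i j)"
      by (subst G.finsum_reindex) (use c in \<open>auto simp: inj_on_def\<close>)
    also have "(\<Oplus>x\<in>I \<times> J. f (fst x) (snd x)) = (\<Oplus>i\<in>I. \<Oplus>j\<in>J. f i j)" using insert.IH c by blast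
    also have "(\<Oplus>j\<in>J. f i j) \<oplus> (\<Oplus>i\<in>I. \<Oplus>j\<in>J. f i j) = (\<Oplus>i\<in>insert i I. \<Oplus>j\<in>J. f i j)"
      by (rule G.finsum_insert[symmetric]) (use insert.hyps c in \<open>auto intro!: G.finsum_closed\<close>)
    finally show ?case .
  qed simp
qed

lemma field_m_comm: "field K \<Longrightarrow> a \<in> carrier K \<Longrightarrow> b \<in> carrier K \<Longrightarrow> a \<otimes>\<^bsub>K\<^esub> b = b \<otimes>\<^bsub>K\<^esub> a"
  by (meson comm_monoid.m_comm cring.axioms(2) domain_def field_def)

lemma tensor_map_with_act: "tensor_map H (with_act M f) (with_act N g) = tensor_map H M N"
  by (simp add: tensor_map_def fun_eq_iff)

lemma tensor_with_act [simp]: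
  "tensor S r l (with_act M f) (with_act N g) = tensor S r l M N"
  by (simp add: tensor_def tensor_rels_def tensor_map_with_act)

lemma pt_with_act [simp]: "pt S r l (with_act M f) (with_act N g) = pt S r l M N"
  by (simp add: pt_def trels_def fun_eq_iff)

lemma ground_simps [simp]:
  "carrier (ground K) = carrier K" "mult (ground K) = mult K" "\<one>\<^bsub>ground K\<^esub> = \<one>\<^bsub>K\<^esub>" "\<zero>\<^bsub>ground K\<^esub> = \<zero>\<^bsub>K\<^esub>"
  "add (ground K) = add K" "Module.smult (ground K) = mult K" "gr (ground K) = (\<lambda>d. if d = 0 then carrier K else {\<zero>\<^bsub>K\<^esub>})"
  by (simp_all add: ground_def)

lemma graded_space_ground:
  assumes "field K" shows "graded_space K (ground K)"
proof -
  interpret K: field K by fact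
  have "comm_group (add_monoid (ground K))"
    by (rule comm_group_cong[OF K.a_comm_group]) simp_all
  then have ab: "abelian_group (ground K)"
    by (simp add: abelian_group_def abelian_group_axioms_def abelian_monoid_def comm_group_def)
  have "module_axioms K (ground K)"
    by unfold_locales (simp_all add: K.l_distr K.r_distr K.m_assoc)
  then have vs: "vectorspace K (ground K)"
    using ab assms K.is_cring unfolding vectorspace_def module_def by blast
  interpret V: vectorspace K "ground K" by (rule vs)
  show ?thesis
  proof (rule graded_spaceI[OF vs, of "\<lambda>d x. if d = 0 then x else \<zero>\<^bsub>K\<^esub>"])
    show "subspace K (gr (ground K) d) (ground K)" for d
      by (intro subspace.intro vs submodule.intro V.module_axioms) (auto split: if_splits)
    show "carrier (ground K) \<subseteq> hsums (ground K)"
      using hsums.homogeneous[of _ "ground K" 0] by auto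
  qed (auto simp: addmap_def split: if_splits)
qed

lemma graded_algebra_ground:
  assumes "field K" shows "graded_algebra K (ground K)"
proof -
  interpret K: field K by fact
  interpret V: graded_space K "ground K" by (rule graded_space_ground[OF assms])
  have "monoid (ground K)" by (rule monoidI) (simp_all add: K.m_assoc)
  then have "ring (ground K)"
    by (intro ringI V.abelian_group_axioms) (simp_all add: K.l_distr K.r_distr)
  then show ?thesis
    by (intro graded_algebra.intro graded_algebra_axioms.intro V.graded_space_axioms)
      (auto simp: K.m_ac split: if_splits)
qed

text \<open>A graded space is a left and a right module over the field placed in degree 0, the right
  structure resting on commutativity of \<open>K\<close>. This turns tensor products over
  \<open>K\<close> into tensor products over an algebra.\<close>

lemma left_gmod_ground:
  assumes "field K" "graded_space K M"
  shows "left_gmod K (ground K) (with_act M (Module.smult M))" "left_gmod K (opposite (ground K)) (with_act M (Module.smult M))"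
proof -
  interpret M: graded_space K M by fact
  interpret K: field K by fact
  have g: "graded_space K (with_act M (Module.smult M))"
    by (rule graded_space_cong[OF M.graded_space_axioms]) simp_all
  have s: "c \<odot>\<^bsub>M\<^esub> (d \<odot>\<^bsub>M\<^esub> x) = d \<odot>\<^bsub>M\<^esub> (c \<odot>\<^bsub>M\<^esub> x)" if "c \<in> carrier K" "d \<in> carrier K" "x \<in> carrier M" for c d x
    using that by (simp add: M.smult_assoc1[symmetric] field_m_comm[OF assms(1)])
  have z: "\<zero>\<^bsub>K\<^esub> \<odot>\<^bsub>M\<^esub> x \<in> gr M d" if "x \<in> gr M e" for x d e
    using M.smult_l_null[OF M.gr_carrier[OF that]] M.gr_zero by simp
  show "left_gmod K (ground K) (with_act M (Module.smult M))"
    by (intro left_gmod.intro left_gmod_axioms.intro graded_algebra_ground assms g)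
      (auto simp: M.smult_r_distr M.smult_l_distr M.smult_assoc1 M.gr_smult z s[of _ _ _] split: if_splits)
  show "left_gmod K (opposite (ground K)) (with_act M (Module.smult M))"
    by (intro left_gmod.intro left_gmod_axioms.intro graded_algebra_ground graded_algebra_opposite assms g)
      (auto simp: M.smult_r_distr M.smult_l_distr M.smult_assoc1 M.gr_smult z field_m_comm[OF assms(1)] s[of _ _ _] split: if_splits)
qed

lemma alin_ground: "alin (ground K) (with_act M (Module.smult M)) (with_act N (Module.smult N)) f \<longleftrightarrow> f \<in> module_hom K M N"
  by (auto simp: alin_def module_hom_def addmap_def)

lemma alin_opposite: "alin (opposite A) M N f \<longleftrightarrow> alin A M N f"
  by (simp add: alin_def)

text \<open>The coordinate functions of a vector space basis. The basis is not chosen homogeneous,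
  so the dual basis is ungraded, which is enough for exactness and finiteness.\<close>

lemma fin_dim_dual_basis:
  fixes M :: "('k, 'm, 'y) gspace_scheme"
  assumes "field K" "graded_space K M" "vectorspace.fin_dim K M"
  shows "\<exists>J p \<phi>. dual_basis (ground K) (with_act M (Module.smult M)) (J :: 'm set) p \<phi>"
proof -
  interpret M: graded_space K M by fact
  interpret K: field K by fact
  obtain B where B: "finite B" "M.basis B" using M.finite_basis_exists[OF assms(3)] by blast
  have BM: "B \<subseteq> carrier M" using B(2) unfolding M.basis_def by simp
  have uniq: "\<And>v. v \<in> carrier M \<Longrightarrow> \<exists>!a. a \<in> B \<rightarrow>\<^sub>E carrier K \<and> M.lincomb a B = v"
    using M.basis_criterion[OF B(1) BM] B(2) by blast
  define co where "co v = (THE a. a \<in> B \<rightarrow>\<^sub>E carrier K \<and> M.lincomb a B = v)" for v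
  have co: "co v \<in> B \<rightarrow>\<^sub>E carrier K" "M.lincomb (co v) B = v" if "v \<in> carrier M" for v
    using theI'[OF uniq[OF that]] unfolding co_def by simp_all
  \<comment> \<open>Uniqueness of coordinates is available among functions that are extensional on
    \<open>B\<close>; a candidate is therefore restricted to \<open>B\<close> before it is
    compared.\<close>
  have coeq: "co v b = a b" if "v \<in> carrier M" "a \<in> B \<rightarrow> carrier K" "M.lincomb a B = v" "b \<in> B" for v a b
  proof -
    have "restrict a B \<in> B \<rightarrow>\<^sub>E carrier K \<and> M.lincomb (restrict a B) B = v"
      using that(2,3) M.lincomb_cong[OF refl BM, of "restrict a B" a] by (auto simp: restrict_def)
    then have "co v = restrict a B" using uniq[OF that(1)] co[OF that(1)] by blast
    then show ?thesis using that(4) by simp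
  qed
  have cc: "co v b \<in> carrier K" if "v \<in> carrier M" "b \<in> B" for v b using co(1)[OF that(1)] that(2) by blast
  have lc: "M.lincomb (co v) B = (\<Oplus>\<^bsub>M\<^esub>b\<in>B. co v b \<odot>\<^bsub>M\<^esub> b)" for v by (simp add: M.lincomb_def)
  have ad: "co (v \<oplus>\<^bsub>M\<^esub> w) b = co v b \<oplus>\<^bsub>K\<^esub> co w b" if v: "v \<in> carrier M" and w: "w \<in> carrier M" and b: "b \<in> B" for v w b
  proof (rule coeq[OF M.a_closed[OF v w] _ _ b])
    show "(\<lambda>b. co v b \<oplus>\<^bsub>K\<^esub> co w b) \<in> B \<rightarrow> carrier K" using cc v w by simp
    have "M.lincomb (\<lambda>b. co v b \<oplus>\<^bsub>K\<^esub> co w b) B = (\<Oplus>\<^bsub>M\<^esub>b\<in>B. co v b \<odot>\<^bsub>M\<^esub> b \<oplus>\<^bsub>M\<^esub> co w b \<odot>\<^bsub>M\<^esub> b)"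
      unfolding M.lincomb_def
      by (rule M.finsum_cong'[OF refl]) (use cc v w BM in \<open>auto simp: M.smult_l_distr subset_iff\<close>)
    also have "\<dots> = M.lincomb (co v) B \<oplus>\<^bsub>M\<^esub> M.lincomb (co w) B"
      unfolding lc by (rule M.finsum_addf) (use cc v w BM in auto)
    finally show "M.lincomb (\<lambda>b. co v b \<oplus>\<^bsub>K\<^esub> co w b) B = v \<oplus>\<^bsub>M\<^esub> w" using co(2) v w by simp
  qed
  have sc: "co (c \<odot>\<^bsub>M\<^esub> v) b = c \<otimes>\<^bsub>K\<^esub> co v b" if c: "c \<in> carrier K" and v: "v \<in> carrier M" and b: "b \<in> B" for c v b
  proof (rule coeq[OF M.smult_closed[OF c v] _ _ b])
    show "(\<lambda>b. c \<otimes>\<^bsub>K\<^esub> co v b) \<in> B \<rightarrow> carrier K" using cc v c by simp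
    have "c \<odot>\<^bsub>M\<^esub> M.lincomb (co v) B = (\<Oplus>\<^bsub>M\<^esub>b\<in>B. c \<odot>\<^bsub>M\<^esub> (co v b \<odot>\<^bsub>M\<^esub> b))"
      unfolding lc
      by (rule addmap_finsum[OF M.abelian_group_axioms M.abelian_group_axioms M.addmap_smult[OF c]]) (use cc v BM in auto)
    also have "\<dots> = M.lincomb (\<lambda>b. c \<otimes>\<^bsub>K\<^esub> co v b) B"
      unfolding M.lincomb_def
      by (rule M.finsum_cong'[OF refl]) (use cc v c BM in \<open>auto simp: M.smult_assoc1 subset_iff\<close>)
    finally show "M.lincomb (\<lambda>b. c \<otimes>\<^bsub>K\<^esub> co v b) B = c \<odot>\<^bsub>M\<^esub> v" using co(2)[OF v] by simp
  qed
  have fs: "finsum (with_act M (Module.smult M)) f B = finsum M f B" for f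
    by (simp add: finsum_def finprod_def)
  have "dual_basis (ground K) (with_act M (Module.smult M)) B (\<lambda>b. b) (\<lambda>b v. co v b)"
    unfolding dual_basis_def using B(1) BM cc ad sc co(2)[unfolded lc] by (auto simp: addmap_def fs)
  then show ?thesis by blast
qed

locale kpair = M: graded_space K M + N: graded_space K N
  for K :: "'k ring" and M :: "('k, 'm, 'y) gspace_scheme" and N :: "('k, 'n, 'z) gspace_scheme" +
  assumes field_K: "field K"
begin

lemma gtensor_ground: "gtensor K (ground K) (with_act M (Module.smult M)) (with_act N (Module.smult N))"
  using left_gmod_ground[OF field_K M.graded_space_axioms] left_gmod_ground[OF field_K N.graded_space_axioms]
  by (simp add: gtensor_def)

sublocale tensor_data "carrier K" "Module.smult M" "Module.smult N" M N
  by (simp add: tensor_data_def tensor_data_axioms_def M.abelian_group_axioms N.abelian_group_axioms)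

lemma graded_space_kT: "graded_space K T"
  using gtensor.graded_space_T[OF gtensor_ground] by simp

lemma smult_kT: "\<lbrakk>c \<in> carrier K; m \<in> carrier M; n \<in> carrier N\<rbrakk> \<Longrightarrow> c \<odot>\<^bsub>T\<^esub> tn m n = tn (c \<odot>\<^bsub>M\<^esub> m) n"
  using gtensor.smult_tn[OF gtensor_ground] by simp

lemma addmap_smult_kT: "c \<in> carrier K \<Longrightarrow> addmap T T (Module.smult T c)"
  using gtensor.addmap_smult_T[OF gtensor_ground] by (simp add: addmap_def)

lemma kT_gr: "\<lbrakk>m \<in> gr M i; n \<in> gr N j\<rbrakk> \<Longrightarrow> tn m n \<in> gr T (i + j)"
  using gtensor.tn_gr[OF gtensor_ground, of m i n j "i + j"] by simp

lemma kT_gr_induct [consumes 1, case_names pure add]: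
  assumes "z \<in> gr T d"
    and "\<And>m n i j. \<lbrakk>m \<in> gr M i; n \<in> gr N j; i + j = d\<rbrakk> \<Longrightarrow> Q (tn m n)"
    and "\<And>x y. \<lbrakk>x \<in> gr T d; y \<in> gr T d; Q x; Q y\<rbrakk> \<Longrightarrow> Q (x \<oplus>\<^bsub>T\<^esub> y)"
  shows "Q z"
  using gtensor.gr_T_induct[OF gtensor_ground, of z d Q] assms by simp

lemma kT_graded_mapI:
  assumes "graded_space K W" "addmap T W h"
    and "\<And>m n i j. \<lbrakk>m \<in> gr M i; n \<in> gr N j\<rbrakk> \<Longrightarrow> h (tn m n) \<in> gr W (i + j)"
  shows "graded_map T W h"
  using gtensor.graded_mapI[OF gtensor_ground assms(1), of h] assms(2,3) by simp

text \<open>Commutativity of \<open>K\<close> makes a dual basis over \<open>ground K\<close> also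
  one over its opposite, where \<open>fin_dim_T\<close> expects it.\<close>

lemma fin_dim_kT:
  assumes "vectorspace.fin_dim K M" "vectorspace.fin_dim K N" shows "vectorspace.fin_dim K T"
proof -
  have o: "dual_basis (ground K) (with_act M (Module.smult M)) J p \<phi> \<Longrightarrow>
    dual_basis (opposite (ground K)) (with_act M (Module.smult M)) J p \<phi>" for J :: "'m set" and p \<phi>
  proof -
    interpret K: field K by (rule field_K)
    assume db: "dual_basis (ground K) (with_act M (Module.smult M)) J p \<phi>"
    then show ?thesis
      using dual_basisD(6)[OF db] field_m_comm[OF field_K] by (auto simp: dual_basis_def addmap_def)
  qed
  obtain J :: "'m set" and p \<phi> where "dual_basis (ground K) (with_act M (Module.smult M)) J p \<phi>"
    using fin_dim_dual_basis[OF field_K M.graded_space_axioms assms(1)] by blast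
  from gtensor.fin_dim_T[OF gtensor_ground o[OF this]] 
  have "vectorspace.fin_dim K (with_act N (Module.smult N)) \<Longrightarrow> vectorspace.fin_dim K T" by simp
  moreover have "vectorspace.fin_dim K (with_act N (Module.smult N))"
    by (rule fin_dim_cong[OF N.graded_space_axioms _ _ _ _ _ assms(2)]) simp_all
  ultimately show ?thesis by blast
qed

end

text \<open>The algebra laws of \<open>alg_tensor K A B\<close> are an assumption here. In a tower
  they are supplied by the projectivity axiom, since the module structure in it contains
  them.\<close>

locale mod_pair = A: graded_algebra K A + B: graded_algebra K B + AB: graded_algebra K "alg_tensor K A B" +
  X: left_gmod K A M + Y: left_gmod K B N
  for K :: "'k ring" and A :: "('k, 'a) gspace" and B :: "('k, 'b) gspace"
    and M :: "('k, 'a, 'm) gmod" and N :: "('k, 'b, 'n) gmod"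
begin

lemma field_K: "field K"
  using A.vectorspace_axioms unfolding vectorspace_def by blast

sublocale U: kpair K A B
  by (simp add: kpair_def kpair_axioms_def field_K A.graded_space_axioms B.graded_space_axioms)

sublocale V: kpair K M N
  by (simp add: kpair_def kpair_axioms_def field_K X.M.graded_space_axioms Y.M.graded_space_axioms)

lemma alg_tensor_simps [simp]:
  "carrier (alg_tensor K A B) = carrier U.T" "add (alg_tensor K A B) = add U.T" "\<zero>\<^bsub>alg_tensor K A B\<^esub> = \<zero>\<^bsub>U.T\<^esub>"
  "Module.smult (alg_tensor K A B) = Module.smult U.T" "gr (alg_tensor K A B) = gr U.T"
  "\<one>\<^bsub>alg_tensor K A B\<^esub> = U.tn \<one>\<^bsub>A\<^esub> \<one>\<^bsub>B\<^esub>"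
  by (simp_all add: alg_tensor_def ptensor_eq)

lemma mod_tensor_simps [simp]:
  "carrier (mod_tensor K M N) = carrier V.T" "add (mod_tensor K M N) = add V.T" "\<zero>\<^bsub>mod_tensor K M N\<^esub> = \<zero>\<^bsub>V.T\<^esub>"
  "Module.smult (mod_tensor K M N) = Module.smult V.T" "gr (mod_tensor K M N) = gr V.T"
  by (simp_all add: mod_tensor_def)

lemma action_mod: "tensor_action (carrier K) (Module.smult A) (Module.smult B) A B (carrier K) (Module.smult M) (Module.smult N) M N (act M) (act N)"
proof (intro tensor_action.intro tensor_action_axioms.intro U.tensor_data_axioms V.tensor_data_axioms)
  fix s a b m n assume "s \<in> carrier K" "a \<in> carrier A" "b \<in> carrier B" "m \<in> carrier M" "n \<in> carrier N"
  then show "V.tn (act M (s \<odot>\<^bsub>A\<^esub> a) m) (act N b n) = V.tn (act M a m) (act N (s \<odot>\<^bsub>B\<^esub> b) n)"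
    "V.tn (act M a (s \<odot>\<^bsub>M\<^esub> m)) (act N b n) = V.tn (act M a m) (act N b (s \<odot>\<^bsub>N\<^esub> n))"
    by (simp_all add: X.act_smult_left Y.act_smult_left X.act_smult_right Y.act_smult_right V.tn_balanced X.act_closed Y.act_closed)
qed (simp_all add: X.addmap_act Y.addmap_act X.addmap_act_left Y.addmap_act_left)

interpretation V: tensor_action "carrier K" "Module.smult A" "Module.smult B" A B "carrier K" "Module.smult M" "Module.smult N" M N "act M" "act N"
  by (rule action_mod)

lemma act_mod_tensor: "act (mod_tensor K M N) = tensor_act (ktensor_rels K M N) M N (act M) (act N)"
  by (simp add: mod_tensor_def)

lemma act_pure: "\<lbrakk>a \<in> carrier A; b \<in> carrier B; m \<in> carrier M; n \<in> carrier N\<rbrakk> \<Longrightarrow>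
    act (mod_tensor K M N) (U.tn a b) (V.tn m n) = V.tn (act M a m) (act N b n)"
  unfolding act_mod_tensor by (rule V.action_pure)

lemma act_left: "z \<in> carrier V.T \<Longrightarrow> addmap U.T V.T (\<lambda>x. act (mod_tensor K M N) x z)"
  unfolding act_mod_tensor by (rule V.action_add_left)

lemma act_right: "x \<in> carrier U.T \<Longrightarrow> addmap V.T V.T (act (mod_tensor K M N) x)"
  unfolding act_mod_tensor by (rule V.action_add_right)

end

text \<open>The multiplication of \<open>A \<boxtimes> B\<close> is its action on the external
  tensor product of the two regular modules, so the formula for actions on pure tensors
  applies.\<close>

lemma mult_alg_tensor:
  assumes "graded_algebra K A" "graded_algebra K B" "graded_algebra K (alg_tensor K A B)"
  shows "\<lbrakk>a \<in> carrier A; b \<in> carrier B; a' \<in> carrier A; b' \<in> carrier B\<rbrakk> \<Longrightarrow>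
    pt (carrier K) (Module.smult A) (Module.smult B) A B a b \<otimes>\<^bsub>alg_tensor K A B\<^esub> pt (carrier K) (Module.smult A) (Module.smult B) A B a' b' =
    pt (carrier K) (Module.smult A) (Module.smult B) A B (a \<otimes>\<^bsub>A\<^esub> a') (b \<otimes>\<^bsub>B\<^esub> b')"
proof -
  assume ab: "a \<in> carrier A" "b \<in> carrier B" "a' \<in> carrier A" "b' \<in> carrier B"
  have reg: "left_gmod K R (with_act R (mult R))" if R: "graded_algebra K R" for R
  proof -
    interpret R: graded_algebra K R by fact
    show ?thesis
      by (intro left_gmod.intro left_gmod_axioms.intro R graded_space_cong[OF R.graded_space_axioms])
        (simp_all add: R.l_distr R.r_distr R.m_assoc R.smult_mult_left R.smult_mult_right R.gr_mult)
  qed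
  interpret mod_pair K A B "with_act A (mult A)" "with_act B (mult B)"
    by (intro mod_pair.intro assms reg)
  have "tensor_act (ktensor_rels K A B) A B (mult A) (mult B) = act (mod_tensor K (with_act A (mult A)) (with_act B (mult B)))"
    by (simp add: mod_tensor_def fun_eq_iff tensor_act_def tensor_rels_def)
  then have "mult (alg_tensor K A B) = act (mod_tensor K (with_act A (mult A)) (with_act B (mult B)))"
    by (simp add: alg_tensor_def)
  then show ?thesis using act_pure[of a b a' b'] ab by simp
qed

context mod_pair
begin

lemma mult_pure: "\<lbrakk>a \<in> carrier A; b \<in> carrier B; a' \<in> carrier A; b' \<in> carrier B\<rbrakk> \<Longrightarrow>
    U.tn a b \<otimes>\<^bsub>alg_tensor K A B\<^esub> U.tn a' b' = U.tn (a \<otimes>\<^bsub>A\<^esub> a') (b \<otimes>\<^bsub>B\<^esub> b')"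
  by (rule mult_alg_tensor[OF A.graded_algebra_axioms B.graded_algebra_axioms AB.graded_algebra_axioms])

lemma addmap_mult_left: "y \<in> carrier U.T \<Longrightarrow> addmap U.T U.T (\<lambda>x. x \<otimes>\<^bsub>alg_tensor K A B\<^esub> y)"
  using AB.l_distr AB.m_closed by (auto intro!: addmapI)

lemma addmap_mult_right: "x \<in> carrier U.T \<Longrightarrow> addmap U.T U.T (\<lambda>y. x \<otimes>\<^bsub>alg_tensor K A B\<^esub> y)"
  using AB.r_distr AB.m_closed by (auto intro!: addmapI)

text \<open>The axioms are additive in each variable, so variables are reduced to pure tensors one
  at a time. For associativity, \<open>m1\<close> removes the module variable and \<open>mm\<close>
  then the two algebra variables.\<close>

lemma left_gmod_mod_tensor: "left_gmod K (alg_tensor K A B) (mod_tensor K M N)"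
proof -
  let ?act = "act (mod_tensor K M N)"
  have cl: "?act x z \<in> carrier V.T" if "x \<in> carrier U.T" "z \<in> carrier V.T" for x z
    by (rule addmap_closed[OF act_right[OF that(1)] that(2)])
  have m1: "?act (U.tn a b \<otimes>\<^bsub>alg_tensor K A B\<^esub> U.tn a' b') z = ?act (U.tn a b) (?act (U.tn a' b') z)"
    if "a \<in> carrier A" "b \<in> carrier B" "a' \<in> carrier A" "b' \<in> carrier B" "z \<in> carrier V.T" for a b a' b' z
  proof (rule V.tensor_ext[OF _ _ that(5)])
    show "addmap V.T V.T (?act (U.tn a b \<otimes>\<^bsub>alg_tensor K A B\<^esub> U.tn a' b'))"
      by (rule act_right) (simp add: mult_pure that U.tn_closed)
    show "addmap V.T V.T (\<lambda>z. ?act (U.tn a b) (?act (U.tn a' b') z))"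
      by (rule addmap_comp[OF act_right act_right]) (simp_all add: U.tn_closed that)
  qed (simp add: mult_pure act_pure that X.act_mult Y.act_mult X.act_closed Y.act_closed)
  have mm: "?act (x \<otimes>\<^bsub>alg_tensor K A B\<^esub> y) z = ?act x (?act y z)"
    if "x \<in> carrier U.T" "y \<in> carrier U.T" "z \<in> carrier V.T" for x y z
  proof (rule U.tensor_ext[OF _ _ that(1)])
    show "addmap U.T V.T (\<lambda>x. ?act (x \<otimes>\<^bsub>alg_tensor K A B\<^esub> y) z)"
      by (rule addmap_comp[OF addmap_mult_left[OF that(2)] act_left[OF that(3)]])
    show "addmap U.T V.T (\<lambda>x. ?act x (?act y z))" by (rule act_left[OF cl[OF that(2,3)]])
    fix a b assume ab: "a \<in> carrier A" "b \<in> carrier B"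
    note c = U.tn_closed[OF ab]
    show "?act (U.tn a b \<otimes>\<^bsub>alg_tensor K A B\<^esub> y) z = ?act (U.tn a b) (?act y z)"
      by (rule U.tensor_ext[OF addmap_comp[OF addmap_mult_right[OF c] act_left[OF that(3)]]
            addmap_comp[OF act_left[OF that(3)] act_right[OF c]] that(2)]) (rule m1; simp add: ab that)
  qed
  have one: "?act (U.tn \<one>\<^bsub>A\<^esub> \<one>\<^bsub>B\<^esub>) z = z" if "z \<in> carrier V.T" for z
    by (rule V.tensor_ext[OF act_right addmap_id that]) (simp_all add: act_pure U.tn_closed X.act_one Y.act_one)
  have sl: "?act (c \<odot>\<^bsub>U.T\<^esub> x) z = c \<odot>\<^bsub>V.T\<^esub> ?act x z" "?act x (c \<odot>\<^bsub>V.T\<^esub> z) = c \<odot>\<^bsub>V.T\<^esub> ?act x z"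
    if c: "c \<in> carrier K" and x: "x \<in> carrier U.T" and z: "z \<in> carrier V.T" for c x z
  proof -
    have 1: "?act (c \<odot>\<^bsub>U.T\<^esub> U.tn a b) z = c \<odot>\<^bsub>V.T\<^esub> ?act (U.tn a b) z \<and> ?act (U.tn a b) (c \<odot>\<^bsub>V.T\<^esub> z) = c \<odot>\<^bsub>V.T\<^esub> ?act (U.tn a b) z"
      if ab: "a \<in> carrier A" "b \<in> carrier B" for a b
    proof -
      note r = act_right[OF U.tn_closed[OF ab]]
      have "?act (c \<odot>\<^bsub>U.T\<^esub> U.tn a b) z = c \<odot>\<^bsub>V.T\<^esub> ?act (U.tn a b) z"
        by (rule V.tensor_ext[OF act_right addmap_comp[OF r V.addmap_smult_kT[OF c]] z])
          (simp_all add: U.smult_kT V.smult_kT c ab U.tn_closed act_pure X.act_closed Y.act_closed X.act_smult_left)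
      moreover have "?act (U.tn a b) (c \<odot>\<^bsub>V.T\<^esub> z) = c \<odot>\<^bsub>V.T\<^esub> ?act (U.tn a b) z"
        by (rule V.tensor_ext[OF addmap_comp[OF V.addmap_smult_kT[OF c] r] addmap_comp[OF r V.addmap_smult_kT[OF c]] z])
          (simp_all add: V.smult_kT c ab act_pure X.act_closed Y.act_closed X.act_smult_right)
      ultimately show ?thesis ..
    qed
    have cz: "c \<odot>\<^bsub>V.T\<^esub> z \<in> carrier V.T" by (rule addmap_closed[OF V.addmap_smult_kT[OF c] z])
    show "?act (c \<odot>\<^bsub>U.T\<^esub> x) z = c \<odot>\<^bsub>V.T\<^esub> ?act x z"
      by (rule U.tensor_ext[OF addmap_comp[OF U.addmap_smult_kT[OF c] act_left[OF z]] addmap_comp[OF act_left[OF z] V.addmap_smult_kT[OF c]] x])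
        (simp add: 1)
    show "?act x (c \<odot>\<^bsub>V.T\<^esub> z) = c \<odot>\<^bsub>V.T\<^esub> ?act x z"
      by (rule U.tensor_ext[OF act_left[OF cz] addmap_comp[OF act_left[OF z] V.addmap_smult_kT[OF c]] x])
        (simp add: 1)
  qed
  interpret VT: graded_space K V.T by (rule V.graded_space_kT)
  interpret UT: graded_space K U.T by (rule U.graded_space_kT)
  have gra: "?act x z \<in> gr V.T (i + j)" if x: "x \<in> gr U.T i" and z: "z \<in> gr V.T j" for x z i j
    using x
  proof (induction rule: U.kT_gr_induct)
    case (pure a b i1 i2)
    have ab: "a \<in> carrier A" "b \<in> carrier B" using pure A.gr_carrier B.gr_carrier by auto
    show ?case using z
    proof (induction rule: V.kT_gr_induct)
      case (pure m n j1 j2)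
      have mn: "m \<in> carrier M" "n \<in> carrier N" using pure X.M.gr_carrier Y.M.gr_carrier by auto
      have "V.tn (act M a m) (act N b n) \<in> gr V.T ((i1 + j1) + (i2 + j2))"
        by (rule V.kT_gr[OF X.gr_act[OF \<open>a \<in> gr A i1\<close> pure(1)] Y.gr_act[OF \<open>b \<in> gr B i2\<close> pure(2)]])
      moreover have "(i1 + j1) + (i2 + j2) = i + j" using pure(3) \<open>i1 + i2 = i\<close> by simp
      ultimately show ?case by (simp add: act_pure ab mn)
    next
      case (add x y)
      show ?case using addmap_add[OF act_right[OF U.tn_closed[OF ab]] VT.gr_carrier[OF add(1)] VT.gr_carrier[OF add(2)]]
        VT.gr_add[OF add(3,4)] by simp
    qed
  next
    case (add x y)
    show ?case using addmap_add[OF act_left[OF VT.gr_carrier[OF z]] UT.gr_carrier[OF add(1)] UT.gr_carrier[OF add(2)]]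
      VT.gr_add[OF add(3,4)] by simp
  qed
  have gs: "graded_space K (mod_tensor K M N)"
    by (rule graded_space_cong[OF V.graded_space_kT]) simp_all
  show ?thesis
    by (intro left_gmod.intro left_gmod_axioms.intro AB.graded_algebra_axioms gs)
      (simp_all add: cl mm one sl gra addmap_add[OF act_right] addmap_add[OF act_left])
qed

text \<open>Dual bases multiply. The functional belonging to \<open>(j, j')\<close> is
  \<open>\<phi> j \<otimes> \<phi>' j'\<close>; it exists because each factor is linear over
  \<open>K\<close>, and the expansion is a product of two finite sums.\<close>

lemma mod_tensor_dual_basis:
  assumes M: "graded_dual_basis A M J \<delta> p \<phi>" and N: "graded_dual_basis B N J' \<delta>' p' \<phi>'"
  shows "\<exists>\<Phi>. graded_dual_basis (alg_tensor K A B) (mod_tensor K M N) (J \<times> J') (\<lambda>(j, j'). \<delta> j + \<delta>' j')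
    (\<lambda>(j, j'). V.tn (p j) (p' j')) \<Phi>"
proof -
  have dM: "dual_basis A M J p \<phi>" and dN: "dual_basis B N J' p' \<phi>'" using M N by (simp_all add: graded_dual_basis_def)
  note D = dual_basisD[OF dM] and D' = dual_basisD[OF dN]
  have pg: "p j \<in> gr M (\<delta> j)" "x \<in> gr M d \<Longrightarrow> \<phi> j x \<in> gr A (d - \<delta> j)" if "j \<in> J" for j x d
    using M that by (simp_all add: graded_dual_basis_def)
  have pg': "p' j \<in> gr N (\<delta>' j)" "x \<in> gr N d \<Longrightarrow> \<phi>' j x \<in> gr B (d - \<delta>' j)" if "j \<in> J'" for j x d
    using N that by (simp_all add: graded_dual_basis_def)
  have sm: "\<phi> j (c \<odot>\<^bsub>M\<^esub> x) = c \<odot>\<^bsub>A\<^esub> \<phi> j x" if "j \<in> J" "c \<in> carrier K" "x \<in> carrier M" for j c x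
    using X.smult_act[of c x] D(4)[of j "c \<odot>\<^bsub>A\<^esub> \<one>\<^bsub>A\<^esub>" x] D(6)[of j x] that by (simp add: A.smult_mult_left)
  have sm': "\<phi>' j (c \<odot>\<^bsub>N\<^esub> x) = c \<odot>\<^bsub>B\<^esub> \<phi>' j x" if "j \<in> J'" "c \<in> carrier K" "x \<in> carrier N" for j c x
    using Y.smult_act[of c x] D'(4)[of j "c \<odot>\<^bsub>B\<^esub> \<one>\<^bsub>B\<^esub>" x] D'(6)[of j x] that by (simp add: B.smult_mult_left)
  have "\<exists>h. addmap V.T U.T h \<and> (\<forall>m n. m \<in> carrier M \<longrightarrow> n \<in> carrier N \<longrightarrow> h (V.tn m n) = U.tn (\<phi> j m) (\<phi>' j' n))"
    if j: "j \<in> J" "j' \<in> J'" for j j'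
  proof (rule V.tensor_lift_ex[OF U.abelian_group_T])
    show "addmap M U.T (\<lambda>m. U.tn (\<phi> j m) (\<phi>' j' n))" if "n \<in> carrier N" for n
      by (rule addmap_comp[OF D(3)[OF j(1)] U.addmap_tn_left[OF D'(6)[OF j(2) that]]])
    show "addmap N U.T (\<lambda>n. U.tn (\<phi> j m) (\<phi>' j' n))" if "m \<in> carrier M" for m
      by (rule addmap_comp[OF D'(3)[OF j(2)] U.addmap_tn_right[OF D(6)[OF j(1) that]]])
  qed (simp add: sm sm' j U.tn_balanced D(6) D'(6))
  then obtain h where h: "\<And>j j'. j \<in> J \<Longrightarrow> j' \<in> J' \<Longrightarrow> addmap V.T U.T (h j j')"
    "\<And>j j' m n. j \<in> J \<Longrightarrow> j' \<in> J' \<Longrightarrow> m \<in> carrier M \<Longrightarrow> n \<in> carrier N \<Longrightarrow> h j j' (V.tn m n) = U.tn (\<phi> j m) (\<phi>' j' n)" by metis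
  interpret MN: left_gmod K "alg_tensor K A B" "mod_tensor K M N" by (rule left_gmod_mod_tensor)
  let ?act = "act (mod_tensor K M N)"
  have lin: "h j j' (?act x z) = x \<otimes>\<^bsub>alg_tensor K A B\<^esub> h j j' z"
    if j: "j \<in> J" "j' \<in> J'" and x: "x \<in> carrier U.T" and z: "z \<in> carrier V.T" for j j' x z
  proof (rule U.tensor_ext[OF addmap_comp[OF act_left[OF z] h(1)[OF j]] addmap_mult_left[OF addmap_closed[OF h(1)[OF j] z]] x])
    fix a b assume ab: "a \<in> carrier A" "b \<in> carrier B"
    show "h j j' (?act (U.tn a b) z) = U.tn a b \<otimes>\<^bsub>alg_tensor K A B\<^esub> h j j' z"
      by (rule V.tensor_ext[OF addmap_comp[OF act_right[OF U.tn_closed[OF ab]] h(1)[OF j]]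
            addmap_comp[OF h(1)[OF j] addmap_mult_right[OF U.tn_closed[OF ab]]] z])
        (simp add: act_pure ab h(2)[OF j] X.act_closed Y.act_closed D D' j mult_pure)
  qed
  have fin: "finite (J \<times> J')" using D(1) D'(1) by simp
  have sums: "addmap V.T V.T (\<lambda>z. \<Oplus>\<^bsub>V.T\<^esub>jj\<in>J \<times> J'. ?act (h (fst jj) (snd jj) z) (V.tn (p (fst jj)) (p' (snd jj))))"
    by (rule addmap_finsum_pointwise[OF V.abelian_group_T V.abelian_group_T])
      (rule addmap_comp[OF h(1) act_left[OF V.tn_closed[OF D(2) D'(2)]]]; auto)
  have exp: "(\<Oplus>\<^bsub>V.T\<^esub>jj\<in>J \<times> J'. ?act (h (fst jj) (snd jj) z) (V.tn (p (fst jj)) (p' (snd jj)))) = z"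
    if z: "z \<in> carrier V.T" for z
  proof (rule V.tensor_ext[OF sums addmap_id z])
    fix m n assume m: "m \<in> carrier M" and n: "n \<in> carrier N"
    have e: "?act (h j j' (V.tn m n)) (V.tn (p j) (p' j')) = V.tn (act M (\<phi> j m) (p j)) (act N (\<phi>' j' n) (p' j'))"
      if "j \<in> J" "j' \<in> J'" for j j'
      using that by (simp add: h(2) m n act_pure D D')
    have ca: "act M (\<phi> j m) (p j) \<in> carrier M" if "j \<in> J" for j using that D m by (simp add: X.act_closed)
    have cb: "act N (\<phi>' j n) (p' j) \<in> carrier N" if "j \<in> J'" for j using that D' n by (simp add: Y.act_closed)
    have "(\<Oplus>\<^bsub>V.T\<^esub>jj\<in>J \<times> J'. ?act (h (fst jj) (snd jj) (V.tn m n)) (V.tn (p (fst jj)) (p' (snd jj)))) =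
        (\<Oplus>\<^bsub>V.T\<^esub>x\<in>J \<times> J'. V.tn (act M (\<phi> (fst x) m) (p (fst x))) (act N (\<phi>' (snd x) n) (p' (snd x))))"
      by (rule V.T.finsum_cong'[OF refl]) (use e V.tn_closed[OF ca cb] in auto)
    also have "\<dots> = (\<Oplus>\<^bsub>V.T\<^esub>j\<in>J. \<Oplus>\<^bsub>V.T\<^esub>j'\<in>J'. V.tn (act M (\<phi> j m) (p j)) (act N (\<phi>' j' n) (p' j')))"
      by (rule finsum_Times[OF V.abelian_group_T D(1) D'(1) V.tn_closed[OF ca cb]])
    also have "\<dots> = (\<Oplus>\<^bsub>V.T\<^esub>j\<in>J. V.tn (act M (\<phi> j m) (p j)) n)"
    proof (rule V.T.finsum_cong'[OF refl])
      fix j assume j: "j \<in> J"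
      have "V.tn (act M (\<phi> j m) (p j)) (\<Oplus>\<^bsub>N\<^esub>j'\<in>J'. act N (\<phi>' j' n) (p' j')) =
          (\<Oplus>\<^bsub>V.T\<^esub>j'\<in>J'. V.tn (act M (\<phi> j m) (p j)) (act N (\<phi>' j' n) (p' j')))"
        by (rule V.tn_finsum_right[OF ca[OF j]]) (use cb in blast)
      then show "(\<Oplus>\<^bsub>V.T\<^esub>j'\<in>J'. V.tn (act M (\<phi> j m) (p j)) (act N (\<phi>' j' n) (p' j'))) = V.tn (act M (\<phi> j m) (p j)) n"
        using D'(5)[OF n] by simp
    qed (use V.tn_closed[OF ca n] in blast)
    also have "\<dots> = V.tn (\<Oplus>\<^bsub>M\<^esub>j\<in>J. act M (\<phi> j m) (p j)) n"
      by (rule V.tn_finsum_left[OF n, symmetric]) (use ca in blast)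
    finally show "(\<Oplus>\<^bsub>V.T\<^esub>jj\<in>J \<times> J'. ?act (h (fst jj) (snd jj) (V.tn m n)) (V.tn (p (fst jj)) (p' (snd jj)))) = V.tn m n"
      using D(5)[OF m] by simp
  qed
  interpret UT: graded_space K U.T by (rule U.graded_space_kT)
  have hg: "h j j' z \<in> gr U.T (d - (\<delta> j + \<delta>' j'))" if j: "j \<in> J" "j' \<in> J'" and z: "z \<in> gr V.T d" for j j' z d
    using z
  proof (induction rule: V.kT_gr_induct)
    case (pure m n i i')
    have "U.tn (\<phi> j m) (\<phi>' j' n) \<in> gr U.T ((i - \<delta> j) + (i' - \<delta>' j'))"
      by (rule U.kT_gr[OF pg(2)[OF j(1) pure(1)] pg'(2)[OF j(2) pure(2)]])
    moreover have "(i - \<delta> j) + (i' - \<delta>' j') = d - (\<delta> j + \<delta>' j')" using pure(3) by simp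
    ultimately show ?case using h(2)[OF j X.M.gr_carrier[OF pure(1)] Y.M.gr_carrier[OF pure(2)]] by simp
  next
    case (add x y)
    interpret VT: graded_space K V.T by (rule V.graded_space_kT)
    show ?case using addmap_add[OF h(1)[OF j] VT.gr_carrier[OF add(1)] VT.gr_carrier[OF add(2)]] UT.gr_add[OF add(3,4)] by simp
  qed
  have "graded_dual_basis (alg_tensor K A B) (mod_tensor K M N) (J \<times> J') (\<lambda>(j, j'). \<delta> j + \<delta>' j')
    (\<lambda>(j, j'). V.tn (p j) (p' j')) (\<lambda>(j, j'). h j j')"
    unfolding graded_dual_basis_def dual_basis_def
  proof (intro conjI ballI allI fin)
    fix x assume x: "x \<in> carrier (mod_tensor K M N)"
    have "(\<Oplus>\<^bsub>mod_tensor K M N\<^esub>j\<in>J \<times> J'. ?act ((case j of (j, j') \<Rightarrow> h j j') x) (case j of (j, j') \<Rightarrow> V.tn (p j) (p' j'))) =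
      (\<Oplus>\<^bsub>V.T\<^esub>jj\<in>J \<times> J'. ?act (h (fst jj) (snd jj) x) (V.tn (p (fst jj)) (p' (snd jj))))"
      by (simp add: finsum_def finprod_def case_prod_beta')
    then show "(\<Oplus>\<^bsub>mod_tensor K M N\<^esub>j\<in>J \<times> J'. ?act ((case j of (j, j') \<Rightarrow> h j j') x) (case j of (j, j') \<Rightarrow> V.tn (p j) (p' j'))) = x"
      using exp x by simp
  qed (auto simp: V.tn_closed D D' lin hg V.kT_gr pg pg' h(1) addmap_closed[OF h(1)] addmap_add[OF h(1)] intro!: addmapI)
  then show ?thesis by blast
qed

lemma fg_projective_mod_tensor:
  assumes "fg_projective K A M" "fg_projective K B N"
  shows "fg_projective K (alg_tensor K A B) (mod_tensor K M N)"
proof -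
  obtain n \<delta> p \<phi> where 1: "graded_dual_basis A M {..<n :: nat} \<delta> p \<phi>" using fg_projective_dual_basis[OF assms(1)] by blast
  obtain n' \<delta>' p' \<phi>' where 2: "graded_dual_basis B N {..<n' :: nat} \<delta>' p' \<phi>'" using fg_projective_dual_basis[OF assms(2)] by blast
  show ?thesis using mod_tensor_dual_basis[OF 1 2] fg_projectiveI[OF left_gmod_mod_tensor] by blast
qed

lemma fin_dim_mod_tensor:
  assumes "vectorspace.fin_dim K M" "vectorspace.fin_dim K N"
  shows "vectorspace.fin_dim K (mod_tensor K M N)"
  by (rule fin_dim_cong[OF V.graded_space_kT _ _ _ _ _ V.fin_dim_kT[OF assms]]) simp_all

end


section \<open>Induction and restriction\<close>

lemma right_reg_simps [simp]:
  "carrier (right_reg \<rho> C) = carrier C" "add (right_reg \<rho> C) = add C" "\<zero>\<^bsub>right_reg \<rho> C\<^esub> = \<zero>\<^bsub>C\<^esub>"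
  "Module.smult (right_reg \<rho> C) = Module.smult C" "gr (right_reg \<rho> C) = gr C"
  by (simp_all add: right_reg_def)

lemma act_right_reg: "act (right_reg \<rho> C) b c = c \<otimes>\<^bsub>C\<^esub> \<rho> b"
  by (simp add: right_reg_def)

lemma Res_simps [simp]:
  "carrier (Res \<rho> M) = carrier M" "add (Res \<rho> M) = add M" "\<zero>\<^bsub>Res \<rho> M\<^esub> = \<zero>\<^bsub>M\<^esub>"
  "Module.smult (Res \<rho> M) = Module.smult M" "gr (Res \<rho> M) = gr M"
  by (simp_all add: Res_def)

lemma act_Res: "act (Res \<rho> M) b x = act M (\<rho> b) x"
  by (simp add: Res_def)

lemma twist_simps [simp]:
  "carrier (twist \<psi> P) = carrier P" "add (twist \<psi> P) = add P" "\<zero>\<^bsub>twist \<psi> P\<^esub> = \<zero>\<^bsub>P\<^esub>"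
  "Module.smult (twist \<psi> P) = Module.smult P" "gr (twist \<psi> P) = gr P"
  by (simp_all add: twist_def)

lemma act_twist: "act (twist \<psi> P) a x = act P (\<psi> a) x"
  by (simp add: twist_def)

locale ind_data = C: graded_algebra K C + gtensor K B "right_reg \<rho> C" N
  for K :: "'k ring" and B :: "('k, 'b) gspace" and C :: "('k, 'c) gspace" and \<rho> :: "'b \<Rightarrow> 'c"
    and N :: "('k, 'b, 'n) gmod" +
  assumes rho: "\<rho> \<in> galg_hom K B C"
begin

abbreviation "I \<equiv> Ind \<rho> B C N"

lemma Ind_simps [simp]:
  "carrier I = carrier T" "add I = add T" "\<zero>\<^bsub>I\<^esub> = \<zero>\<^bsub>T\<^esub>" "Module.smult I = Module.smult T" "gr I = gr T"
  by (simp_all add: Ind_def)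

lemma act_Ind: "act I c = tensor_map (tensor_rels (carrier B) (act (right_reg \<rho> C)) (act N) (right_reg \<rho> C) N) (right_reg \<rho> C) N (mult C c) (\<lambda>n. n)"
  by (simp add: Ind_def tensor_map_def fun_eq_iff)

lemma rho_closed: "b \<in> carrier B \<Longrightarrow> \<rho> b \<in> carrier C"
  by (rule galg_homD(1)[OF rho])

lemma tn_c: "c \<in> carrier C \<Longrightarrow> n \<in> carrier N \<Longrightarrow> tn c n \<in> carrier T"
  by (rule tn_closed) simp_all

lemma tn_bal: "b \<in> carrier B \<Longrightarrow> c \<in> carrier C \<Longrightarrow> n \<in> carrier N \<Longrightarrow> tn (c \<otimes>\<^bsub>C\<^esub> \<rho> b) n = tn c (act N b n)"
  using tn_balanced[of b c n] by (simp add: act_right_reg)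

lemma addmap_mult: "c \<in> carrier C \<Longrightarrow> addmap (right_reg \<rho> C) (right_reg \<rho> C) (mult C c)"
  by (rule addmapI) (simp_all add: C.r_distr)

text \<open>Left multiplication on the first factor respects balancing because it commutes with
  right multiplication by \<open>\<rho> b\<close>.\<close>

lemma act_Ind_right: "c \<in> carrier C \<Longrightarrow> addmap T T (act I c)"
  and act_Ind_pure: "\<lbrakk>c \<in> carrier C; c' \<in> carrier C; n \<in> carrier N\<rbrakk> \<Longrightarrow> act I c (tn c' n) = tn (c \<otimes>\<^bsub>C\<^esub> c') n"
proof -
  assume c: "c \<in> carrier C"
  have bal: "tn (c \<otimes>\<^bsub>C\<^esub> act (right_reg \<rho> C) b c') n = tn (c \<otimes>\<^bsub>C\<^esub> c') (act N b n)"
    if "b \<in> carrier B" "c' \<in> carrier (right_reg \<rho> C)" "n \<in> carrier N" for b c' n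
    using that c tn_bal[of b "c \<otimes>\<^bsub>C\<^esub> c'" n] by (simp add: act_right_reg C.m_assoc rho_closed)
  note map = tensor_map[of "mult C c" "\<lambda>n. n", OF addmap_mult[OF c] addmap_id]
  show "addmap T T (act I c)" unfolding act_Ind by (rule map(1)[OF bal])
  show "act I c (tn c' n) = tn (c \<otimes>\<^bsub>C\<^esub> c') n" if "c' \<in> carrier C" "n \<in> carrier N"
    unfolding act_Ind by (rule map(2)[OF bal]) (use that in simp_all)
qed

lemma act_Ind_left: assumes z: "z \<in> carrier T" shows "addmap C T (\<lambda>c. act I c z)"
proof (rule addmapI)
  fix c assume "c \<in> carrier C" then show "act I c z \<in> carrier T" by (rule addmap_closed[OF act_Ind_right z])
next
  fix c d assume c: "c \<in> carrier C" and d: "d \<in> carrier C"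
  show "act I (c \<oplus>\<^bsub>C\<^esub> d) z = act I c z \<oplus>\<^bsub>T\<^esub> act I d z"
  proof (rule tensor_ext[OF act_Ind_right addmap_plus[OF abelian_group_T act_Ind_right[OF c] act_Ind_right[OF d]] z])
    show "c \<oplus>\<^bsub>C\<^esub> d \<in> carrier C" using c d by simp
    fix c' n assume cn: "c' \<in> carrier (right_reg \<rho> C)" "n \<in> carrier N"
    then show "act I (c \<oplus>\<^bsub>C\<^esub> d) (tn c' n) = act I c (tn c' n) \<oplus>\<^bsub>T\<^esub> act I d (tn c' n)"
      using tn_add_left[of "c \<otimes>\<^bsub>C\<^esub> c'" "d \<otimes>\<^bsub>C\<^esub> c'" n] c d by (simp add: act_Ind_pure C.l_distr)
  qed
qed

lemma smult_tn': "\<lbrakk>k \<in> carrier K; c \<in> carrier C; n \<in> carrier N\<rbrakk> \<Longrightarrow> k \<odot>\<^bsub>T\<^esub> tn c n = tn (k \<odot>\<^bsub>C\<^esub> c) n"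
  using smult_tn[of k c n] by simp

lemma left_gmod_Ind: "left_gmod K C I"
proof -
  interpret TG: graded_space K T by (rule graded_space_T)
  have gs: "graded_space K I" by (rule graded_space_cong[OF graded_space_T]) simp_all
  note cl = addmap_closed[OF act_Ind_right]
  have mm: "act I (c \<otimes>\<^bsub>C\<^esub> d) z = act I c (act I d z)" if "c \<in> carrier C" "d \<in> carrier C" "z \<in> carrier T" for c d z
    by (rule tensor_ext[OF act_Ind_right addmap_comp[OF act_Ind_right act_Ind_right] that(3)])
      (use that in \<open>simp_all add: act_Ind_pure C.m_assoc\<close>)
  have one: "act I \<one>\<^bsub>C\<^esub> z = z" if "z \<in> carrier T" for z
    by (rule tensor_ext[OF act_Ind_right addmap_id that]) (simp_all add: act_Ind_pure)
  have sl: "act I (k \<odot>\<^bsub>C\<^esub> c) z = k \<odot>\<^bsub>T\<^esub> act I c z" "act I c (k \<odot>\<^bsub>T\<^esub> z) = k \<odot>\<^bsub>T\<^esub> act I c z"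
    if k: "k \<in> carrier K" and c: "c \<in> carrier C" and z: "z \<in> carrier T" for k c z
  proof -
    show "act I (k \<odot>\<^bsub>C\<^esub> c) z = k \<odot>\<^bsub>T\<^esub> act I c z"
      by (rule tensor_ext[OF act_Ind_right addmap_comp[OF act_Ind_right[OF c] addmap_smult_T[OF k]] z])
        (use k c in \<open>simp_all add: act_Ind_pure smult_tn' C.smult_mult_left\<close>)
    show "act I c (k \<odot>\<^bsub>T\<^esub> z) = k \<odot>\<^bsub>T\<^esub> act I c z"
      by (rule tensor_ext[OF addmap_comp[OF addmap_smult_T[OF k] act_Ind_right[OF c]] addmap_comp[OF act_Ind_right[OF c] addmap_smult_T[OF k]] z])
        (use k c in \<open>simp_all add: act_Ind_pure smult_tn' C.smult_mult_right\<close>)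
  qed
  have gra: "act I c z \<in> gr T (i + j)" if c: "c \<in> gr C i" and z: "z \<in> gr T j" for c z i j
    using z
  proof (induction rule: gr_T_induct)
    case (pure c' n j1 j2)
    then have cn: "c' \<in> gr C j1" "n \<in> gr N j2" by simp_all
    have "tn (c \<otimes>\<^bsub>C\<^esub> c') n \<in> gr T (i + j)"
      by (rule tn_gr[OF _ cn(2), of _ "i + j1"]) (use C.gr_mult[OF c cn(1)] pure(3) in simp_all)
    then show ?case using act_Ind_pure[OF C.gr_carrier[OF c] C.gr_carrier[OF cn(1)] R.M.gr_carrier[OF cn(2)]] by simp
  next
    case (add x y)
    show ?case
      using addmap_add[OF act_Ind_right[OF C.gr_carrier[OF c]] gr_T_carrier[OF add(1)] gr_T_carrier[OF add(2)]] gr_T_add[OF add(3,4)]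
      by simp
  qed
  show ?thesis
    by (intro left_gmod.intro left_gmod_axioms.intro C.graded_algebra_axioms gs)
      (simp_all add: cl mm one sl gra addmap_add[OF act_Ind_right] addmap_add[OF act_Ind_left])
qed

text \<open>The generators become \<open>1 \<otimes> p j\<close>, of unchanged degree, with
  functionals \<open>c \<otimes> n \<mapsto> c \<rho> (\<phi> j n)\<close>. Moving
  \<open>\<rho> (\<phi> j n)\<close> across the tensor sign recovers
  \<open>c \<otimes> n\<close>.\<close>

lemma Ind_dual_basis:
  assumes db: "graded_dual_basis B N J \<delta> p \<phi>"
  shows "\<exists>\<Phi>. graded_dual_basis C I J \<delta> (\<lambda>j. tn \<one>\<^bsub>C\<^esub> (p j)) \<Phi>"
proof -
  have d: "dual_basis B N J p \<phi>" using db by (simp add: graded_dual_basis_def)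
  note D = dual_basisD[OF d]
  note h = galg_homD[OF rho]
  have lm: "addmap C C (\<lambda>c. c \<otimes>\<^bsub>C\<^esub> d)" "addmap C C (\<lambda>c. d \<otimes>\<^bsub>C\<^esub> c)" if "d \<in> carrier C" for d
    using that by (auto intro!: addmapI simp: C.l_distr C.r_distr)
  have "\<exists>g. addmap T C g \<and> (\<forall>c n. c \<in> carrier (right_reg \<rho> C) \<longrightarrow> n \<in> carrier N \<longrightarrow> g (tn c n) = c \<otimes>\<^bsub>C\<^esub> \<rho> (\<phi> j n))" if j: "j \<in> J" for j
  proof (rule lift_ex[OF C.abelian_group_axioms])
    show "addmap (right_reg \<rho> C) C (\<lambda>c. c \<otimes>\<^bsub>C\<^esub> \<rho> (\<phi> j n))" if "n \<in> carrier N" for n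
      using lm(1)[OF h(1)[OF D(6)[OF j that]]] by (simp add: addmap_def)
    show "addmap N C (\<lambda>n. c \<otimes>\<^bsub>C\<^esub> \<rho> (\<phi> j n))" if "c \<in> carrier (right_reg \<rho> C)" for c
      by (rule addmap_comp[OF addmap_comp[OF D(3)[OF j] h(7)] lm(2)]) (use that in simp)
  qed (use j in \<open>simp add: act_right_reg D h C.m_assoc\<close>)
  then obtain g where g: "\<And>j. j \<in> J \<Longrightarrow> addmap T C (g j)"
    "\<And>j c n. j \<in> J \<Longrightarrow> c \<in> carrier C \<Longrightarrow> n \<in> carrier N \<Longrightarrow> g j (tn c n) = c \<otimes>\<^bsub>C\<^esub> \<rho> (\<phi> j n)"
    unfolding right_reg_simps by metis
  have one: "tn \<one>\<^bsub>C\<^esub> (p j) \<in> carrier T" if "j \<in> J" for j using that by (intro tn_c C.one_closed D(2))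
  have lin: "g j (act I a z) = a \<otimes>\<^bsub>C\<^esub> g j z" if j: "j \<in> J" and a: "a \<in> carrier C" and z: "z \<in> carrier T" for j a z
    by (rule tensor_ext[OF addmap_comp[OF act_Ind_right[OF a] g(1)[OF j]] addmap_comp[OF g(1)[OF j] lm(2)[OF a]] z])
      (use a j in \<open>simp add: act_Ind_pure g(2) C.m_assoc h(1) D(6)\<close>)
  have sums: "addmap T T (\<lambda>z. \<Oplus>\<^bsub>T\<^esub>j\<in>J. act I (g j z) (tn \<one>\<^bsub>C\<^esub> (p j)))"
    by (rule addmap_finsum_pointwise[OF abelian_group_T abelian_group_T])
      (rule addmap_comp[OF g(1) act_Ind_left[OF one]])
  have exp: "(\<Oplus>\<^bsub>T\<^esub>j\<in>J. act I (g j z) (tn \<one>\<^bsub>C\<^esub> (p j))) = z" if z: "z \<in> carrier T" for z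
  proof (rule tensor_ext[OF sums addmap_id z])
    fix c n assume c': "c \<in> carrier (right_reg \<rho> C)" and n: "n \<in> carrier N"
    then have c: "c \<in> carrier C" by simp
    have an: "act N (\<phi> j n) (p j) \<in> carrier N" if "j \<in> J" for j using that D n by (simp add: R.act_closed)
    have e: "act I (g j (tn c n)) (tn \<one>\<^bsub>C\<^esub> (p j)) = tn c (act N (\<phi> j n) (p j))" if "j \<in> J" for j
      using that c n tn_bal[of "\<phi> j n" c "p j"] by (simp add: g(2) act_Ind_pure D h(1))
    have "(\<Oplus>\<^bsub>T\<^esub>j\<in>J. act I (g j (tn c n)) (tn \<one>\<^bsub>C\<^esub> (p j))) = (\<Oplus>\<^bsub>T\<^esub>j\<in>J. tn c (act N (\<phi> j n) (p j)))"
      by (rule T.finsum_cong'[OF refl]) (use e tn_c[OF c an] in auto)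
    also have "\<dots> = tn c (\<Oplus>\<^bsub>N\<^esub>j\<in>J. act N (\<phi> j n) (p j))"
      by (rule tn_finsum_right[OF c', symmetric]) (use an in blast)
    finally show "(\<Oplus>\<^bsub>T\<^esub>j\<in>J. act I (g j (tn c n)) (tn \<one>\<^bsub>C\<^esub> (p j))) = tn c n" using D(5)[OF n] by simp
  qed
  have pg: "p j \<in> gr N (\<delta> j)" "x \<in> gr N d \<Longrightarrow> \<phi> j x \<in> gr B (d - \<delta> j)" if "j \<in> J" for j x d
    using db that by (simp_all add: graded_dual_basis_def)
  have gg: "g j z \<in> gr C (d - \<delta> j)" if j: "j \<in> J" and z: "z \<in> gr T d" for j z d
    using z
  proof (induction rule: gr_T_induct)
    case (pure c n i i')
    then have cn: "c \<in> gr C i" "n \<in> gr N i'" by simp_all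
    have "c \<otimes>\<^bsub>C\<^esub> \<rho> (\<phi> j n) \<in> gr C (i + (i' - \<delta> j))"
      by (rule C.gr_mult[OF cn(1) h(6)[OF pg(2)[OF j cn(2)]]])
    moreover have "i + (i' - \<delta> j) = d - \<delta> j" using pure(3) by simp
    ultimately show ?case using g(2)[OF j C.gr_carrier[OF cn(1)] R.M.gr_carrier[OF cn(2)]] by simp
  next
    case (add x y)
    show ?case using addmap_add[OF g(1)[OF j] gr_T_carrier[OF add(1)] gr_T_carrier[OF add(2)]] C.gr_add[OF add(3,4)] by simp
  qed
  have og: "tn \<one>\<^bsub>C\<^esub> (p j) \<in> gr T (\<delta> j)" if "j \<in> J" for j
    by (rule tn_gr[of _ 0 _ "\<delta> j"]) (use C.gr_one pg(1)[OF that] in simp_all)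
  have fs: "finsum I f J = finsum T f J" for f by (simp add: finsum_def finprod_def)
  have "graded_dual_basis C I J \<delta> (\<lambda>j. tn \<one>\<^bsub>C\<^esub> (p j)) g"
    unfolding graded_dual_basis_def dual_basis_def
  proof (intro conjI ballI allI D(1))
    show "addmap I C (g j)" if "j \<in> J" for j using g(1)[OF that] by (simp add: addmap_def)
  qed (simp_all add: one lin exp fs og gg)
  then show ?thesis by blast
qed

lemma fg_projective_Ind: assumes "fg_projective K B N" shows "fg_projective K C I"
proof -
  obtain n \<delta> p \<phi> where "graded_dual_basis B N {..<n :: nat} \<delta> p \<phi>" using fg_projective_dual_basis[OF assms] by blast
  from Ind_dual_basis[OF this] show ?thesis using fg_projectiveI[OF left_gmod_Ind] by blast
qed

lemma fin_dim_Ind: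
  assumes "dual_basis (opposite B) (right_reg \<rho> C) J p \<phi>" "vectorspace.fin_dim K N"
  shows "vectorspace.fin_dim K I"
  by (rule fin_dim_cong[OF graded_space_T _ _ _ _ _ fin_dim_T[OF assms]]) simp_all

end

lemma Ind_functor:
  assumes I: "ind_data K B C \<rho> N" "ind_data K B C \<rho> N'" and g: "g \<in> gmod_hom K B N N'"
  shows "\<exists>F \<in> gmod_hom K C (Ind \<rho> B C N) (Ind \<rho> B C N'). \<forall>c n. c \<in> carrier C \<longrightarrow> n \<in> carrier N \<longrightarrow>
    F (pt (carrier B) (act (right_reg \<rho> C)) (act N) (right_reg \<rho> C) N c n) =
    pt (carrier B) (act (right_reg \<rho> C)) (act N') (right_reg \<rho> C) N' c (g n)"
proof -
  interpret I: ind_data K B C \<rho> N by fact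
  interpret I': ind_data K B C \<rho> N' by fact
  have gl: "alin B N N' g" and gg: "graded_map N N' g" using g by (simp_all add: gmod_hom_iff)
  obtain F where F: "addmap I.T I'.T F" "F \<in> module_hom K I.T I'.T"
    "\<And>c n. c \<in> carrier C \<Longrightarrow> n \<in> carrier N \<Longrightarrow> F (I.tn c n) = I'.tn c (g n)" "graded_map I.T I'.T F"
    using tensor_functor[OF I.gtensor_axioms I'.gtensor_axioms alin_id gl] graded_map_id gg unfolding right_reg_simps by blast
  note gc = addmap_closed[OF alin_addmap[OF gl]]
  have "F (act I.I a z) = act I'.I a (F z)" if a: "a \<in> carrier C" and z: "z \<in> carrier I.T" for a z
    by (rule I.tensor_ext[OF addmap_comp[OF I.act_Ind_right[OF a] F(1)] addmap_comp[OF F(1) I'.act_Ind_right[OF a]] z])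
      (use a in \<open>simp add: I.act_Ind_pure I'.act_Ind_pure F(3) gc\<close>)
  then have "F \<in> gmod_hom K C I.I I'.I"
    using F by (auto simp: gmod_hom_iff module_hom_iff alin_def addmap_def graded_map_def)
  then show ?thesis using F(3) by blast
qed

text \<open>The dual basis belongs to \<open>C\<close> as a right module over \<open>B\<close>; it
  makes tensoring with \<open>C\<close> exact, and the induced maps are linear over \<open>C\<close>
  by \<open>Ind_functor\<close>.\<close>

lemma short_exact_Ind:
  assumes I: "ind_data K B C \<rho> N'" "ind_data K B C \<rho> N" "ind_data K B C \<rho> N''"
    and db: "dual_basis (opposite B) (right_reg \<rho> C) J p \<phi>" and ex: "short_exact K B N' N N''"
  shows "short_exact K C (Ind \<rho> B C N') (Ind \<rho> B C N) (Ind \<rho> B C N'')"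
proof -
  interpret I': ind_data K B C \<rho> N' by fact
  interpret I: ind_data K B C \<rho> N by fact
  interpret I'': ind_data K B C \<rho> N'' by fact
  obtain f g where f: "f \<in> gmod_hom K B N' N" and g: "g \<in> gmod_hom K B N N''" and ex': "exact_seq N' N N'' f g"
    using ex unfolding short_exact_iff by blast
  obtain F where F: "F \<in> gmod_hom K C I'.I I.I" "\<And>c n. c \<in> carrier C \<Longrightarrow> n \<in> carrier N' \<Longrightarrow> F (I'.tn c n) = I.tn c (f n)"
    using Ind_functor[OF I(1,2) f] by blast
  obtain H where H: "H \<in> gmod_hom K C I.I I''.I" "\<And>c n. c \<in> carrier C \<Longrightarrow> n \<in> carrier N \<Longrightarrow> H (I.tn c n) = I''.tn c (g n)"
    using Ind_functor[OF I(2,3) g] by blast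
  have "exact_seq I'.T I.T I''.T F H"
  proof (rule tensor_exact_right[OF I'.gtensor_axioms I.gtensor_axioms I''.gtensor_axioms db _ _ ex'])
    show "alin B N' N f" "alin B N N'' g" using f g by (simp_all add: gmod_hom_iff)
    show "addmap I'.T I.T F" "addmap I.T I''.T H" using F(1) H(1) by (simp_all add: gmod_hom_iff module_hom_iff addmap_def)
  qed (simp_all add: F(2) H(2))
  then have "exact_seq I'.I I.I I''.I F H" by (simp add: exact_seq_def)
  then show ?thesis unfolding short_exact_iff using F(1) H(1) by blast
qed

text \<open>A splitting over the field only. This is all that an external tensor product requires,
  and it leaves room for sections that ignore the algebra and the grading.\<close>

definition ksplit :: "'k ring \<Rightarrow> ('k, 'u, 'x) gspace_scheme \<Rightarrow> ('k, 'v, 'y) gspace_scheme \<Rightarrow> ('k, 'w, 'z) gspace_scheme \<Rightarrow>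
    ('u \<Rightarrow> 'v) \<Rightarrow> ('v \<Rightarrow> 'w) \<Rightarrow> bool" where
  "ksplit K M' M M'' f g \<longleftrightarrow> (\<exists>s \<in> module_hom K M M'. \<exists>t \<in> module_hom K M'' M.
     (\<forall>x \<in> carrier M'. s (f x) = x) \<and> (\<forall>y \<in> carrier M''. g (t y) = y) \<and>
     (\<forall>x \<in> carrier M'. g (f x) = \<zero>\<^bsub>M''\<^esub>) \<and> (\<forall>x \<in> carrier M. f (s x) \<oplus>\<^bsub>M\<^esub> t (g x) = x))"

text \<open>Projective modules may be infinite-dimensional, so the splitting comes from
  \<open>projective_split\<close>; it is linear over \<open>A\<close> and therefore over
  \<open>K\<close>.\<close>

lemma ksplit_projective:
  assumes M: "left_gmod K A M'" "left_gmod K A M" "fg_projective K A M''"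
    and f: "f \<in> gmod_hom K A M' M" and g: "g \<in> gmod_hom K A M M''" and ex: "exact_seq M' M M'' f g"
  shows "ksplit K M' M M'' f g"
proof -
  have M'': "left_gmod K A M''" by (rule fg_projective_left_gmod[OF M(3)])
  obtain n \<delta> p \<phi> where "graded_dual_basis A M'' {..<n :: nat} \<delta> p \<phi>" using fg_projective_dual_basis[OF M(3)] by blast
  then have db: "dual_basis A M'' {..<n} p \<phi>" by (simp add: graded_dual_basis_def)
  have fl: "alin A M' M f" "alin A M M'' g" using f g by (simp_all add: gmod_hom_iff)
  obtain s t where st: "alin A M M' s" "alin A M'' M t" "\<forall>x \<in> carrier M'. s (f x) = x" "\<forall>y \<in> carrier M''. g (t y) = y"
    "\<forall>x \<in> carrier M'. g (f x) = \<zero>\<^bsub>M''\<^esub>" "\<forall>x \<in> carrier M. f (s x) \<oplus>\<^bsub>M\<^esub> t (g x) = x"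
    using projective_split[OF M(1,2) M'' db fl ex] by blast
  have "s \<in> module_hom K M M'" "t \<in> module_hom K M'' M"
    using alin_smult[OF M(2,1) st(1)] alin_smult[OF M'' M(2) st(2)] alin_addmap st(1,2) by (auto simp: module_hom_iff)
  then show ?thesis unfolding ksplit_def using st by blast
qed

text \<open>Over the field the quotient has a dual basis, and \<open>projective_split\<close>
  applies with the algebra \<open>ground K\<close>.\<close>

lemma ksplit_fin_dim:
  fixes M'' :: "('k, 'w, 'z) gspace_scheme"
  assumes K: "field K" and M: "graded_space K M'" "graded_space K M" "graded_space K M''" and fin: "vectorspace.fin_dim K M''"
    and f: "f \<in> module_hom K M' M" and g: "g \<in> module_hom K M M''" and ex: "exact_seq M' M M'' f g"
  shows "ksplit K M' M M'' f g"
proof -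
  obtain J :: "'w set" and p \<phi> where db: "dual_basis (ground K) (with_act M'' (Module.smult M'')) J p \<phi>"
    using fin_dim_dual_basis[OF K M(3) fin] by blast
  have ex': "exact_seq (with_act M' (Module.smult M')) (with_act M (Module.smult M)) (with_act M'' (Module.smult M'')) f g"
    using ex by (simp add: exact_seq_def)
  obtain s t where st: "s \<in> module_hom K M M'" "t \<in> module_hom K M'' M"
    "\<forall>x \<in> carrier M'. s (f x) = x" "\<forall>y \<in> carrier M''. g (t y) = y"
    "\<forall>x \<in> carrier M'. g (f x) = \<zero>\<^bsub>M''\<^esub>" "\<forall>x \<in> carrier M. f (s x) \<oplus>\<^bsub>M\<^esub> t (g x) = x"
    using projective_split[OF left_gmod_ground(1)[OF K M(1)] left_gmod_ground(1)[OF K M(2)] left_gmod_ground(1)[OF K M(3)]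
      db alin_ground[THEN iffD2, OF f] alin_ground[THEN iffD2, OF g] ex'] unfolding alin_ground with_act_simps by blast
  then show ?thesis unfolding ksplit_def by blast
qed

lemma kT_functor:
  assumes G: "kpair K M N" "kpair K M' N'" and f: "f \<in> module_hom K M M'" and g: "g \<in> module_hom K N N'"
  shows "\<exists>F. addmap (ktensor K M N) (ktensor K M' N') F \<and> F \<in> module_hom K (ktensor K M N) (ktensor K M' N') \<and>
    (\<forall>m n. m \<in> carrier M \<longrightarrow> n \<in> carrier N \<longrightarrow>
      F (pt (carrier K) (Module.smult M) (Module.smult N) M N m n) = pt (carrier K) (Module.smult M') (Module.smult N') M' N' (f m) (g n)) \<and>
    (graded_map M M' f \<longrightarrow> graded_map N N' g \<longrightarrow> graded_map (ktensor K M N) (ktensor K M' N') F)"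
proof -
  have fl: "alin (opposite (ground K)) (with_act M (Module.smult M)) (with_act M' (Module.smult M')) f"
    unfolding alin_opposite alin_ground by (rule f)
  have gl: "alin (ground K) (with_act N (Module.smult N)) (with_act N' (Module.smult N')) g"
    unfolding alin_ground by (rule g)
  have gm: "graded_map (with_act M f') (with_act M' g') = graded_map M M'" for M M' f' g'
    by (simp add: graded_map_def fun_eq_iff)
  show ?thesis
    using tensor_functor[OF kpair.gtensor_ground[OF G(1)] kpair.gtensor_ground[OF G(2)] fl gl]
    by (simp only: tensor_with_act pt_with_act with_act_simps ground_simps gm)
qed

text \<open>The map and its degrees come from the tensor product over \<open>K\<close>; linearity
  over \<open>A \<boxtimes> B\<close> is then an identity on pure tensors.\<close>

lemma mod_tensor_functor:
  assumes P: "mod_pair K A B M N" "mod_pair K A B M' N'" and f: "f \<in> gmod_hom K A M M'" and g: "g \<in> gmod_hom K B N N'"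
  shows "\<exists>F \<in> gmod_hom K (alg_tensor K A B) (mod_tensor K M N) (mod_tensor K M' N').
    \<forall>m n. m \<in> carrier M \<longrightarrow> n \<in> carrier N \<longrightarrow>
      F (pt (carrier K) (Module.smult M) (Module.smult N) M N m n) = pt (carrier K) (Module.smult M') (Module.smult N') M' N' (f m) (g n)"
proof -
  interpret P: mod_pair K A B M N by fact
  interpret P': mod_pair K A B M' N' by fact
  have fh: "f \<in> module_hom K M M'" "graded_map M M' f" "alin A M M' f" and gh: "g \<in> module_hom K N N'" "graded_map N N' g" "alin B N N' g"
    using f g by (simp_all add: gmod_hom_iff)
  obtain F where F: "addmap P.V.T P'.V.T F" "F \<in> module_hom K P.V.T P'.V.T"
    "\<And>m n. m \<in> carrier M \<Longrightarrow> n \<in> carrier N \<Longrightarrow> F (P.V.tn m n) = P'.V.tn (f m) (g n)" "graded_map P.V.T P'.V.T F"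
    using kT_functor[OF P.V.kpair_axioms P'.V.kpair_axioms fh(1) gh(1)] fh(2) gh(2) by blast
  note fc = addmap_closed[OF alin_addmap[OF fh(3)]] and gc = addmap_closed[OF alin_addmap[OF gh(3)]]
  have "F (act (mod_tensor K M N) x z) = act (mod_tensor K M' N') x (F z)" if x: "x \<in> carrier P.U.T" and z: "z \<in> carrier P.V.T" for x z
  proof (rule P.U.tensor_ext[OF addmap_comp[OF P.act_left[OF z] F(1)] P'.act_left[OF addmap_closed[OF F(1) z]] x])
    fix a b assume ab: "a \<in> carrier A" "b \<in> carrier B"
    show "F (act (mod_tensor K M N) (P.U.tn a b) z) = act (mod_tensor K M' N') (P.U.tn a b) (F z)"
      by (rule P.V.tensor_ext[OF addmap_comp[OF P.act_right[OF P.U.tn_closed[OF ab]] F(1)] addmap_comp[OF F(1) P'.act_right[OF P.U.tn_closed[OF ab]]] z])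
        (simp add: P.act_pure P'.act_pure ab F(3) fc gc P.X.act_closed P.Y.act_closed alin_act[OF fh(3)] alin_act[OF gh(3)])
  qed
  then have "F \<in> gmod_hom K (alg_tensor K A B) (mod_tensor K M N) (mod_tensor K M' N')"
    using F by (auto simp: gmod_hom_iff module_hom_iff alin_def addmap_def graded_map_def)
  then show ?thesis using F(3) by blast
qed

lemma module_hom_id: "(\<lambda>x. x) \<in> module_hom K M M" by (simp add: module_hom_def)

lemma gmod_hom_id: "(\<lambda>x. x) \<in> gmod_hom K A M M" by (auto simp: gmod_hom_def module_hom_def)

text \<open>Only the maps \<open>F\<close> and \<open>H\<close> of the sequence have to be graded
  and linear over \<open>A \<boxtimes> B\<close>. The tensored splittings \<open>S\<close> and
  \<open>R\<close> serve as additive maps that witness exactness.\<close>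

lemma short_exact_mod_tensor_left:
  assumes P: "mod_pair K A B M' N" "mod_pair K A B M N" "mod_pair K A B M'' N"
    and f: "f \<in> gmod_hom K A M' M" and g: "g \<in> gmod_hom K A M M''" and sp: "ksplit K M' M M'' f g"
  shows "short_exact K (alg_tensor K A B) (mod_tensor K M' N) (mod_tensor K M N) (mod_tensor K M'' N)"
proof -
  interpret P': mod_pair K A B M' N by fact
  interpret P: mod_pair K A B M N by fact
  interpret P'': mod_pair K A B M'' N by fact
  obtain s t where st: "s \<in> module_hom K M M'" "t \<in> module_hom K M'' M" "\<And>x. x \<in> carrier M' \<Longrightarrow> s (f x) = x"
    "\<And>y. y \<in> carrier M'' \<Longrightarrow> g (t y) = y" "\<And>x. x \<in> carrier M' \<Longrightarrow> g (f x) = \<zero>\<^bsub>M''\<^esub>" "\<And>x. x \<in> carrier M \<Longrightarrow> f (s x) \<oplus>\<^bsub>M\<^esub> t (g x) = x"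
    using sp unfolding ksplit_def by blast
  obtain F where F: "F \<in> gmod_hom K (alg_tensor K A B) (mod_tensor K M' N) (mod_tensor K M N)"
    "\<And>m n. m \<in> carrier M' \<Longrightarrow> n \<in> carrier N \<Longrightarrow> F (P'.V.tn m n) = P.V.tn (f m) n"
    using mod_tensor_functor[OF P(1,2) f gmod_hom_id] by blast
  obtain H where H: "H \<in> gmod_hom K (alg_tensor K A B) (mod_tensor K M N) (mod_tensor K M'' N)"
    "\<And>m n. m \<in> carrier M \<Longrightarrow> n \<in> carrier N \<Longrightarrow> H (P.V.tn m n) = P''.V.tn (g m) n"
    using mod_tensor_functor[OF P(2,3) g gmod_hom_id] by blast
  obtain S where S: "addmap P.V.T P'.V.T S" "\<And>m n. m \<in> carrier M \<Longrightarrow> n \<in> carrier N \<Longrightarrow> S (P.V.tn m n) = P'.V.tn (s m) n"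
    using kT_functor[OF P.V.kpair_axioms P'.V.kpair_axioms st(1) module_hom_id] by blast
  obtain R where R: "addmap P''.V.T P.V.T R" "\<And>m n. m \<in> carrier M'' \<Longrightarrow> n \<in> carrier N \<Longrightarrow> R (P''.V.tn m n) = P.V.tn (t m) n"
    using kT_functor[OF P''.V.kpair_axioms P.V.kpair_axioms st(2) module_hom_id] by blast
  have Fa: "addmap P'.V.T P.V.T F" and Ha: "addmap P.V.T P''.V.T H"
    using F(1) H(1) by (simp_all add: gmod_hom_iff module_hom_iff addmap_def)
  have cl: "x \<in> carrier M' \<Longrightarrow> f x \<in> carrier M" "y \<in> carrier M \<Longrightarrow> g y \<in> carrier M''" "y \<in> carrier M \<Longrightarrow> s y \<in> carrier M'"
    "z \<in> carrier M'' \<Longrightarrow> t z \<in> carrier M" for x y z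
    using f g st(1,2) by (auto simp: gmod_hom_iff module_hom_iff addmap_def)
  have z0: "addmap P'.V.T P''.V.T (\<lambda>_. \<zero>\<^bsub>P''.V.T\<^esub>)" by (rule addmapI) simp_all
  have "exact_seq P'.V.T P.V.T P''.V.T F H"
  proof (rule exact_splitI[OF P'.V.abelian_group_T P.V.abelian_group_T P''.V.abelian_group_T Fa Ha S(1) R(1)])
    show "S (F x) = x" if "x \<in> carrier P'.V.T" for x
      by (rule P'.V.tensor_ext[OF addmap_comp[OF Fa S(1)] addmap_id that]) (simp add: F(2) S(2) cl st(3))
    show "H (R y) = y" if "y \<in> carrier P''.V.T" for y
      by (rule P''.V.tensor_ext[OF addmap_comp[OF R(1) Ha] addmap_id that]) (simp add: R(2) H(2) cl st(4))
    show "H (F x) = \<zero>\<^bsub>P''.V.T\<^esub>" if "x \<in> carrier P'.V.T" for x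
      by (rule P'.V.tensor_ext[OF addmap_comp[OF Fa Ha] z0 that]) (simp add: F(2) H(2) cl st(5) P''.V.tn_zero_left)
    show "F (S z) \<oplus>\<^bsub>P.V.T\<^esub> R (H z) = z" if "z \<in> carrier P.V.T" for z
      by (rule P.V.tensor_ext[OF addmap_plus[OF P.V.abelian_group_T addmap_comp[OF S(1) Fa] addmap_comp[OF Ha R(1)]] addmap_id that])
        (simp add: F(2) H(2) S(2) R(2) cl st(6) P.V.tn_add_left[symmetric])
  qed
  then have "exact_seq (mod_tensor K M' N) (mod_tensor K M N) (mod_tensor K M'' N) F H"
    by (simp add: exact_seq_def)
  then show ?thesis unfolding short_exact_iff using F(1) H(1) by blast
qed

lemma short_exact_mod_tensor_right:
  assumes P: "mod_pair K A B N M'" "mod_pair K A B N M" "mod_pair K A B N M''"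
    and f: "f \<in> gmod_hom K B M' M" and g: "g \<in> gmod_hom K B M M''" and sp: "ksplit K M' M M'' f g"
  shows "short_exact K (alg_tensor K A B) (mod_tensor K N M') (mod_tensor K N M) (mod_tensor K N M'')"
proof -
  interpret P': mod_pair K A B N M' by fact
  interpret P: mod_pair K A B N M by fact
  interpret P'': mod_pair K A B N M'' by fact
  obtain s t where st: "s \<in> module_hom K M M'" "t \<in> module_hom K M'' M" "\<And>x. x \<in> carrier M' \<Longrightarrow> s (f x) = x"
    "\<And>y. y \<in> carrier M'' \<Longrightarrow> g (t y) = y" "\<And>x. x \<in> carrier M' \<Longrightarrow> g (f x) = \<zero>\<^bsub>M''\<^esub>" "\<And>x. x \<in> carrier M \<Longrightarrow> f (s x) \<oplus>\<^bsub>M\<^esub> t (g x) = x"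
    using sp unfolding ksplit_def by blast
  obtain F where F: "F \<in> gmod_hom K (alg_tensor K A B) (mod_tensor K N M') (mod_tensor K N M)"
    "\<And>n m. n \<in> carrier N \<Longrightarrow> m \<in> carrier M' \<Longrightarrow> F (P'.V.tn n m) = P.V.tn n (f m)"
    using mod_tensor_functor[OF P(1,2) gmod_hom_id f] by blast
  obtain H where H: "H \<in> gmod_hom K (alg_tensor K A B) (mod_tensor K N M) (mod_tensor K N M'')"
    "\<And>n m. n \<in> carrier N \<Longrightarrow> m \<in> carrier M \<Longrightarrow> H (P.V.tn n m) = P''.V.tn n (g m)"
    using mod_tensor_functor[OF P(2,3) gmod_hom_id g] by blast
  obtain S where S: "addmap P.V.T P'.V.T S" "\<And>n m. n \<in> carrier N \<Longrightarrow> m \<in> carrier M \<Longrightarrow> S (P.V.tn n m) = P'.V.tn n (s m)"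
    using kT_functor[OF P.V.kpair_axioms P'.V.kpair_axioms module_hom_id st(1)] by blast
  obtain R where R: "addmap P''.V.T P.V.T R" "\<And>n m. n \<in> carrier N \<Longrightarrow> m \<in> carrier M'' \<Longrightarrow> R (P''.V.tn n m) = P.V.tn n (t m)"
    using kT_functor[OF P''.V.kpair_axioms P.V.kpair_axioms module_hom_id st(2)] by blast
  have Fa: "addmap P'.V.T P.V.T F" and Ha: "addmap P.V.T P''.V.T H"
    using F(1) H(1) by (simp_all add: gmod_hom_iff module_hom_iff addmap_def)
  have cl: "x \<in> carrier M' \<Longrightarrow> f x \<in> carrier M" "y \<in> carrier M \<Longrightarrow> g y \<in> carrier M''" "y \<in> carrier M \<Longrightarrow> s y \<in> carrier M'"
    "z \<in> carrier M'' \<Longrightarrow> t z \<in> carrier M" for x y z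
    using f g st(1,2) by (auto simp: gmod_hom_iff module_hom_iff addmap_def)
  have z0: "addmap P'.V.T P''.V.T (\<lambda>_. \<zero>\<^bsub>P''.V.T\<^esub>)" by (rule addmapI) simp_all
  have "exact_seq P'.V.T P.V.T P''.V.T F H"
  proof (rule exact_splitI[OF P'.V.abelian_group_T P.V.abelian_group_T P''.V.abelian_group_T Fa Ha S(1) R(1)])
    show "S (F x) = x" if "x \<in> carrier P'.V.T" for x
      by (rule P'.V.tensor_ext[OF addmap_comp[OF Fa S(1)] addmap_id that]) (simp add: F(2) S(2) cl st(3))
    show "H (R y) = y" if "y \<in> carrier P''.V.T" for y
      by (rule P''.V.tensor_ext[OF addmap_comp[OF R(1) Ha] addmap_id that]) (simp add: R(2) H(2) cl st(4))
    show "H (F x) = \<zero>\<^bsub>P''.V.T\<^esub>" if "x \<in> carrier P'.V.T" for x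
      by (rule P'.V.tensor_ext[OF addmap_comp[OF Fa Ha] z0 that]) (simp add: F(2) H(2) cl st(5) P''.V.tn_zero_right)
    show "F (S z) \<oplus>\<^bsub>P.V.T\<^esub> R (H z) = z" if "z \<in> carrier P.V.T" for z
      by (rule P.V.tensor_ext[OF addmap_plus[OF P.V.abelian_group_T addmap_comp[OF S(1) Fa] addmap_comp[OF Ha R(1)]] addmap_id that])
        (simp add: F(2) H(2) S(2) R(2) cl st(6) P.V.tn_add_right[symmetric])
  qed
  then have "exact_seq (mod_tensor K N M') (mod_tensor K N M) (mod_tensor K N M'') F H"
    by (simp add: exact_seq_def)
  then show ?thesis unfolding short_exact_iff using F(1) H(1) by blast
qed

lemma short_exact_Res:
  assumes "\<rho> \<in> galg_hom K B C" "short_exact K C M' M M''"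
  shows "short_exact K B (Res \<rho> M') (Res \<rho> M) (Res \<rho> M'')"
proof -
  obtain f g where f: "f \<in> gmod_hom K C M' M" and g: "g \<in> gmod_hom K C M M''" and ex': "exact_seq M' M M'' f g"
    using assms(2) unfolding short_exact_iff by blast
  have "f \<in> gmod_hom K B (Res \<rho> M') (Res \<rho> M)" "g \<in> gmod_hom K B (Res \<rho> M) (Res \<rho> M'')"
    using f g galg_homD(1)[OF assms(1)] by (auto simp: gmod_hom_iff module_hom_iff alin_def addmap_def graded_map_def act_Res)
  moreover have "exact_seq (Res \<rho> M') (Res \<rho> M) (Res \<rho> M'') f g" using ex' by (simp add: exact_seq_def)
  ultimately show ?thesis unfolding short_exact_iff by blast
qed

text \<open>Dual bases compose: the generators are the products of a basis element of
  \<open>C\<close> over \<open>B\<close> with one of \<open>P\<close> over \<open>C\<close>, and the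
  functionals are the \<open>\<phi>' k\<close> applied to \<open>\<phi> j x\<close>.\<close>

lemma fg_projective_Res:
  assumes \<rho>: "\<rho> \<in> galg_hom K B C" and C: "graded_algebra K C" and L: "fg_projective K B (left_reg \<rho> C)" and P: "fg_projective K C P"
  shows "fg_projective K B (Res \<rho> P)"
proof -
  interpret L: left_gmod K B "left_reg \<rho> C" by (rule fg_projective_left_gmod[OF L])
  interpret P: left_gmod K C P by (rule fg_projective_left_gmod[OF P])
  have R: "left_gmod K B (Res \<rho> P)" by (rule left_gmod_Res[OF L.A.graded_algebra_axioms \<rho> P.left_gmod_axioms])
  obtain n \<delta> p \<phi> where 1: "graded_dual_basis C P {..<n :: nat} \<delta> p \<phi>" using fg_projective_dual_basis[OF P] by blast
  obtain n' \<delta>' p' \<phi>' where 2: "graded_dual_basis B (left_reg \<rho> C) {..<n' :: nat} \<delta>' p' \<phi>'" using fg_projective_dual_basis[OF L] by blast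
  have d1: "dual_basis C P {..<n} p \<phi>" and d2: "dual_basis B (left_reg \<rho> C) {..<n'} p' \<phi>'" using 1 2 by (simp_all add: graded_dual_basis_def)
  have lr: "carrier (left_reg \<rho> C) = carrier C" "add (left_reg \<rho> C) = add C" "gr (left_reg \<rho> C) = gr C"
    "act (left_reg \<rho> C) b c = \<rho> b \<otimes>\<^bsub>C\<^esub> c" for b c by (simp_all add: left_reg_def)
  have fl: "finsum (left_reg \<rho> C) f I = finsum C f I" for f :: "nat \<Rightarrow> _" and I by (simp add: finsum_def finprod_def left_reg_def)
  note D = dual_basisD[OF d1] and D' = dual_basisD[OF d2, unfolded lr fl]
  note h = galg_homD[OF \<rho>]
  have a': "addmap C B (\<phi>' k)" if "k \<in> {..<n'}" for k using D'(3)[OF that] by (simp add: addmap_def lr)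
  let ?J = "{..<n'} \<times> {..<n}"
  have dec: "(\<Oplus>\<^bsub>P\<^esub>kj\<in>?J. act P (\<rho> (\<phi>' (fst kj) (\<phi> (snd kj) x))) (act P (p' (fst kj)) (p (snd kj)))) = x"
    if x: "x \<in> carrier P" for x
  proof -
    have c: "\<rho> (\<phi>' k (\<phi> j x)) \<otimes>\<^bsub>C\<^esub> p' k \<in> carrier C" if "k < n'" "j < n" for k j
      using that D D' h x by (intro P.A.m_closed) auto
    have "(\<Oplus>\<^bsub>P\<^esub>kj\<in>?J. act P (\<rho> (\<phi>' (fst kj) (\<phi> (snd kj) x))) (act P (p' (fst kj)) (p (snd kj)))) =
        (\<Oplus>\<^bsub>P\<^esub>jk\<in>{..<n} \<times> {..<n'}. act P (\<rho> (\<phi>' (snd jk) (\<phi> (fst jk) x)) \<otimes>\<^bsub>C\<^esub> p' (snd jk)) (p (fst jk)))"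
    proof -
      \<comment> \<open>The index pairs are swapped so that the inner sum runs over the basis of
        \<open>C\<close>, where it recovers the coefficient \<open>\<phi> j x\<close> for each
        \<open>j\<close>.\<close>
      have sw: "?J = prod.swap ` ({..<n} \<times> {..<n'})" by auto
      show ?thesis unfolding sw
        by (subst P.M.finsum_reindex)
          (use D D' h x c in \<open>auto intro!: P.M.finsum_cong' P.act_closed simp: P.act_mult inj_on_def\<close>)
    qed
    also have "\<dots> = (\<Oplus>\<^bsub>P\<^esub>j\<in>{..<n}. \<Oplus>\<^bsub>P\<^esub>k\<in>{..<n'}. act P (\<rho> (\<phi>' k (\<phi> j x)) \<otimes>\<^bsub>C\<^esub> p' k) (p j))"
      by (rule finsum_Times[OF P.M.abelian_group_axioms]) (use c D in \<open>auto intro!: P.act_closed\<close>)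
    also have "\<dots> = (\<Oplus>\<^bsub>P\<^esub>j\<in>{..<n}. act P (\<phi> j x) (p j))"
    proof (rule P.M.finsum_cong'[OF refl])
      fix j assume j: "j \<in> {..<n}"
      have "act P (\<Oplus>\<^bsub>C\<^esub>k\<in>{..<n'}. \<rho> (\<phi>' k (\<phi> j x)) \<otimes>\<^bsub>C\<^esub> p' k) (p j) = (\<Oplus>\<^bsub>P\<^esub>k\<in>{..<n'}. act P (\<rho> (\<phi>' k (\<phi> j x)) \<otimes>\<^bsub>C\<^esub> p' k) (p j))"
        by (rule addmap_finsum[OF P.A.abelian_group_axioms P.M.abelian_group_axioms P.addmap_act_left[OF D(2)[OF j]]]) (use c j in auto)
      then show "(\<Oplus>\<^bsub>P\<^esub>k\<in>{..<n'}. act P (\<rho> (\<phi>' k (\<phi> j x)) \<otimes>\<^bsub>C\<^esub> p' k) (p j)) = act P (\<phi> j x) (p j)"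
        using D'(5)[OF D(6)[OF j x]] by simp
    qed (use D x in \<open>auto intro!: P.act_closed\<close>)
    finally show ?thesis using D(5)[OF x] by simp
  qed
  have fR: "finsum (Res \<rho> P) f I = finsum P f I" for f :: "nat \<times> nat \<Rightarrow> _" and I by (simp add: finsum_def finprod_def)
  have g1: "p j \<in> gr P (\<delta> j)" "x \<in> gr P d \<Longrightarrow> \<phi> j x \<in> gr C (d - \<delta> j)" if "j < n" for j x d using 1 that by (simp_all add: graded_dual_basis_def)
  have g2: "p' j \<in> gr C (\<delta>' j)" "x \<in> gr C d \<Longrightarrow> \<phi>' j x \<in> gr B (d - \<delta>' j)" if "j < n'" for j x d using 2 that by (simp_all add: graded_dual_basis_def lr)
  have "graded_dual_basis B (Res \<rho> P) ?J (\<lambda>kj. \<delta>' (fst kj) + \<delta> (snd kj)) (\<lambda>kj. act P (p' (fst kj)) (p (snd kj))) (\<lambda>kj x. \<phi>' (fst kj) (\<phi> (snd kj) x))"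
    unfolding graded_dual_basis_def dual_basis_def
  proof (intro conjI ballI allI)
    fix kj assume kj: "kj \<in> ?J"
    then have k: "fst kj < n'" "snd kj < n" by auto
    show "act P (p' (fst kj)) (p (snd kj)) \<in> carrier (Res \<rho> P)" using k D D' by (simp add: P.act_closed)
    show "addmap (Res \<rho> P) B (\<lambda>x. \<phi>' (fst kj) (\<phi> (snd kj) x))"
      using addmap_comp[OF D(3)[of "snd kj"] a'[of "fst kj"]] k by (simp add: addmap_def)
    show "\<phi>' (fst kj) (\<phi> (snd kj) (act (Res \<rho> P) b x)) = b \<otimes>\<^bsub>B\<^esub> \<phi>' (fst kj) (\<phi> (snd kj) x)"
      if "b \<in> carrier B" "x \<in> carrier (Res \<rho> P)" for b x
      using that k D(4)[of "snd kj" "\<rho> b" x] D'(4)[of "fst kj" b "\<phi> (snd kj) x"] D(6)[of "snd kj" x] by (simp add: act_Res h(1))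
    show "act P (p' (fst kj)) (p (snd kj)) \<in> gr (Res \<rho> P) (\<delta>' (fst kj) + \<delta> (snd kj))"
      using P.gr_act[OF g2(1)[OF k(1)] g1(1)[OF k(2)]] by simp
    show "\<phi>' (fst kj) (\<phi> (snd kj) x) \<in> gr B (d - (\<delta>' (fst kj) + \<delta> (snd kj)))" if "x \<in> gr (Res \<rho> P) d" for d x
      using g2(2)[OF k(1) g1(2)[OF k(2)], of x d] that by (simp add: algebra_simps)
  qed (simp_all add: act_Res fR dec)
  then show ?thesis by (rule fg_projectiveI[OF R])
qed


section \<open>The pairing of modules\<close>

lemma shift_simps [simp]:
  "carrier (shift M) = carrier M" "add (shift M) = add M" "\<zero>\<^bsub>shift M\<^esub> = \<zero>\<^bsub>M\<^esub>"
  "Module.smult (shift M) = Module.smult M" "gr (shift M) d = gr M (d - 1)" "act (shift M) = act M"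
  by (simp_all add: shift_def)

lemma alin_inv:
  assumes M: "left_gmod K A M" and f: "alin A M N f" and bij: "bij_betw f (carrier M) (carrier N)"
  shows "alin A N M (the_inv_into (carrier M) f)"
    and "\<And>x. x \<in> carrier M \<Longrightarrow> the_inv_into (carrier M) f (f x) = x"
    and "\<And>y. y \<in> carrier N \<Longrightarrow> f (the_inv_into (carrier M) f y) = y"
    and "\<And>y. y \<in> carrier N \<Longrightarrow> the_inv_into (carrier M) f y \<in> carrier M"
proof -
  interpret M: left_gmod K A M by fact
  let ?g = "the_inv_into (carrier M) f"
  have inj: "inj_on f (carrier M)" and im: "f ` carrier M = carrier N" using bij by (simp_all add: bij_betw_def)
  show gf: "\<And>x. x \<in> carrier M \<Longrightarrow> ?g (f x) = x" by (rule the_inv_into_f_f[OF inj])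
  show fg: "\<And>y. y \<in> carrier N \<Longrightarrow> f (?g y) = y" by (rule f_the_inv_into_f[OF inj]) (simp add: im)
  show gc: "\<And>y. y \<in> carrier N \<Longrightarrow> ?g y \<in> carrier M" by (rule the_inv_into_into[OF inj _ order_refl]) (simp add: im)
  show "alin A N M ?g"
    unfolding alin_def
  proof (intro conjI ballI addmapI gc)
    fix x y assume x: "x \<in> carrier N" and y: "y \<in> carrier N"
    have "f (?g x \<oplus>\<^bsub>M\<^esub> ?g y) = x \<oplus>\<^bsub>N\<^esub> y" using addmap_add[OF alin_addmap[OF f] gc[OF x] gc[OF y]] fg x y by simp
    then show "?g (x \<oplus>\<^bsub>N\<^esub> y) = ?g x \<oplus>\<^bsub>M\<^esub> ?g y" using gf[of "?g x \<oplus>\<^bsub>M\<^esub> ?g y"] gc x y by simp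
  next
    fix a x assume a: "a \<in> carrier A" and x: "x \<in> carrier N"
    have "f (act M a (?g x)) = act N a x" using alin_act[OF f a gc[OF x]] fg x by simp
    then show "?g (act N a x) = act M a (?g x)" using gf[OF M.act_closed[OF a gc[OF x]]] by simp
  qed
qed

lemma gmod_iso_sym:
  assumes M: "left_gmod K A M" "left_gmod K A N" and iso: "gmod_iso K A M N"
  shows "gmod_iso K A N M"
proof -
  interpret M: left_gmod K A M by fact
  interpret N: left_gmod K A N by fact
  obtain f where f: "f \<in> gmod_hom K A M N" and bij: "bij_betw f (carrier M) (carrier N)" using iso unfolding gmod_iso_def by blast
  have fl: "alin A M N f" and fg: "graded_map M N f" using f by (simp_all add: gmod_hom_iff)
  note i = alin_inv[OF M(1) fl bij]
  have "graded_map N M (the_inv_into (carrier M) f)"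
    unfolding graded_map_def
  proof (intro allI ballI)
    fix d y assume "y \<in> gr N d"
    then have "y \<in> f ` gr M d"
      using graded_iso_surj[OF M.M.graded_space_axioms N.M.graded_space_axioms alin_addmap[OF fl] fg bij] by simp
    then obtain x where "x \<in> gr M d" "y = f x" by blast
    then show "the_inv_into (carrier M) f y \<in> gr M d" using i(2)[OF M.M.gr_carrier] by simp
  qed
  then have "the_inv_into (carrier M) f \<in> gmod_hom K A N M" by (rule gmod_homI[OF M(2,1) i(1)])
  then show ?thesis unfolding gmod_iso_def using bij_betw_the_inv_into[OF bij] by blast
qed

lemma gmod_hom_comp:
  "f \<in> gmod_hom K A M N \<Longrightarrow> g \<in> gmod_hom K A N L \<Longrightarrow> (\<lambda>x. g (f x)) \<in> gmod_hom K A M L"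
  by (auto simp: gmod_hom_iff module_hom_iff alin_def addmap_def graded_map_def)

lemma gmod_iso_refl: "gmod_iso K A M M"
  unfolding gmod_iso_def by (rule bexI[OF _ gmod_hom_id]) (simp add: bij_betw_def)

text \<open>Needed because classes are formed from the copies chosen by \<open>rep\<close>:
  exactness must carry over from the modules that a functor produces to these copies.\<close>

lemma short_exact_iso:
  assumes M: "left_gmod K A M'" "left_gmod K A M" "left_gmod K A M''" and N: "left_gmod K A N'" "left_gmod K A N" "left_gmod K A N''"
    and iso: "gmod_iso K A M' N'" "gmod_iso K A M N" "gmod_iso K A M'' N''" and ex: "short_exact K A M' M M''"
  shows "short_exact K A N' N N''"
proof -
  obtain f g where f: "f \<in> gmod_hom K A M' M" and g: "g \<in> gmod_hom K A M M''" and ex': "exact_seq M' M M'' f g"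
    using ex unfolding short_exact_iff by blast
  have inj: "inj_on f (carrier M')" and surj: "g ` carrier M = carrier M''"
    and ker: "f ` carrier M' = {x \<in> carrier M. g x = \<zero>\<^bsub>M''\<^esub>}" using ex' by (simp_all add: exact_seq_def)
  obtain u' where u': "u' \<in> gmod_hom K A N' M'" "bij_betw u' (carrier N') (carrier M')"
    using gmod_iso_sym[OF M(1) N(1) iso(1)] unfolding gmod_iso_def by blast
  obtain v where v: "v \<in> gmod_hom K A M N" "bij_betw v (carrier M) (carrier N)" using iso(2) unfolding gmod_iso_def by blast
  obtain u where u: "u \<in> gmod_hom K A N M" "bij_betw u (carrier N) (carrier M)" "\<And>x. x \<in> carrier M \<Longrightarrow> u (v x) = x" "\<And>y. y \<in> carrier N \<Longrightarrow> v (u y) = y"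
  proof -
    have vl: "alin A M N v" "graded_map M N v" using v(1) by (simp_all add: gmod_hom_iff)
    note i = alin_inv[OF M(2) vl(1) v(2)]
    interpret M: left_gmod K A M by (rule M(2))
    interpret N: left_gmod K A N by (rule N(2))
    have "graded_map N M (the_inv_into (carrier M) v)"
      unfolding graded_map_def
    proof (intro allI ballI)
      fix d y assume "y \<in> gr N d"
      then have "y \<in> v ` gr M d"
        using graded_iso_surj[OF M.M.graded_space_axioms N.M.graded_space_axioms alin_addmap[OF vl(1)] vl(2) v(2)] by simp
      then obtain x where "x \<in> gr M d" "y = v x" by blast
      then show "the_inv_into (carrier M) v y \<in> gr M d" using i(2)[OF M.M.gr_carrier] by simp
    qed
    from gmod_homI[OF N(2) M(2) i(1) this] bij_betw_the_inv_into[OF v(2)] i(2,3) show thesis by (rule that)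
  qed
  obtain w where w: "w \<in> gmod_hom K A M'' N''" "bij_betw w (carrier M'') (carrier N'')" using iso(3) unfolding gmod_iso_def by blast
  have bu': "u' ` carrier N' = carrier M'" "inj_on u' (carrier N')" using u'(2) by (simp_all add: bij_betw_def)
  have bw: "w ` carrier M'' = carrier N''" "inj_on w (carrier M'')" using w(2) by (simp_all add: bij_betw_def)
  have bu: "u ` carrier N = carrier M" using u(2) by (simp add: bij_betw_def)
  have bv: "v ` carrier M = carrier N" "inj_on v (carrier M)" using v(2) by (simp_all add: bij_betw_def)
  interpret M'': left_gmod K A M'' by (rule M(3))
  interpret N'': left_gmod K A N'' by (rule N(3))
  have wa: "addmap M'' N'' w" using w(1) by (simp add: gmod_hom_iff alin_def)
  have w0: "w \<zero>\<^bsub>M''\<^esub> = \<zero>\<^bsub>N''\<^esub>" by (rule addmap_zero[OF M''.M.abelian_group_axioms N''.M.abelian_group_axioms wa])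
  have gc: "g x \<in> carrier M''" if "x \<in> carrier M" for x using imageI[OF that, of g] unfolding surj .
  have uc: "u y \<in> carrier M" if "y \<in> carrier N" for y using imageI[OF that, of u] unfolding bu .
  have vc: "v y \<in> carrier N" if "y \<in> carrier M" for y using imageI[OF that, of v] unfolding bv(1) .
  have "exact_seq N' N N'' (\<lambda>x. v (f (u' x))) (\<lambda>y. w (g (u y)))"
    unfolding exact_seq_def
  proof (intro conjI)
    have fc: "f x \<in> carrier M" if "x \<in> carrier M'" for x using imageI[OF that, of f] unfolding ker by simp
    have "inj_on v (f ` carrier M')" by (rule inj_on_subset[OF bv(2)]) (use fc in blast)
    then have "inj_on (\<lambda>x. v (f x)) (u' ` carrier N')"
      using comp_inj_on[OF inj] unfolding bu'(1) by (simp add: comp_def)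
    then show "inj_on (\<lambda>x. v (f (u' x))) (carrier N')"
      using comp_inj_on[OF bu'(2)] by (simp add: comp_def)
    have "(\<lambda>y. w (g (u y))) ` carrier N = w ` (g ` (u ` carrier N))" by (simp add: image_image)
    then show "(\<lambda>y. w (g (u y))) ` carrier N = carrier N''" unfolding bu surj bw .
    have "(\<lambda>x. v (f (u' x))) ` carrier N' = v ` (f ` (u' ` carrier N'))" by (simp add: image_image)
    also have "\<dots> = v ` {x \<in> carrier M. g x = \<zero>\<^bsub>M''\<^esub>}" unfolding bu'(1) ker ..
    also have "\<dots> = {y \<in> carrier N. w (g (u y)) = \<zero>\<^bsub>N''\<^esub>}"
    proof (intro equalityI subsetI)
      fix y assume "y \<in> v ` {x \<in> carrier M. g x = \<zero>\<^bsub>M''\<^esub>}"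
      then show "y \<in> {y \<in> carrier N. w (g (u y)) = \<zero>\<^bsub>N''\<^esub>}" using u(3) w0 vc by auto
    next
      fix y assume "y \<in> {y \<in> carrier N. w (g (u y)) = \<zero>\<^bsub>N''\<^esub>}"
      then have y: "y \<in> carrier N" "w (g (u y)) = w \<zero>\<^bsub>M''\<^esub>" using w0 by auto
      have "g (u y) = \<zero>\<^bsub>M''\<^esub>" by (rule inj_onD[OF bw(2) y(2) gc[OF uc[OF y(1)]] M''.M.zero_closed])
      then show "y \<in> v ` {x \<in> carrier M. g x = \<zero>\<^bsub>M''\<^esub>}" using uc[OF y(1)] u(4)[OF y(1)] by (intro image_eqI[of _ v "u y"]) simp_all
    qed
    finally show "(\<lambda>x. v (f (u' x))) ` carrier N' = {y \<in> carrier N. w (g (u y)) = \<zero>\<^bsub>N''\<^esub>}" .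
  qed
  then show ?thesis
    unfolding short_exact_iff
    using gmod_hom_comp[OF gmod_hom_comp[OF u'(1) f] v(1)] gmod_hom_comp[OF gmod_hom_comp[OF u(1) g] w(1)] by blast
qed

context anti_galg
begin

lemma gtensor_twist: "left_gmod K A P \<Longrightarrow> left_gmod K A M \<Longrightarrow> gtensor K A (twist \<psi> P) M"
  by (simp add: gtensor_def left_gmod_twist)

lemma dual_basis_twist_ex:
  assumes "fg_projective K A P"
  shows "\<exists>n p \<phi>. dual_basis (opposite A) (twist \<psi> P) {..<n :: nat} p \<phi>"
proof -
  obtain n \<delta> p \<phi> where "graded_dual_basis A P {..<n :: nat} \<delta> p \<phi>" using fg_projective_dual_basis[OF assms] by blast
  then have "dual_basis A P {..<n} p \<phi>" by (simp add: graded_dual_basis_def)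
  from twist_dual_basis[OF fg_projective_left_gmod[OF assms] this] show ?thesis by blast
qed

text \<open>This makes every \<open>gdim\<close> in the pairing a genuine graded dimension.\<close>

lemma fin_dim_pairing:
  assumes P: "fg_projective K A P" and M: "left_gmod K A M" "vectorspace.fin_dim K M"
  shows "vectorspace.fin_dim K (mtensor A (twist \<psi> P) M)"
  using dual_basis_twist_ex[OF P] gtensor.fin_dim_T[OF gtensor_twist[OF fg_projective_left_gmod[OF P] M(1)] _ M(2)] by blast

lemma alin_twist: "alin A P P' f \<Longrightarrow> alin (opposite A) (twist \<psi> P) (twist \<psi> P') f"
  using galg_homD(1)[OF psi_hom] by (simp add: alin_def addmap_def act_twist)

text \<open>Functoriality of the tensor product in both factors, applied to the isomorphisms and to
  their inverses. It makes the pairing independent of the choices in \<open>rep\<close>.\<close>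

lemma pairing_iso:
  assumes P: "fg_projective K A P" "left_gmod K A P'" and M: "left_gmod K A M" "vectorspace.fin_dim K M" "left_gmod K A M'"
    and iso: "gmod_iso K A P P'" "gmod_iso K A M M'"
  shows "gdim K (mtensor A (twist \<psi> P) M) = gdim K (mtensor A (twist \<psi> P') M')"
proof -
  note Pl = fg_projective_left_gmod[OF P(1)]
  interpret G: gtensor K A "twist \<psi> P" M by (rule gtensor_twist[OF Pl M(1)])
  interpret G': gtensor K A "twist \<psi> P'" M' by (rule gtensor_twist[OF P(2) M(3)])
  obtain f where f: "f \<in> gmod_hom K A P P'" and fb: "bij_betw f (carrier P) (carrier P')" using iso(1) unfolding gmod_iso_def by blast
  obtain g where g: "g \<in> gmod_hom K A M M'" and gb: "bij_betw g (carrier M) (carrier M')" using iso(2) unfolding gmod_iso_def by blast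
  have fl: "alin A P P' f" "graded_map (twist \<psi> P) (twist \<psi> P') f" and gl: "alin A M M' g" "graded_map M M' g"
    using f g by (simp_all add: gmod_hom_iff graded_map_def)
  let ?f = "the_inv_into (carrier P) f" and ?g = "the_inv_into (carrier M) g"
  note i = alin_inv[OF Pl fl(1) fb] and j = alin_inv[OF M(1) gl(1) gb]
  note fc = addmap_closed[OF alin_addmap[OF fl(1)]] and gc = addmap_closed[OF alin_addmap[OF gl(1)]]
  obtain F where F: "addmap G.T G'.T F" "F \<in> module_hom K G.T G'.T" "graded_map G.T G'.T F"
    "\<And>p m. p \<in> carrier P \<Longrightarrow> m \<in> carrier M \<Longrightarrow> F (G.tn p m) = G'.tn (f p) (g m)"
    using tensor_functor[OF G.gtensor_axioms G'.gtensor_axioms alin_twist[OF fl(1)] gl(1)] fl(2) gl(2) unfolding twist_simps by blast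
  obtain H where H: "addmap G'.T G.T H" "\<And>p m. p \<in> carrier P' \<Longrightarrow> m \<in> carrier M' \<Longrightarrow> H (G'.tn p m) = G.tn (?f p) (?g m)"
    using tensor_functor[OF G'.gtensor_axioms G.gtensor_axioms alin_twist[OF i(1)] j(1)] unfolding twist_simps by blast
  have "H (F z) = z" if "z \<in> carrier G.T" for z
    by (rule G.tensor_ext[OF addmap_comp[OF F(1) H(1)] addmap_id that]) (simp add: F(4) H(2) fc gc i(2) j(2))
  moreover have "F (H z) = z" if "z \<in> carrier G'.T" for z
    by (rule G'.tensor_ext[OF addmap_comp[OF H(1) F(1)] addmap_id that]) (simp add: F(4) H(2) i(3,4) j(3,4))
  ultimately have "bij_betw F (carrier G.T) (carrier G'.T)"
    using addmap_closed[OF F(1)] addmap_closed[OF H(1)] by (intro bij_betw_byWitness[of _ H]) auto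
  then show ?thesis
    by (rule gdim_iso[OF G.graded_space_T G'.graded_space_T F(2,3) _ fin_dim_pairing[OF P(1) M(1,2)]])
qed

text \<open>The dual basis of the twisted projective keeps the sequence exact after tensoring, and
  all three products are finite-dimensional, so \<open>gdim\<close> is additive.\<close>

lemma pairing_exact_right:
  assumes P: "fg_projective K A P" and M: "left_gmod K A M'" "left_gmod K A M" "left_gmod K A M''"
    "vectorspace.fin_dim K M'" "vectorspace.fin_dim K M" "vectorspace.fin_dim K M''" and ex: "short_exact K A M' M M''"
  shows "gdim K (mtensor A (twist \<psi> P) M) = gdim K (mtensor A (twist \<psi> P) M') + gdim K (mtensor A (twist \<psi> P) M'')"
proof -
  note Pl = fg_projective_left_gmod[OF P]
  interpret G': gtensor K A "twist \<psi> P" M' by (rule gtensor_twist[OF Pl M(1)])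
  interpret G: gtensor K A "twist \<psi> P" M by (rule gtensor_twist[OF Pl M(2)])
  interpret G'': gtensor K A "twist \<psi> P" M'' by (rule gtensor_twist[OF Pl M(3)])
  obtain f g where f: "f \<in> gmod_hom K A M' M" and g: "g \<in> gmod_hom K A M M''" and ex': "exact_seq M' M M'' f g"
    using ex unfolding short_exact_iff by blast
  have fl: "alin A M' M f" "graded_map M' M f" and gl: "alin A M M'' g" "graded_map M M'' g" using f g by (simp_all add: gmod_hom_iff)
  obtain F where F: "addmap G'.T G.T F" "F \<in> module_hom K G'.T G.T" "graded_map G'.T G.T F"
    "\<And>p m. p \<in> carrier (twist \<psi> P) \<Longrightarrow> m \<in> carrier M' \<Longrightarrow> F (G'.tn p m) = G.tn p (f m)"
    using tensor_functor[OF G'.gtensor_axioms G.gtensor_axioms alin_id fl(1)] graded_map_id fl(2) by blast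
  obtain H where H: "addmap G.T G''.T H" "H \<in> module_hom K G.T G''.T" "graded_map G.T G''.T H"
    "\<And>p m. p \<in> carrier (twist \<psi> P) \<Longrightarrow> m \<in> carrier M \<Longrightarrow> H (G.tn p m) = G''.tn p (g m)"
    using tensor_functor[OF G.gtensor_axioms G''.gtensor_axioms alin_id gl(1)] graded_map_id gl(2) by blast
  obtain n p \<phi> where db: "dual_basis (opposite A) (twist \<psi> P) {..<n :: nat} p \<phi>" using dual_basis_twist_ex[OF P] by blast
  have "exact_seq G'.T G.T G''.T F H"
    by (rule tensor_exact_right[OF G'.gtensor_axioms G.gtensor_axioms G''.gtensor_axioms db fl(1) gl(1) ex' F(1,4) H(1,4)])
  then show ?thesis
    by (rule gdim_exact[OF G'.graded_space_T G.graded_space_T G''.graded_space_T F(2,3) H(2,3)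
          fin_dim_pairing[OF P M(1,4)] fin_dim_pairing[OF P M(2,5)] fin_dim_pairing[OF P M(3,6)]])
qed

text \<open>Tensoring with an arbitrary \<open>M\<close> keeps this sequence exact because it
  splits, \<open>P''\<close> being projective. The splitting maps are used ungraded; the graded maps
  \<open>F\<close> and \<open>H\<close> then give the count in each degree.\<close>

lemma pairing_exact_left:
  assumes P: "fg_projective K A P'" "fg_projective K A P" "fg_projective K A P''" and M: "left_gmod K A M" "vectorspace.fin_dim K M"
    and ex: "short_exact K A P' P P''"
  shows "gdim K (mtensor A (twist \<psi> P) M) = gdim K (mtensor A (twist \<psi> P') M) + gdim K (mtensor A (twist \<psi> P'') M)"
proof -
  note Pl = P[THEN fg_projective_left_gmod]
  interpret G': gtensor K A "twist \<psi> P'" M by (rule gtensor_twist[OF Pl(1) M(1)])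
  interpret G: gtensor K A "twist \<psi> P" M by (rule gtensor_twist[OF Pl(2) M(1)])
  interpret G'': gtensor K A "twist \<psi> P''" M by (rule gtensor_twist[OF Pl(3) M(1)])
  obtain f g where f: "f \<in> gmod_hom K A P' P" and g: "g \<in> gmod_hom K A P P''" and ex': "exact_seq P' P P'' f g"
    using ex unfolding short_exact_iff by blast
  have fl: "alin A P' P f" "graded_map (twist \<psi> P') (twist \<psi> P) f" and gl: "alin A P P'' g" "graded_map (twist \<psi> P) (twist \<psi> P'') g"
    using f g by (simp_all add: gmod_hom_iff graded_map_def)
  obtain n \<delta> p \<phi> where "graded_dual_basis A P'' {..<n :: nat} \<delta> p \<phi>" using fg_projective_dual_basis[OF P(3)] by blast
  then have db: "dual_basis A P'' {..<n} p \<phi>" by (simp add: graded_dual_basis_def)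
  obtain s t where st: "alin A P P' s" "alin A P'' P t" "\<And>x. x \<in> carrier P' \<Longrightarrow> s (f x) = x" "\<And>y. y \<in> carrier P'' \<Longrightarrow> g (t y) = y"
    "\<And>x. x \<in> carrier P' \<Longrightarrow> g (f x) = \<zero>\<^bsub>P''\<^esub>" "\<And>x. x \<in> carrier P \<Longrightarrow> f (s x) \<oplus>\<^bsub>P\<^esub> t (g x) = x"
    using projective_split[OF Pl db fl(1) gl(1) ex'] by blast
  obtain F where F: "addmap G'.T G.T F" "F \<in> module_hom K G'.T G.T" "graded_map G'.T G.T F"
    "\<And>p m. p \<in> carrier P' \<Longrightarrow> m \<in> carrier M \<Longrightarrow> F (G'.tn p m) = G.tn (f p) m"
    using tensor_functor[OF G'.gtensor_axioms G.gtensor_axioms alin_twist[OF fl(1)] alin_id] graded_map_id fl(2) unfolding twist_simps by blast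
  obtain H where H: "addmap G.T G''.T H" "H \<in> module_hom K G.T G''.T" "graded_map G.T G''.T H"
    "\<And>p m. p \<in> carrier P \<Longrightarrow> m \<in> carrier M \<Longrightarrow> H (G.tn p m) = G''.tn (g p) m"
    using tensor_functor[OF G.gtensor_axioms G''.gtensor_axioms alin_twist[OF gl(1)] alin_id] graded_map_id gl(2) unfolding twist_simps by blast
  obtain S where S: "addmap G.T G'.T S" "\<And>p m. p \<in> carrier P \<Longrightarrow> m \<in> carrier M \<Longrightarrow> S (G.tn p m) = G'.tn (s p) m"
    using tensor_functor[OF G.gtensor_axioms G'.gtensor_axioms alin_twist[OF st(1)] alin_id] unfolding twist_simps by blast
  obtain R where R: "addmap G''.T G.T R" "\<And>p m. p \<in> carrier P'' \<Longrightarrow> m \<in> carrier M \<Longrightarrow> R (G''.tn p m) = G.tn (t p) m"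
    using tensor_functor[OF G''.gtensor_axioms G.gtensor_axioms alin_twist[OF st(2)] alin_id] unfolding twist_simps by blast
  have cl: "x \<in> carrier P' \<Longrightarrow> f x \<in> carrier P" "y \<in> carrier P \<Longrightarrow> g y \<in> carrier P''" "y \<in> carrier P \<Longrightarrow> s y \<in> carrier P'"
    "z \<in> carrier P'' \<Longrightarrow> t z \<in> carrier P" for x y z
    using fl(1) gl(1) st(1,2) by (auto simp: alin_def addmap_def)
  have z0: "addmap G'.T G''.T (\<lambda>_. \<zero>\<^bsub>G''.T\<^esub>)" by (rule addmapI) simp_all
  have "exact_seq G'.T G.T G''.T F H"
  proof (rule exact_splitI[OF G'.abelian_group_T G.abelian_group_T G''.abelian_group_T F(1) H(1) S(1) R(1)])
    show "S (F x) = x" if "x \<in> carrier G'.T" for x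
      by (rule G'.tensor_ext[OF addmap_comp[OF F(1) S(1)] addmap_id that]) (simp add: F(4) S(2) cl st(3))
    show "H (R y) = y" if "y \<in> carrier G''.T" for y
      by (rule G''.tensor_ext[OF addmap_comp[OF R(1) H(1)] addmap_id that]) (simp add: R(2) H(4) cl st(4))
    show "H (F x) = \<zero>\<^bsub>G''.T\<^esub>" if "x \<in> carrier G'.T" for x
      by (rule G'.tensor_ext[OF addmap_comp[OF F(1) H(1)] z0 that])
        (use G''.tn_zero_left in \<open>simp add: F(4) H(4) cl st(5)\<close>)
    show "F (S z) \<oplus>\<^bsub>G.T\<^esub> R (H z) = z" if "z \<in> carrier G.T" for z
    proof (rule G.tensor_ext[OF addmap_plus[OF G.abelian_group_T addmap_comp[OF S(1) F(1)] addmap_comp[OF H(1) R(1)]] addmap_id that])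
      fix p m assume pm: "p \<in> carrier (twist \<psi> P)" "m \<in> carrier M"
      then have "F (S (G.tn p m)) = G.tn (f (s p)) m" "R (H (G.tn p m)) = G.tn (t (g p)) m"
        by (simp_all add: F(4) H(4) S(2) R(2) cl)
      moreover have "G.tn (f (s p) \<oplus>\<^bsub>P\<^esub> t (g p)) m = G.tn (f (s p)) m \<oplus>\<^bsub>G.T\<^esub> G.tn (t (g p)) m"
        using G.tn_add_left[of "f (s p)" "t (g p)" m] pm by (simp add: cl)
      ultimately show "F (S (G.tn p m)) \<oplus>\<^bsub>G.T\<^esub> R (H (G.tn p m)) = G.tn p m" using pm by (simp add: st(6))
    qed
  qed
  then show ?thesis
    by (rule gdim_exact[OF G'.graded_space_T G.graded_space_T G''.graded_space_T F(2,3) H(2,3)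
          fin_dim_pairing[OF P(1) M] fin_dim_pairing[OF P(2) M] fin_dim_pairing[OF P(3) M]])
qed

end

section \<open>The grading shift\<close>

lemma lookup_q_mult: "Poly_Mapping.lookup (q * p) d = Poly_Mapping.lookup p (d - 1)"
proof -
  have "Poly_Mapping.keys p \<subseteq> UNIV" by simp
  then show ?thesis
  proof (induction p rule: frag_induction)
    case (one x)
    show ?case by (simp add: mult_single lookup_single when_def)
  next
    case (diff a b)
    then show ?case by (simp add: right_diff_distrib lookup_minus)
  qed simp
qed

lemma left_gmod_shift: assumes "left_gmod K A M" shows "left_gmod K A (shift M)"
proof -
  interpret M: left_gmod K A M by fact
  have vs: "vectorspace K (shift M)"
  proof -
    have "graded_space K (with_act M (act M))" by (rule graded_space_cong[OF M.M.graded_space_axioms]) simp_all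
    have "comm_group (add_monoid (shift M))" by (rule comm_group_cong[OF M.M.a_comm_group]) simp_all
    then have "abelian_group (shift M)"
      by (simp add: abelian_group_def abelian_group_axioms_def abelian_monoid_def comm_group_def)
    moreover have "module_axioms K (shift M)"
      by unfold_locales (simp_all add: M.M.smult_l_distr M.M.smult_r_distr M.M.smult_assoc1)
    ultimately show ?thesis using M.M.vectorspace_axioms unfolding vectorspace_def module_def by blast
  qed
  interpret S: vectorspace K "shift M" by (rule vs)
  have "graded_space K (shift M)"
  proof (rule graded_spaceI[OF vs, of "\<lambda>d x. hcomp M x (d - 1)"])
    show "subspace K (gr (shift M) d) (shift M)" for d
      by (intro subspace.intro vs submodule.intro S.module_axioms)
        (auto simp: M.M.gr_carrier M.M.gr_add M.M.gr_zero M.M.gr_smult)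
    show "carrier (shift M) \<subseteq> hsums (shift M)"
    proof
      fix x assume "x \<in> carrier (shift M)"
      then have "x \<in> carrier M" by simp
      then show "x \<in> hsums (shift M)"
      proof (induction rule: M.M.gr_induct)
        case (homogeneous d x)
        \<comment> \<open>Degree \<open>d\<close> of \<open>M\<close> is degree \<open>d + 1\<close>
          of \<open>shift M\<close>.\<close>
        then show ?case by (intro hsums.homogeneous[of _ _ "d + 1"]) simp
      next
        case (add x y)
        then show ?case using hsums.add[of x "shift M" y] by simp
      qed
    qed
    show "addmap (shift M) (shift M) (\<lambda>x. hcomp M x (d - 1))" for d
      using M.M.addmap_hcomp[of "d - 1"] by (simp add: addmap_def)
  qed (auto simp: M.M.hcomp_homogeneous)
  then show ?thesis
    by (intro left_gmod.intro left_gmod_axioms.intro M.A.graded_algebra_axioms)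
      (auto simp: M.act_closed M.act_add_right M.act_add_left M.act_mult M.act_one M.act_smult_left M.act_smult_right
        add_diff_eq[symmetric] intro: M.gr_act)
qed

lemma gdim_shift:
  fixes T :: "('k, 'v, 'y) gspace_scheme" and T' :: "('k, 'v, 'z) gspace_scheme"
  assumes T: "graded_space K T" "vectorspace.fin_dim K T" and T': "graded_space K T'"
    and eq: "carrier T' = carrier T" "add T' = add T" "\<zero>\<^bsub>T'\<^esub> = \<zero>\<^bsub>T\<^esub>" "Module.smult T' = Module.smult T"
      "\<And>d. gr T' d = gr T (d - 1)"
  shows "gdim K T' = q * gdim K T"
proof (rule poly_mapping_eqI)
  fix d
  interpret T: graded_space K T by fact
  interpret T': graded_space K T' by fact
  have "vectorspace.fin_dim K T'"
    by (rule fin_dim_image[OF T.vectorspace_axioms T'.vectorspace_axioms _ T(2), of "\<lambda>x. x"]) (simp_all add: module_hom_def eq)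
  moreover have "vectorspace.dim K (T\<lparr>carrier := gr T (d - 1)\<rparr>) = vectorspace.dim K (T'\<lparr>carrier := gr T' d\<rparr>)"
    by (rule dim_iso[OF T.gr_vectorspace T'.gr_vectorspace _ T.gr_fin_dim[OF T(2)], of "\<lambda>x. x"])
      (simp_all add: module_hom_def eq bij_betw_def)
  ultimately show "Poly_Mapping.lookup (gdim K T') d = Poly_Mapping.lookup (q * gdim K T) d"
    using T(2) by (simp add: T.lookup_gdim T'.lookup_gdim lookup_q_mult)
qed

context anti_galg
begin

text \<open>Relations and carrier are those of the unshifted product; only the degrees of the
  homogeneous generators move by one.\<close>

lemma pairing_shift_left:
  assumes P: "fg_projective K A P" and M: "left_gmod K A M" "vectorspace.fin_dim K M"
  shows "gdim K (mtensor A (twist \<psi> (shift P)) M) = q * gdim K (mtensor A (twist \<psi> P) M)"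
proof -
  note Pl = fg_projective_left_gmod[OF P]
  interpret G: gtensor K A "twist \<psi> P" M by (rule gtensor_twist[OF Pl M(1)])
  interpret G': gtensor K A "twist \<psi> (shift P)" M by (rule gtensor_twist[OF left_gmod_shift[OF Pl] M(1)])
  have a: "act (twist \<psi> (shift P)) = act (twist \<psi> P)" by (simp add: twist_def)
  have r: "trels (carrier A) (act (twist \<psi> P)) (act M) (twist \<psi> (shift P)) M = trels (carrier A) (act (twist \<psi> P)) (act M) (twist \<psi> P) M"
    by (simp add: trels_def)
  have g: "{frag_of (m, n) |m n i j. m \<in> gr P (i - 1) \<and> n \<in> gr M j \<and> i + j = d} =
      {frag_of (m, n) |m n i j. m \<in> gr P i \<and> n \<in> gr M j \<and> i + j = d - 1}" for d
  proof (intro equalityI subsetI; elim CollectE exE conjE)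
    fix x m n i j assume "x = frag_of (m, n)" "m \<in> gr P (i - 1)" "n \<in> gr M j" "i + j = d"
    then show "x \<in> {frag_of (m, n) |m n i j. m \<in> gr P i \<and> n \<in> gr M j \<and> i + j = d - 1}"
      by (intro CollectI exI[of _ m] exI[of _ n] exI[of _ "i - 1"] exI[of _ j]) simp
  next
    fix x m n i j assume "x = frag_of (m, n)" "m \<in> gr P i" "n \<in> gr M j" "i + j = d - 1"
    then show "x \<in> {frag_of (m, n) |m n i j. m \<in> gr P (i - 1) \<and> n \<in> gr M j \<and> i + j = d}"
      by (intro CollectI exI[of _ m] exI[of _ n] exI[of _ "i + 1"] exI[of _ j]) simp
  qed
  have t: "tensor_map H (twist \<psi> (shift P)) M f h = tensor_map H (twist \<psi> P) M f h" for H f h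
    by (simp add: tensor_map_def fun_eq_iff)
  show ?thesis
  proof (rule gdim_shift[OF G.graded_space_T fin_dim_pairing[OF P M] G'.graded_space_T])
    show "gr G'.T d = gr G.T (d - 1)" for d
      unfolding G'.gr_T G.gr_T unfolding a r by (simp only: twist_simps shift_simps g)
  qed (simp_all add: tensor_def Let_def tensor_rels_eq a r t)
qed

lemma pairing_shift_right:
  assumes P: "fg_projective K A P" and M: "left_gmod K A M" "vectorspace.fin_dim K M"
  shows "gdim K (mtensor A (twist \<psi> P) (shift M)) = q * gdim K (mtensor A (twist \<psi> P) M)"
proof -
  note Pl = fg_projective_left_gmod[OF P]
  interpret G: gtensor K A "twist \<psi> P" M by (rule gtensor_twist[OF Pl M(1)])
  interpret G': gtensor K A "twist \<psi> P" "shift M" by (rule gtensor_twist[OF Pl left_gmod_shift[OF M(1)]])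
  have r: "trels (carrier A) (act (twist \<psi> P)) (act M) (twist \<psi> P) (shift M) = trels (carrier A) (act (twist \<psi> P)) (act M) (twist \<psi> P) M"
    by (simp add: trels_def)
  have g: "{frag_of (m, n) |m n i j. m \<in> gr P i \<and> n \<in> gr M (j - 1) \<and> i + j = d} =
      {frag_of (m, n) |m n i j. m \<in> gr P i \<and> n \<in> gr M j \<and> i + j = d - 1}" for d
  proof (intro equalityI subsetI; elim CollectE exE conjE)
    fix x m n i j assume "x = frag_of (m, n)" "m \<in> gr P i" "n \<in> gr M (j - 1)" "i + j = d"
    then show "x \<in> {frag_of (m, n) |m n i j. m \<in> gr P i \<and> n \<in> gr M j \<and> i + j = d - 1}"
      by (intro CollectI exI[of _ m] exI[of _ n] exI[of _ i] exI[of _ "j - 1"]) simp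
  next
    fix x m n i j assume "x = frag_of (m, n)" "m \<in> gr P i" "n \<in> gr M j" "i + j = d - 1"
    then show "x \<in> {frag_of (m, n) |m n i j. m \<in> gr P i \<and> n \<in> gr M (j - 1) \<and> i + j = d}"
      by (intro CollectI exI[of _ m] exI[of _ n] exI[of _ i] exI[of _ "j + 1"]) simp
  qed
  have t: "tensor_map H (twist \<psi> P) (shift M) f h = tensor_map H (twist \<psi> P) M f h" for H f h
    by (simp add: tensor_map_def fun_eq_iff)
  have a: "act (shift M) = act M" by simp
  show ?thesis
  proof (rule gdim_shift[OF G.graded_space_T fin_dim_pairing[OF P M] G'.graded_space_T])
    show "gr G'.T d = gr G.T (d - 1)" for d
      unfolding G'.gr_T G.gr_T unfolding a r by (simp only: twist_simps shift_simps g)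
  qed (simp_all add: tensor_def Let_def tensor_rels_eq r t)
qed

end


section \<open>Adjunction of induction and restriction\<close>

text \<open>In a tower \<open>\<chi>\<close> is \<open>psi2\<close>. The assumption
  \<open>compat\<close> lets restriction along \<open>\<rho>\<close> and twisting be
  interchanged.\<close>

locale adj_data = Cx: anti_galg K C \<psi> + Bx: anti_galg K B \<chi> + Rr: left_gmod K "opposite B" "right_reg \<rho> C"
  for K :: "'k ring" and B :: "('k, 'b) gspace" and C :: "('k, 'c) gspace" and \<rho> :: "'b \<Rightarrow> 'c" and \<psi> \<chi> +
  assumes rho: "\<rho> \<in> galg_hom K B C"
    and compat: "b \<in> carrier B \<Longrightarrow> \<psi> (\<rho> b) = \<rho> (\<chi> b)"
begin

lemma ind_data: "left_gmod K B N \<Longrightarrow> ind_data K B C \<rho> N"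
  by (simp add: ind_data_def ind_data_axioms_def gtensor_def rho Cx.graded_algebra_axioms Rr.left_gmod_axioms)

lemma left_gmod_Res': "left_gmod K C M \<Longrightarrow> left_gmod K B (Res \<rho> M)"
  by (rule left_gmod_Res[OF Bx.graded_algebra_axioms rho])

text \<open>The inverse sends \<open>(c \<otimes> n) \<otimes> m\<close> to
  \<open>n \<otimes> \<psi>i c m\<close>, where \<open>\<psi>i\<close> is the inverse of
  \<open>\<psi>\<close>. It is lifted in two stages: for fixed \<open>m\<close> the map
  \<open>\<beta> m\<close> is defined on the induced module, and then \<open>\<alpha>\<close> is
  lifted from the resulting biadditive map.\<close>

lemma pairing_Ind_left:
  assumes N: "fg_projective K B N" and M: "left_gmod K C M" "vectorspace.fin_dim K M"
  shows "gdim K (mtensor C (twist \<psi> (Ind \<rho> B C N)) M) = gdim K (mtensor B (twist \<chi> N) (Res \<rho> M))"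
proof -
  note Nl = fg_projective_left_gmod[OF N]
  interpret I: ind_data K B C \<rho> N by (rule ind_data[OF Nl])
  interpret M: left_gmod K C M by (rule M(1))
  interpret S: gtensor K C "twist \<psi> I.I" M by (rule Cx.gtensor_twist[OF I.left_gmod_Ind M(1)])
  interpret T: gtensor K B "twist \<chi> N" "Res \<rho> M" by (rule Bx.gtensor_twist[OF Nl left_gmod_Res'[OF M(1)]])
  note h = galg_homD[OF rho] and c = galg_homD[OF Bx.psi_hom] and p = galg_homD[OF Cx.psi_hom]
  have Tb: "T.tn (act N (\<chi> b) n) m = T.tn n (act M (\<rho> b) m)" if "b \<in> carrier B" "n \<in> carrier N" "m \<in> carrier M" for b n m
    using T.tn_balanced[of b n m] that by (simp add: act_twist act_Res)
  have Sb: "S.tn (act I.I (\<psi> a) z) m = S.tn z (act M a m)" if "a \<in> carrier C" "z \<in> carrier I.T" "m \<in> carrier M" for a z m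
    using S.tn_balanced[of a z m] that by (simp add: act_twist)
  \<comment> \<open>Compatibility with \<open>\<rho>\<close> passes to the inverse
    anti-automorphisms; balancing of \<open>\<beta> m\<close> over \<open>B\<close> rests on
    it.\<close>
  have rchi: "Cx.\<psi>i (\<rho> b) = \<rho> (Bx.\<psi>i b)" if "b \<in> carrier B" for b
    by (rule Cx.psi_inv_eqI) (use that compat[of "Bx.\<psi>i b"] in \<open>simp_all add: Bx.psi_inv h(1)\<close>)
  have 1: "\<exists>\<beta>. addmap I.T T.T \<beta> \<and> (\<forall>a n. a \<in> carrier (right_reg \<rho> C) \<longrightarrow> n \<in> carrier N \<longrightarrow> \<beta> (I.tn a n) = T.tn n (act M (Cx.\<psi>i a) m))"
    if m: "m \<in> carrier M" for m
  proof (rule I.lift_ex[OF T.abelian_group_T])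
    show "addmap (right_reg \<rho> C) T.T (\<lambda>a. T.tn n (act M (Cx.\<psi>i a) m))" if n: "n \<in> carrier N" for n
    proof -
      have "addmap C (Res \<rho> M) (\<lambda>a. act M (Cx.\<psi>i a) m)"
        using addmap_comp[OF Cx.addmap_psi_inv M.addmap_act_left[OF m]] by (simp add: addmap_def)
      from addmap_comp[OF this T.addmap_tn_right] n show ?thesis by (simp add: addmap_def)
    qed
    show "addmap N T.T (\<lambda>n. T.tn n (act M (Cx.\<psi>i a) m))" if "a \<in> carrier (right_reg \<rho> C)" for a
      using T.addmap_tn_left[of "act M (Cx.\<psi>i a) m"] that m by (simp add: addmap_def M.act_closed Cx.psi_inv)
    show "T.tn n (act M (Cx.\<psi>i (act (right_reg \<rho> C) b a)) m) = T.tn (act N b n) (act M (Cx.\<psi>i a) m)"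
      if "b \<in> carrier B" "a \<in> carrier (right_reg \<rho> C)" "n \<in> carrier N" for b a n
      using Tb[of "Bx.\<psi>i b" n "act M (Cx.\<psi>i a) m"] that m
      by (simp add: act_right_reg Cx.psi_inv_mult h(1) rchi Bx.psi_inv M.act_mult Cx.psi_inv M.act_closed)
  qed
  then obtain \<beta> where \<beta>: "\<And>m. m \<in> carrier M \<Longrightarrow> addmap I.T T.T (\<beta> m)"
    "\<And>m a n. m \<in> carrier M \<Longrightarrow> a \<in> carrier C \<Longrightarrow> n \<in> carrier N \<Longrightarrow> \<beta> m (I.tn a n) = T.tn n (act M (Cx.\<psi>i a) m)"
    unfolding right_reg_simps by metis
  have \<beta>m: "addmap M T.T (\<lambda>m. \<beta> m z)" if z: "z \<in> carrier I.T" for z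
  proof (rule addmapI)
    fix m m' assume m: "m \<in> carrier M" "m' \<in> carrier M"
    show "\<beta> (m \<oplus>\<^bsub>M\<^esub> m') z = \<beta> m z \<oplus>\<^bsub>T.T\<^esub> \<beta> m' z"
    proof (rule I.tensor_ext[OF \<beta>(1) addmap_plus[OF T.abelian_group_T \<beta>(1)[OF m(1)] \<beta>(1)[OF m(2)]] z])
      fix a n assume an: "a \<in> carrier (right_reg \<rho> C)" "n \<in> carrier N"
      have "T.tn n (act M (Cx.\<psi>i a) m \<oplus>\<^bsub>M\<^esub> act M (Cx.\<psi>i a) m') = T.tn n (act M (Cx.\<psi>i a) m) \<oplus>\<^bsub>T.T\<^esub> T.tn n (act M (Cx.\<psi>i a) m')"
        using T.tn_add_right[of n "act M (Cx.\<psi>i a) m'" "act M (Cx.\<psi>i a) m"] an m by (simp add: M.act_closed Cx.psi_inv)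
      then show "\<beta> (m \<oplus>\<^bsub>M\<^esub> m') (I.tn a n) = \<beta> m (I.tn a n) \<oplus>\<^bsub>T.T\<^esub> \<beta> m' (I.tn a n)"
        using an m by (simp add: \<beta>(2) M.act_add_right Cx.psi_inv)
    qed (use m in simp)
  qed (use addmap_closed[OF \<beta>(1) z] in simp)
  have "\<exists>\<alpha>. addmap S.T T.T \<alpha> \<and> (\<forall>z m. z \<in> carrier (twist \<psi> I.I) \<longrightarrow> m \<in> carrier M \<longrightarrow> \<alpha> (S.tn z m) = \<beta> m z)"
  proof (rule S.lift_ex[OF T.abelian_group_T])
    show "addmap (twist \<psi> I.I) T.T (\<lambda>z. \<beta> m z)" if "m \<in> carrier M" for m
      using \<beta>(1)[OF that] by (simp add: addmap_def)
    show "addmap M T.T (\<lambda>m. \<beta> m z)" if "z \<in> carrier (twist \<psi> I.I)" for z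
      using \<beta>m that by simp
    show "\<beta> m (act (twist \<psi> I.I) a z) = \<beta> (act M a m) z"
      if a: "a \<in> carrier C" and z': "z \<in> carrier (twist \<psi> I.I)" and m: "m \<in> carrier M" for a z m
    proof -
      have z: "z \<in> carrier I.T" using z' by simp
      have am: "act M a m \<in> carrier M" by (rule M.act_closed[OF a m])
      have pa: "\<psi> a \<in> carrier C" using p(1)[OF a] by simp
      have "\<beta> m (act I.I (\<psi> a) z) = \<beta> (act M a m) z"
      proof (rule I.tensor_ext[OF addmap_comp[OF I.act_Ind_right[OF pa] \<beta>(1)[OF m]] \<beta>(1)[OF am] z])
        fix b n assume bn: "b \<in> carrier (right_reg \<rho> C)" "n \<in> carrier N"
        then show "\<beta> m (act I.I (\<psi> a) (I.tn b n)) = \<beta> (act M a m) (I.tn b n)"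
          using a m am pa by (simp add: I.act_Ind_pure \<beta>(2) Cx.psi_inv_mult Cx.psi_inv M.act_mult)
      qed
      then show ?thesis by (simp add: act_twist)
    qed
  qed
  then obtain \<alpha> where \<alpha>: "addmap S.T T.T \<alpha>" "\<And>z m. z \<in> carrier I.T \<Longrightarrow> m \<in> carrier M \<Longrightarrow> \<alpha> (S.tn z m) = \<beta> m z"
    unfolding twist_simps I.Ind_simps by blast
  have one: "I.tn \<one>\<^bsub>C\<^esub> n \<in> carrier I.T" if "n \<in> carrier N" for n by (rule I.tn_c[OF Cx.one_closed that])
  have "\<exists>\<gamma>. addmap T.T S.T \<gamma> \<and> (\<forall>n m. n \<in> carrier (twist \<chi> N) \<longrightarrow> m \<in> carrier (Res \<rho> M) \<longrightarrow> \<gamma> (T.tn n m) = S.tn (I.tn \<one>\<^bsub>C\<^esub> n) m)"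
  proof (rule T.lift_ex[OF S.abelian_group_T])
    show "addmap (twist \<chi> N) S.T (\<lambda>n. S.tn (I.tn \<one>\<^bsub>C\<^esub> n) m)" if "m \<in> carrier (Res \<rho> M)" for m
      using addmap_comp[OF I.addmap_tn_right[of "\<one>\<^bsub>C\<^esub>"], of S.T "\<lambda>z. S.tn z m"] S.addmap_tn_left[of m] that by (simp add: addmap_def)
    show "addmap (Res \<rho> M) S.T (\<lambda>m. S.tn (I.tn \<one>\<^bsub>C\<^esub> n) m)" if "n \<in> carrier (twist \<chi> N)" for n
      using S.addmap_tn_right[of "I.tn \<one>\<^bsub>C\<^esub> n"] that one by (simp add: addmap_def)
    show "S.tn (I.tn \<one>\<^bsub>C\<^esub> (act (twist \<chi> N) b n)) m = S.tn (I.tn \<one>\<^bsub>C\<^esub> n) (act (Res \<rho> M) b m)"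
      if "b \<in> carrier B" "n \<in> carrier (twist \<chi> N)" "m \<in> carrier (Res \<rho> M)" for b n m
    proof -
      have cb: "\<chi> b \<in> carrier B" using c(1)[OF that(1)] by simp
      \<comment> \<open>Balancing of \<open>\<gamma>\<close>: pulling \<open>\<chi> b\<close> out of
        the second slot yields \<open>\<rho> (\<chi> b)\<close>, and \<open>compat\<close> rewrites
        it as \<open>\<psi> (\<rho> b)\<close>, which is how \<open>\<rho> b\<close> acts on the
        twisted module.\<close>
      have "I.tn \<one>\<^bsub>C\<^esub> (act N (\<chi> b) n) = act I.I (\<psi> (\<rho> b)) (I.tn \<one>\<^bsub>C\<^esub> n)"
        using I.tn_bal[of "\<chi> b" "\<one>\<^bsub>C\<^esub>" n] that cb h(1)[OF cb] by (simp add: I.act_Ind_pure compat)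
      then show ?thesis using Sb[of "\<rho> b" "I.tn \<one>\<^bsub>C\<^esub> n" m] that h(1) one by (simp add: act_twist act_Res)
    qed
  qed
  then obtain \<gamma> where \<gamma>: "addmap T.T S.T \<gamma>" "\<And>n m. n \<in> carrier N \<Longrightarrow> m \<in> carrier M \<Longrightarrow> \<gamma> (T.tn n m) = S.tn (I.tn \<one>\<^bsub>C\<^esub> n) m"
    unfolding twist_simps Res_simps by blast
  have ag: "\<alpha> (\<gamma> z) = z" if "z \<in> carrier T.T" for z
    by (rule T.tensor_ext[OF addmap_comp[OF \<gamma>(1) \<alpha>(1)] addmap_id that])
      (simp add: \<gamma>(2) \<alpha>(2) \<beta>(2) one Cx.psi_inv_one M.act_one)
  have ga: "\<gamma> (\<alpha> z) = z" if "z \<in> carrier S.T" for z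
  proof (rule S.tensor_ext[OF addmap_comp[OF \<alpha>(1) \<gamma>(1)] addmap_id that])
    fix y m assume y: "y \<in> carrier (twist \<psi> I.I)" and m: "m \<in> carrier M"
    have "\<gamma> (\<beta> m y) = S.tn y m"
    proof (rule I.tensor_ext[OF addmap_comp[OF \<beta>(1)[OF m] \<gamma>(1)]])
      show "addmap I.T S.T (\<lambda>y. S.tn y m)" using S.addmap_tn_left[OF m] by (simp add: addmap_def)
      show "y \<in> carrier I.T" using y by simp
      fix a n assume an: "a \<in> carrier (right_reg \<rho> C)" "n \<in> carrier N"
      have "act I.I (\<psi> (Cx.\<psi>i a)) (I.tn \<one>\<^bsub>C\<^esub> n) = I.tn a n" using an by (simp add: Cx.psi_inv I.act_Ind_pure)
      then show "\<gamma> (\<beta> m (I.tn a n)) = S.tn (I.tn a n) m"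
        using Sb[of "Cx.\<psi>i a" "I.tn \<one>\<^bsub>C\<^esub> n" m] an m one by (simp add: \<beta>(2) \<gamma>(2) M.act_closed Cx.psi_inv)
    qed
    then show "\<gamma> (\<alpha> (S.tn y m)) = S.tn y m" using y m by (simp add: \<alpha>(2))
  qed
  have bij: "bij_betw \<gamma> (carrier T.T) (carrier S.T)"
    using addmap_closed[OF \<gamma>(1)] addmap_closed[OF \<alpha>(1)] ag ga by (intro bij_betw_byWitness[of _ \<alpha>]) auto
  have "\<gamma> \<in> module_hom K T.T S.T"
  proof (rule T.module_homI[OF S.vectorspace_T \<gamma>(1)])
    fix k n m assume k: "k \<in> carrier K" "n \<in> carrier (twist \<chi> N)" "m \<in> carrier (Res \<rho> M)"
    have kn: "k \<odot>\<^bsub>N\<^esub> n \<in> carrier N" using k I.R.M.smult_closed by simp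
    have "I.tn \<one>\<^bsub>C\<^esub> (k \<odot>\<^bsub>N\<^esub> n) = k \<odot>\<^bsub>I.T\<^esub> I.tn \<one>\<^bsub>C\<^esub> n"
      using I.smult_tn[of k "\<one>\<^bsub>C\<^esub>" n] I.tn_smult[of k "\<one>\<^bsub>C\<^esub>" n] k by simp
    then show "\<gamma> (T.tn (k \<odot>\<^bsub>twist \<chi> N\<^esub> n) m) = k \<odot>\<^bsub>S.T\<^esub> \<gamma> (T.tn n m)"
      using k kn one S.smult_tn[of k "I.tn \<one>\<^bsub>C\<^esub> n" m] by (simp add: \<gamma>(2))
  qed
  moreover have "graded_map T.T S.T \<gamma>"
  proof (rule T.graded_mapI[OF S.graded_space_T \<gamma>(1)])
    fix n m i j assume nm: "n \<in> gr (twist \<chi> N) i" "m \<in> gr (Res \<rho> M) j"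
    have "I.tn \<one>\<^bsub>C\<^esub> n \<in> gr I.T i" by (rule I.tn_gr[of _ 0 _ i]) (use nm Cx.gr_one in simp_all)
    then have "S.tn (I.tn \<one>\<^bsub>C\<^esub> n) m \<in> gr S.T (i + j)" by (intro S.tn_gr[of _ i _ j]) (use nm in simp_all)
    then show "\<gamma> (T.tn n m) \<in> gr S.T (i + j)" using nm I.R.M.gr_carrier[of n i] M.M.gr_carrier[of m j] by (simp add: \<gamma>(2))
  qed
  moreover have "vectorspace.fin_dim K T.T"
    by (rule Bx.fin_dim_pairing[OF N left_gmod_Res'[OF M(1)] fin_dim_cong[OF M.M.graded_space_axioms _ _ _ _ _ M(2)]]) simp_all
  ultimately show ?thesis using gdim_iso[OF T.graded_space_T S.graded_space_T _ _ bij] by simp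
qed

text \<open>This is cancellation of the middle factor: the maps are
  \<open>x \<otimes> n \<mapsto> x \<otimes> (1 \<otimes> n)\<close> and
  \<open>x \<otimes> (c \<otimes> n) \<mapsto> \<psi> c x \<otimes> n\<close>. By
  \<open>compat\<close> the restriction of the twisted module is the twist of the restricted
  one.\<close>

lemma pairing_Ind_right:
  assumes P: "fg_projective K C P" "fg_projective K B (Res \<rho> P)" and N: "left_gmod K B N" "vectorspace.fin_dim K N"
  shows "gdim K (mtensor C (twist \<psi> P) (Ind \<rho> B C N)) = gdim K (mtensor B (twist \<chi> (Res \<rho> P)) N)"
proof -
  note Pl = fg_projective_left_gmod[OF P(1)]
  interpret I: ind_data K B C \<rho> N by (rule ind_data[OF N(1)])
  interpret P: left_gmod K C P by (rule Pl)
  interpret S: gtensor K C "twist \<psi> P" I.I by (rule Cx.gtensor_twist[OF Pl I.left_gmod_Ind])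
  interpret T: gtensor K B "twist \<chi> (Res \<rho> P)" N by (rule Bx.gtensor_twist[OF left_gmod_Res'[OF Pl] N(1)])
  note h = galg_homD[OF rho] and p = galg_homD[OF Cx.psi_hom]
  have pc: "\<psi> a \<in> carrier C" if "a \<in> carrier C" for a using p(1)[OF that] by simp
  have Tb: "T.tn (act P (\<psi> (\<rho> b)) x) n = T.tn x (act N b n)" if "b \<in> carrier B" "x \<in> carrier P" "n \<in> carrier N" for b n x
    using T.tn_balanced[of b x n] that by (simp add: act_twist act_Res compat)
  have Sb: "S.tn (act P (\<psi> a) x) z = S.tn x (act I.I a z)" if "a \<in> carrier C" "z \<in> carrier I.T" "x \<in> carrier P" for a z x
    using S.tn_balanced[of a x z] that by (simp add: act_twist)
  have 1: "\<exists>\<beta>. addmap I.T T.T \<beta> \<and> (\<forall>a n. a \<in> carrier (right_reg \<rho> C) \<longrightarrow> n \<in> carrier N \<longrightarrow> \<beta> (I.tn a n) = T.tn (act P (\<psi> a) x) n)"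
    if x: "x \<in> carrier P" for x
  proof (rule I.lift_ex[OF T.abelian_group_T])
    show "addmap (right_reg \<rho> C) T.T (\<lambda>a. T.tn (act P (\<psi> a) x) n)" if n: "n \<in> carrier N" for n
    proof -
      have "addmap C (twist \<chi> (Res \<rho> P)) (\<lambda>a. act P (\<psi> a) x)"
        using p(3) pc P.act_add_left x by (auto simp: addmap_def P.act_closed)
      from addmap_comp[OF this T.addmap_tn_left[OF n]] show ?thesis by (simp add: addmap_def)
    qed
    show "addmap N T.T (\<lambda>n. T.tn (act P (\<psi> a) x) n)" if "a \<in> carrier (right_reg \<rho> C)" for a
      using T.addmap_tn_right[of "act P (\<psi> a) x"] that x pc by (simp add: P.act_closed)
    show "T.tn (act P (\<psi> (act (right_reg \<rho> C) b a)) x) n = T.tn (act P (\<psi> a) x) (act N b n)"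
      if "b \<in> carrier B" "a \<in> carrier (right_reg \<rho> C)" "n \<in> carrier N" for b a n
      using Tb[of b "act P (\<psi> a) x" n] that x pc p(2)[of a "\<rho> b"]
      by (simp add: act_right_reg h(1) P.act_mult P.act_closed)
  qed
  then obtain \<beta> where \<beta>: "\<And>x. x \<in> carrier P \<Longrightarrow> addmap I.T T.T (\<beta> x)"
    "\<And>x a n. x \<in> carrier P \<Longrightarrow> a \<in> carrier C \<Longrightarrow> n \<in> carrier N \<Longrightarrow> \<beta> x (I.tn a n) = T.tn (act P (\<psi> a) x) n"
    unfolding right_reg_simps by metis
  have \<beta>x: "addmap (twist \<psi> P) T.T (\<lambda>x. \<beta> x z)" if z: "z \<in> carrier I.T" for z
  proof (rule addmapI)
    fix x y assume "x \<in> carrier (twist \<psi> P)" "y \<in> carrier (twist \<psi> P)"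
    then have x: "x \<in> carrier P" and y: "y \<in> carrier P" by simp_all
    have "\<beta> (x \<oplus>\<^bsub>P\<^esub> y) z = \<beta> x z \<oplus>\<^bsub>T.T\<^esub> \<beta> y z"
    proof (rule I.tensor_ext[OF \<beta>(1) addmap_plus[OF T.abelian_group_T \<beta>(1)[OF x] \<beta>(1)[OF y]] z])
      fix a n assume an: "a \<in> carrier (right_reg \<rho> C)" "n \<in> carrier N"
      then show "\<beta> (x \<oplus>\<^bsub>P\<^esub> y) (I.tn a n) = \<beta> x (I.tn a n) \<oplus>\<^bsub>T.T\<^esub> \<beta> y (I.tn a n)"
        using x y T.tn_add_left[of "act P (\<psi> a) x" "act P (\<psi> a) y" n] by (simp add: \<beta>(2) P.act_add_right pc P.act_closed)
    qed (use x y in simp)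
    then show "\<beta> (x \<oplus>\<^bsub>twist \<psi> P\<^esub> y) z = \<beta> x z \<oplus>\<^bsub>T.T\<^esub> \<beta> y z" by simp
  qed (use addmap_closed[OF \<beta>(1) z] in simp)
  have "\<exists>\<alpha>. addmap S.T T.T \<alpha> \<and> (\<forall>x z. x \<in> carrier (twist \<psi> P) \<longrightarrow> z \<in> carrier I.I \<longrightarrow> \<alpha> (S.tn x z) = \<beta> x z)"
  proof (rule S.lift_ex[OF T.abelian_group_T])
    show "addmap (twist \<psi> P) T.T (\<lambda>x. \<beta> x z)" if "z \<in> carrier I.I" for z using \<beta>x that by simp
    show "addmap I.I T.T (\<beta> x)" if "x \<in> carrier (twist \<psi> P)" for x using \<beta>(1)[of x] that by (simp add: addmap_def)
    show "\<beta> (act (twist \<psi> P) a x) z = \<beta> x (act I.I a z)"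
      if a: "a \<in> carrier C" and x': "x \<in> carrier (twist \<psi> P)" and z': "z \<in> carrier I.I" for a z x
    proof -
      have x: "x \<in> carrier P" and z: "z \<in> carrier I.T" using x' z' by simp_all
      have ax: "act P (\<psi> a) x \<in> carrier P" by (rule P.act_closed[OF pc[OF a] x])
      have "\<beta> (act P (\<psi> a) x) z = \<beta> x (act I.I a z)"
      proof (rule I.tensor_ext[OF \<beta>(1)[OF ax] addmap_comp[OF I.act_Ind_right[OF a] \<beta>(1)[OF x]] z])
        fix b n assume bn: "b \<in> carrier (right_reg \<rho> C)" "n \<in> carrier N"
        then show "\<beta> (act P (\<psi> a) x) (I.tn b n) = \<beta> x (act I.I a (I.tn b n))"
          using a x ax pc p(2)[of a b] by (simp add: I.act_Ind_pure \<beta>(2) P.act_mult)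
      qed
      then show ?thesis by (simp add: act_twist)
    qed
  qed
  then obtain \<alpha> where \<alpha>: "addmap S.T T.T \<alpha>" "\<And>x z. x \<in> carrier P \<Longrightarrow> z \<in> carrier I.T \<Longrightarrow> \<alpha> (S.tn x z) = \<beta> x z"
    unfolding twist_simps I.Ind_simps by blast
  have one: "I.tn \<one>\<^bsub>C\<^esub> n \<in> carrier I.T" if "n \<in> carrier N" for n by (rule I.tn_c[OF Cx.one_closed that])
  have "\<exists>\<gamma>. addmap T.T S.T \<gamma> \<and> (\<forall>x n. x \<in> carrier (twist \<chi> (Res \<rho> P)) \<longrightarrow> n \<in> carrier N \<longrightarrow> \<gamma> (T.tn x n) = S.tn x (I.tn \<one>\<^bsub>C\<^esub> n))"
  proof (rule T.lift_ex[OF S.abelian_group_T])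
    show "addmap (twist \<chi> (Res \<rho> P)) S.T (\<lambda>x. S.tn x (I.tn \<one>\<^bsub>C\<^esub> n))" if "n \<in> carrier N" for n
      using S.addmap_tn_left[of "I.tn \<one>\<^bsub>C\<^esub> n"] that one by (simp add: addmap_def)
    show "addmap N S.T (\<lambda>n. S.tn x (I.tn \<one>\<^bsub>C\<^esub> n))" if "x \<in> carrier (twist \<chi> (Res \<rho> P))" for x
      using addmap_comp[OF I.addmap_tn_right[of "\<one>\<^bsub>C\<^esub>"], of S.T "\<lambda>z. S.tn x z"] S.addmap_tn_right[of x] that by (simp add: addmap_def)
    show "S.tn (act (twist \<chi> (Res \<rho> P)) b x) (I.tn \<one>\<^bsub>C\<^esub> n) = S.tn x (I.tn \<one>\<^bsub>C\<^esub> (act N b n))"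
      if "b \<in> carrier B" "x \<in> carrier (twist \<chi> (Res \<rho> P))" "n \<in> carrier N" for b x n
    proof -
      have "I.tn \<one>\<^bsub>C\<^esub> (act N b n) = act I.I (\<rho> b) (I.tn \<one>\<^bsub>C\<^esub> n)"
        using I.tn_bal[of b "\<one>\<^bsub>C\<^esub>" n] that h(1)[OF that(1)] by (simp add: I.act_Ind_pure)
      then show ?thesis using Sb[of "\<rho> b" "I.tn \<one>\<^bsub>C\<^esub> n" x] that h(1) one by (simp add: act_twist act_Res compat)
    qed
  qed
  then obtain \<gamma> where \<gamma>: "addmap T.T S.T \<gamma>" "\<And>x n. x \<in> carrier P \<Longrightarrow> n \<in> carrier N \<Longrightarrow> \<gamma> (T.tn x n) = S.tn x (I.tn \<one>\<^bsub>C\<^esub> n)"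
    unfolding twist_simps Res_simps by blast
  have psi1: "\<psi> \<one>\<^bsub>C\<^esub> = \<one>\<^bsub>C\<^esub>" using p(4) by simp
  have ag: "\<alpha> (\<gamma> z) = z" if "z \<in> carrier T.T" for z
    by (rule T.tensor_ext[OF addmap_comp[OF \<gamma>(1) \<alpha>(1)] addmap_id that])
      (simp add: \<gamma>(2) \<alpha>(2) \<beta>(2) one psi1 P.act_one)
  have ga: "\<gamma> (\<alpha> z) = z" if "z \<in> carrier S.T" for z
  proof (rule S.tensor_ext[OF addmap_comp[OF \<alpha>(1) \<gamma>(1)] addmap_id that])
    fix x y assume x': "x \<in> carrier (twist \<psi> P)" and y': "y \<in> carrier I.I"
    then have x: "x \<in> carrier P" and y: "y \<in> carrier I.T" by simp_all
    have "\<gamma> (\<beta> x y) = S.tn x y"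
    proof (rule I.tensor_ext[OF addmap_comp[OF \<beta>(1)[OF x] \<gamma>(1)] _ y])
      show "addmap I.T S.T (\<lambda>y. S.tn x y)" using S.addmap_tn_right[OF x'] by (simp add: addmap_def)
      fix a n assume an: "a \<in> carrier (right_reg \<rho> C)" "n \<in> carrier N"
      have "act I.I a (I.tn \<one>\<^bsub>C\<^esub> n) = I.tn a n" using an by (simp add: I.act_Ind_pure)
      then show "\<gamma> (\<beta> x (I.tn a n)) = S.tn x (I.tn a n)"
        using Sb[of a "I.tn \<one>\<^bsub>C\<^esub> n" x] an x one pc by (simp add: \<beta>(2) \<gamma>(2) P.act_closed)
    qed
    then show "\<gamma> (\<alpha> (S.tn x y)) = S.tn x y" using x y by (simp add: \<alpha>(2))
  qed
  have bij: "bij_betw \<gamma> (carrier T.T) (carrier S.T)"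
    using addmap_closed[OF \<gamma>(1)] addmap_closed[OF \<alpha>(1)] ag ga by (intro bij_betw_byWitness[of _ \<alpha>]) auto
  have "\<gamma> \<in> module_hom K T.T S.T"
  proof (rule T.module_homI[OF S.vectorspace_T \<gamma>(1)])
    fix k x n assume k: "k \<in> carrier K" "x \<in> carrier (twist \<chi> (Res \<rho> P))" "n \<in> carrier N"
    then show "\<gamma> (T.tn (k \<odot>\<^bsub>twist \<chi> (Res \<rho> P)\<^esub> x) n) = k \<odot>\<^bsub>S.T\<^esub> \<gamma> (T.tn x n)"
      using one S.smult_tn[of k x "I.tn \<one>\<^bsub>C\<^esub> n"] P.M.smult_closed[of k x] by (simp add: \<gamma>(2))
  qed
  moreover have "graded_map T.T S.T \<gamma>"
  proof (rule T.graded_mapI[OF S.graded_space_T \<gamma>(1)])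
    fix x n i j assume nm: "x \<in> gr (twist \<chi> (Res \<rho> P)) i" "n \<in> gr N j"
    have "I.tn \<one>\<^bsub>C\<^esub> n \<in> gr I.T j" by (rule I.tn_gr[of _ 0 _ j]) (use nm Cx.gr_one in simp_all)
    then have "S.tn x (I.tn \<one>\<^bsub>C\<^esub> n) \<in> gr S.T (i + j)" by (intro S.tn_gr[of _ i _ j]) (use nm in simp_all)
    then show "\<gamma> (T.tn x n) \<in> gr S.T (i + j)" using nm I.R.M.gr_carrier[of n j] P.M.gr_carrier[of x i] by (simp add: \<gamma>(2))
  qed
  moreover have "vectorspace.fin_dim K T.T" by (rule Bx.fin_dim_pairing[OF P(2) N])
  ultimately show ?thesis using gdim_iso[OF T.graded_space_T S.graded_space_T _ _ bij] by simp
qed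

end

text \<open>\<open>\<psi>\<close> and \<open>\<chi>\<close> are linear over \<open>K\<close>, so
  their tensor product exists, and that of the inverses inverts it. Reversal of products is additive
  in either argument and is checked on pure tensors.\<close>

lemma anti_galg_tensor:
  assumes A: "anti_galg K A \<psi>" and B: "anti_galg K B \<chi>" and AB: "graded_algebra K (alg_tensor K A B)"
  shows "anti_galg K (alg_tensor K A B) (tensor_map (ktensor_rels K A B) A B \<psi> \<chi>)"
    and "\<lbrakk>a \<in> carrier A; b \<in> carrier B\<rbrakk> \<Longrightarrow> tensor_map (ktensor_rels K A B) A B \<psi> \<chi>
      (pt (carrier K) (Module.smult A) (Module.smult B) A B a b) = pt (carrier K) (Module.smult A) (Module.smult B) A B (\<psi> a) (\<chi> b)"
proof -
  interpret A: anti_galg K A \<psi> by fact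
  interpret B: anti_galg K B \<chi> by fact
  interpret AB: graded_algebra K "alg_tensor K A B" by fact
  have K: "field K" using A.vectorspace_axioms unfolding vectorspace_def by blast
  interpret U: kpair K A B by (simp add: kpair_def kpair_axioms_def K A.graded_space_axioms B.graded_space_axioms)
  note a = galg_homD[OF A.psi_hom, simplified] and b = galg_homD[OF B.psi_hom, simplified]
  have aa: "addmap A A \<psi>" and ba: "addmap B B \<chi>" using a(3) b(3) a(1) b(1) by (simp_all add: addmap_def)
  let ?t = "tensor_map (ktensor_rels K A B) A B \<psi> \<chi>" and ?s = "tensor_map (ktensor_rels K A B) A B A.\<psi>i B.\<psi>i"
  have t: "addmap U.T U.T ?t" "\<And>x y. x \<in> carrier A \<Longrightarrow> y \<in> carrier B \<Longrightarrow> ?t (U.tn x y) = U.tn (\<psi> x) (\<chi> y)"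
    by (rule U.tensor_map[OF aa ba]; simp add: a b U.tn_balanced)+
  have s: "addmap U.T U.T ?s" "\<And>x y. x \<in> carrier A \<Longrightarrow> y \<in> carrier B \<Longrightarrow> ?s (U.tn x y) = U.tn (A.\<psi>i x) (B.\<psi>i y)"
    by (rule U.tensor_map[OF A.addmap_psi_inv B.addmap_psi_inv]; simp add: A.psi_inv_smult B.psi_inv_smult A.psi_inv B.psi_inv U.tn_balanced)+
  show "\<lbrakk>a \<in> carrier A; b \<in> carrier B\<rbrakk> \<Longrightarrow> ?t (U.tn a b) = U.tn (\<psi> a) (\<chi> b)" by (rule t(2))
  have c: "carrier (alg_tensor K A B) = carrier U.T" "add (alg_tensor K A B) = add U.T" "Module.smult (alg_tensor K A B) = Module.smult U.T"
    "gr (alg_tensor K A B) = gr U.T" "\<one>\<^bsub>alg_tensor K A B\<^esub> = U.tn \<one>\<^bsub>A\<^esub> \<one>\<^bsub>B\<^esub>"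
    by (simp_all add: alg_tensor_def ptensor_eq)
  note tc = addmap_closed[OF t(1)]
  note m = mult_alg_tensor[OF A.graded_algebra_axioms B.graded_algebra_axioms AB]
  have ml: "addmap U.T U.T (\<lambda>x. x \<otimes>\<^bsub>alg_tensor K A B\<^esub> y)" "addmap U.T U.T (\<lambda>x. y \<otimes>\<^bsub>alg_tensor K A B\<^esub> x)" if "y \<in> carrier U.T" for y
    using that AB.l_distr AB.r_distr AB.m_closed by (auto intro!: addmapI simp: c)
  have mult: "?t (x \<otimes>\<^bsub>alg_tensor K A B\<^esub> y) = ?t y \<otimes>\<^bsub>alg_tensor K A B\<^esub> ?t x" if x: "x \<in> carrier U.T" and y: "y \<in> carrier U.T" for x y
  proof (rule U.tensor_ext[OF addmap_comp[OF ml(1)[OF y] t(1)] addmap_comp[OF t(1) ml(2)[OF tc[OF y]]] x])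
    fix a' b' assume ab: "a' \<in> carrier A" "b' \<in> carrier B"
    note abT = U.tn_closed[OF ab]
    show "?t (U.tn a' b' \<otimes>\<^bsub>alg_tensor K A B\<^esub> y) = ?t y \<otimes>\<^bsub>alg_tensor K A B\<^esub> ?t (U.tn a' b')"
      by (rule U.tensor_ext[OF addmap_comp[OF ml(2)[OF abT] t(1)] addmap_comp[OF t(1) ml(1)[OF tc[OF abT]]] y])
        (simp add: m ab t(2) a b)
  qed
  have sm: "?t (k \<odot>\<^bsub>U.T\<^esub> x) = k \<odot>\<^bsub>U.T\<^esub> ?t x" if "k \<in> carrier K" "x \<in> carrier U.T" for k x
    by (rule U.tensor_ext[OF addmap_comp[OF U.addmap_smult_kT[OF that(1)] t(1)] addmap_comp[OF t(1) U.addmap_smult_kT[OF that(1)]] that(2)])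
      (simp add: U.smult_kT that(1) t(2) a b)
  have gr: "graded_map U.T U.T ?t"
    by (rule U.kT_graded_mapI[OF U.graded_space_kT t(1)])
      (simp add: t(2) A.gr_carrier B.gr_carrier U.kT_gr a(6) b(6))
  have "?t \<in> galg_hom K (alg_tensor K A B) (opposite (alg_tensor K A B))"
    unfolding galg_hom_def ring_hom_def
    using tc addmap_add[OF t(1)] mult sm gr a(4) b(4)
    by (auto simp: c t(2) graded_map_def)
  moreover have "bij_betw ?t (carrier (alg_tensor K A B)) (carrier (alg_tensor K A B))"
  proof -
    have "?s (?t z) = z" if "z \<in> carrier U.T" for z
      by (rule U.tensor_ext[OF addmap_comp[OF t(1) s(1)] addmap_id that]) (simp add: t(2) s(2) a b A.psi_inv B.psi_inv)
    moreover have "?t (?s z) = z" if "z \<in> carrier U.T" for z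
      by (rule U.tensor_ext[OF addmap_comp[OF s(1) t(1)] addmap_id that]) (simp add: t(2) s(2) a b A.psi_inv B.psi_inv)
    ultimately show ?thesis
      unfolding c using tc addmap_closed[OF s(1)] by (intro bij_betw_byWitness[of _ ?s]) auto
  qed
  ultimately show "anti_galg K (alg_tensor K A B) ?t"
    by (simp add: anti_galg_def anti_galg_axioms_def AB)
qed


section \<open>Grothendieck groups\<close>

lemma field_facts:
  assumes "field K"
  shows "ring K" "\<one>\<^bsub>K\<^esub> \<in> carrier K" "\<zero>\<^bsub>K\<^esub> \<in> carrier K"
    "\<And>a b. \<lbrakk>a \<in> carrier K; b \<in> carrier K\<rbrakk> \<Longrightarrow> a \<oplus>\<^bsub>K\<^esub> b \<in> carrier K"
    "\<And>a b. \<lbrakk>a \<in> carrier K; b \<in> carrier K\<rbrakk> \<Longrightarrow> a \<otimes>\<^bsub>K\<^esub> b \<in> carrier K"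
    "\<And>a b c. \<lbrakk>a \<in> carrier K; b \<in> carrier K; c \<in> carrier K\<rbrakk> \<Longrightarrow> (a \<oplus>\<^bsub>K\<^esub> b) \<otimes>\<^bsub>K\<^esub> c = a \<otimes>\<^bsub>K\<^esub> c \<oplus>\<^bsub>K\<^esub> b \<otimes>\<^bsub>K\<^esub> c"
    "\<And>a b c. \<lbrakk>a \<in> carrier K; b \<in> carrier K; c \<in> carrier K\<rbrakk> \<Longrightarrow> c \<otimes>\<^bsub>K\<^esub> (a \<oplus>\<^bsub>K\<^esub> b) = c \<otimes>\<^bsub>K\<^esub> a \<oplus>\<^bsub>K\<^esub> c \<otimes>\<^bsub>K\<^esub> b"
    "\<And>a b c. \<lbrakk>a \<in> carrier K; b \<in> carrier K; c \<in> carrier K\<rbrakk> \<Longrightarrow> a \<otimes>\<^bsub>K\<^esub> b \<otimes>\<^bsub>K\<^esub> c = a \<otimes>\<^bsub>K\<^esub> (b \<otimes>\<^bsub>K\<^esub> c)"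
    "\<And>a b c. \<lbrakk>a \<in> carrier K; b \<in> carrier K; c \<in> carrier K\<rbrakk> \<Longrightarrow> a \<otimes>\<^bsub>K\<^esub> (b \<otimes>\<^bsub>K\<^esub> c) = b \<otimes>\<^bsub>K\<^esub> (a \<otimes>\<^bsub>K\<^esub> c)"
    "\<And>a. a \<in> carrier K \<Longrightarrow> \<one>\<^bsub>K\<^esub> \<otimes>\<^bsub>K\<^esub> a = a"
    "\<And>a. a \<in> carrier K \<Longrightarrow> a \<otimes>\<^bsub>K\<^esub> \<one>\<^bsub>K\<^esub> = a"
    "\<And>a. a \<in> carrier K \<Longrightarrow> \<zero>\<^bsub>K\<^esub> \<otimes>\<^bsub>K\<^esub> a = \<zero>\<^bsub>K\<^esub>"
    "\<And>a. a \<in> carrier K \<Longrightarrow> a \<otimes>\<^bsub>K\<^esub> \<zero>\<^bsub>K\<^esub> = \<zero>\<^bsub>K\<^esub>"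
proof -
  interpret field K by (rule assms)
  show "ring K" by (rule ring_axioms)
qed (use assms in \<open>simp_all add: field_def domain_def cring_def ring.ring_simprules comm_monoid.m_lcomm monoid.r_one comm_monoid.axioms\<close>)

section \<open>Algebras that consist of the scalars\<close>

locale scalar_galg = anti_galg K A \<psi> for K :: "'k ring" and A :: "('k, 'a) gspace" and \<psi> +
  assumes scalar: "bij_betw (\<lambda>c. c \<odot>\<^bsub>A\<^esub> \<one>\<^bsub>A\<^esub>) (carrier K) (carrier A)"
begin

lemma field_K: "field K"
  using vectorspace_axioms unfolding vectorspace_def by blast

abbreviation "\<kappa> \<equiv> inv_into (carrier K) (\<lambda>c. c \<odot>\<^bsub>A\<^esub> \<one>\<^bsub>A\<^esub>)"
abbreviation "E \<equiv> eta K A (ground K)"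

lemma kappa: "a \<in> carrier A \<Longrightarrow> \<kappa> a \<in> carrier K" "a \<in> carrier A \<Longrightarrow> \<kappa> a \<odot>\<^bsub>A\<^esub> \<one>\<^bsub>A\<^esub> = a"
proof -
  have im: "(\<lambda>c. c \<odot>\<^bsub>A\<^esub> \<one>\<^bsub>A\<^esub>) ` carrier K = carrier A" using scalar by (simp add: bij_betw_def)
  show "a \<in> carrier A \<Longrightarrow> \<kappa> a \<in> carrier K" "a \<in> carrier A \<Longrightarrow> \<kappa> a \<odot>\<^bsub>A\<^esub> \<one>\<^bsub>A\<^esub> = a"
    using inv_into_into[of a "\<lambda>c. c \<odot>\<^bsub>A\<^esub> \<one>\<^bsub>A\<^esub>" "carrier K"] f_inv_into_f[of a "\<lambda>c. c \<odot>\<^bsub>A\<^esub> \<one>\<^bsub>A\<^esub>" "carrier K"] unfolding im by simp_all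
qed

lemma kappa_eqI: "c \<in> carrier K \<Longrightarrow> c \<odot>\<^bsub>A\<^esub> \<one>\<^bsub>A\<^esub> = a \<Longrightarrow> \<kappa> a = c"
  using inv_into_f_f[OF bij_betw_imp_inj_on[OF scalar]] by blast

lemmas K_facts = field_facts[OF field_K] field_m_comm[OF field_K]

lemma kappa_add: assumes a: "a \<in> carrier A" and b: "b \<in> carrier A" shows "\<kappa> (a \<oplus>\<^bsub>A\<^esub> b) = \<kappa> a \<oplus>\<^bsub>K\<^esub> \<kappa> b"
proof -
  show ?thesis by (rule kappa_eqI) (simp_all add: kappa a b smult_l_distr K_facts)
qed

lemma kappa_act: assumes a: "a \<in> carrier A" and y: "y \<in> carrier A" shows "a \<otimes>\<^bsub>A\<^esub> y = \<kappa> a \<odot>\<^bsub>A\<^esub> y"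
  using smult_mult_left[OF kappa(1)[OF a] one_closed y] unfolding kappa(2)[OF a] using y by simp

lemma kappa_mult: assumes a: "a \<in> carrier A" and b: "b \<in> carrier A" shows "\<kappa> (a \<otimes>\<^bsub>A\<^esub> b) = \<kappa> a \<otimes>\<^bsub>K\<^esub> \<kappa> b"
proof -
  have "(\<kappa> a \<otimes>\<^bsub>K\<^esub> \<kappa> b) \<odot>\<^bsub>A\<^esub> \<one>\<^bsub>A\<^esub> = \<kappa> a \<odot>\<^bsub>A\<^esub> (\<kappa> b \<odot>\<^bsub>A\<^esub> \<one>\<^bsub>A\<^esub>)"
    by (rule smult_assoc1) (simp_all add: kappa a b)
  then show ?thesis by (intro kappa_eqI) (simp_all add: kappa a b K_facts kappa_act)
qed

lemma kappa_one: "\<kappa> \<one>\<^bsub>A\<^esub> = \<one>\<^bsub>K\<^esub>" by (rule kappa_eqI) (simp_all add: K_facts)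

lemma kappa_smult: assumes c: "c \<in> carrier K" and a: "a \<in> carrier A" shows "\<kappa> (c \<odot>\<^bsub>A\<^esub> a) = c \<otimes>\<^bsub>K\<^esub> \<kappa> a"
proof -
  show ?thesis by (rule kappa_eqI) (simp_all add: kappa c a smult_assoc1 K_facts)
qed

text \<open>An anti-automorphism of \<open>K\<close>-algebras is linear over \<open>K\<close> and
  fixes the unit, hence fixes all its multiples.\<close>

lemma kappa_psi: assumes a: "a \<in> carrier A" shows "\<kappa> (\<psi> a) = \<kappa> a"
proof -
  have "\<psi> (\<kappa> a \<odot>\<^bsub>A\<^esub> \<one>\<^bsub>A\<^esub>) = \<kappa> a \<odot>\<^bsub>A\<^esub> \<one>\<^bsub>A\<^esub>"
    using galg_homD(4,5)[OF psi_hom] kappa(1)[OF a] by simp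
  then show ?thesis using kappa a by simp
qed

text \<open>Every element is a multiple of the unit and so has degree 0; an element with two
  different degrees is zero.\<close>

lemma gr_scalar: assumes a: "a \<in> gr A i" shows "i = 0 \<or> a = \<zero>\<^bsub>A\<^esub>"
proof -
  note ac = gr_carrier[OF a]
  have "\<kappa> a \<odot>\<^bsub>A\<^esub> \<one>\<^bsub>A\<^esub> \<in> gr A 0" by (rule gr_smult[OF kappa(1)[OF ac] gr_one])
  then have "a \<in> gr A 0" using kappa(2)[OF ac] by simp
  from hcomp_homogeneous[OF this, of i] hcomp_homogeneous[OF a, of i] show ?thesis by (auto split: if_splits)
qed

lemma act_scalar: "left_gmod K A M \<Longrightarrow> a \<in> carrier A \<Longrightarrow> x \<in> carrier M \<Longrightarrow> act M a x = \<kappa> a \<odot>\<^bsub>M\<^esub> x"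
  using left_gmod.smult_act[of K A M "\<kappa> a" x] kappa by simp

lemma E_simps [simp]:
  "carrier E = carrier K" "add E = add K" "\<zero>\<^bsub>E\<^esub> = \<zero>\<^bsub>K\<^esub>" "Module.smult E = mult K" "gr E = gr (ground K)"
  by (simp_all add: eta_def)

lemma act_E: "act E a x = \<kappa> a \<otimes>\<^bsub>K\<^esub> x" by (simp add: eta_def)

lemma left_gmod_E: "left_gmod K A E"
proof -
  have gs: "graded_space K E" by (rule graded_space_cong[OF graded_space_ground[OF field_K]]) simp_all
  have gra: "\<kappa> a \<otimes>\<^bsub>K\<^esub> x \<in> gr (ground K) (i + j)" if "a \<in> gr A i" "x \<in> gr (ground K) j" for a x i j
  proof -
    have x: "x \<in> carrier K" "j = 0 \<or> x = \<zero>\<^bsub>K\<^esub>" using that(2) by (auto split: if_splits)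
    have a: "a \<in> carrier A" "i = 0 \<or> \<kappa> a = \<zero>\<^bsub>K\<^esub>"
      using gr_carrier[OF that(1)] gr_scalar[OF that(1)] kappa_eqI[of "\<zero>\<^bsub>K\<^esub>" "\<zero>\<^bsub>A\<^esub>"] by auto
    show ?thesis using x a kappa(1)[OF a(1)] by auto
  qed
  show ?thesis
    by (intro left_gmod.intro left_gmod_axioms.intro graded_algebra_axioms gs)
      (use gra in \<open>simp_all add: act_E kappa K_facts kappa_add kappa_mult kappa_one kappa_smult\<close>)
qed

text \<open>Free of rank one: the basis vector is 1 in degree 0, and the functional regards a scalar
  as an element of \<open>A\<close>.\<close>

lemma fg_projective_E: "fg_projective K A E"
proof -
  interpret E: left_gmod K A E by (rule left_gmod_E)
  have "graded_dual_basis A E {()} (\<lambda>_. 0) (\<lambda>_. \<one>\<^bsub>K\<^esub>) (\<lambda>_ x. x \<odot>\<^bsub>A\<^esub> \<one>\<^bsub>A\<^esub>)"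
    unfolding graded_dual_basis_def dual_basis_def
  proof (intro conjI ballI allI)
    show "addmap E A (\<lambda>x. x \<odot>\<^bsub>A\<^esub> \<one>\<^bsub>A\<^esub>)" by (rule addmapI) (simp_all add: smult_l_distr)
    fix a x assume a: "a \<in> carrier A" and x: "x \<in> carrier E"
    then have x: "x \<in> carrier K" by simp
    have e: "(\<kappa> a \<otimes>\<^bsub>K\<^esub> x) \<odot>\<^bsub>A\<^esub> \<one>\<^bsub>A\<^esub> = \<kappa> a \<odot>\<^bsub>A\<^esub> (x \<odot>\<^bsub>A\<^esub> \<one>\<^bsub>A\<^esub>)"
      by (rule smult_assoc1) (simp_all add: kappa a x)
    show "act E a x \<odot>\<^bsub>A\<^esub> \<one>\<^bsub>A\<^esub> = a \<otimes>\<^bsub>A\<^esub> (x \<odot>\<^bsub>A\<^esub> \<one>\<^bsub>A\<^esub>)"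
      unfolding act_E e by (rule kappa_act[symmetric]) (use a x in simp_all)
  next
    fix x assume "x \<in> carrier E"
    then have x: "x \<in> carrier K" by simp
    have "\<kappa> (x \<odot>\<^bsub>A\<^esub> \<one>\<^bsub>A\<^esub>) = x" by (rule kappa_eqI[OF x refl])
    then have "act E (x \<odot>\<^bsub>A\<^esub> \<one>\<^bsub>A\<^esub>) \<one>\<^bsub>K\<^esub> = x" using x by (simp add: act_E)
    then show "(\<Oplus>\<^bsub>E\<^esub>j\<in>{()}. act E (x \<odot>\<^bsub>A\<^esub> \<one>\<^bsub>A\<^esub>) \<one>\<^bsub>K\<^esub>) = x" using x by simp
  next
    fix d x assume x: "x \<in> gr E d"
    show "x \<odot>\<^bsub>A\<^esub> \<one>\<^bsub>A\<^esub> \<in> gr A (d - 0)"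
    proof (cases "d = 0")
      case True
      then show ?thesis using x gr_smult[OF _ gr_one, of x] by simp
    next
      case False
      then have "x = \<zero>\<^bsub>K\<^esub>" using x by simp
      then show ?thesis using gr_zero by simp
    qed
  qed simp_all
  then show ?thesis by (rule fg_projectiveI[OF left_gmod_E])
qed

lemma fin_dim_E: "vectorspace.fin_dim K E"
proof -
  interpret E: left_gmod K A E by (rule left_gmod_E)
  have "carrier E \<subseteq> W" if "submodule K W E" "{\<one>\<^bsub>K\<^esub>} \<subseteq> W" for W
  proof
    fix x assume "x \<in> carrier E"
    then have x: "x \<in> carrier K" by simp
    have "x \<odot>\<^bsub>E\<^esub> \<one>\<^bsub>K\<^esub> \<in> W" using submodule.smult_closed[OF that(1) x] that(2) by blast
    then show "x \<in> W" using x by simp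
  qed
  then show ?thesis unfolding E.M.fin_dim_iff by (intro exI[of _ "{\<one>\<^bsub>K\<^esub>}"]) simp
qed

text \<open>The map \<open>c \<otimes> m \<mapsto> c m\<close> has inverse
  \<open>m \<mapsto> 1 \<otimes> m\<close>. Balancing holds because \<open>\<psi>\<close> fixes
  scalars and \<open>A\<close> acts through them.\<close>

lemma pairing_unit_left:
  assumes M: "left_gmod K A M" "vectorspace.fin_dim K M"
  shows "gdim K (mtensor A (twist \<psi> E) M) = gdim K M"
proof -
  interpret M: left_gmod K A M by (rule M(1))
  interpret T: gtensor K A "twist \<psi> E" M by (rule gtensor_twist[OF left_gmod_E M(1)])
  have "\<exists>\<alpha>. addmap T.T M \<alpha> \<and> (\<forall>c m. c \<in> carrier (twist \<psi> E) \<longrightarrow> m \<in> carrier M \<longrightarrow> \<alpha> (T.tn c m) = c \<odot>\<^bsub>M\<^esub> m)"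
  proof (rule T.lift_ex[OF M.M.abelian_group_axioms])
    show "addmap (twist \<psi> E) M (\<lambda>c. c \<odot>\<^bsub>M\<^esub> m)" if "m \<in> carrier M" for m
      by (rule addmapI) (use that in \<open>simp_all add: M.M.smult_l_distr\<close>)
    show "addmap M M (\<lambda>m. c \<odot>\<^bsub>M\<^esub> m)" if "c \<in> carrier (twist \<psi> E)" for c
      using M.M.addmap_smult[of c] that by simp
    show "act (twist \<psi> E) a c \<odot>\<^bsub>M\<^esub> m = c \<odot>\<^bsub>M\<^esub> act M a m"
      if "a \<in> carrier A" "c \<in> carrier (twist \<psi> E)" "m \<in> carrier M" for a c m
      using that by (simp add: act_twist act_E kappa_psi act_scalar[OF M(1)] kappa M.M.smult_assoc1[symmetric] field_m_comm[OF field_K])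
  qed
  then obtain \<alpha> where \<alpha>: "addmap T.T M \<alpha>" "\<And>c m. c \<in> carrier K \<Longrightarrow> m \<in> carrier M \<Longrightarrow> \<alpha> (T.tn c m) = c \<odot>\<^bsub>M\<^esub> m"
    unfolding twist_simps E_simps by blast
  have one: "\<one>\<^bsub>K\<^esub> \<in> carrier (twist \<psi> E)" by simp
  have \<gamma>: "addmap M T.T (T.tn \<one>\<^bsub>K\<^esub>)" by (rule T.addmap_tn_right[OF one])
  have "T.tn \<one>\<^bsub>K\<^esub> (\<alpha> z) = z" if "z \<in> carrier T.T" for z
  proof (rule T.tensor_ext[OF addmap_comp[OF \<alpha>(1) \<gamma>] addmap_id that])
    fix c m assume cm: "c \<in> carrier (twist \<psi> E)" "m \<in> carrier M"
    then show "T.tn \<one>\<^bsub>K\<^esub> (\<alpha> (T.tn c m)) = T.tn c m"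
      using T.tn_smult[of c "\<one>\<^bsub>K\<^esub>" m] by (simp add: \<alpha>(2))
  qed
  moreover have "\<alpha> (T.tn \<one>\<^bsub>K\<^esub> m) = m" if "m \<in> carrier M" for m using that by (simp add: \<alpha>(2))
  ultimately have bij: "bij_betw \<alpha> (carrier T.T) (carrier M)"
    using addmap_closed[OF \<alpha>(1)] addmap_closed[OF \<gamma>] by (intro bij_betw_byWitness[of _ "T.tn \<one>\<^bsub>K\<^esub>"]) auto
  have h: "\<alpha> \<in> module_hom K T.T M"
    by (rule T.module_homI[OF M.M.vectorspace_axioms \<alpha>(1)]) (simp add: \<alpha>(2) M.M.smult_assoc1)
  have g: "graded_map T.T M \<alpha>"
  proof (rule T.graded_mapI[OF M.M.graded_space_axioms \<alpha>(1)])
    fix c m i j assume c: "c \<in> gr (twist \<psi> E) i" and m: "m \<in> gr M j"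
    have cc: "c \<in> carrier K" "i = 0 \<or> c = \<zero>\<^bsub>K\<^esub>" using c by (auto split: if_splits)
    have "c \<odot>\<^bsub>M\<^esub> m \<in> gr M (i + j)"
      using cc M.M.gr_smult[OF cc(1) m] M.M.gr_zero M.M.smult_l_null[OF M.M.gr_carrier[OF m]] by auto
    then show "\<alpha> (T.tn c m) \<in> gr M (i + j)" using cc M.M.gr_carrier[OF m] by (simp add: \<alpha>(2))
  qed
  show ?thesis
    by (rule gdim_iso[OF T.graded_space_T M.M.graded_space_axioms h g bij fin_dim_pairing[OF fg_projective_E M]])
qed

text \<open>The mirror map is \<open>x \<otimes> c \<mapsto> c x\<close>. Finite dimension of
  \<open>P\<close> is deduced: it is carried over from the tensor product, where
  \<open>fin_dim_pairing\<close> supplies it.\<close>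

lemma pairing_unit_right:
  assumes P: "fg_projective K A P"
  shows "gdim K (mtensor A (twist \<psi> P) E) = gdim K P" and "vectorspace.fin_dim K P"
proof -
  note Pl = fg_projective_left_gmod[OF P]
  interpret P: left_gmod K A P by (rule Pl)
  interpret T: gtensor K A "twist \<psi> P" E by (rule gtensor_twist[OF Pl left_gmod_E])
  have pa: "\<psi> a \<in> carrier A" if "a \<in> carrier A" for a using galg_homD(1)[OF psi_hom that] by simp
  have "\<exists>\<alpha>. addmap T.T P \<alpha> \<and> (\<forall>x c. x \<in> carrier (twist \<psi> P) \<longrightarrow> c \<in> carrier E \<longrightarrow> \<alpha> (T.tn x c) = c \<odot>\<^bsub>P\<^esub> x)"
  proof (rule T.lift_ex[OF P.M.abelian_group_axioms])
    show "addmap (twist \<psi> P) P (\<lambda>x. c \<odot>\<^bsub>P\<^esub> x)" if "c \<in> carrier E" for c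
      using P.M.addmap_smult[of c] that by (simp add: addmap_def)
    show "addmap E P (\<lambda>c. c \<odot>\<^bsub>P\<^esub> x)" if "x \<in> carrier (twist \<psi> P)" for x
      by (rule addmapI) (use that in \<open>simp_all add: P.M.smult_l_distr\<close>)
    show "c \<odot>\<^bsub>P\<^esub> act (twist \<psi> P) a x = act E a c \<odot>\<^bsub>P\<^esub> x"
      if "a \<in> carrier A" "x \<in> carrier (twist \<psi> P)" "c \<in> carrier E" for a x c
      using that by (simp add: act_twist act_E kappa_psi act_scalar[OF Pl pa] kappa P.M.smult_assoc1[symmetric] field_m_comm[OF field_K])
  qed
  then obtain \<alpha> where \<alpha>: "addmap T.T P \<alpha>" "\<And>x c. x \<in> carrier P \<Longrightarrow> c \<in> carrier K \<Longrightarrow> \<alpha> (T.tn x c) = c \<odot>\<^bsub>P\<^esub> x"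
    unfolding twist_simps E_simps by blast
  have one: "\<one>\<^bsub>K\<^esub> \<in> carrier E" by simp
  have \<gamma>: "addmap P T.T (\<lambda>x. T.tn x \<one>\<^bsub>K\<^esub>)" using T.addmap_tn_left[OF one] by (simp add: addmap_def)
  have "T.tn (\<alpha> z) \<one>\<^bsub>K\<^esub> = z" if "z \<in> carrier T.T" for z
  proof (rule T.tensor_ext[OF addmap_comp[OF \<alpha>(1) \<gamma>] addmap_id that])
    fix x c assume cm: "x \<in> carrier (twist \<psi> P)" "c \<in> carrier E"
    then show "T.tn (\<alpha> (T.tn x c)) \<one>\<^bsub>K\<^esub> = T.tn x c"
      using T.tn_smult[of c x "\<one>\<^bsub>K\<^esub>"] by (simp add: \<alpha>(2))
  qed
  moreover have "\<alpha> (T.tn x \<one>\<^bsub>K\<^esub>) = x" if "x \<in> carrier P" for x using that by (simp add: \<alpha>(2))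
  ultimately have bij: "bij_betw \<alpha> (carrier T.T) (carrier P)"
    using addmap_closed[OF \<alpha>(1)] addmap_closed[OF \<gamma>] by (intro bij_betw_byWitness[of _ "\<lambda>x. T.tn x \<one>\<^bsub>K\<^esub>"]) auto
  have h: "\<alpha> \<in> module_hom K T.T P"
    by (rule T.module_homI[OF P.M.vectorspace_axioms \<alpha>(1)])
      (simp add: \<alpha>(2) P.M.smult_assoc1[symmetric] field_m_comm[OF field_K])
  have g: "graded_map T.T P \<alpha>"
  proof (rule T.graded_mapI[OF P.M.graded_space_axioms \<alpha>(1)])
    fix x c i j assume x: "x \<in> gr (twist \<psi> P) i" and c: "c \<in> gr E j"
    then have x: "x \<in> gr P i" by simp
    have cc: "c \<in> carrier K" "j = 0 \<or> c = \<zero>\<^bsub>K\<^esub>" using c by (auto split: if_splits)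
    have "c \<odot>\<^bsub>P\<^esub> x \<in> gr P (i + j)"
      using cc P.M.gr_smult[OF cc(1) x] P.M.gr_zero P.M.smult_l_null[OF P.M.gr_carrier[OF x]] by auto
    then show "\<alpha> (T.tn x c) \<in> gr P (i + j)" using cc P.M.gr_carrier[OF x] by (simp add: \<alpha>(2))
  qed
  note fd = fin_dim_pairing[OF P left_gmod_E fin_dim_E]
  show "gdim K (mtensor A (twist \<psi> P) E) = gdim K P"
    by (rule gdim_iso[OF T.graded_space_T P.M.graded_space_axioms h g bij fd])
  show "vectorspace.fin_dim K P"
    by (rule fin_dim_image[OF T.vectorspace_T P.M.vectorspace_axioms h fd]) (use bij in \<open>simp add: bij_betw_def\<close>)
qed

end

section \<open>Representatives on the prescribed carrier type\<close>

lemma left_gmod_copy: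
  fixes M :: "('k, 'a, 'v) gmod" and h :: "'v \<Rightarrow> 'w"
  assumes M: "left_gmod K A M" and inj: "inj_on h (carrier M)"
  shows "\<exists>N :: ('k, 'a, 'w) gmod. left_gmod K A N \<and> gmod_iso K A M N"
proof -
  interpret M: left_gmod K A M by fact
  \<comment> \<open>Any injection of sets will do: the operations of the copy are those of
    \<open>M\<close>, conjugated by \<open>h\<close> and its inverse \<open>?g\<close>.\<close>
  let ?g = "the_inv_into (carrier M) h"
  define N :: "('k, 'a, 'w) gmod" where "N = \<lparr>carrier = h ` carrier M, mult = (\<lambda>x _. x), one = h \<zero>\<^bsub>M\<^esub>, ring.zero = h \<zero>\<^bsub>M\<^esub>,
    add = (\<lambda>x y. h (?g x \<oplus>\<^bsub>M\<^esub> ?g y)), smult = (\<lambda>c x. h (c \<odot>\<^bsub>M\<^esub> ?g x)), gr = (\<lambda>d. h ` gr M d), act = (\<lambda>a x. h (act M a (?g x)))\<rparr>"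
  have g: "?g (h x) = x" if "x \<in> carrier M" for x by (rule the_inv_into_f_f[OF inj that])
  have bij: "bij_betw h (carrier M) (carrier N)" using inj by (simp add: bij_betw_def N_def)
  have N: "left_gmod K A N"
    by (rule left_gmod_iso[OF M bij]) (simp_all add: N_def g)
  have "h \<in> gmod_hom K A M N"
    by (rule gmod_homI[OF M N]) (auto simp: alin_def addmap_def graded_map_def N_def g)
  then show ?thesis unfolding gmod_iso_def using N bij by blast
qed

lemma fin_dim_gmod_iso:
  assumes "left_gmod K A M" "left_gmod K A N" "gmod_iso K A M N" "vectorspace.fin_dim K M"
  shows "vectorspace.fin_dim K N"
proof -
  interpret M: left_gmod K A M by fact
  interpret N: left_gmod K A N by fact
  obtain f where "f \<in> gmod_hom K A M N" "bij_betw f (carrier M) (carrier N)" using assms(3) unfolding gmod_iso_def by blast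
  then have "f \<in> module_hom K M N" "f ` carrier M = carrier N" by (simp_all add: gmod_hom_def bij_betw_def)
  then show ?thesis by (intro fin_dim_image[OF M.M.vectorspace_axioms N.M.vectorspace_axioms _ assms(4)])
qed

lemma fg_projective_gmod_iso:
  assumes P: "fg_projective K A P" and N: "left_gmod K A N" and iso: "gmod_iso K A P N"
  shows "fg_projective K A N"
proof -
  note Pl = fg_projective_left_gmod[OF P]
  obtain f where f: "f \<in> gmod_hom K A P N" "bij_betw f (carrier P) (carrier N)" using iso unfolding gmod_iso_def by blast
  obtain g where g: "g \<in> gmod_hom K A N P" "\<And>y. y \<in> carrier N \<Longrightarrow> f (g y) = y"
  proof -
    interpret M: left_gmod K A P by (rule Pl)
    interpret N: left_gmod K A N by (rule N)
    have vl: "alin A P N f" "graded_map P N f" using f(1) by (simp_all add: gmod_hom_iff)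
    note i = alin_inv[OF Pl vl(1) f(2)]
    have "graded_map N P (the_inv_into (carrier P) f)"
      unfolding graded_map_def
    proof (intro allI ballI)
      fix d y assume "y \<in> gr N d"
      then have "y \<in> f ` gr P d"
        using graded_iso_surj[OF M.M.graded_space_axioms N.M.graded_space_axioms alin_addmap[OF vl(1)] vl(2) f(2)] by simp
      then obtain x where "x \<in> gr P d" "y = f x" by blast
      then show "the_inv_into (carrier P) f y \<in> gr P d" using i(2)[OF M.M.gr_carrier] by simp
    qed
    from gmod_homI[OF N Pl i(1) this] i(3) show thesis by (rule that)
  qed
  obtain ds i r where ir: "i \<in> gmod_hom K A P (free_gmod A ds)" "r \<in> gmod_hom K A (free_gmod A ds) P"
    "\<forall>x \<in> carrier P. r (i x) = x" using P unfolding fg_projective_def by blast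
  have gP: "g y \<in> carrier P" if "y \<in> carrier N" for y
    using g(1) that by (simp add: gmod_hom_def module_hom_def Pi_iff)
  show ?thesis
    unfolding fg_projective_def
    by (intro conjI N exI[of _ ds] bexI[OF _ gmod_hom_comp[OF g(1) ir(1)]] bexI[OF _ gmod_hom_comp[OF ir(2) f(1)]] ballI)
      (simp add: ir(3)[rule_format, OF gP] g(2))
qed

text \<open>The embedding into a free module is an injection into lists over the algebra, so a copy
  of \<open>P\<close> on that type exists and the choice in \<open>rep\<close> has a
  witness.\<close>

lemma rep_pmod:
  assumes P: "fg_projective K A P"
  shows "rep K A (pmod K A) P \<in> pmod K A" "gmod_iso K A P (rep K A (pmod K A) P)"
proof -
  obtain ds i r where ir: "i \<in> gmod_hom K A P (free_gmod A ds)" "r \<in> gmod_hom K A (free_gmod A ds) P"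
    "\<forall>x \<in> carrier P. r (i x) = x" using P unfolding fg_projective_def by blast
  have "inj_on i (carrier P)" by (rule inj_on_inverseI[of _ r]) (use ir(3) in blast)
  from left_gmod_copy[OF fg_projective_left_gmod[OF P] this]
  obtain N :: "('a, 'b, 'b list) gmod" where N: "left_gmod K A N" "gmod_iso K A P N" by blast
  have "N \<in> pmod K A" unfolding pmod_def using fg_projective_gmod_iso[OF P N] by simp
  then have "\<exists>N. N \<in> pmod K A \<and> gmod_iso K A P N" using N(2) by blast
  from someI_ex[OF this] show "rep K A (pmod K A) P \<in> pmod K A" "gmod_iso K A P (rep K A (pmod K A) P)"
    unfolding rep_def by simp_all
qed

text \<open>Coordinates with respect to a basis, written as multiples of the unit of
  \<open>A\<close>, inject a finite-dimensional module into the lists over \<open>A\<close>.\<close>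

lemma rep_fmod:
  fixes M :: "('k, 'a, 'v) gmod"
  assumes M: "left_gmod K A M" "vectorspace.fin_dim K M"
  shows "rep K A (fmod K A) M \<in> fmod K A" "gmod_iso K A M (rep K A (fmod K A) M)"
proof -
  interpret M: left_gmod K A M by (rule M(1))
  have field: "field K" using M.M.vectorspace_axioms unfolding vectorspace_def by blast
  obtain J :: "'v set" and p \<phi> where db: "dual_basis (ground K) (with_act M (Module.smult M)) J p \<phi>"
    using fin_dim_dual_basis[OF field M.M.graded_space_axioms M(2)] by blast
  note D = dual_basisD[OF db, simplified]
  obtain js where js: "set js = J" "distinct js" using finite_distinct_list[OF D(1)] by blast
  let ?h = "\<lambda>x. map (\<lambda>j. \<phi> j x \<odot>\<^bsub>A\<^esub> \<one>\<^bsub>A\<^esub>) js"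
  have "inj_on ?h (carrier M)"
  proof (rule inj_onI)
    fix x y assume x: "x \<in> carrier M" and y: "y \<in> carrier M" and xy: "?h x = ?h y"
    \<comment> \<open>The element \<open>c \<odot> 1\<close> of \<open>A\<close> determines how the
      scalar \<open>c\<close> acts on \<open>M\<close>; this recovers the summands of the basis
      expansion without recovering \<open>c\<close> itself.\<close>
    have e: "\<phi> j x \<odot>\<^bsub>M\<^esub> p j = \<phi> j y \<odot>\<^bsub>M\<^esub> p j" if j: "j \<in> J" for j
    proof -
      have "\<phi> j x \<odot>\<^bsub>A\<^esub> \<one>\<^bsub>A\<^esub> = \<phi> j y \<odot>\<^bsub>A\<^esub> \<one>\<^bsub>A\<^esub>" using xy j js(1) by auto
      then show ?thesis using M.smult_act[of "\<phi> j x" "p j"] M.smult_act[of "\<phi> j y" "p j"] D(2)[OF j] D(6)[OF j x] D(6)[OF j y] by simp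
    qed
    have "(\<Oplus>\<^bsub>with_act M (Module.smult M)\<^esub>j\<in>J. \<phi> j x \<odot>\<^bsub>M\<^esub> p j) = (\<Oplus>\<^bsub>with_act M (Module.smult M)\<^esub>j\<in>J. \<phi> j y \<odot>\<^bsub>M\<^esub> p j)"
    proof -
      have fs: "finsum (with_act M (Module.smult M)) f J = finsum M f J" for f by (simp add: finsum_def finprod_def)
      show ?thesis unfolding fs by (rule M.M.finsum_cong'[OF refl]) (use e D(2) D(6) y in auto)
    qed
    then show "x = y" using D(5)[OF x] D(5)[OF y] by simp
  qed
  from left_gmod_copy[OF M(1) this]
  obtain N :: "('k, 'a, 'a list) gmod" where N: "left_gmod K A N" "gmod_iso K A M N" by blast
  have "N \<in> fmod K A" unfolding fmod_def using fin_dim_gmod_iso[OF M(1) N M(2)] N(1) by simp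
  then have "\<exists>N. N \<in> fmod K A \<and> gmod_iso K A M N" using N(2) by blast
  from someI_ex[OF this] show "rep K A (fmod K A) M \<in> fmod K A" "gmod_iso K A M (rep K A (fmod K A) M)"
    unfolding rep_def by simp_all
qed

section \<open>Relations and induced maps of Grothendieck groups\<close>

definition krels :: "'k ring \<Rightarrow> ('k, 'a) gspace \<Rightarrow> ('k, 'a, 'v) gmod set \<Rightarrow> (('k, 'a, 'v) gmod \<Rightarrow>\<^sub>0 int) set" where
  "krels K A C = {frag_of M - frag_of M' - frag_of M'' | M' M M''.
     M' \<in> C \<and> M \<in> C \<and> M'' \<in> C \<and> short_exact K A M' M M''}"

lemma K0_rels_eq: "K0_rels K A C = generate (free_Abelian_group C) (krels K A C)"
  by (simp add: K0_rels_def krels_def)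

lemma K0_eq: "K0 K A C = presented C (krels K A C)"
  by (simp add: K0_def K0_rels_eq)

abbreviation "kcoset K A C \<equiv> gcoset C (krels K A C)"

lemma presentation_krels:
  fixes C :: "('k, 'a, 'v) gmod set"
  shows "presentation C (krels K A C)"
proof
  have k: "Poly_Mapping.keys (a - b) \<subseteq> C" if "Poly_Mapping.keys a \<subseteq> C" "Poly_Mapping.keys b \<subseteq> C" for a b :: "('k, 'a, 'v) gmod \<Rightarrow>\<^sub>0 int"
    using that keys_diff[of a b] by blast
  show "krels K A C \<subseteq> carrier (free_Abelian_group C)"
  proof
    fix r assume "r \<in> krels K A C"
    then obtain M' M M'' where r: "r = frag_of M - frag_of M' - frag_of M''" "M' \<in> C" "M \<in> C" "M'' \<in> C"
      unfolding krels_def by blast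
    have "Poly_Mapping.keys r \<subseteq> C"
      unfolding r(1) by (intro k) (use r in \<open>simp_all add: keys_frag_of\<close>)
    then show "r \<in> carrier (free_Abelian_group C)" by simp
  qed
qed

lemma K0_class_eq: "K0_class K A C M = kcoset K A C (frag_of (rep K A C M))"
  by (simp add: K0_class_def K0_rels_eq)

lemma krels_rel:
  "\<lbrakk>M' \<in> C; M \<in> C; M'' \<in> C; short_exact K A M' M M''\<rbrakk> \<Longrightarrow>
    frag_of M - frag_of M' - frag_of M'' \<in> generate (free_Abelian_group C) (krels K A C)"
  by (rule generate.incl) (auto simp: krels_def)

lemma K0_map_kcoset:
  assumes "\<And>M' M M''. \<lbrakk>M' \<in> C; M \<in> C; M'' \<in> C; short_exact K A M' M M''\<rbrakk> \<Longrightarrow>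
     rep K B D (F M') \<in> D \<and> rep K B D (F M) \<in> D \<and> rep K B D (F M'') \<in> D \<and>
     short_exact K B (rep K B D (F M')) (rep K B D (F M)) (rep K B D (F M''))"
  shows "K0_map K B D F (kcoset K A C u) = kcoset K B D (frag_extend (\<lambda>M. frag_of (rep K B D (F M))) u)"
  unfolding K0_map_def K0_rels_eq
proof (rule presentation.gcoset_map[OF presentation_krels presentation_krels])
  fix r assume "r \<in> krels K A C"
  then obtain M' M M'' where r: "r = frag_of M - frag_of M' - frag_of M''" "M' \<in> C" "M \<in> C" "M'' \<in> C" "short_exact K A M' M M''"
    unfolding krels_def by blast
  show "frag_extend (\<lambda>M. frag_of (rep K B D (F M))) r \<in> generate (free_Abelian_group D) (krels K B D)"
    unfolding r(1) frag_extend_diff frag_extend_of using assms[OF r(2-5)] krels_rel by blast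
qed

lemma K0_map2_kcoset:
  assumes 1: "\<And>M' M M'' N. \<lbrakk>M' \<in> C; M \<in> C; M'' \<in> C; short_exact K A M' M M''; N \<in> C'\<rbrakk> \<Longrightarrow>
     rep K B D (F M' N) \<in> D \<and> rep K B D (F M N) \<in> D \<and> rep K B D (F M'' N) \<in> D \<and>
     short_exact K B (rep K B D (F M' N)) (rep K B D (F M N)) (rep K B D (F M'' N))"
    and 2: "\<And>M' M M'' N. \<lbrakk>M' \<in> C'; M \<in> C'; M'' \<in> C'; short_exact K A' M' M M''; N \<in> C\<rbrakk> \<Longrightarrow>
     rep K B D (F N M') \<in> D \<and> rep K B D (F N M) \<in> D \<and> rep K B D (F N M'') \<in> D \<and>
     short_exact K B (rep K B D (F N M')) (rep K B D (F N M)) (rep K B D (F N M''))"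
    and u: "Poly_Mapping.keys u \<subseteq> C" and v: "Poly_Mapping.keys v \<subseteq> C'"
  shows "K0_map2 K B D F (kcoset K A C u) (kcoset K A' C' v) =
    kcoset K B D (frag_extend (\<lambda>M. frag_extend (\<lambda>N. frag_of (rep K B D (F M N))) v) u)"
  unfolding K0_map2_def K0_rels_eq
proof (rule gcoset_map2[OF presentation_krels presentation_krels presentation_krels _ _ u v])
  fix r N assume "r \<in> krels K A C" and N: "N \<in> C'"
  then obtain M' M M'' where r: "r = frag_of M - frag_of M' - frag_of M''" "M' \<in> C" "M \<in> C" "M'' \<in> C" "short_exact K A M' M M''"
    unfolding krels_def by blast
  show "frag_extend (\<lambda>M. frag_of (rep K B D (F M N))) r \<in> generate (free_Abelian_group D) (krels K B D)"
    unfolding r(1) frag_extend_diff frag_extend_of using 1[OF r(2-5) N] krels_rel by blast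
next
  fix r N assume "r \<in> krels K A' C'" and N: "N \<in> C"
  then obtain M' M M'' where r: "r = frag_of M - frag_of M' - frag_of M''" "M' \<in> C'" "M \<in> C'" "M'' \<in> C'" "short_exact K A' M' M M''"
    unfolding krels_def by blast
  show "frag_extend (\<lambda>M. frag_of (rep K B D (F N M))) r \<in> generate (free_Abelian_group D) (krels K B D)"
    unfolding r(1) frag_extend_diff frag_extend_of using 2[OF r(2-5) N] krels_rel by blast
qed

section \<open>Laurent-valued functions on formal sums of modules\<close>

lemma laurent_extend_superset:
  assumes "finite I" "Poly_Mapping.keys x \<subseteq> I"
  shows "laurent_extend f x = (\<Sum>i\<in>I. of_int (Poly_Mapping.lookup x i) * f i)"
  unfolding laurent_extend_def
  by (rule sum.mono_neutral_left) (use assms in \<open>auto simp: in_keys_iff\<close>)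

lemma laurent_extend_diff: "laurent_extend f (x - y) = laurent_extend f x - laurent_extend f y"
proof -
  let ?I = "Poly_Mapping.keys x \<union> Poly_Mapping.keys y"
  have f: "finite ?I" by simp
  show ?thesis
    using laurent_extend_superset[OF f keys_diff, of f] laurent_extend_superset[OF f, of x f] laurent_extend_superset[OF f, of y f]
    by (simp add: lookup_minus left_diff_distrib sum_subtractf)
qed

lemma laurent_extend_zero [simp]: "laurent_extend f 0 = 0"
  by (simp add: laurent_extend_def)

lemma laurent_extend_of [simp]: "laurent_extend f (frag_of x) = f x"
  by (simp add: laurent_extend_def keys_frag_of)

lemma laurent_extend_add: "laurent_extend f (x + y) = laurent_extend f x + laurent_extend f y"
  using laurent_extend_diff[of f "x + y" y] by simp

lemma laurent_extend_cong: "(\<And>i. i \<in> Poly_Mapping.keys x \<Longrightarrow> f i = g i) \<Longrightarrow> laurent_extend f x = laurent_extend g x"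
  by (simp add: laurent_extend_def)

lemma laurent_extend_frag_extend:
  "laurent_extend f (frag_extend F u) = laurent_extend (\<lambda>s. laurent_extend f (F s)) u"
proof -
  have "Poly_Mapping.keys u \<subseteq> UNIV" by simp
  then show ?thesis
  proof (induction u rule: frag_induction)
    case (diff a b)
    show ?case unfolding frag_extend_diff laurent_extend_diff diff ..
  qed simp_all
qed

lemma laurent_extend_swap:
  "laurent_extend (\<lambda>s. laurent_extend (\<lambda>t. h s t) v) u = laurent_extend (\<lambda>t. laurent_extend (\<lambda>s. h s t) u) v"
  unfolding laurent_extend_def sum_distrib_left
  by (subst sum.swap) (simp add: mult.left_commute)

lemma laurent_extend_mult_left: "laurent_extend (\<lambda>s. c * h s) u = c * laurent_extend h u"
  by (simp add: laurent_extend_def sum_distrib_left mult.left_commute)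

text \<open>A function additive on short exact sequences has extension zero on the generating
  relations, hence on the subgroup they generate.\<close>

lemma laurent_extend_invariant:
  assumes "\<And>M' M M''. \<lbrakk>M' \<in> C; M \<in> C; M'' \<in> C; short_exact K A M' M M''\<rbrakk> \<Longrightarrow> f M = f M' + f M''"
    and "x \<in> kcoset K A C u"
  shows "laurent_extend f x = laurent_extend f u"
proof -
  interpret P: presentation C "krels K A C" by (rule presentation_krels)
  have "laurent_extend f h = 0" if "h \<in> generate (free_Abelian_group C) (krels K A C)" for h
    using that
  proof (induction rule: P.rels_induct)
    case (incl r)
    then obtain M' M M'' where r: "r = frag_of M - frag_of M' - frag_of M''" "M' \<in> C" "M \<in> C" "M'' \<in> C" "short_exact K A M' M M''"
      unfolding krels_def by blast
    show ?case using assms(1)[OF r(2-5)] unfolding r(1) laurent_extend_diff laurent_extend_of by simp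
  qed (simp_all add: laurent_extend_diff)
  from this[OF assms(2)[unfolded P.mem_gcoset]] have "laurent_extend f (x - u) = 0" .
  then show ?thesis by (simp add: laurent_extend_diff)
qed

text \<open>One argument is replaced at a time: first the representative on the module side, using
  \<open>pairing_exact_right\<close>, then the one on the projective side, using
  \<open>pairing_exact_left\<close>. The set under \<open>the_elem\<close> is thereby a
  singleton.\<close>

lemma (in anti_galg) K0_pairing_kcoset:
  assumes u: "Poly_Mapping.keys u \<subseteq> pmod K A" and v: "Poly_Mapping.keys v \<subseteq> fmod K A"
  shows "K0_pairing K A \<psi> (kcoset K A (pmod K A) u) (kcoset K A (fmod K A) v) =
    laurent_extend (\<lambda>P. laurent_extend (\<lambda>M. gdim K (mtensor A (twist \<psi> P) M)) v) u"
proof -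
  interpret P: presentation "pmod K A" "krels K A (pmod K A)" by (rule presentation_krels)
  interpret F: presentation "fmod K A" "krels K A (fmod K A)" by (rule presentation_krels)
  let ?pr = "\<lambda>P M. gdim K (mtensor A (twist \<psi> P) M)"
  have "laurent_extend (\<lambda>P. laurent_extend (?pr P) y) x = laurent_extend (\<lambda>P. laurent_extend (?pr P) v) u"
    if x: "x \<in> kcoset K A (pmod K A) u" and y: "y \<in> kcoset K A (fmod K A) v" for x y
  proof -
    have kx: "Poly_Mapping.keys x \<subseteq> pmod K A" by (rule P.gcoset_keys[OF u x])
    have "laurent_extend (\<lambda>P. laurent_extend (?pr P) y) x = laurent_extend (\<lambda>P. laurent_extend (?pr P) v) x"
    proof (rule laurent_extend_cong)
      fix P assume "P \<in> Poly_Mapping.keys x"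
      then have P: "fg_projective K A P" using kx by (auto simp: pmod_def)
      show "laurent_extend (?pr P) y = laurent_extend (?pr P) v"
      proof (rule laurent_extend_invariant[OF _ y])
        fix M' M M'' assume "M' \<in> fmod K A" "M \<in> fmod K A" "M'' \<in> fmod K A" and e: "short_exact K A M' M M''"
        then have m: "left_gmod K A M'" "left_gmod K A M" "left_gmod K A M''"
          "vectorspace.fin_dim K M'" "vectorspace.fin_dim K M" "vectorspace.fin_dim K M''" by (auto simp: fmod_def)
        show "?pr P M = ?pr P M' + ?pr P M''" by (rule pairing_exact_right[OF P m e])
      qed
    qed
    \<comment> \<open>The order of summation is exchanged so that the projective argument varies
      while the module is held fixed.\<close>
    also have "\<dots> = laurent_extend (\<lambda>M. laurent_extend (\<lambda>P. ?pr P M) x) v" by (rule laurent_extend_swap)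
    also have "\<dots> = laurent_extend (\<lambda>M. laurent_extend (\<lambda>P. ?pr P M) u) v"
    proof (rule laurent_extend_cong)
      fix M assume "M \<in> Poly_Mapping.keys v"
      then have M: "left_gmod K A M" "vectorspace.fin_dim K M" using v by (auto simp: fmod_def)
      show "laurent_extend (\<lambda>P. ?pr P M) x = laurent_extend (\<lambda>P. ?pr P M) u"
      proof (rule laurent_extend_invariant[OF _ x])
        fix P' P P'' assume "P' \<in> pmod K A" "P \<in> pmod K A" "P'' \<in> pmod K A" and e: "short_exact K A P' P P''"
        then have p: "fg_projective K A P'" "fg_projective K A P" "fg_projective K A P''" by (auto simp: pmod_def)
        show "?pr P M = ?pr P' M + ?pr P'' M" by (rule pairing_exact_left[OF p M e])
      qed
    qed
    also have "\<dots> = laurent_extend (\<lambda>P. laurent_extend (?pr P) v) u" by (rule laurent_extend_swap)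
    finally show ?thesis .
  qed
  note e = this
  let ?V = "laurent_extend (\<lambda>P. laurent_extend (?pr P) v) u"
  have "{z. \<exists>x y. z = laurent_extend (\<lambda>P. laurent_extend (?pr P) y) x \<and> x \<in> kcoset K A (pmod K A) u \<and> y \<in> kcoset K A (fmod K A) v} = {?V}"
  proof (intro Set.set_eqI iffI)
    fix z assume "z \<in> {z. \<exists>x y. z = laurent_extend (\<lambda>P. laurent_extend (?pr P) y) x \<and> x \<in> kcoset K A (pmod K A) u \<and> y \<in> kcoset K A (fmod K A) v}"
    then obtain x y where "z = laurent_extend (\<lambda>P. laurent_extend (?pr P) y) x" "x \<in> kcoset K A (pmod K A) u" "y \<in> kcoset K A (fmod K A) v"
      by (elim CollectE exE conjE)
    with e[of x y] show "z \<in> {?V}" by simp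
  next
    fix z assume "z \<in> {?V}"
    then show "z \<in> {z. \<exists>x y. z = laurent_extend (\<lambda>P. laurent_extend (?pr P) y) x \<and> x \<in> kcoset K A (pmod K A) u \<and> y \<in> kcoset K A (fmod K A) v}"
      by (intro CollectI exI[of _ u] exI[of _ v] conjI P.gcoset_self F.gcoset_self) simp
  qed
  then show ?thesis unfolding K0_pairing_def by (simp only: the_elem_eq)
qed

lemma fin_dim_shift:
  assumes "left_gmod K A M" "vectorspace.fin_dim K M" shows "vectorspace.fin_dim K (shift M)"
proof -
  interpret M: left_gmod K A M by fact
  interpret S: left_gmod K A "shift M" by (rule left_gmod_shift[OF assms(1)])
  have "(\<lambda>x. x) \<in> module_hom K M (shift M)" by (auto simp: module_hom_def)
  then show ?thesis by (rule fin_dim_image[OF M.M.vectorspace_axioms S.M.vectorspace_axioms _ assms(2)]) simp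
qed

lemma fg_projective_shift: assumes P: "fg_projective K A P" shows "fg_projective K A (shift P)"
proof -
  obtain n \<delta> p \<phi> where db: "graded_dual_basis A P {..<n :: nat} \<delta> p \<phi>" using fg_projective_dual_basis[OF P] by blast
  have fs: "finsum (shift P) f J = finsum P f J" for f and J :: "nat set" by (simp add: finsum_def finprod_def)
  have am: "addmap (shift P) A = addmap P A" by (simp add: fun_eq_iff addmap_def)
  have "graded_dual_basis A (shift P) {..<n} (\<lambda>j. \<delta> j + 1) p \<phi>"
    unfolding graded_dual_basis_def dual_basis_def
  proof (intro conjI ballI allI)
    fix j d x assume j: "j \<in> {..<n}" and x: "x \<in> gr (shift P) d"
    then have "\<phi> j x \<in> gr A (d - 1 - \<delta> j)" using db unfolding graded_dual_basis_def by simp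
    then show "\<phi> j x \<in> gr A (d - (\<delta> j + 1))" by (simp add: algebra_simps)
  qed (use db in \<open>simp_all add: graded_dual_basis_def dual_basis_def fs am\<close>)
  then show ?thesis by (rule fg_projectiveI[OF left_gmod_shift[OF fg_projective_left_gmod[OF P]]])
qed

lemma gmod_hom_shift: "f \<in> gmod_hom K A M N \<Longrightarrow> f \<in> gmod_hom K A (shift M) (shift N)"
  by (simp add: gmod_hom_def module_hom_def)

lemma short_exact_shift:
  fixes M' :: "('k, 'a, 'u) gmod" and M :: "('k, 'a, 'v) gmod" and M'' :: "('k, 'a, 'w) gmod"
  assumes "short_exact K A M' M M''"
  shows "short_exact K A (shift M') (shift M) (shift M'')"
proof -
  show ?thesis
    using assms unfolding short_exact_def
  proof (elim bexE)
    fix f g assume f: "f \<in> gmod_hom K A M' M" and g: "g \<in> gmod_hom K A M M''"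
      and e: "inj_on f (carrier M') \<and> g ` carrier M = carrier M'' \<and> f ` carrier M' = {x \<in> carrier M. g x = \<zero>\<^bsub>M''\<^esub>}"
    show "\<exists>f \<in> gmod_hom K A (shift M') (shift M). \<exists>g \<in> gmod_hom K A (shift M) (shift M'').
      inj_on f (carrier (shift M')) \<and> g ` carrier (shift M) = carrier (shift M'') \<and>
      f ` carrier (shift M') = {x \<in> carrier (shift M). g x = \<zero>\<^bsub>shift M''\<^esub>}"
      by (intro bexI[OF _ gmod_hom_shift[OF f]] bexI[OF _ gmod_hom_shift[OF g]]) (simp add: e)
  qed
qed

text \<open>What \<open>rep\<close> is meant to deliver. For a module isomorphic to no member of
  \<open>C\<close> the choice in \<open>rep\<close> would be arbitrary, so this has to be verified
  for every functor.\<close>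

definition has_rep :: "'k ring \<Rightarrow> ('k, 'a) gspace \<Rightarrow> ('k, 'a, 'v) gmod set \<Rightarrow> ('k, 'a, 'u) gmod \<Rightarrow> bool" where
  "has_rep K A C X \<longleftrightarrow> left_gmod K A X \<and> rep K A C X \<in> C \<and> gmod_iso K A X (rep K A C X)"

lemma has_rep_pmod: "fg_projective K A P \<Longrightarrow> has_rep K A (pmod K A) P"
  by (simp add: has_rep_def rep_pmod fg_projective_left_gmod)

lemma has_rep_fmod: "left_gmod K A M \<Longrightarrow> vectorspace.fin_dim K M \<Longrightarrow> has_rep K A (fmod K A) M"
  by (simp add: has_rep_def rep_fmod)

lemma pmodD: "P \<in> pmod K A \<Longrightarrow> fg_projective K A P" "P \<in> pmod K A \<Longrightarrow> left_gmod K A P"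
  by (simp_all add: pmod_def fg_projective_left_gmod)

lemma fmodD: "M \<in> fmod K A \<Longrightarrow> left_gmod K A M" "M \<in> fmod K A \<Longrightarrow> vectorspace.fin_dim K M"
  by (simp_all add: fmod_def)

lemma rep_short_exact:
  assumes lm: "\<And>N. N \<in> D \<Longrightarrow> left_gmod K B N"
    and r: "has_rep K B D X'" "has_rep K B D X" "has_rep K B D X''" and ex: "short_exact K B X' X X''"
  shows "rep K B D X' \<in> D \<and> rep K B D X \<in> D \<and> rep K B D X'' \<in> D \<and>
    short_exact K B (rep K B D X') (rep K B D X) (rep K B D X'')"
proof -
  note a = r[unfolded has_rep_def, THEN conjunct1]
  note b = r[unfolded has_rep_def, THEN conjunct2, THEN conjunct1]
  note c = r[unfolded has_rep_def, THEN conjunct2, THEN conjunct2]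
  show ?thesis using b short_exact_iso[OF a b[THEN lm] c ex] by simp
qed

lemma K0_map_functor:
  assumes lm: "\<And>N. N \<in> D \<Longrightarrow> left_gmod K B N" and r: "\<And>M. M \<in> C \<Longrightarrow> has_rep K B D (F M)"
    and ex: "\<And>M' M M''. \<lbrakk>M' \<in> C; M \<in> C; M'' \<in> C; short_exact K A M' M M''\<rbrakk> \<Longrightarrow> short_exact K B (F M') (F M) (F M'')"
  shows "K0_map K B D F (kcoset K A C u) = kcoset K B D (frag_extend (\<lambda>M. frag_of (rep K B D (F M))) u)"
  by (rule K0_map_kcoset) (rule rep_short_exact[OF lm r r r ex])

lemma K0_map2_functor:
  assumes lm: "\<And>N. N \<in> D \<Longrightarrow> left_gmod K B N" and r: "\<And>M N. \<lbrakk>M \<in> C; N \<in> C'\<rbrakk> \<Longrightarrow> has_rep K B D (F M N)"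
    and ex1: "\<And>M' M M'' N. \<lbrakk>M' \<in> C; M \<in> C; M'' \<in> C; short_exact K A M' M M''; N \<in> C'\<rbrakk> \<Longrightarrow> short_exact K B (F M' N) (F M N) (F M'' N)"
    and ex2: "\<And>M' M M'' N. \<lbrakk>M' \<in> C'; M \<in> C'; M'' \<in> C'; short_exact K A' M' M M''; N \<in> C\<rbrakk> \<Longrightarrow> short_exact K B (F N M') (F N M) (F N M'')"
    and u: "Poly_Mapping.keys u \<subseteq> C" and v: "Poly_Mapping.keys v \<subseteq> C'"
  shows "K0_map2 K B D F (kcoset K A C u) (kcoset K A' C' v) =
    kcoset K B D (frag_extend (\<lambda>M. frag_extend (\<lambda>N. frag_of (rep K B D (F M N))) v) u)"
proof (rule K0_map2_kcoset[OF _ _ u v])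
  fix M' M M'' N assume *: "M' \<in> C" "M \<in> C" "M'' \<in> C" "short_exact K A M' M M''" "N \<in> C'"
  show "rep K B D (F M' N) \<in> D \<and> rep K B D (F M N) \<in> D \<and> rep K B D (F M'' N) \<in> D \<and>
     short_exact K B (rep K B D (F M' N)) (rep K B D (F M N)) (rep K B D (F M'' N))"
    by (rule rep_short_exact[OF lm r[OF *(1,5)] r[OF *(2,5)] r[OF *(3,5)] ex1[OF *]])
next
  fix M' M M'' N assume *: "M' \<in> C'" "M \<in> C'" "M'' \<in> C'" "short_exact K A' M' M M''" "N \<in> C"
  show "rep K B D (F N M') \<in> D \<and> rep K B D (F N M) \<in> D \<and> rep K B D (F N M'') \<in> D \<and>
     short_exact K B (rep K B D (F N M')) (rep K B D (F N M)) (rep K B D (F N M''))"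
    by (rule rep_short_exact[OF lm r[OF *(5,1)] r[OF *(5,2)] r[OF *(5,3)] ex2[OF *]])
qed

lemma K0_cases:
  assumes "X \<in> carrier (K0 K A C)"
  obtains u where "Poly_Mapping.keys u \<subseteq> C" "X = kcoset K A C u"
  using presentation.presented_cases[OF presentation_krels] assms unfolding K0_eq by blast

lemma kcoset_closed: "Poly_Mapping.keys u \<subseteq> C \<Longrightarrow> kcoset K A C u \<in> carrier (K0 K A C)"
  unfolding K0_eq by (rule presentation.gcoset_closed[OF presentation_krels])

lemma kcoset_zero: "kcoset K A C 0 = \<one>\<^bsub>K0 K A C\<^esub>"
  unfolding K0_eq by (rule presentation.gcoset_zero[OF presentation_krels])

lemma kcoset_add: "\<lbrakk>Poly_Mapping.keys u \<subseteq> C; Poly_Mapping.keys v \<subseteq> C\<rbrakk> \<Longrightarrow>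
    kcoset K A C u \<otimes>\<^bsub>K0 K A C\<^esub> kcoset K A C v = kcoset K A C (u + v)"
  unfolding K0_eq by (rule presentation.gcoset_add[OF presentation_krels])

lemma K0_comm_group: "comm_group (K0 K A C)"
  unfolding K0_eq by (rule presentation.presented_comm_group[OF presentation_krels])

lemma keys_frag_extend_rep:
  assumes "\<forall>M \<in> C. has_rep K B D (F M)" "Poly_Mapping.keys u \<subseteq> C"
  shows "Poly_Mapping.keys (frag_extend (\<lambda>M. frag_of (rep K B D (F M))) u) \<subseteq> D"
  by (rule frag_extend_in_carrier[OF _ assms(2)]) (use assms(1) in \<open>simp add: has_rep_def keys_frag_of\<close>)

lemma keys_frag_extend_rep2:
  assumes "\<forall>M \<in> C. \<forall>N \<in> C'. has_rep K B D (F M N)" "Poly_Mapping.keys u \<subseteq> C" "Poly_Mapping.keys v \<subseteq> C'"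
  shows "Poly_Mapping.keys (frag_extend (\<lambda>M. frag_extend (\<lambda>N. frag_of (rep K B D (F M N))) v) u) \<subseteq> D"
proof (rule frag_extend_in_carrier[OF _ assms(2)])
  fix M assume "M \<in> C"
  from bspec[OF assms(1) this] show "Poly_Mapping.keys (frag_extend (\<lambda>N. frag_of (rep K B D (F M N))) v) \<subseteq> D"
    by (rule keys_frag_extend_rep[OF _ assms(3)])
qed

text \<open>Products in a tower are sums over \<open>k \<le> n\<close> at each level
  \<open>n\<close>, whereas pairings with a coproduct run over all pairs. Finite support bounds
  \<open>i + j\<close>, and the resulting triangle is summed along its antidiagonals.\<close>

lemma Sum_any_antidiagonal:
  fixes h :: "nat \<times> nat \<Rightarrow> 'a :: comm_monoid_add"
  assumes fin: "finite {x. h x \<noteq> 0}"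
  shows "Sum_any (\<lambda>n. \<Sum>k\<le>n. h (k, n - k)) = Sum_any h"
proof -
  obtain N where N: "(\<lambda>(i, j). i + j) ` {x. h x \<noteq> 0} \<subseteq> {..<N}"
    using finite_nat_bounded[OF finite_imageI[OF fin]] by blast
  have z: "h (i, j) = 0" if "N \<le> i + j" for i j
  proof (rule ccontr)
    assume "h (i, j) \<noteq> 0"
    then have "(i, j) \<in> {x. h x \<noteq> 0}" by simp
    from imageI[OF this, of "\<lambda>(i, j). i + j"] N that show False by auto
  qed
  have "Sum_any h = sum h {(i, j). i + j < N}"
  proof (rule Sum_any.expand_superset)
    show "finite {(i, j). i + j < N}"
      by (rule finite_subset[of _ "{..<N} \<times> {..<N}"]) auto
    show "{x. h x \<noteq> 0} \<subseteq> {(i, j). i + j < N}" using z by (auto simp: not_less[symmetric])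
  qed
  also have "\<dots> = (\<Sum>(i, j)\<in>{(i, j). i + j < N}. h (i, j))" by (simp add: case_prod_unfold)
  also have "\<dots> = (\<Sum>n<N. \<Sum>k\<le>n. h (k, n - k))" by (rule sum.triangle_reindex)
  also have "\<dots> = Sum_any (\<lambda>n. \<Sum>k\<le>n. h (k, n - k))"
  proof (rule Sum_any.expand_superset[symmetric])
    have "(\<Sum>k\<le>n. h (k, n - k)) = 0" if "N \<le> n" for n
      by (rule sum.neutral) (use z that in auto)
    then show "{n. (\<Sum>k\<le>n. h (k, n - k)) \<noteq> 0} \<subseteq> {..<N}" by (auto simp: not_less[symmetric])
  qed simp
  finally show ?thesis by simp
qed

text \<open>A splitting over the field arises for two different reasons: a projective quotient may
  be infinite-dimensional but maps out of it lift, while a finite-dimensional one may fail to be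
  projective but has a basis.\<close>

lemma short_exact_split:
  assumes M: "left_gmod K A M'" "left_gmod K A M" "left_gmod K A M''"
    and c: "fg_projective K A M'' \<or> vectorspace.fin_dim K M''" and ex: "short_exact K A M' M M''"
  obtains f g where "f \<in> gmod_hom K A M' M" "g \<in> gmod_hom K A M M''" "ksplit K M' M M'' f g"
proof -
  interpret M': left_gmod K A M' by (rule M)
  interpret M: left_gmod K A M by (rule M)
  interpret M'': left_gmod K A M'' by (rule M)
  have field: "field K" using M.M.vectorspace_axioms unfolding vectorspace_def by blast
  obtain f g where f: "f \<in> gmod_hom K A M' M" and g: "g \<in> gmod_hom K A M M''" and e: "exact_seq M' M M'' f g"
    using ex unfolding short_exact_iff by blast
  have mh: "f \<in> module_hom K M' M" "g \<in> module_hom K M M''" using f g by (simp_all add: gmod_hom_def)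
  have "ksplit K M' M M'' f g"
    using c
  proof
    assume "fg_projective K A M''" then show ?thesis by (rule ksplit_projective[OF M(1,2) _ f g e])
  next
    assume "vectorspace.fin_dim K M''"
    then show ?thesis
      by (rule ksplit_fin_dim[OF field M'.M.graded_space_axioms M.M.graded_space_axioms M''.M.graded_space_axioms _ mh e])
  qed
  with f g show thesis by (rule that)
qed


section \<open>Towers\<close>

text \<open>Besides being the base case of additivity over finite products, this is what confines
  the sum over the levels of a tower to a finite support.\<close>

lemma K0_pairing_one:
  assumes A: "anti_galg K A \<psi>"
  shows "Y \<in> carrier (K0 K A (fmod K A)) \<Longrightarrow> K0_pairing K A \<psi> \<one>\<^bsub>K0 K A (pmod K A)\<^esub> Y = 0"
    and "X \<in> carrier (K0 K A (pmod K A)) \<Longrightarrow> K0_pairing K A \<psi> X \<one>\<^bsub>K0 K A (fmod K A)\<^esub> = 0"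
proof -
  have k: "Poly_Mapping.keys 0 \<subseteq> C" for C :: "'x set" by simp
  show "K0_pairing K A \<psi> \<one>\<^bsub>K0 K A (pmod K A)\<^esub> Y = 0" if Y: "Y \<in> carrier (K0 K A (fmod K A))"
  proof -
    obtain v where v: "Poly_Mapping.keys v \<subseteq> fmod K A" "Y = kcoset K A (fmod K A) v" by (rule K0_cases[OF Y])
    show ?thesis unfolding v(2) kcoset_zero[symmetric] by (subst anti_galg.K0_pairing_kcoset[OF A k v(1)]) simp
  qed
  show "K0_pairing K A \<psi> X \<one>\<^bsub>K0 K A (fmod K A)\<^esub> = 0" if X: "X \<in> carrier (K0 K A (pmod K A))"
  proof -
    obtain u where u: "Poly_Mapping.keys u \<subseteq> pmod K A" "X = kcoset K A (pmod K A) u" by (rule K0_cases[OF X])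
    show ?thesis unfolding u(2) kcoset_zero[symmetric]
      by (subst anti_galg.K0_pairing_kcoset[OF A u(1) k]) (simp add: laurent_extend_def)
  qed
qed

lemma K0_pairing_mult:
  assumes A: "anti_galg K A \<psi>"
  shows "\<lbrakk>X \<in> carrier (K0 K A (pmod K A)); X' \<in> carrier (K0 K A (pmod K A)); Y \<in> carrier (K0 K A (fmod K A))\<rbrakk> \<Longrightarrow>
      K0_pairing K A \<psi> (X \<otimes>\<^bsub>K0 K A (pmod K A)\<^esub> X') Y = K0_pairing K A \<psi> X Y + K0_pairing K A \<psi> X' Y"
    and "\<lbrakk>X \<in> carrier (K0 K A (pmod K A)); Y \<in> carrier (K0 K A (fmod K A)); Y' \<in> carrier (K0 K A (fmod K A))\<rbrakk> \<Longrightarrow>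
      K0_pairing K A \<psi> X (Y \<otimes>\<^bsub>K0 K A (fmod K A)\<^esub> Y') = K0_pairing K A \<psi> X Y + K0_pairing K A \<psi> X Y'"
proof -
  note pk = anti_galg.K0_pairing_kcoset[OF A]
  have ka: "Poly_Mapping.keys (a + b) \<subseteq> C" if "Poly_Mapping.keys a \<subseteq> C" "Poly_Mapping.keys b \<subseteq> C" for a b :: "'x \<Rightarrow>\<^sub>0 int" and C
    using that keys_add[of a b] by blast
  show "K0_pairing K A \<psi> (X \<otimes>\<^bsub>K0 K A (pmod K A)\<^esub> X') Y = K0_pairing K A \<psi> X Y + K0_pairing K A \<psi> X' Y"
    if X: "X \<in> carrier (K0 K A (pmod K A))" and X': "X' \<in> carrier (K0 K A (pmod K A))" and Y: "Y \<in> carrier (K0 K A (fmod K A))"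
  proof -
    obtain u where u: "Poly_Mapping.keys u \<subseteq> pmod K A" "X = kcoset K A (pmod K A) u" by (rule K0_cases[OF X])
    obtain u' where u': "Poly_Mapping.keys u' \<subseteq> pmod K A" "X' = kcoset K A (pmod K A) u'" by (rule K0_cases[OF X'])
    obtain v where v: "Poly_Mapping.keys v \<subseteq> fmod K A" "Y = kcoset K A (fmod K A) v" by (rule K0_cases[OF Y])
    show ?thesis unfolding u(2) u'(2) v(2) kcoset_add[OF u(1) u'(1)] pk[OF u(1) v(1)] pk[OF u'(1) v(1)] pk[OF ka[OF u(1) u'(1)] v(1)]
      by (rule laurent_extend_add)
  qed
  show "K0_pairing K A \<psi> X (Y \<otimes>\<^bsub>K0 K A (fmod K A)\<^esub> Y') = K0_pairing K A \<psi> X Y + K0_pairing K A \<psi> X Y'"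
    if X: "X \<in> carrier (K0 K A (pmod K A))" and Y: "Y \<in> carrier (K0 K A (fmod K A))" and Y': "Y' \<in> carrier (K0 K A (fmod K A))"
  proof -
    obtain u where u: "Poly_Mapping.keys u \<subseteq> pmod K A" "X = kcoset K A (pmod K A) u" by (rule K0_cases[OF X])
    obtain v where v: "Poly_Mapping.keys v \<subseteq> fmod K A" "Y = kcoset K A (fmod K A) v" by (rule K0_cases[OF Y])
    obtain v' where v': "Poly_Mapping.keys v' \<subseteq> fmod K A" "Y' = kcoset K A (fmod K A) v'" by (rule K0_cases[OF Y'])
    have kv: "Poly_Mapping.keys (v + v') \<subseteq> fmod K A" using keys_add[of v v'] v(1) v'(1) by blast
    show ?thesis unfolding u(2) v(2) v'(2) kcoset_add[OF v(1) v'(1)] pk[OF u(1) v(1)] pk[OF u(1) v'(1)] pk[OF u(1) kv]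
      by (simp add: laurent_extend_def[of _ u] laurent_extend_add distrib_left sum.distrib)
  qed
qed

text \<open>The components of \<open>tower_prod\<close> are finite products in multiplicatively
  written groups; the pairing turns them into sums.\<close>

lemma K0_pairing_finprod:
  assumes A: "anti_galg K A \<psi>" and I: "finite I"
  shows "\<lbrakk>\<And>i. i \<in> I \<Longrightarrow> X i \<in> carrier (K0 K A (pmod K A)); Y \<in> carrier (K0 K A (fmod K A))\<rbrakk> \<Longrightarrow>
      K0_pairing K A \<psi> (\<Otimes>\<^bsub>K0 K A (pmod K A)\<^esub>i\<in>I. X i) Y = (\<Sum>i\<in>I. K0_pairing K A \<psi> (X i) Y)"
    and "\<lbrakk>Z \<in> carrier (K0 K A (pmod K A)); \<And>i. i \<in> I \<Longrightarrow> W i \<in> carrier (K0 K A (fmod K A))\<rbrakk> \<Longrightarrow>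
      K0_pairing K A \<psi> Z (\<Otimes>\<^bsub>K0 K A (fmod K A)\<^esub>i\<in>I. W i) = (\<Sum>i\<in>I. K0_pairing K A \<psi> Z (W i))"
proof -
  interpret P: comm_group "K0 K A (pmod K A)" by (rule K0_comm_group)
  interpret F: comm_group "K0 K A (fmod K A)" by (rule K0_comm_group)
  show "K0_pairing K A \<psi> (\<Otimes>\<^bsub>K0 K A (pmod K A)\<^esub>i\<in>I. X i) Y = (\<Sum>i\<in>I. K0_pairing K A \<psi> (X i) Y)"
    if "\<And>i. i \<in> I \<Longrightarrow> X i \<in> carrier (K0 K A (pmod K A))" "Y \<in> carrier (K0 K A (fmod K A))"
    using I that(1)
  proof (induction rule: finite_induct)
    case empty
    then show ?case using K0_pairing_one(1)[OF A that(2)] by simp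
  next
    case (insert i I)
    have c: "X \<in> I \<rightarrow> carrier (K0 K A (pmod K A))" "X i \<in> carrier (K0 K A (pmod K A))" using insert.prems by auto
    show ?case
      using insert K0_pairing_mult(1)[OF A c(2) P.finprod_closed[OF c(1)] that(2)] P.finprod_insert[OF insert.hyps c] by simp
  qed
  show "K0_pairing K A \<psi> Z (\<Otimes>\<^bsub>K0 K A (fmod K A)\<^esub>i\<in>I. W i) = (\<Sum>i\<in>I. K0_pairing K A \<psi> Z (W i))"
    if "Z \<in> carrier (K0 K A (pmod K A))" "\<And>i. i \<in> I \<Longrightarrow> W i \<in> carrier (K0 K A (fmod K A))"
    using I that(2)
  proof (induction rule: finite_induct)
    case empty
    then show ?case using K0_pairing_one(2)[OF A that(1)] by simp
  next
    case (insert i I)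
    have c: "W \<in> I \<rightarrow> carrier (K0 K A (fmod K A))" "W i \<in> carrier (K0 K A (fmod K A))" using insert.prems by auto
    show ?case
      using insert K0_pairing_mult(2)[OF A that(1) c(2) F.finprod_closed[OF c(1)]] F.finprod_insert[OF insert.hyps c] by simp
  qed
qed

context nice_tower
begin

lemma galg: "graded_algebra K (A n)"
  using nice unfolding nice_algebra_def by blast

text \<open>Projectivity of the left regular module includes that it is a module, and this in turn
  contains the algebra laws of \<open>A m \<boxtimes> A n\<close>.\<close>

lemma galg2: "graded_algebra K (twr2 K A m n)"
  by (rule left_gmod.axioms(1)[OF fg_projective_left_gmod[OF projective_left]])

lemma anti: "anti_galg K (A n) (\<psi> n)"
  by (intro anti_galg.intro anti_galg_axioms.intro galg psi_hom psi_bij)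

lemmas anti2 = anti_galg_tensor[OF anti anti galg2]

lemma mod_pair: "\<lbrakk>left_gmod K (A k) M; left_gmod K (A l) N\<rbrakk> \<Longrightarrow> mod_pair K (A k) (A l) M N"
  by (simp add: mod_pair_def galg galg2)

text \<open>The tower axiom speaks of pure tensors; both sides are additive, so it extends to all of
  \<open>A k \<boxtimes> A l\<close>.\<close>

lemma psi_rho_psi2:
  assumes "b \<in> carrier (twr2 K A k l)" shows "\<psi> (k + l) (\<rho> k l b) = \<rho> k l (psi2 K A \<psi> k l b)"
proof -
  interpret Ak: graded_algebra K "A k" by (rule galg)
  interpret Al: graded_algebra K "A l" by (rule galg)
  interpret U: kpair K "A k" "A l" by (simp add: kpair_def kpair_axioms_def field Ak.graded_space_axioms Al.graded_space_axioms)
  have c: "carrier (twr2 K A k l) = carrier U.T" "add (twr2 K A k l) = add U.T" by (simp_all add: alg_tensor_def)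
  have am: "addmap U.T X f" if "addmap (twr2 K A k l) X f" for X :: "('k, 'a) gspace" and f
    using that by (simp add: addmap_def c)
  note r = galg_homD[OF rho_hom[of k l]] and p = galg_homD[OF psi_hom[of "k + l"], simplified]
    and t = galg_homD[OF anti_galg.psi_hom[OF anti2(1)], simplified]
  have 1: "addmap U.T (A (k + l)) (\<lambda>b. \<psi> (k + l) (\<rho> k l b))"
    by (rule am, rule addmapI) (simp_all add: r p)
  have 2: "addmap U.T (A (k + l)) (\<lambda>b. \<rho> k l (psi2 K A \<psi> k l b))"
    by (rule am, rule addmapI) (simp_all add: r t)
  show ?thesis
  proof (rule U.tensor_ext[OF 1 2])
    fix a a' assume a: "a \<in> carrier (A k)" "a' \<in> carrier (A l)"
    show "\<psi> (k + l) (\<rho> k l (U.tn a a')) = \<rho> k l (psi2 K A \<psi> k l (U.tn a a'))"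
      unfolding anti2(2)[OF a] using psi_rho[OF a] by (simp add: ptensor_eq)
  qed (use assms c in simp)
qed

lemma adj: "adj_data K (twr2 K A k l) (A (k + l)) (\<rho> k l) (\<psi> (k + l)) (psi2 K A \<psi> k l)"
  by (intro adj_data.intro adj_data_axioms.intro anti anti2(1) fg_projective_left_gmod[OF projective_right] rho_hom psi_rho_psi2)

lemma reg_dual_basis: obtains n p \<phi> where "dual_basis (opposite (twr2 K A k l)) (right_reg (\<rho> k l) (A (k + l))) {..<n :: nat} p \<phi>"
  using fg_projective_dual_basis[OF projective_right] unfolding graded_dual_basis_def by blast

lemma scalar: "scalar_galg K (A 0) (\<psi> 0)"
  by (intro scalar_galg.intro scalar_galg_axioms.intro anti A0)

abbreviation "indT k l M N \<equiv> Ind (\<rho> k l) (twr2 K A k l) (A (k + l)) (mod_tensor K M N)"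

lemma mod_tensor_left:
  assumes "left_gmod K (A k) M'" "left_gmod K (A k) M" "left_gmod K (A k) M''" "left_gmod K (A l) N"
    and "fg_projective K (A k) M'' \<or> vectorspace.fin_dim K M''" "short_exact K (A k) M' M M''"
  shows "short_exact K (twr2 K A k l) (mod_tensor K M' N) (mod_tensor K M N) (mod_tensor K M'' N)"
proof -
  obtain f g where "f \<in> gmod_hom K (A k) M' M" "g \<in> gmod_hom K (A k) M M''" "ksplit K M' M M'' f g"
    by (rule short_exact_split[OF assms(1-3,5,6)])
  then show ?thesis by (rule short_exact_mod_tensor_left[OF assms(1-3)[THEN mod_pair, OF assms(4)]])
qed

lemma mod_tensor_right:
  assumes "left_gmod K (A l) M'" "left_gmod K (A l) M" "left_gmod K (A l) M''" "left_gmod K (A k) N"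
    and "fg_projective K (A l) M'' \<or> vectorspace.fin_dim K M''" "short_exact K (A l) M' M M''"
  shows "short_exact K (twr2 K A k l) (mod_tensor K N M') (mod_tensor K N M) (mod_tensor K N M'')"
proof -
  obtain f g where "f \<in> gmod_hom K (A l) M' M" "g \<in> gmod_hom K (A l) M M''" "ksplit K M' M M'' f g"
    by (rule short_exact_split[OF assms(1-3,5,6)])
  then show ?thesis by (rule short_exact_mod_tensor_right[OF assms(1-3)[THEN mod_pair[OF assms(4)]]])
qed

lemma left_gmod_tensor: "\<lbrakk>left_gmod K (A k) M; left_gmod K (A l) N\<rbrakk> \<Longrightarrow> left_gmod K (twr2 K A k l) (mod_tensor K M N)"
  by (rule mod_pair.left_gmod_mod_tensor[OF mod_pair])

lemma indT_exact:
  assumes "left_gmod K (twr2 K A k l) M'" "left_gmod K (twr2 K A k l) M" "left_gmod K (twr2 K A k l) M''" "short_exact K (twr2 K A k l) M' M M''"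
  shows "short_exact K (A (k + l)) (Ind (\<rho> k l) (twr2 K A k l) (A (k + l)) M')
    (Ind (\<rho> k l) (twr2 K A k l) (A (k + l)) M) (Ind (\<rho> k l) (twr2 K A k l) (A (k + l)) M'')"
proof -
  obtain n p \<phi> where db: "dual_basis (opposite (twr2 K A k l)) (right_reg (\<rho> k l) (A (k + l))) {..<n :: nat} p \<phi>"
    by (rule reg_dual_basis)
  note id = adj_data.ind_data[OF adj]
  show ?thesis by (rule short_exact_Ind[OF id[OF assms(1)] id[OF assms(2)] id[OF assms(3)] db assms(4)])
qed

lemma projective_tensor: "\<lbrakk>M \<in> pmod K (A k); N \<in> pmod K (A l)\<rbrakk> \<Longrightarrow> fg_projective K (twr2 K A k l) (mod_tensor K M N)"
  by (intro mod_pair.fg_projective_mod_tensor mod_pair pmodD)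

lemma fin_dim_tensor: "\<lbrakk>M \<in> fmod K (A k); N \<in> fmod K (A l)\<rbrakk> \<Longrightarrow> vectorspace.fin_dim K (mod_tensor K M N)"
  by (intro mod_pair.fin_dim_mod_tensor[of K "A k" "A l"] mod_pair fmodD)

lemma projective_indT: "\<lbrakk>M \<in> pmod K (A k); N \<in> pmod K (A l)\<rbrakk> \<Longrightarrow> fg_projective K (A (k + l)) (indT k l M N)"
  by (rule ind_data.fg_projective_Ind[OF adj_data.ind_data[OF adj] projective_tensor]) (simp_all add: left_gmod_tensor pmodD)

lemma left_gmod_indT: "\<lbrakk>left_gmod K (A k) M; left_gmod K (A l) N\<rbrakk> \<Longrightarrow> left_gmod K (A (k + l)) (indT k l M N)"
  by (rule ind_data.left_gmod_Ind[OF adj_data.ind_data[OF adj left_gmod_tensor]])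

lemma fin_dim_indT: assumes "M \<in> fmod K (A k)" "N \<in> fmod K (A l)" shows "vectorspace.fin_dim K (indT k l M N)"
proof -
  obtain n p \<phi> where db: "dual_basis (opposite (twr2 K A k l)) (right_reg (\<rho> k l) (A (k + l))) {..<n :: nat} p \<phi>"
    by (rule reg_dual_basis)
  show ?thesis
    by (rule ind_data.fin_dim_Ind[OF adj_data.ind_data[OF adj left_gmod_tensor] db fin_dim_tensor]) (use assms in \<open>simp_all add: fmodD\<close>)
qed

lemma projective_Res: "P \<in> pmod K (A (k + l)) \<Longrightarrow> fg_projective K (twr2 K A k l) (Res (\<rho> k l) P)"
  by (rule fg_projective_Res[OF rho_hom galg projective_left pmodD(1)])

lemma left_gmod_Res_tower: "left_gmod K (A (k + l)) M \<Longrightarrow> left_gmod K (twr2 K A k l) (Res (\<rho> k l) M)"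
  by (rule left_gmod_Res[OF galg2 rho_hom])

lemma fin_dim_Res: assumes "M \<in> fmod K (A (k + l))" shows "vectorspace.fin_dim K (Res (\<rho> k l) M)"
proof -
  interpret left_gmod K "A (k + l)" M by (rule fmodD(1)[OF assms])
  show ?thesis by (rule fin_dim_cong[OF M.graded_space_axioms _ _ _ _ _ fmodD(2)[OF assms]]) simp_all
qed

lemmas has_rep_tower =
  has_rep_pmod[OF projective_tensor] has_rep_fmod[OF left_gmod_tensor[OF fmodD(1) fmodD(1)] fin_dim_tensor]
  has_rep_pmod[OF projective_indT] has_rep_fmod[OF left_gmod_indT[OF fmodD(1) fmodD(1)] fin_dim_indT]
  has_rep_pmod[OF projective_Res] has_rep_fmod[OF left_gmod_Res_tower[OF fmodD(1)] fin_dim_Res]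

text \<open>Stated with bounded quantifiers, the form of the premises of
  \<open>keys_frag_extend_rep\<close> and \<open>keys_frag_extend_rep2\<close>.\<close>

lemma has_rep_ball:
  "\<forall>M \<in> pmod K (A k). \<forall>N \<in> pmod K (A l). has_rep K (twr2 K A k l) (pmod K (twr2 K A k l)) (mod_tensor K M N)"
  "\<forall>M \<in> fmod K (A k). \<forall>N \<in> fmod K (A l). has_rep K (twr2 K A k l) (fmod K (twr2 K A k l)) (mod_tensor K M N)"
  "\<forall>M \<in> pmod K (A k). \<forall>N \<in> pmod K (A l). has_rep K (A (k + l)) (pmod K (A (k + l))) (indT k l M N)"
  "\<forall>M \<in> fmod K (A k). \<forall>N \<in> fmod K (A l). has_rep K (A (k + l)) (fmod K (A (k + l))) (indT k l M N)"
  "\<forall>M \<in> pmod K (A (k + l)). has_rep K (twr2 K A k l) (pmod K (twr2 K A k l)) (Res (\<rho> k l) M)"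
  "\<forall>M \<in> fmod K (A (k + l)). has_rep K (twr2 K A k l) (fmod K (twr2 K A k l)) (Res (\<rho> k l) M)"
  using has_rep_tower by simp_all

end

section \<open>The structure maps of a tower on classes\<close>

context nice_tower
begin

lemma K0_tensor_pmod:
  assumes "Poly_Mapping.keys u \<subseteq> pmod K (A k)" "Poly_Mapping.keys v \<subseteq> pmod K (A l)"
  shows "K0_map2 K (twr2 K A k l) (pmod K (twr2 K A k l)) (mod_tensor K) (kcoset K (A k) (pmod K (A k)) u) (kcoset K (A l) (pmod K (A l)) v) =
    kcoset K (twr2 K A k l) (pmod K (twr2 K A k l))
      (frag_extend (\<lambda>M. frag_extend (\<lambda>N. frag_of (rep K (twr2 K A k l) (pmod K (twr2 K A k l)) (mod_tensor K M N))) v) u)"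
proof (rule K0_map2_functor[OF pmodD(2) has_rep_tower(1) _ _ assms])
  show "short_exact K (twr2 K A k l) (mod_tensor K M' N) (mod_tensor K M N) (mod_tensor K M'' N)"
    if "M' \<in> pmod K (A k)" "M \<in> pmod K (A k)" "M'' \<in> pmod K (A k)" "short_exact K (A k) M' M M''" "N \<in> pmod K (A l)" for M' M M'' N
    by (rule mod_tensor_left[OF that(1-3)[THEN pmodD(2)] pmodD(2)[OF that(5)] disjI1[OF pmodD(1)[OF that(3)]] that(4)])
  show "short_exact K (twr2 K A k l) (mod_tensor K N M') (mod_tensor K N M) (mod_tensor K N M'')"
    if "M' \<in> pmod K (A l)" "M \<in> pmod K (A l)" "M'' \<in> pmod K (A l)" "short_exact K (A l) M' M M''" "N \<in> pmod K (A k)" for M' M M'' N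
    by (rule mod_tensor_right[OF that(1-3)[THEN pmodD(2)] pmodD(2)[OF that(5)] disjI1[OF pmodD(1)[OF that(3)]] that(4)])
qed

lemma K0_tensor_fmod:
  assumes "Poly_Mapping.keys u \<subseteq> fmod K (A k)" "Poly_Mapping.keys v \<subseteq> fmod K (A l)"
  shows "K0_map2 K (twr2 K A k l) (fmod K (twr2 K A k l)) (mod_tensor K) (kcoset K (A k) (fmod K (A k)) u) (kcoset K (A l) (fmod K (A l)) v) =
    kcoset K (twr2 K A k l) (fmod K (twr2 K A k l))
      (frag_extend (\<lambda>M. frag_extend (\<lambda>N. frag_of (rep K (twr2 K A k l) (fmod K (twr2 K A k l)) (mod_tensor K M N))) v) u)"
proof (rule K0_map2_functor[OF fmodD(1) has_rep_tower(2) _ _ assms])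
  show "short_exact K (twr2 K A k l) (mod_tensor K M' N) (mod_tensor K M N) (mod_tensor K M'' N)"
    if "M' \<in> fmod K (A k)" "M \<in> fmod K (A k)" "M'' \<in> fmod K (A k)" "short_exact K (A k) M' M M''" "N \<in> fmod K (A l)" for M' M M'' N
    by (rule mod_tensor_left[OF that(1-3)[THEN fmodD(1)] fmodD(1)[OF that(5)] disjI2[OF fmodD(2)[OF that(3)]] that(4)])
  show "short_exact K (twr2 K A k l) (mod_tensor K N M') (mod_tensor K N M) (mod_tensor K N M'')"
    if "M' \<in> fmod K (A l)" "M \<in> fmod K (A l)" "M'' \<in> fmod K (A l)" "short_exact K (A l) M' M M''" "N \<in> fmod K (A k)" for M' M M'' N
    by (rule mod_tensor_right[OF that(1-3)[THEN fmodD(1)] fmodD(1)[OF that(5)] disjI2[OF fmodD(2)[OF that(3)]] that(4)])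
qed

lemma K0_ind_pmod:
  assumes "Poly_Mapping.keys u \<subseteq> pmod K (A k)" "Poly_Mapping.keys v \<subseteq> pmod K (A l)"
  shows "K0_map2 K (A (k + l)) (pmod K (A (k + l))) (indT k l) (kcoset K (A k) (pmod K (A k)) u) (kcoset K (A l) (pmod K (A l)) v) =
    kcoset K (A (k + l)) (pmod K (A (k + l)))
      (frag_extend (\<lambda>M. frag_extend (\<lambda>N. frag_of (rep K (A (k + l)) (pmod K (A (k + l))) (indT k l M N))) v) u)"
proof (rule K0_map2_functor[OF pmodD(2) has_rep_tower(3) _ _ assms])
  show "short_exact K (A (k + l)) (indT k l M' N) (indT k l M N) (indT k l M'' N)"
    if "M' \<in> pmod K (A k)" "M \<in> pmod K (A k)" "M'' \<in> pmod K (A k)" "short_exact K (A k) M' M M''" "N \<in> pmod K (A l)" for M' M M'' N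
    by (rule indT_exact[OF that(1-3)[THEN pmodD(2), THEN left_gmod_tensor[OF _ pmodD(2)[OF that(5)]]]
        mod_tensor_left[OF that(1-3)[THEN pmodD(2)] pmodD(2)[OF that(5)] disjI1[OF pmodD(1)[OF that(3)]] that(4)]])
  show "short_exact K (A (k + l)) (indT k l N M') (indT k l N M) (indT k l N M'')"
    if "M' \<in> pmod K (A l)" "M \<in> pmod K (A l)" "M'' \<in> pmod K (A l)" "short_exact K (A l) M' M M''" "N \<in> pmod K (A k)" for M' M M'' N
    by (rule indT_exact[OF that(1-3)[THEN pmodD(2), THEN left_gmod_tensor[OF pmodD(2)[OF that(5)]]]
        mod_tensor_right[OF that(1-3)[THEN pmodD(2)] pmodD(2)[OF that(5)] disjI1[OF pmodD(1)[OF that(3)]] that(4)]])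
qed

lemma K0_ind_fmod:
  assumes "Poly_Mapping.keys u \<subseteq> fmod K (A k)" "Poly_Mapping.keys v \<subseteq> fmod K (A l)"
  shows "K0_map2 K (A (k + l)) (fmod K (A (k + l))) (indT k l) (kcoset K (A k) (fmod K (A k)) u) (kcoset K (A l) (fmod K (A l)) v) =
    kcoset K (A (k + l)) (fmod K (A (k + l)))
      (frag_extend (\<lambda>M. frag_extend (\<lambda>N. frag_of (rep K (A (k + l)) (fmod K (A (k + l))) (indT k l M N))) v) u)"
proof (rule K0_map2_functor[OF fmodD(1) has_rep_tower(4) _ _ assms])
  show "short_exact K (A (k + l)) (indT k l M' N) (indT k l M N) (indT k l M'' N)"
    if "M' \<in> fmod K (A k)" "M \<in> fmod K (A k)" "M'' \<in> fmod K (A k)" "short_exact K (A k) M' M M''" "N \<in> fmod K (A l)" for M' M M'' N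
    by (rule indT_exact[OF that(1-3)[THEN fmodD(1), THEN left_gmod_tensor[OF _ fmodD(1)[OF that(5)]]]
        mod_tensor_left[OF that(1-3)[THEN fmodD(1)] fmodD(1)[OF that(5)] disjI2[OF fmodD(2)[OF that(3)]] that(4)]])
  show "short_exact K (A (k + l)) (indT k l N M') (indT k l N M) (indT k l N M'')"
    if "M' \<in> fmod K (A l)" "M \<in> fmod K (A l)" "M'' \<in> fmod K (A l)" "short_exact K (A l) M' M M''" "N \<in> fmod K (A k)" for M' M M'' N
    by (rule indT_exact[OF that(1-3)[THEN fmodD(1), THEN left_gmod_tensor[OF fmodD(1)[OF that(5)]]]
        mod_tensor_right[OF that(1-3)[THEN fmodD(1)] fmodD(1)[OF that(5)] disjI2[OF fmodD(2)[OF that(3)]] that(4)]])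
qed

lemma K0_res_pmod:
  "K0_map K (twr2 K A k l) (pmod K (twr2 K A k l)) (Res (\<rho> k l)) (kcoset K (A (k + l)) (pmod K (A (k + l))) u) =
    kcoset K (twr2 K A k l) (pmod K (twr2 K A k l)) (frag_extend (\<lambda>M. frag_of (rep K (twr2 K A k l) (pmod K (twr2 K A k l)) (Res (\<rho> k l) M))) u)"
  by (rule K0_map_functor[OF pmodD(2) has_rep_tower(5) short_exact_Res[OF rho_hom]])

lemma K0_res_fmod:
  "K0_map K (twr2 K A k l) (fmod K (twr2 K A k l)) (Res (\<rho> k l)) (kcoset K (A (k + l)) (fmod K (A (k + l))) u) =
    kcoset K (twr2 K A k l) (fmod K (twr2 K A k l)) (frag_extend (\<lambda>M. frag_of (rep K (twr2 K A k l) (fmod K (twr2 K A k l)) (Res (\<rho> k l) M))) u)"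
  by (rule K0_map_functor[OF fmodD(1) has_rep_tower(6) short_exact_Res[OF rho_hom]])

text \<open>Isomorphic projectives pair alike, so the choice hidden in \<open>rep\<close> drops
  out.\<close>

lemma pairing_rep_left:
  assumes A: "anti_galg K B \<chi>" and P: "fg_projective K B P" and M: "left_gmod K B M" "vectorspace.fin_dim K M"
  shows "gdim K (mtensor B (twist \<chi> (rep K B (pmod K B) P)) M) = gdim K (mtensor B (twist \<chi> P) M)"
  using has_rep_pmod[OF P] anti_galg.pairing_iso[OF A P _ M M(1) _ gmod_iso_refl] pmodD(2)
  unfolding has_rep_def by metis

lemma pairing_rep_right:
  assumes A: "anti_galg K B \<chi>" and P: "fg_projective K B P" and M: "left_gmod K B M" "vectorspace.fin_dim K M"
  shows "gdim K (mtensor B (twist \<chi> P) (rep K B (fmod K B) M)) = gdim K (mtensor B (twist \<chi> P) M)"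
  using has_rep_fmod[OF M] anti_galg.pairing_iso[OF A P fg_projective_left_gmod[OF P] M _ gmod_iso_refl] fmodD(1)
  unfolding has_rep_def by metis

lemma pairing_rep:
  assumes A: "anti_galg K B \<chi>" and P: "fg_projective K B P" and M: "left_gmod K B M" "vectorspace.fin_dim K M"
  shows "gdim K (mtensor B (twist \<chi> (rep K B (pmod K B) P)) (rep K B (fmod K B) M)) = gdim K (mtensor B (twist \<chi> P) M)"
proof -
  have "rep K B (pmod K B) P \<in> pmod K B" using has_rep_pmod[OF P] unfolding has_rep_def by blast
  from pairing_rep_right[OF A pmodD(1)[OF this] M] pairing_rep_left[OF A P M] show ?thesis by simp
qed

text \<open>On formal sums both sides are the same triple sum, whose terms agree by
  \<open>pairing_Ind_left\<close>. The closure statement is what additivity over the factors of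
  \<open>tower_prod\<close> asks for.\<close>

lemma K0_pairing_prod_left:
  assumes X: "X \<in> carrier (K0 K (A k) (pmod K (A k)))" and Y: "Y \<in> carrier (K0 K (A l) (pmod K (A l)))"
    and Z: "Z \<in> carrier (K0 K (A (k + l)) (fmod K (A (k + l))))"
  shows "K0_pairing K (A (k + l)) (\<psi> (k + l)) (K0_map2 K (A (k + l)) (pmod K (A (k + l))) (indT k l) X Y) Z =
    K0_pairing K (twr2 K A k l) (psi2 K A \<psi> k l) (K0_map2 K (twr2 K A k l) (pmod K (twr2 K A k l)) (mod_tensor K) X Y)
      (K0_map K (twr2 K A k l) (fmod K (twr2 K A k l)) (Res (\<rho> k l)) Z)"
    and "K0_map2 K (A (k + l)) (pmod K (A (k + l))) (indT k l) X Y \<in> carrier (K0 K (A (k + l)) (pmod K (A (k + l))))"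
proof -
  obtain u where u: "Poly_Mapping.keys u \<subseteq> pmod K (A k)" "X = kcoset K (A k) (pmod K (A k)) u" by (rule K0_cases[OF X])
  obtain v where v: "Poly_Mapping.keys v \<subseteq> pmod K (A l)" "Y = kcoset K (A l) (pmod K (A l)) v" by (rule K0_cases[OF Y])
  obtain w where w: "Poly_Mapping.keys w \<subseteq> fmod K (A (k + l))" "Z = kcoset K (A (k + l)) (fmod K (A (k + l))) w" by (rule K0_cases[OF Z])
  note kI = keys_frag_extend_rep2[OF has_rep_ball(3) u(1) v(1)] and kT = keys_frag_extend_rep2[OF has_rep_ball(1) u(1) v(1)]
    and kR = keys_frag_extend_rep[OF has_rep_ball(6) w(1)]
  show "K0_map2 K (A (k + l)) (pmod K (A (k + l))) (indT k l) X Y \<in> carrier (K0 K (A (k + l)) (pmod K (A (k + l))))"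
    unfolding u(2) v(2) K0_ind_pmod[OF u(1) v(1)] by (rule kcoset_closed[OF kI])
  show "K0_pairing K (A (k + l)) (\<psi> (k + l)) (K0_map2 K (A (k + l)) (pmod K (A (k + l))) (indT k l) X Y) Z =
    K0_pairing K (twr2 K A k l) (psi2 K A \<psi> k l) (K0_map2 K (twr2 K A k l) (pmod K (twr2 K A k l)) (mod_tensor K) X Y)
      (K0_map K (twr2 K A k l) (fmod K (twr2 K A k l)) (Res (\<rho> k l)) Z)"
    unfolding u(2) v(2) w(2) K0_ind_pmod[OF u(1) v(1)] K0_tensor_pmod[OF u(1) v(1)] K0_res_fmod
      anti_galg.K0_pairing_kcoset[OF anti kI w(1)] anti_galg.K0_pairing_kcoset[OF anti2(1) kT kR]
      laurent_extend_frag_extend laurent_extend_of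
  proof (intro laurent_extend_cong)
    fix M N V assume k: "M \<in> Poly_Mapping.keys u" "N \<in> Poly_Mapping.keys v" "V \<in> Poly_Mapping.keys w"
    note m = subsetD[OF u(1) k(1)] subsetD[OF v(1) k(2)] subsetD[OF w(1) k(3)]
    note zl = fmodD[OF m(3)]
    show "gdim K (mtensor (A (k + l)) (twist (\<psi> (k + l)) (rep K (A (k + l)) (pmod K (A (k + l))) (indT k l M N))) V) =
      gdim K (mtensor (twr2 K A k l) (twist (psi2 K A \<psi> k l) (rep K (twr2 K A k l) (pmod K (twr2 K A k l)) (mod_tensor K M N)))
        (rep K (twr2 K A k l) (fmod K (twr2 K A k l)) (Res (\<rho> k l) V)))"
      unfolding pairing_rep_left[OF anti projective_indT[OF m(1,2)] zl]
        pairing_rep[OF anti2(1) projective_tensor[OF m(1,2)] left_gmod_Res_tower[OF zl(1)] fin_dim_Res[OF m(3)]]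
      by (rule adj_data.pairing_Ind_left[OF adj projective_tensor[OF m(1,2)] zl])
  qed
qed

text \<open>The terms agree by \<open>pairing_Ind_right\<close>. Here the restriction of a
  projective module must be projective again for its class to be formed, which is where
  \<open>A (k + l)\<close> being projective on the left enters.\<close>

lemma K0_pairing_prod_right:
  assumes Z: "Z \<in> carrier (K0 K (A (k + l)) (pmod K (A (k + l))))"
    and X: "X \<in> carrier (K0 K (A k) (fmod K (A k)))" and Y: "Y \<in> carrier (K0 K (A l) (fmod K (A l)))"
  shows "K0_pairing K (A (k + l)) (\<psi> (k + l)) Z (K0_map2 K (A (k + l)) (fmod K (A (k + l))) (indT k l) X Y) =
    K0_pairing K (twr2 K A k l) (psi2 K A \<psi> k l) (K0_map K (twr2 K A k l) (pmod K (twr2 K A k l)) (Res (\<rho> k l)) Z)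
      (K0_map2 K (twr2 K A k l) (fmod K (twr2 K A k l)) (mod_tensor K) X Y)"
    and "K0_map2 K (A (k + l)) (fmod K (A (k + l))) (indT k l) X Y \<in> carrier (K0 K (A (k + l)) (fmod K (A (k + l))))"
proof -
  obtain u where u: "Poly_Mapping.keys u \<subseteq> fmod K (A k)" "X = kcoset K (A k) (fmod K (A k)) u" by (rule K0_cases[OF X])
  obtain v where v: "Poly_Mapping.keys v \<subseteq> fmod K (A l)" "Y = kcoset K (A l) (fmod K (A l)) v" by (rule K0_cases[OF Y])
  obtain w where w: "Poly_Mapping.keys w \<subseteq> pmod K (A (k + l))" "Z = kcoset K (A (k + l)) (pmod K (A (k + l))) w" by (rule K0_cases[OF Z])
  note kI = keys_frag_extend_rep2[OF has_rep_ball(4) u(1) v(1)] and kT = keys_frag_extend_rep2[OF has_rep_ball(2) u(1) v(1)]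
    and kR = keys_frag_extend_rep[OF has_rep_ball(5) w(1)]
  show "K0_map2 K (A (k + l)) (fmod K (A (k + l))) (indT k l) X Y \<in> carrier (K0 K (A (k + l)) (fmod K (A (k + l))))"
    unfolding u(2) v(2) K0_ind_fmod[OF u(1) v(1)] by (rule kcoset_closed[OF kI])
  show "K0_pairing K (A (k + l)) (\<psi> (k + l)) Z (K0_map2 K (A (k + l)) (fmod K (A (k + l))) (indT k l) X Y) =
    K0_pairing K (twr2 K A k l) (psi2 K A \<psi> k l) (K0_map K (twr2 K A k l) (pmod K (twr2 K A k l)) (Res (\<rho> k l)) Z)
      (K0_map2 K (twr2 K A k l) (fmod K (twr2 K A k l)) (mod_tensor K) X Y)"
    unfolding u(2) v(2) w(2) K0_ind_fmod[OF u(1) v(1)] K0_tensor_fmod[OF u(1) v(1)] K0_res_pmod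
      anti_galg.K0_pairing_kcoset[OF anti w(1) kI] anti_galg.K0_pairing_kcoset[OF anti2(1) kR kT]
      laurent_extend_frag_extend laurent_extend_of
  proof (intro laurent_extend_cong)
    fix V M N assume k: "V \<in> Poly_Mapping.keys w" "M \<in> Poly_Mapping.keys u" "N \<in> Poly_Mapping.keys v"
    note m = subsetD[OF u(1) k(2)] subsetD[OF v(1) k(3)] subsetD[OF w(1) k(1)]
    note l = left_gmod_tensor[OF fmodD(1)[OF m(1)] fmodD(1)[OF m(2)]]
    show "gdim K (mtensor (A (k + l)) (twist (\<psi> (k + l)) V) (rep K (A (k + l)) (fmod K (A (k + l))) (indT k l M N))) =
      gdim K (mtensor (twr2 K A k l) (twist (psi2 K A \<psi> k l) (rep K (twr2 K A k l) (pmod K (twr2 K A k l)) (Res (\<rho> k l) V)))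
        (rep K (twr2 K A k l) (fmod K (twr2 K A k l)) (mod_tensor K M N)))"
      unfolding pairing_rep_right[OF anti pmodD(1)[OF m(3)] left_gmod_indT[OF fmodD(1)[OF m(1)] fmodD(1)[OF m(2)]] fin_dim_indT[OF m(1,2)]]
        pairing_rep[OF anti2(1) projective_Res[OF m(3)] l fin_dim_tensor[OF m(1,2)]]
      by (rule adj_data.pairing_Ind_right[OF adj pmodD(1)[OF m(3)] projective_Res[OF m(3)] l fin_dim_tensor[OF m(1,2)]])
  qed
qed

lemma K0_pairing_shift:
  assumes X: "X \<in> carrier (K0 K (A n) (pmod K (A n)))" and Y: "Y \<in> carrier (K0 K (A n) (fmod K (A n)))"
  shows "K0_pairing K (A n) (\<psi> n) (K0_map K (A n) (pmod K (A n)) shift X) Y = q * K0_pairing K (A n) (\<psi> n) X Y"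
    and "K0_pairing K (A n) (\<psi> n) X (K0_map K (A n) (fmod K (A n)) shift Y) = q * K0_pairing K (A n) (\<psi> n) X Y"
proof -
  obtain u where u: "Poly_Mapping.keys u \<subseteq> pmod K (A n)" "X = kcoset K (A n) (pmod K (A n)) u" by (rule K0_cases[OF X])
  obtain v where v: "Poly_Mapping.keys v \<subseteq> fmod K (A n)" "Y = kcoset K (A n) (fmod K (A n)) v" by (rule K0_cases[OF Y])
  have rp: "\<forall>P \<in> pmod K (A n). has_rep K (A n) (pmod K (A n)) (shift P)"
    by (intro ballI has_rep_pmod fg_projective_shift pmodD(1))
  have rf: "\<forall>M \<in> fmod K (A n). has_rep K (A n) (fmod K (A n)) (shift M)"
    by (intro ballI has_rep_fmod left_gmod_shift fin_dim_shift[where A = "A n"] fmodD)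
  have sp: "K0_map K (A n) (pmod K (A n)) shift (kcoset K (A n) (pmod K (A n)) u) =
      kcoset K (A n) (pmod K (A n)) (frag_extend (\<lambda>M. frag_of (rep K (A n) (pmod K (A n)) (shift M))) u)"
    by (rule K0_map_functor[OF pmodD(2) rp[rule_format] short_exact_shift])
  have sf: "K0_map K (A n) (fmod K (A n)) shift (kcoset K (A n) (fmod K (A n)) v) =
      kcoset K (A n) (fmod K (A n)) (frag_extend (\<lambda>M. frag_of (rep K (A n) (fmod K (A n)) (shift M))) v)"
    by (rule K0_map_functor[OF fmodD(1) rf[rule_format] short_exact_shift])
  note kp = keys_frag_extend_rep[OF rp u(1)] and kf = keys_frag_extend_rep[OF rf v(1)]
  note pk = anti_galg.K0_pairing_kcoset[OF anti]
  show "K0_pairing K (A n) (\<psi> n) (K0_map K (A n) (pmod K (A n)) shift X) Y = q * K0_pairing K (A n) (\<psi> n) X Y"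
    unfolding u(2) v(2) sp pk[OF kp v(1)] pk[OF u(1) v(1)] laurent_extend_frag_extend laurent_extend_of laurent_extend_mult_left[symmetric]
  proof (intro laurent_extend_cong)
    fix P M assume "P \<in> Poly_Mapping.keys u" "M \<in> Poly_Mapping.keys v"
    then have m: "P \<in> pmod K (A n)" "M \<in> fmod K (A n)" using u(1) v(1) by blast+
    show "gdim K (mtensor (A n) (twist (\<psi> n) (rep K (A n) (pmod K (A n)) (shift P))) M) = q * gdim K (mtensor (A n) (twist (\<psi> n) P) M)"
      unfolding pairing_rep_left[OF anti fg_projective_shift[OF pmodD(1)[OF m(1)]] fmodD[OF m(2)]]
      by (rule anti_galg.pairing_shift_left[OF anti pmodD(1)[OF m(1)] fmodD[OF m(2)]])
  qed
  show "K0_pairing K (A n) (\<psi> n) X (K0_map K (A n) (fmod K (A n)) shift Y) = q * K0_pairing K (A n) (\<psi> n) X Y"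
    unfolding u(2) v(2) sf pk[OF u(1) kf] pk[OF u(1) v(1)] laurent_extend_frag_extend laurent_extend_of laurent_extend_mult_left[symmetric]
  proof (intro laurent_extend_cong)
    fix P M assume "P \<in> Poly_Mapping.keys u" "M \<in> Poly_Mapping.keys v"
    then have m: "P \<in> pmod K (A n)" "M \<in> fmod K (A n)" using u(1) v(1) by blast+
    show "gdim K (mtensor (A n) (twist (\<psi> n) P) (rep K (A n) (fmod K (A n)) (shift M))) = q * gdim K (mtensor (A n) (twist (\<psi> n) P) M)"
      unfolding pairing_rep_right[OF anti pmodD(1)[OF m(1)] left_gmod_shift[OF fmodD(1)[OF m(2)]] fin_dim_shift[OF fmodD[OF m(2)]]]
      by (rule anti_galg.pairing_shift_right[OF anti pmodD(1)[OF m(1)] fmodD[OF m(2)]])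
  qed
qed

lemma K0_pairing_class:
  assumes P: "fg_projective K (A n) P" and M: "left_gmod K (A n) M" "vectorspace.fin_dim K M"
  shows "K0_pairing K (A n) (\<psi> n) (K0_class K (A n) (pmod K (A n)) P) (K0_class K (A n) (fmod K (A n)) M) = gdim K (mtensor (A n) (twist (\<psi> n) P) M)"
proof -
  have k: "Poly_Mapping.keys (frag_of (rep K (A n) (pmod K (A n)) P)) \<subseteq> pmod K (A n)" "Poly_Mapping.keys (frag_of (rep K (A n) (fmod K (A n)) M)) \<subseteq> fmod K (A n)"
    using has_rep_pmod[OF P] has_rep_fmod[OF M] by (simp_all add: has_rep_def keys_frag_of)
  show ?thesis
    unfolding K0_class_eq anti_galg.K0_pairing_kcoset[OF anti k] laurent_extend_of by (rule pairing_rep[OF anti P M])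
qed

lemma K0_class_closed: "has_rep K B D X \<Longrightarrow> K0_class K B D X \<in> carrier (K0 K B D)"
  unfolding K0_class_eq by (rule kcoset_closed) (simp add: has_rep_def keys_frag_of)

text \<open>\<open>the_elem\<close> has a value because \<open>gdim\<close> is constant on the
  coset. Additivity of \<open>gdim\<close> is a hypothesis, since it is derived differently for the
  two kinds of modules.\<close>

lemma counit_kcoset:
  assumes "\<And>M' M M''. \<lbrakk>M' \<in> C; M \<in> C; M'' \<in> C; short_exact K (A 0) M' M M''\<rbrakk> \<Longrightarrow> gdim K M = gdim K M' + gdim K M''"
    and "x 0 = kcoset K (A 0) C v"
  shows "tower_counit K x = laurent_extend (gdim K) v"
proof -
  have i: "laurent_extend (gdim K) y = laurent_extend (gdim K) v" if "y \<in> kcoset K (A 0) C v" for y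
    by (rule laurent_extend_invariant[OF _ that]) (rule assms(1))
  have vx: "v \<in> kcoset K (A 0) C v" by (rule presentation.gcoset_self[OF presentation_krels])
  have "laurent_extend (gdim K) ` kcoset K (A 0) C v = {laurent_extend (gdim K) v}"
  proof (rule Set.equalityI)
    show "laurent_extend (gdim K) ` kcoset K (A 0) C v \<subseteq> {laurent_extend (gdim K) v}"
      by (rule image_subsetI) (simp only: i singleton_iff)
    show "{laurent_extend (gdim K) v} \<subseteq> laurent_extend (gdim K) ` kcoset K (A 0) C v"
      using imageI[OF vx, of "laurent_extend (gdim K)"] by (simp only: insert_subset empty_subsetI)
  qed
  then show ?thesis unfolding tower_counit_def assms(2) by (simp only: the_elem_eq)
qed

lemma unit_left:
  assumes m: "m 0 \<in> carrier (K0 K (A 0) (fmod K (A 0)))"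
  shows "K0_pairing K (A 0) (\<psi> 0) (K0_class K (A 0) (pmod K (A 0)) (eta K (A 0) (ground K))) (m 0) = tower_counit K m"
proof -
  interpret S: scalar_galg K "A 0" "\<psi> 0" by (rule scalar)
  obtain v where v: "Poly_Mapping.keys v \<subseteq> fmod K (A 0)" "m 0 = kcoset K (A 0) (fmod K (A 0)) v" by (rule K0_cases[OF m])
  note E = S.fg_projective_E
  have k: "Poly_Mapping.keys (frag_of (rep K (A 0) (pmod K (A 0)) S.E)) \<subseteq> pmod K (A 0)"
    using has_rep_pmod[OF E] by (simp add: has_rep_def keys_frag_of)
  \<comment> \<open>Additivity of \<open>gdim\<close> is read off from exactness of the pairing with
    the unit module, because that pairing computes \<open>gdim\<close>.\<close>
  have e: "gdim K M = gdim K M' + gdim K M''" if "M' \<in> fmod K (A 0)" "M \<in> fmod K (A 0)" "M'' \<in> fmod K (A 0)" "short_exact K (A 0) M' M M''" for M' M M''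
    using S.pairing_exact_right[OF E that(1-3)[THEN fmodD(1)] that(1-3)[THEN fmodD(2)] that(4)]
    unfolding S.pairing_unit_left[OF fmodD[OF that(2)]] S.pairing_unit_left[OF fmodD[OF that(1)]] S.pairing_unit_left[OF fmodD[OF that(3)]] .
  have "K0_pairing K (A 0) (\<psi> 0) (K0_class K (A 0) (pmod K (A 0)) S.E) (m 0) = laurent_extend (gdim K) v"
    unfolding v(2) K0_class_eq S.K0_pairing_kcoset[OF k v(1)] laurent_extend_of
  proof (rule laurent_extend_cong)
    fix M assume "M \<in> Poly_Mapping.keys v"
    then have M: "M \<in> fmod K (A 0)" using v(1) by blast
    show "gdim K (mtensor (A 0) (twist (\<psi> 0) (rep K (A 0) (pmod K (A 0)) S.E)) M) = gdim K M"
      unfolding pairing_rep_left[OF anti E fmodD[OF M]] by (rule S.pairing_unit_left[OF fmodD[OF M]])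
  qed
  moreover have "tower_counit K m = laurent_extend (gdim K) v" by (rule counit_kcoset[where x = m, OF _ v(2)]) (rule e)
  ultimately show ?thesis by simp
qed

lemma unit_right:
  assumes p: "p 0 \<in> carrier (K0 K (A 0) (pmod K (A 0)))"
  shows "K0_pairing K (A 0) (\<psi> 0) (p 0) (K0_class K (A 0) (fmod K (A 0)) (eta K (A 0) (ground K))) = tower_counit K p"
proof -
  interpret S: scalar_galg K "A 0" "\<psi> 0" by (rule scalar)
  obtain u where u: "Poly_Mapping.keys u \<subseteq> pmod K (A 0)" "p 0 = kcoset K (A 0) (pmod K (A 0)) u" by (rule K0_cases[OF p])
  note E = S.left_gmod_E S.fin_dim_E
  have k: "Poly_Mapping.keys (frag_of (rep K (A 0) (fmod K (A 0)) S.E)) \<subseteq> fmod K (A 0)"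
    using has_rep_fmod[OF E] by (simp add: has_rep_def keys_frag_of)
  \<comment> \<open>The same device in the other argument: for projective modules the pairing with
    the unit module again computes \<open>gdim\<close>, and \<open>pairing_exact_left\<close> makes
    it additive.\<close>
  have e: "gdim K P = gdim K P' + gdim K P''" if "P' \<in> pmod K (A 0)" "P \<in> pmod K (A 0)" "P'' \<in> pmod K (A 0)" "short_exact K (A 0) P' P P''" for P' P P''
    using S.pairing_exact_left[OF that(1-3)[THEN pmodD(1)] E that(4)]
    unfolding S.pairing_unit_right(1)[OF pmodD(1)[OF that(1)]] S.pairing_unit_right(1)[OF pmodD(1)[OF that(2)]]
      S.pairing_unit_right(1)[OF pmodD(1)[OF that(3)]] .
  have "K0_pairing K (A 0) (\<psi> 0) (p 0) (K0_class K (A 0) (fmod K (A 0)) S.E) = laurent_extend (gdim K) u"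
    unfolding u(2) K0_class_eq S.K0_pairing_kcoset[OF u(1) k] laurent_extend_of
  proof (rule laurent_extend_cong)
    fix P assume "P \<in> Poly_Mapping.keys u"
    then have P: "fg_projective K (A 0) P" using u(1) pmodD(1) by blast
    show "gdim K (mtensor (A 0) (twist (\<psi> 0) P) (rep K (A 0) (fmod K (A 0)) S.E)) = gdim K P"
      unfolding pairing_rep_right[OF anti P E] by (rule S.pairing_unit_right(1)[OF P])
  qed
  moreover have "tower_counit K p = laurent_extend (gdim K) u" by (rule counit_kcoset[where x = p, OF _ u(2)]) (rule e)
  ultimately show ?thesis by simp
qed

end

section \<open>Bilinearity and the bialgebra identities\<close>

context nice_tower
begin

lemma carrier_KK:
  assumes "p \<in> carrier (KK K A)"
  shows "p n \<in> carrier (K0 K (A n) (pmod K (A n)))" "finite {n. p n \<noteq> \<one>\<^bsub>K0 K (A n) (pmod K (A n))\<^esub>}"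
  using assms carrier_sum_group[of UNIV "\<lambda>n. K0 K (A n) (pmod K (A n))"] comm_group.axioms(2)[OF K0_comm_group]
  unfolding KK_def by (auto simp: PiE_UNIV_domain)

lemma carrier_GG:
  assumes "m \<in> carrier (GG K A)"
  shows "m n \<in> carrier (K0 K (A n) (fmod K (A n)))" "finite {n. m n \<noteq> \<one>\<^bsub>K0 K (A n) (fmod K (A n))\<^esub>}"
  using assms carrier_sum_group[of UNIV "\<lambda>n. K0 K (A n) (fmod K (A n))"] comm_group.axioms(2)[OF K0_comm_group]
  unfolding GG_def by (auto simp: PiE_UNIV_domain)

lemmas pairing_one = K0_pairing_one[OF anti]

text \<open>At a level where \<open>p\<close> is neutral the pairing is zero, so the finite support
  of \<open>p\<close> bounds the support of the sum. Distributivity of \<open>Sum_any\<close>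
  depends on this.\<close>

lemma finite_pairing_left:
  assumes p: "finite {n. p n \<noteq> \<one>\<^bsub>K0 K (A n) (pmod K (A n))\<^esub>}" and m: "\<And>n. m n \<in> carrier (K0 K (A n) (fmod K (A n)))"
  shows "finite {n. K0_pairing K (A n) (\<psi> n) (p n) (m n) \<noteq> 0}"
proof (rule finite_subset[OF _ p], rule Collect_mono, rule impI, rule notI)
  fix n assume nz: "K0_pairing K (A n) (\<psi> n) (p n) (m n) \<noteq> 0" and e: "p n = \<one>\<^bsub>K0 K (A n) (pmod K (A n))\<^esub>"
  show False using nz unfolding e pairing_one(1)[OF m] by simp
qed

lemma tower_pairing_homog_left:
  assumes "\<And>i. m i \<in> carrier (K0 K (A i) (fmod K (A i)))"
  shows "tower_pairing K A \<psi> (homog_elt K A (pcat K A) n P) m = K0_pairing K (A n) (\<psi> n) (K0_class K (A n) (pmod K (A n)) P) (m n)"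
proof -
  have "K0_pairing K (A i) (\<psi> i) (homog_elt K A (pcat K A) n P i) (m i) =
      (if i = n then K0_pairing K (A n) (\<psi> n) (K0_class K (A n) (pmod K (A n)) P) (m n) else 0)" for i
    by (simp add: homog_elt_def pairing_one(1)[OF assms])
  then have "tower_pairing K A \<psi> (homog_elt K A (pcat K A) n P) m =
      Sum_any (\<lambda>i. if i = n then K0_pairing K (A n) (\<psi> n) (K0_class K (A n) (pmod K (A n)) P) (m n) else 0)"
    by (simp add: tower_pairing_def)
  also have "\<dots> = K0_pairing K (A n) (\<psi> n) (K0_class K (A n) (pmod K (A n)) P) (m n)" by (rule Sum_any.delta)
  finally show ?thesis .
qed

lemma tower_pairing_homog_right:
  assumes "\<And>i. p i \<in> carrier (K0 K (A i) (pmod K (A i)))"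
  shows "tower_pairing K A \<psi> p (homog_elt K A (fcat K A) n M) = K0_pairing K (A n) (\<psi> n) (p n) (K0_class K (A n) (fmod K (A n)) M)"
proof -
  have "K0_pairing K (A i) (\<psi> i) (p i) (homog_elt K A (fcat K A) n M i) =
      (if i = n then K0_pairing K (A n) (\<psi> n) (p n) (K0_class K (A n) (fmod K (A n)) M) else 0)" for i
    by (simp add: homog_elt_def pairing_one(2)[OF assms])
  then have "tower_pairing K A \<psi> p (homog_elt K A (fcat K A) n M) =
      Sum_any (\<lambda>i. if i = n then K0_pairing K (A n) (\<psi> n) (p n) (K0_class K (A n) (fmod K (A n)) M) else 0)"
    by (simp add: tower_pairing_def)
  also have "\<dots> = K0_pairing K (A n) (\<psi> n) (p n) (K0_class K (A n) (fmod K (A n)) M)" by (rule Sum_any.delta)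
  finally show ?thesis .
qed

lemma homog_elt_fmod_closed:
  assumes "M \<in> fmod K (A n)" shows "homog_elt K A (fcat K A) n M i \<in> carrier (K0 K (A i) (fmod K (A i)))"
proof (cases "i = n")
  case True
  then show ?thesis using K0_class_closed[OF has_rep_fmod[OF fmodD[OF assms]]] by (simp add: homog_elt_def)
next
  case False
  then show ?thesis
    using monoid.one_closed[OF comm_monoid.axioms(1)[OF comm_group.axioms(1)[OF K0_comm_group]]] by (simp add: homog_elt_def)
qed

lemma tower_pairing_homog:
  assumes P: "P \<in> pmod K (A n)" and M: "M \<in> fmod K (A l)"
  shows "tower_pairing K A \<psi> (homog_elt K A (pcat K A) n P) (homog_elt K A (fcat K A) l M) =
    (if n = l then gdim K (mtensor (A n) (twist (\<psi> n) P) M) else 0)"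
proof -
  have e: "tower_pairing K A \<psi> (homog_elt K A (pcat K A) n P) (homog_elt K A (fcat K A) l M) =
      K0_pairing K (A n) (\<psi> n) (K0_class K (A n) (pmod K (A n)) P) (homog_elt K A (fcat K A) l M n)"
    by (rule tower_pairing_homog_left[OF homog_elt_fmod_closed[OF M]])
  show ?thesis
  proof (cases "n = l")
    case True
    note M' = M[folded True]
    show ?thesis unfolding e using True K0_pairing_class[OF pmodD(1)[OF P] fmodD[OF M']] by (simp add: homog_elt_def)
  next
    case False
    then show ?thesis
      unfolding e using pairing_one(2)[OF K0_class_closed[OF has_rep_pmod[OF pmodD(1)[OF P]]]] by (simp add: homog_elt_def)
  qed
qed

lemma tower_pairing_mult_left:
  assumes p: "p \<in> carrier (KK K A)" and p': "p' \<in> carrier (KK K A)" and m: "m \<in> carrier (GG K A)"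
  shows "tower_pairing K A \<psi> (p \<otimes>\<^bsub>KK K A\<^esub> p') m = tower_pairing K A \<psi> p m + tower_pairing K A \<psi> p' m"
proof -
  have "tower_pairing K A \<psi> (p \<otimes>\<^bsub>KK K A\<^esub> p') m =
      Sum_any (\<lambda>n. K0_pairing K (A n) (\<psi> n) (p n) (m n) + K0_pairing K (A n) (\<psi> n) (p' n) (m n))"
    unfolding tower_pairing_def KK_def mult_sum_group restrict_UNIV
    by (simp add: K0_pairing_mult(1)[OF anti carrier_KK(1)[OF p] carrier_KK(1)[OF p'] carrier_GG(1)[OF m]])
  also have "\<dots> = tower_pairing K A \<psi> p m + tower_pairing K A \<psi> p' m"
    unfolding tower_pairing_def
    by (rule Sum_any.distrib; rule finite_pairing_left[OF _ carrier_GG(1)[OF m]]; rule carrier_KK(2)[OF p] carrier_KK(2)[OF p'])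
  finally show ?thesis .
qed

lemma tower_pairing_mult_right:
  assumes p: "p \<in> carrier (KK K A)" and m: "m \<in> carrier (GG K A)" and m': "m' \<in> carrier (GG K A)"
  shows "tower_pairing K A \<psi> p (m \<otimes>\<^bsub>GG K A\<^esub> m') = tower_pairing K A \<psi> p m + tower_pairing K A \<psi> p m'"
proof -
  have "tower_pairing K A \<psi> p (m \<otimes>\<^bsub>GG K A\<^esub> m') =
      Sum_any (\<lambda>n. K0_pairing K (A n) (\<psi> n) (p n) (m n) + K0_pairing K (A n) (\<psi> n) (p n) (m' n))"
    unfolding tower_pairing_def GG_def mult_sum_group restrict_UNIV
    by (simp add: K0_pairing_mult(2)[OF anti carrier_KK(1)[OF p] carrier_GG(1)[OF m] carrier_GG(1)[OF m']])
  also have "\<dots> = tower_pairing K A \<psi> p m + tower_pairing K A \<psi> p m'"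
    unfolding tower_pairing_def
    by (rule Sum_any.distrib; rule finite_pairing_left[OF carrier_KK(2)[OF p]]; rule carrier_GG(1)[OF m] carrier_GG(1)[OF m'])
  finally show ?thesis .
qed

lemma tower_pairing_q:
  assumes p: "p \<in> carrier (KK K A)" and m: "m \<in> carrier (GG K A)"
  shows "tower_pairing K A \<psi> (q_act K A (pcat K A) p) m = q * tower_pairing K A \<psi> p m"
    and "tower_pairing K A \<psi> p (q_act K A (fcat K A) m) = q * tower_pairing K A \<psi> p m"
  unfolding tower_pairing_def q_act_def K0_pairing_shift[OF carrier_KK(1)[OF p] carrier_GG(1)[OF m]]
  by (rule Sum_any_right_distrib[symmetric, OF finite_pairing_left[OF carrier_KK(2)[OF p] carrier_GG(1)[OF m]]])+

text \<open>Both sides are sums over all pairs \<open>(k, l)\<close>: on the left grouped by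
  \<open>n = k + l\<close>, on the right taken directly. Term by term they agree by
  \<open>K0_pairing_prod_left\<close>.\<close>

lemma tower_pairing_prod_left:
  assumes p: "p \<in> carrier (KK K A)" and p': "p' \<in> carrier (KK K A)" and m: "m \<in> carrier (GG K A)"
  shows "tower_pairing K A \<psi> (tower_prod K A \<rho> (pcat K A) p p') m =
    tower_pairing2 K A \<psi> (ext_prod K A (pcat2 K A) p p') (tower_coprod K A \<rho> (fcat2 K A) m)"
proof -
  let ?g = "\<lambda>k l. K0_map2 K (A (k + l)) (pmod K (A (k + l))) (indT k l) (p k) (p' l)"
  let ?h = "\<lambda>(k, l). K0_pairing K (A (k + l)) (\<psi> (k + l)) (?g k l) (m (k + l))"
  have "tower_pairing K A \<psi> (tower_prod K A \<rho> (pcat K A) p p') m = Sum_any (\<lambda>n. \<Sum>k\<le>n. ?h (k, n - k))"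
    unfolding tower_pairing_def
  proof (rule arg_cong[where f = Sum_any], rule ext)
    fix n
    let ?f = "\<lambda>k. K0_map2 K (A n) (pmod K (A n)) (\<lambda>M N. Ind (\<rho> k (n - k)) (twr2 K A k (n - k)) (A n) (mod_tensor K M N)) (p k) (p' (n - k))"
    have f: "?f k = ?g k (n - k)" "?g k (n - k) \<in> carrier (K0 K (A n) (pmod K (A n)))" if k: "k \<in> {..n}" for k
    proof -
      \<comment> \<open>\<open>tower_prod\<close> names the target level \<open>n\<close>, while the
        induced module is formed at level \<open>k + (n - k)\<close>. With truncated subtraction the
        two coincide because \<open>k \<le> n\<close>.\<close>
      have e: "k + (n - k) = n" using k by simp
      show "?f k = ?g k (n - k)" unfolding e ..
      show "?g k (n - k) \<in> carrier (K0 K (A n) (pmod K (A n)))"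
        using K0_pairing_prod_left(2)[OF carrier_KK(1)[OF p, of k] carrier_KK(1)[OF p', of "n - k"] carrier_GG(1)[OF m, of "k + (n - k)"]]
        unfolding e .
    qed
    have "K0_pairing K (A n) (\<psi> n) (tower_prod K A \<rho> (pcat K A) p p' n) (m n) = (\<Sum>k\<in>{..n}. K0_pairing K (A n) (\<psi> n) (?f k) (m n))"
      unfolding tower_prod_def
      by (rule K0_pairing_finprod(1)[OF anti finite_atMost _ carrier_GG(1)[OF m]]) (simp only: f)
    also have "\<dots> = (\<Sum>k\<le>n. ?h (k, n - k))"
    proof (rule sum.cong[OF refl])
      fix k assume k: "k \<in> {..n}"
      then have "k + (n - k) = n" by simp
      then show "K0_pairing K (A n) (\<psi> n) (?f k) (m n) = ?h (k, n - k)" by simp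
    qed
    finally show "K0_pairing K (A n) (\<psi> n) (tower_prod K A \<rho> (pcat K A) p p' n) (m n) = (\<Sum>k\<le>n. ?h (k, n - k))" .
  qed
  also have "\<dots> = Sum_any ?h"
  proof (rule Sum_any_antidiagonal)
    let ?P = "{k. p k \<noteq> \<one>\<^bsub>K0 K (A k) (pmod K (A k))\<^esub>}" and ?P' = "{k. p' k \<noteq> \<one>\<^bsub>K0 K (A k) (pmod K (A k))\<^esub>}"
    have k0: "Poly_Mapping.keys 0 \<subseteq> C" for C :: "('k, 'a, 'a list) gmod set" by simp
    \<comment> \<open>A neutral component of \<open>p\<close> or \<open>p'\<close> is represented by
      the zero formal sum, so the induced class is neutral and pairs to zero. The support thus lies
      in a product of two finite sets.\<close>
    have z: "?h (k, l) = 0" if "k \<notin> ?P \<or> l \<notin> ?P'" for k l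
    proof -
      obtain u where u: "Poly_Mapping.keys u \<subseteq> pmod K (A k)" "p k = kcoset K (A k) (pmod K (A k)) u" by (rule K0_cases[OF carrier_KK(1)[OF p]])
      obtain v where v: "Poly_Mapping.keys v \<subseteq> pmod K (A l)" "p' l = kcoset K (A l) (pmod K (A l)) v" by (rule K0_cases[OF carrier_KK(1)[OF p']])
      have "?g k l = \<one>\<^bsub>K0 K (A (k + l)) (pmod K (A (k + l)))\<^esub>"
        using that
      proof
        assume "k \<notin> ?P"
        then have e: "p k = kcoset K (A k) (pmod K (A k)) 0" by (simp add: kcoset_zero)
        show ?thesis unfolding e v(2) K0_ind_pmod[OF k0 v(1)] by (simp add: kcoset_zero)
      next
        assume "l \<notin> ?P'"
        then have e: "p' l = kcoset K (A l) (pmod K (A l)) 0" by (simp add: kcoset_zero)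
        show ?thesis unfolding e u(2) K0_ind_pmod[OF u(1) k0] by (simp add: kcoset_zero frag_extend_eq_0)
      qed
      then show ?thesis using pairing_one(1)[OF carrier_GG(1)[OF m]] by simp
    qed
    have "{x. ?h x \<noteq> 0} \<subseteq> ?P \<times> ?P'"
    proof (rule subsetI)
      fix x assume x: "x \<in> {x. ?h x \<noteq> 0}"
      obtain k l where kl: "x = (k, l)" by (cases x)
      show "x \<in> ?P \<times> ?P'" using x z[of k l] unfolding kl by (simp only: mem_Sigma_iff mem_Collect_eq not_not) blast
    qed
    then show "finite {x. ?h x \<noteq> 0}" by (rule finite_subset) (intro finite_cartesian_product carrier_KK(2) p p')
  qed
  also have "\<dots> = tower_pairing2 K A \<psi> (ext_prod K A (pcat2 K A) p p') (tower_coprod K A \<rho> (fcat2 K A) m)"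
    unfolding tower_pairing2_def ext_prod_def tower_coprod_def prod.case
      K0_pairing_prod_left(1)[OF carrier_KK(1)[OF p] carrier_KK(1)[OF p'] carrier_GG(1)[OF m]] ..
  finally show ?thesis .
qed

text \<open>The same regrouping by antidiagonals, with the induced classes now in the module
  argument and their supports controlled by those of \<open>m\<close> and \<open>m'\<close>.\<close>

lemma tower_pairing_prod_right:
  assumes p: "p \<in> carrier (KK K A)" and m: "m \<in> carrier (GG K A)" and m': "m' \<in> carrier (GG K A)"
  shows "tower_pairing K A \<psi> p (tower_prod K A \<rho> (fcat K A) m m') =
    tower_pairing2 K A \<psi> (tower_coprod K A \<rho> (pcat2 K A) p) (ext_prod K A (fcat2 K A) m m')"
proof -
  let ?g = "\<lambda>k l. K0_map2 K (A (k + l)) (fmod K (A (k + l))) (indT k l) (m k) (m' l)"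
  let ?h = "\<lambda>(k, l). K0_pairing K (A (k + l)) (\<psi> (k + l)) (p (k + l)) (?g k l)"
  have "tower_pairing K A \<psi> p (tower_prod K A \<rho> (fcat K A) m m') = Sum_any (\<lambda>n. \<Sum>k\<le>n. ?h (k, n - k))"
    unfolding tower_pairing_def
  proof (rule arg_cong[where f = Sum_any], rule ext)
    fix n
    let ?f = "\<lambda>k. K0_map2 K (A n) (fmod K (A n)) (\<lambda>M N. Ind (\<rho> k (n - k)) (twr2 K A k (n - k)) (A n) (mod_tensor K M N)) (m k) (m' (n - k))"
    have f: "?f k = ?g k (n - k)" "?g k (n - k) \<in> carrier (K0 K (A n) (fmod K (A n)))" if k: "k \<in> {..n}" for k
    proof -
      have e: "k + (n - k) = n" using k by simp
      show "?f k = ?g k (n - k)" unfolding e ..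
      show "?g k (n - k) \<in> carrier (K0 K (A n) (fmod K (A n)))"
        using K0_pairing_prod_right(2)[OF carrier_KK(1)[OF p, of "k + (n - k)"] carrier_GG(1)[OF m, of k] carrier_GG(1)[OF m', of "n - k"]]
        unfolding e .
    qed
    have "K0_pairing K (A n) (\<psi> n) (p n) (tower_prod K A \<rho> (fcat K A) m m' n) = (\<Sum>k\<in>{..n}. K0_pairing K (A n) (\<psi> n) (p n) (?f k))"
      unfolding tower_prod_def
      by (rule K0_pairing_finprod(2)[OF anti finite_atMost carrier_KK(1)[OF p]]) (simp only: f)
    also have "\<dots> = (\<Sum>k\<le>n. ?h (k, n - k))"
    proof (rule sum.cong[OF refl])
      fix k assume k: "k \<in> {..n}"
      then have "k + (n - k) = n" by simp
      then show "K0_pairing K (A n) (\<psi> n) (p n) (?f k) = ?h (k, n - k)" by simp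
    qed
    finally show "K0_pairing K (A n) (\<psi> n) (p n) (tower_prod K A \<rho> (fcat K A) m m' n) = (\<Sum>k\<le>n. ?h (k, n - k))" .
  qed
  also have "\<dots> = Sum_any ?h"
  proof (rule Sum_any_antidiagonal)
    let ?P = "{k. m k \<noteq> \<one>\<^bsub>K0 K (A k) (fmod K (A k))\<^esub>}" and ?P' = "{k. m' k \<noteq> \<one>\<^bsub>K0 K (A k) (fmod K (A k))\<^esub>}"
    have k0: "Poly_Mapping.keys 0 \<subseteq> C" for C :: "('k, 'a, 'a list) gmod set" by simp
    have z: "?h (k, l) = 0" if "k \<notin> ?P \<or> l \<notin> ?P'" for k l
    proof -
      obtain u where u: "Poly_Mapping.keys u \<subseteq> fmod K (A k)" "m k = kcoset K (A k) (fmod K (A k)) u" by (rule K0_cases[OF carrier_GG(1)[OF m]])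
      obtain v where v: "Poly_Mapping.keys v \<subseteq> fmod K (A l)" "m' l = kcoset K (A l) (fmod K (A l)) v" by (rule K0_cases[OF carrier_GG(1)[OF m']])
      have "?g k l = \<one>\<^bsub>K0 K (A (k + l)) (fmod K (A (k + l)))\<^esub>"
        using that
      proof
        assume "k \<notin> ?P"
        then have e: "m k = kcoset K (A k) (fmod K (A k)) 0" by (simp add: kcoset_zero)
        show ?thesis unfolding e v(2) K0_ind_fmod[OF k0 v(1)] by (simp add: kcoset_zero)
      next
        assume "l \<notin> ?P'"
        then have e: "m' l = kcoset K (A l) (fmod K (A l)) 0" by (simp add: kcoset_zero)
        show ?thesis unfolding e u(2) K0_ind_fmod[OF u(1) k0] by (simp add: kcoset_zero frag_extend_eq_0)
      qed
      then show ?thesis using pairing_one(2)[OF carrier_KK(1)[OF p]] by simp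
    qed
    have "{x. ?h x \<noteq> 0} \<subseteq> ?P \<times> ?P'"
    proof (rule subsetI)
      fix x assume x: "x \<in> {x. ?h x \<noteq> 0}"
      obtain k l where kl: "x = (k, l)" by (cases x)
      show "x \<in> ?P \<times> ?P'" using x z[of k l] unfolding kl by (simp only: mem_Sigma_iff mem_Collect_eq not_not) blast
    qed
    then show "finite {x. ?h x \<noteq> 0}" by (rule finite_subset) (intro finite_cartesian_product carrier_GG(2) m m')
  qed
  also have "\<dots> = tower_pairing2 K A \<psi> (tower_coprod K A \<rho> (pcat2 K A) p) (ext_prod K A (fcat2 K A) m m')"
    unfolding tower_pairing2_def ext_prod_def tower_coprod_def prod.case
      K0_pairing_prod_right(1)[OF carrier_KK(1)[OF p] carrier_GG(1)[OF m] carrier_GG(1)[OF m']] ..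
  finally show ?thesis .
qed

text \<open>The unit lives in level 0 alone, so a single term of the sum survives and
  \<open>unit_left\<close> evaluates it.\<close>

lemma tower_pairing_unit_left:
  assumes m: "m \<in> carrier (GG K A)"
  shows "tower_pairing K A \<psi> (tower_unit K A (pcat K A)) m = tower_counit K m"
  unfolding tower_unit_def tower_pairing_homog_left[OF carrier_GG(1)[OF m]] by (rule unit_left[where m = m, OF carrier_GG(1)[OF m]])

lemma tower_pairing_unit_right:
  assumes p: "p \<in> carrier (KK K A)"
  shows "tower_pairing K A \<psi> p (tower_unit K A (fcat K A)) = tower_counit K p"
  unfolding tower_unit_def tower_pairing_homog_right[OF carrier_KK(1)[OF p]] by (rule unit_right[where p = p, OF carrier_KK(1)[OF p]])

end

theorem proposition2p3p3:
  fixes K :: "'k ring" and A :: "nat \<Rightarrow> ('k, 'a) gspace"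
    and \<rho> :: "nat \<Rightarrow> nat \<Rightarrow> ('a \<times> 'a \<Rightarrow>\<^sub>0 int) set \<Rightarrow> 'a" and \<psi> :: "nat \<Rightarrow> 'a \<Rightarrow> 'a"
  assumes "nice_tower K A \<rho> \<psi>"
  shows
    "(\<forall>n l. \<forall>P \<in> pmod K (A n). \<forall>M \<in> fmod K (A l).
        tower_pairing K A \<psi> (homog_elt K A (pcat K A) n P) (homog_elt K A (fcat K A) l M) =
          (if n = l then gdim K (mtensor (A n) (twist (\<psi> n) P) M) else 0)) \<and>
     (\<forall>p \<in> carrier (KK K A). \<forall>p' \<in> carrier (KK K A). \<forall>m \<in> carrier (GG K A).
        tower_pairing K A \<psi> (p \<otimes>\<^bsub>KK K A\<^esub> p') m =
          tower_pairing K A \<psi> p m + tower_pairing K A \<psi> p' m) \<and>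
     (\<forall>p \<in> carrier (KK K A). \<forall>m \<in> carrier (GG K A). \<forall>m' \<in> carrier (GG K A).
        tower_pairing K A \<psi> p (m \<otimes>\<^bsub>GG K A\<^esub> m') =
          tower_pairing K A \<psi> p m + tower_pairing K A \<psi> p m') \<and>
     (\<forall>p \<in> carrier (KK K A). \<forall>m \<in> carrier (GG K A).
        tower_pairing K A \<psi> (q_act K A (pcat K A) p) m = q * tower_pairing K A \<psi> p m \<and>
        tower_pairing K A \<psi> p (q_act K A (fcat K A) m) = q * tower_pairing K A \<psi> p m) \<and>
     (\<forall>p \<in> carrier (KK K A). \<forall>p' \<in> carrier (KK K A). \<forall>m \<in> carrier (GG K A).
        tower_pairing K A \<psi> (tower_prod K A \<rho> (pcat K A) p p') m =
          tower_pairing2 K A \<psi> (ext_prod K A (pcat2 K A) p p') (tower_coprod K A \<rho> (fcat2 K A) m)) \<and>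
     (\<forall>p \<in> carrier (KK K A). \<forall>m \<in> carrier (GG K A). \<forall>m' \<in> carrier (GG K A).
        tower_pairing K A \<psi> p (tower_prod K A \<rho> (fcat K A) m m') =
          tower_pairing2 K A \<psi> (tower_coprod K A \<rho> (pcat2 K A) p) (ext_prod K A (fcat2 K A) m m')) \<and>
     (\<forall>m \<in> carrier (GG K A).
        tower_pairing K A \<psi> (tower_unit K A (pcat K A)) m = tower_counit K m) \<and>
     (\<forall>p \<in> carrier (KK K A).
        tower_pairing K A \<psi> p (tower_unit K A (fcat K A)) = tower_counit K p)"
proof -
  interpret nice_tower K A \<rho> \<psi> by fact
  show ?thesis
    by (intro conjI ballI allI tower_pairing_homog tower_pairing_mult_left tower_pairing_mult_right tower_pairing_q
      tower_pairing_prod_left tower_pairing_prod_right tower_pairing_unit_left tower_pairing_unit_right)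
qed

end
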